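(* Let $N\ge 2$, let $\mathbf{A}\in C^1(\mathbb{S}^{N-1},\mathbb{R}^N)$ satisfy $\mathbf{A}(\theta)\cdot\theta=0$ for all $\theta\in\mathbb{S}^{N-1}$, and let $a\in L^\infty(\mathbb{S}^{N-1},\mathbb{R})$ be such that $\mu_1(\mathbf{A},a)>-\left(\frac{N-2}{2}\right)^2$. Then the set of the eigenvalues of the operator $L_{\mathbf{A},a}:\mathcal{H}\to\mathcal{H}^\star$ is $$\{\gamma_{m,k}:\ k,m\in\mathbb{N},\ k\ge 1\},\qquad \gamma_{m,k}=m-\frac{\alpha_k}{2}.$$ Each eigenvalue $\gamma_{m,k}$ has finite multiplicity equal to $$\#\left\{j\in\mathbb{N},\ j\ge 1:\ \gamma_{m,k}+\frac{\alpha_j}{2}\in\mathbb{N}\right\},$$ and a basis of the corresponding eigenspace is $$\left\{V_{n,j}:\ j,n\in\mathbb{N},\ j\ge 1,\ \gamma_{m,k}=n-\frac{\alpha_j}{2}\right\},$$ where $$V_{n,j}(x)=|x|^{-\alpha_j}P_{j,n}\left(\frac{|x|^2}{4}\right)\psi_j\left(\frac{x}{|x|}\right),\qquad P_{j,n}(t)=\sum_{i=0}^n\frac{(-n)_i}{\left(\frac N2-\alpha_j\right)_i}\,\frac{t^i}{i!},$$ and $(s)_i=\prod_{l=0}^{i-1}(s+l)$, $(s)_0=1$, denotes Pochhammer's symbol.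
   Context: $\mathbb{N}=\{0,1,2,\dots\}$; $\mathbb{S}^{N-1}$ is the unit sphere of $\mathbb{R}^N$. The magnetic gradient is $\nabla_{\mathbf{A}}v=\nabla v+i\frac{\mathbf{A}(x/|x|)}{|x|}v$. Angular operator: $T_{\mathbf{A},a}=(-i\nabla_{\mathbb{S}^{N-1}}+\mathbf{A})^2-a(\theta)=-\Delta_{\mathbb{S}^{N-1}}+(|\mathbf{A}|^2-a(\theta)-i\,\mathrm{div}_{\mathbb{S}^{N-1}}\mathbf{A})-2i\mathbf{A}\cdot\nabla_{\mathbb{S}^{N-1}}$ on $\mathbb{S}^{N-1}$. It has a diverging sequence of real eigenvalues $\mu_1(\mathbf{A},a)\le\mu_2(\mathbf{A},a)\le\cdots$ (repeated according to their finite multiplicity), with eigenfunctions $\psi_k$, $T_{\mathbf{A},a}\psi_k=\mu_k(\mathbf{A},a)\psi_k$, $k\geq1$, chosen so that $\{\psi_k\}_{k\ge1}$ is an orthonormal basis of $L^2(\mathbb{S}^{N-1},\mathbb{C})$. In particular $$\mu_1(\mathbf{A},a)=\min_{\psi\in H^1(\mathbb{S}^{N-1})\setminus\{0\}}\frac{\int_{\mathbb{S}^{N-1}}[|(\nabla_{\mathbb{S}^{N-1}}+i\mathbf{A})\psi|^2-a|\psi|^2]\,dS}{\int_{\mathbb{S}^{N-1}}|\psi|^2\,dS}.$$ Set $\alpha_k=\frac{N-2}{2}-\sqrt{\left(\frac{N-2}{2}\right)^2+\mu_k(\mathbf{A},a)}$. $\mathcal{H}$ is the completion of $C_c^\infty(\mathbb{R}^N\setminus\{0\},\mathbb{C})$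 with respect to the norm $\|v\|_{\mathcal{H}}=\left(\int_{\mathbb{R}^N}\left(|\nabla v|^2+|v|^2+\frac{|v|^2}{|x|^2}\right)e^{-|x|^2/4}dx\right)^{1/2}$, and $\mathcal{H}^\star$ is its dual. The operator $L_{\mathbf{A},a}:\mathcal{H}\to\mathcal{H}^\star$ (formally $(-i\nabla+\frac{\mathbf{A}(x/|x|)}{|x|})^2-\frac{a(x/|x|)}{|x|^2}+\frac x2\cdot\nabla$) is defined by $${}_{\mathcal{H}^\star}\langle L_{\mathbf{A},a}v,w\rangle_{\mathcal{H}}=\int_{\mathbb{R}^N}\left(\nabla_{\mathbf{A}}v\cdot\overline{\nabla_{\mathbf{A}}w}-\frac{a(x/|x|)}{|x|^2}v\overline{w}\right)e^{-|x|^2/4}dx,\quad v,w\in\mathcal{H}.$$ $\gamma$ is an eigenvalue of $L_{\mathbf{A},a}$ with eigenfunction $g\in\mathcal{H}\setminus\{0\}$ if ${}_{\mathcal{H}^\star}\langle L_{\mathbf{A},a}g,w\rangle_{\mathcal{H}}=\gamma\int_{\mathbb{R}^N}g\overline{w}\,e^{-|x|^2/4}dx$ for all $w\in\mathcal{H}$. *)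

theory Defs
  imports "HOL-Analysis.Analysis"
begin

section \<open>Calculus on open sets and on the unit sphere\<close>

definition partial_deriv :: "'n \<Rightarrow> (real^'n \<Rightarrow> 'b::real_normed_vector) \<Rightarrow> real^'n \<Rightarrow> 'b" where
  "partial_deriv i f x = frechet_derivative f (at x) (axis i 1)"

text \<open>The class \<open>C\<^sup>k(S)\<close>, meaningful for open \<open>S\<close>.\<close>

primrec Ck_on :: "nat \<Rightarrow> (real^'n) set \<Rightarrow> (real^'n \<Rightarrow> 'b::real_normed_vector) \<Rightarrow> bool" where
  "Ck_on 0 S f \<longleftrightarrow> continuous_on S f"
| "Ck_on (Suc k) S f \<longleftrightarrow> f differentiable_on S \<and> (\<forall>i. Ck_on k S (partial_deriv i f))"

definition smooth_on :: "(real^'n) set \<Rightarrow> (real^'n \<Rightarrow> 'b::real_normed_vector) \<Rightarrow> bool" where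
  "smooth_on S f \<longleftrightarrow> (\<forall>k. Ck_on k S f)"

definition grad :: "(real^'n \<Rightarrow> complex) \<Rightarrow> real^'n \<Rightarrow> complex^'n" where
  "grad f x = (\<chi> i. partial_deriv i f x)"

text \<open>
  A function on the unit sphere is represented by a function on the whole space of which only
  the values on \<^term>\<open>sphere 0 1\<close> matter. Its regularity and its tangential gradient are those
  of the extension \<open>x \<mapsto> f (x / |x|)\<close>, homogeneous of degree 0 (recall \<open>sgn x = x / |x|\<close>):
  the radial derivative of the extension vanishes, so its Euclidean gradient at a point of the
  sphere is the gradient on the sphere.
\<close>

definition Ck_sphere :: "nat \<Rightarrow> (real^'n \<Rightarrow> 'b::real_normed_vector) \<Rightarrow> bool" where
  "Ck_sphere k f \<longleftrightarrow> Ck_on k (- {0}) (\<lambda>x. f (sgn x))"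

definition smooth_sphere :: "(real^'n \<Rightarrow> 'b::real_normed_vector) \<Rightarrow> bool" where
  "smooth_sphere f \<longleftrightarrow> smooth_on (- {0}) (\<lambda>x. f (sgn x))"

definition sphere_grad :: "(real^'n \<Rightarrow> complex) \<Rightarrow> real^'n \<Rightarrow> complex^'n" where
  "sphere_grad f \<theta> = grad (\<lambda>x. f (sgn x)) \<theta>"

text \<open>The Hermitian product of \<open>\<complex>\<^sup>N\<close>, linear in the first argument.\<close>

definition cdot :: "complex^'n \<Rightarrow> complex^'n \<Rightarrow> complex" where
  "cdot u w = (\<Sum>i\<in>UNIV. u $ i * cnj (w $ i))"


section \<open>The sphere: surface measure, Sobolev space, angular operator\<close>

text \<open>
  Surface measure: \<open>\<sigma>(E) = N \<lambda>({r \<theta> | 0 < r < 1, \<theta> \<in> E})\<close>, which is the measure of the polar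
  coordinates formula \<open>dx = r\<^bsup>N-1\<^esup> dr d\<sigma>\<close>.
\<close>

definition sphere_measure :: "(real^'n) measure" where
  "sphere_measure =
     scale_measure (of_nat CARD('n))
       (distr (restrict_space lborel (ball 0 1 - {0})) (restrict_space borel (sphere 0 1)) sgn)"

definition Linf_sphere :: "(real^'n \<Rightarrow> real) \<Rightarrow> bool" where
  "Linf_sphere a \<longleftrightarrow>
     a \<in> borel_measurable sphere_measure \<and> (\<exists>C. AE \<theta> in sphere_measure. \<bar>a \<theta>\<bar> \<le> C)"

definition L2_sphere :: "(real^'n \<Rightarrow> complex) set" where
  "L2_sphere = {f \<in> borel_measurable sphere_measure.
     (\<integral>\<^sup>+\<theta>. ennreal ((norm (f \<theta>))\<^sup>2) \<partial>sphere_measure) < \<infinity>}"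

definition L2_sphere_inner :: "(real^'n \<Rightarrow> complex) \<Rightarrow> (real^'n \<Rightarrow> complex) \<Rightarrow> complex" where
  "L2_sphere_inner f g = (\<integral>\<theta>. f \<theta> * cnj (g \<theta>) \<partial>sphere_measure)"

text \<open>
  \<open>H\<^sup>1\<close> of the sphere is the completion of the smooth functions in the \<open>H\<^sup>1\<close> norm, realised inside
  \<open>L\<^sup>2\<close>: \<open>u\<close> is a limit of smooth functions whose gradients converge to \<open>G\<close>. The function \<open>u\<close>
  determines \<open>G\<close> almost everywhere.
\<close>

definition has_H1_sphere_grad :: "(real^'n \<Rightarrow> complex) \<Rightarrow> (real^'n \<Rightarrow> complex^'n) \<Rightarrow> bool" where
  "has_H1_sphere_grad u G \<longleftrightarrow>
     u \<in> borel_measurable sphere_measure \<and> G \<in> borel_measurable sphere_measure \<and>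
     (\<exists>\<phi> :: nat \<Rightarrow> real^'n \<Rightarrow> complex. (\<forall>n. smooth_sphere (\<phi> n)) \<and>
        (\<lambda>n. \<integral>\<^sup>+\<theta>. ennreal ((norm (sphere_grad (\<phi> n) \<theta> - G \<theta>))\<^sup>2 + (norm (\<phi> n \<theta> - u \<theta>))\<^sup>2)
               \<partial>sphere_measure) \<longlonglongrightarrow> 0)"

definition H1_sphere :: "(real^'n \<Rightarrow> complex) set" where
  "H1_sphere = {u. \<exists>G. has_H1_sphere_grad u G}"

definition H1_sphere_grad :: "(real^'n \<Rightarrow> complex) \<Rightarrow> real^'n \<Rightarrow> complex^'n" where
  "H1_sphere_grad u = (SOME G. has_H1_sphere_grad u G)"

definition mag_sphere_grad ::
  "(real^'n \<Rightarrow> real^'n) \<Rightarrow> (real^'n \<Rightarrow> complex) \<Rightarrow> real^'n \<Rightarrow> complex^'n" where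
  "mag_sphere_grad A u \<theta> =
     H1_sphere_grad u \<theta> + (\<chi> i. \<i> * complex_of_real (A \<theta> $ i) * u \<theta>)"

text \<open>
  The operator \<open>T\<^bsub>A,a\<^esub> = (-i \<nabla> + A)\<^sup>2 - a\<close> in weak form, \<open>T_form A a u w\<close> being the pairing of
  \<open>T\<^bsub>A,a\<^esub> u\<close> with \<open>w\<close>; note \<open>-i \<nabla> + A = -i (\<nabla> + i A)\<close>.
\<close>

definition T_form ::
  "(real^'n \<Rightarrow> real^'n) \<Rightarrow> (real^'n \<Rightarrow> real) \<Rightarrow> (real^'n \<Rightarrow> complex) \<Rightarrow> (real^'n \<Rightarrow> complex) \<Rightarrow> complex"
where
  "T_form A a u w =
     (\<integral>\<theta>. cdot (mag_sphere_grad A u \<theta>) (mag_sphere_grad A w \<theta>)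
          - complex_of_real (a \<theta>) * u \<theta> * cnj (w \<theta>) \<partial>sphere_measure)"

definition T_eigenfunction ::
  "(real^'n \<Rightarrow> real^'n) \<Rightarrow> (real^'n \<Rightarrow> real) \<Rightarrow> real \<Rightarrow> (real^'n \<Rightarrow> complex) \<Rightarrow> bool" where
  "T_eigenfunction A a \<mu> u \<longleftrightarrow>
     u \<in> H1_sphere \<and> \<not> (AE \<theta> in sphere_measure. u \<theta> = 0) \<and>
     (\<forall>w\<in>H1_sphere. T_form A a u w = complex_of_real \<mu> * L2_sphere_inner u w)"

text \<open>Families are indexed by \<open>k \<ge> 1\<close>; the entry at index 0 is irrelevant.\<close>

definition orthonormal_basis_L2_sphere :: "(nat \<Rightarrow> real^'n \<Rightarrow> complex) \<Rightarrow> bool" where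
  "orthonormal_basis_L2_sphere \<psi> \<longleftrightarrow>
     (\<forall>k\<ge>1. \<psi> k \<in> L2_sphere) \<and>
     (\<forall>j\<ge>1. \<forall>k\<ge>1. L2_sphere_inner (\<psi> j) (\<psi> k) = (if j = k then 1 else 0)) \<and>
     (\<forall>f\<in>L2_sphere.
        (\<lambda>n. \<integral>\<^sup>+\<theta>. ennreal ((norm (f \<theta> - (\<Sum>k=1..n. L2_sphere_inner f (\<psi> k) * \<psi> k \<theta>)))\<^sup>2)
               \<partial>sphere_measure) \<longlonglongrightarrow> 0)"

text \<open>
  \<open>\<mu>\<^sub>1 \<le> \<mu>\<^sub>2 \<le> \<dots>\<close> is the sequence of the eigenvalues of \<open>T\<^bsub>A,a\<^esub>\<close> and \<open>\<psi>\<close> an associated orthonormal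
  basis of eigenfunctions. As \<open>T\<^bsub>A,a\<^esub>\<close> is symmetric and \<open>\<psi>\<close> is complete, every eigenvalue occurs in
  \<open>\<mu>\<close>, as often as its multiplicity; so \<open>\<mu>\<close> is determined by \<open>A\<close> and \<open>a\<close>.
\<close>

definition angular_spectrum ::
  "(real^'n \<Rightarrow> real^'n) \<Rightarrow> (real^'n \<Rightarrow> real) \<Rightarrow> (nat \<Rightarrow> real) \<Rightarrow> (nat \<Rightarrow> real^'n \<Rightarrow> complex) \<Rightarrow> bool"
where
  "angular_spectrum A a \<mu> \<psi> \<longleftrightarrow>
     (\<forall>j\<ge>1. \<forall>k\<ge>j. \<mu> j \<le> \<mu> k) \<and> filterlim \<mu> at_top sequentially \<and>
     (\<forall>k\<ge>1. T_eigenfunction A a (\<mu> k) (\<psi> k)) \<and>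
     orthonormal_basis_L2_sphere \<psi>"


section \<open>The weighted space and the operator\<close>

definition test_fun :: "(real^'n \<Rightarrow> complex) \<Rightarrow> bool" where
  "test_fun \<phi> \<longleftrightarrow>
     smooth_on UNIV \<phi> \<and> compact (closure {x. \<phi> x \<noteq> 0}) \<and> closure {x. \<phi> x \<noteq> 0} \<subseteq> - {0}"

text \<open>The square of the norm of \<open>\<H>\<close>, for a function \<open>v\<close> with gradient \<open>G\<close>.\<close>

definition H_norm_sq :: "(real^'n \<Rightarrow> complex) \<Rightarrow> (real^'n \<Rightarrow> complex^'n) \<Rightarrow> ennreal" where
  "H_norm_sq v G =
     (\<integral>\<^sup>+x. ennreal (((norm (G x))\<^sup>2 + (norm (v x))\<^sup>2 + (norm (v x))\<^sup>2 / (norm x)\<^sup>2)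
                   * exp (- (norm x)\<^sup>2 / 4)) \<partial>lborel)"

text \<open>
  The completion \<open>\<H>\<close> of the test functions, realised as a space of functions: \<open>v\<close> is a limit of
  test functions whose gradients converge to \<open>G\<close> in the weighted \<open>L\<^sup>2\<close> space. The function \<open>v\<close>
  determines \<open>G\<close> almost everywhere, since \<open>G\<close> is its weak gradient.
\<close>

definition has_H_grad :: "(real^'n \<Rightarrow> complex) \<Rightarrow> (real^'n \<Rightarrow> complex^'n) \<Rightarrow> bool" where
  "has_H_grad v G \<longleftrightarrow>
     v \<in> borel_measurable lborel \<and> G \<in> borel_measurable lborel \<and>
     (\<exists>\<phi> :: nat \<Rightarrow> real^'n \<Rightarrow> complex. (\<forall>n. test_fun (\<phi> n)) \<and>
        (\<lambda>n. H_norm_sq (\<lambda>x. \<phi> n x - v x) (\<lambda>x. grad (\<phi> n) x - G x)) \<longlonglongrightarrow> 0)"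

definition H_space :: "(real^'n \<Rightarrow> complex) set" where
  "H_space = {v. \<exists>G. has_H_grad v G}"

definition H_grad :: "(real^'n \<Rightarrow> complex) \<Rightarrow> real^'n \<Rightarrow> complex^'n" where
  "H_grad v = (SOME G. has_H_grad v G)"

definition mag_grad ::
  "(real^'n \<Rightarrow> real^'n) \<Rightarrow> (real^'n \<Rightarrow> complex) \<Rightarrow> real^'n \<Rightarrow> complex^'n" where
  "mag_grad A v x =
     H_grad v x + (\<chi> i. \<i> * complex_of_real (A (sgn x) $ i / norm x) * v x)"

definition L_op ::
  "(real^'n \<Rightarrow> real^'n) \<Rightarrow> (real^'n \<Rightarrow> real) \<Rightarrow> (real^'n \<Rightarrow> complex) \<Rightarrow> (real^'n \<Rightarrow> complex) \<Rightarrow> complex"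
where
  "L_op A a v w =
     (\<integral>x. (cdot (mag_grad A v x) (mag_grad A w x)
           - complex_of_real (a (sgn x) / (norm x)\<^sup>2) * v x * cnj (w x))
          * complex_of_real (exp (- (norm x)\<^sup>2 / 4)) \<partial>lborel)"

definition L_eigen_eq ::
  "(real^'n \<Rightarrow> real^'n) \<Rightarrow> (real^'n \<Rightarrow> real) \<Rightarrow> complex \<Rightarrow> (real^'n \<Rightarrow> complex) \<Rightarrow> bool" where
  "L_eigen_eq A a \<gamma> g \<longleftrightarrow>
     (\<forall>w\<in>H_space. L_op A a g w =
        \<gamma> * (\<integral>x. g x * cnj (w x) * complex_of_real (exp (- (norm x)\<^sup>2 / 4)) \<partial>lborel))"


section \<open>Functions modulo almost everywhere equality\<close>

quotient_type (overloaded) 'a ae_fun = "'a::euclidean_space \<Rightarrow> complex" /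
  "\<lambda>f g. AE x in lborel. f x = g x" morphisms rep_ae_fun ae_class
proof (rule equivpI)
  show "transp (\<lambda>f g :: 'a \<Rightarrow> complex. AE x in lborel. f x = g x)"
    by (rule transpI) (auto elim: eventually_elim2)
qed (auto intro!: reflpI sympI elim: eventually_mono)

instantiation ae_fun :: (euclidean_space) ab_group_add
begin

lift_definition zero_ae_fun :: "'a ae_fun" is "\<lambda>_. 0" .
lift_definition plus_ae_fun :: "'a ae_fun \<Rightarrow> 'a ae_fun \<Rightarrow> 'a ae_fun" is "\<lambda>f g x. f x + g x"
  by (auto elim: eventually_elim2)
lift_definition minus_ae_fun :: "'a ae_fun \<Rightarrow> 'a ae_fun \<Rightarrow> 'a ae_fun" is "\<lambda>f g x. f x - g x"
  by (auto elim: eventually_elim2)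
lift_definition uminus_ae_fun :: "'a ae_fun \<Rightarrow> 'a ae_fun" is "\<lambda>f x. - f x"
  by (auto elim: eventually_mono)

instance
  by standard (transfer; simp add: algebra_simps)+

end

lift_definition scale_ae :: "complex \<Rightarrow> 'a::euclidean_space ae_fun \<Rightarrow> 'a ae_fun"
  is "\<lambda>c f x. c * f x"
  by (auto elim: eventually_mono)

global_interpretation ae: vector_space scale_ae
  by standard (transfer; simp add: algebra_simps)+

definition L_eigenspace ::
  "(real^'n \<Rightarrow> real^'n) \<Rightarrow> (real^'n \<Rightarrow> real) \<Rightarrow> complex \<Rightarrow> (real^'n) ae_fun set" where
  "L_eigenspace A a \<gamma> = ae_class ` {g \<in> H_space. L_eigen_eq A a \<gamma> g}"

definition L_eigenvalue ::
  "(real^'n \<Rightarrow> real^'n) \<Rightarrow> (real^'n \<Rightarrow> real) \<Rightarrow> complex \<Rightarrow> bool" where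
  "L_eigenvalue A a \<gamma> \<longleftrightarrow> (\<exists>g\<in>H_space. ae_class g \<noteq> 0 \<and> L_eigen_eq A a \<gamma> g)"


section \<open>The explicit eigenvalues and eigenfunctions\<close>

definition alpha :: "nat \<Rightarrow> (nat \<Rightarrow> real) \<Rightarrow> nat \<Rightarrow> real" where
  "alpha N \<mu> k = (real N - 2) / 2 - sqrt (((real N - 2) / 2)\<^sup>2 + \<mu> k)"

definition gamma_mk :: "nat \<Rightarrow> (nat \<Rightarrow> real) \<Rightarrow> nat \<Rightarrow> nat \<Rightarrow> real" where
  "gamma_mk N \<mu> m k = real m - alpha N \<mu> k / 2"

definition P_poly :: "nat \<Rightarrow> (nat \<Rightarrow> real) \<Rightarrow> nat \<Rightarrow> nat \<Rightarrow> real \<Rightarrow> real" where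
  "P_poly N \<mu> j n t =
     (\<Sum>i=0..n. pochhammer (- real n) i / pochhammer (real N / 2 - alpha N \<mu> j) i * (t ^ i / fact i))"

definition V_fun ::
  "(nat \<Rightarrow> real) \<Rightarrow> (nat \<Rightarrow> real^'n \<Rightarrow> complex) \<Rightarrow> nat \<Rightarrow> nat \<Rightarrow> real^'n \<Rightarrow> complex" where
  "V_fun \<mu> \<psi> n j x =
     complex_of_real (norm x powr (- alpha CARD('n) \<mu> j) * P_poly CARD('n) \<mu> j n ((norm x)\<^sup>2 / 4))
       * \<psi> j (sgn x)"

end

theory Submission
  imports Defs "HOL-Real_Asymp.Real_Asymp"
begin

text \<open>
  In polar coordinates the operator splits: testing \<open>V = \<rho>(|x|\<^sup>2) \<psi>\<^sub>j(x/|x|)\<close> against a test function,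
  the angular eigenvalue equation leaves an integrand which is an exact radial derivative as soon as
  \<open>4 q \<rho>'' + (2 N - q) \<rho>' - \<mu>\<^sub>j \<rho>/q + \<gamma> \<rho> = 0\<close>; for \<open>\<rho> = q\<^sup>s p(q/4)\<close> with \<open>s = - \<alpha>\<^sub>j/2\<close> this is Kummer's
  equation for \<open>p\<close>. So every \<open>V\<^sub>n\<^sub>,\<^sub>j\<close> is an eigenfunction.

  No asymptotics of radial solutions are needed for the converse. The form is Hermitian and the
  \<open>\<gamma>\<^sub>m\<^sub>,\<^sub>k\<close> are real, so an eigenfunction for \<open>\<gamma>\<close> is orthogonal to every \<open>V\<^sub>n\<^sub>,\<^sub>j\<close> with another
  eigenvalue. Subtracting its projection on the finitely many \<open>V\<^sub>n\<^sub>,\<^sub>j\<close> with eigenvalue \<open>\<gamma>\<close> gives an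
  element orthogonal to all \<open>V\<^sub>n\<^sub>,\<^sub>j\<close>: all moments of its angular coefficients against a weight with
  exponential decay vanish, hence so do the coefficients, and the element is zero since \<open>\<psi>\<close> is complete.
\<close>

section \<open>Calculus of smooth functions\<close>

text \<open>Both Sobolev spaces are completions realised by functions, with gradients picked by
  \<open>SOME\<close>, so no form can be evaluated before gradients are known to be unique almost
  everywhere. On the whole space this is integration by parts; on the sphere it is inherited by
  lifting u to |x|^2 u(x/|x|). Test functions avoid the origin, so membership of
  \<open>V_fun\<close> in \<open>H_space\<close> needs truncations near 0; their gradients grow like
  1/|x|, which the inverse square weight of the norm absorbs. The hypothesis on
  \<open>\<mu> 1\<close> enters through -\<alpha>_j/2 > (2 - N)/4: this is the integrability of
  |x|^(-2\<alpha>_j - 2) at the origin, and it makes the parameter N/2 - \<alpha>_j of Kummer's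
  equation positive. An eigenvalue and j determine n, so orthogonality inside an eigenspace only
  involves different j and comes from the \<psi>_j. The polynomial of \<open>V_fun\<close> has exact
  degree n, which is why orthogonality to all of them with fixed j yields every moment in
  |x|^2.\<close>

lemma partial_deriv_eq:
  assumes "(f has_derivative f') (at x)"
  shows "partial_deriv i f x = f' (axis i 1)"
  using frechet_derivative_at[OF assms] by (simp add: partial_deriv_def)

lemma partial_deriv_cong:
  assumes "open S" "x \<in> S" "f differentiable_on S" "\<And>y. y \<in> S \<Longrightarrow> f y = g y"
  shows "partial_deriv i f x = partial_deriv i g x"
proof -
  have "f differentiable (at x)"
    using assms differentiable_on_eq_differentiable_at by blast
  then have "(f has_derivative frechet_derivative f (at x)) (at x)"
    by (simp add: frechet_derivative_works)
  then have "(g has_derivative frechet_derivative f (at x)) (at x)"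
    using has_derivative_transform_within_open assms by blast
  then show ?thesis
    unfolding partial_deriv_def using frechet_derivative_at by metis
qed

lemma Ck_on_cong:
  assumes S: "open S" and "Ck_on k S f" "\<And>y. y \<in> S \<Longrightarrow> f y = g y"
  shows "Ck_on k S g"
  using assms(2,3)
proof (induction k arbitrary: f g)
  case 0
  then show ?case by (simp cong: continuous_on_cong)
next
  case (Suc k)
  have "g differentiable_on S"
    using Suc.prems by (metis Ck_on.simps(2) differentiable_on_def differentiable_transform_within zero_less_one)
  moreover have "Ck_on k S (partial_deriv i g)" for i
    using Suc.IH[of "partial_deriv i f" "partial_deriv i g"] Suc.prems partial_deriv_cong[OF S]
    by (metis Ck_on.simps(2))
  ultimately show ?case by simp
qed

lemma Ck_on_Suc_imp: "Ck_on (Suc k) S f \<Longrightarrow> Ck_on k S f"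
proof (induction k arbitrary: f)
  case 0
  then show ?case using differentiable_imp_continuous_on by auto
next
  case (Suc k)
  then show ?case by (metis Ck_on.simps(2))
qed

lemma has_derivative_Ck:
  assumes "open S" "Ck_on (Suc k) S f" "x \<in> S"
  shows "(f has_derivative frechet_derivative f (at x)) (at x)"
proof -
  have "f differentiable (at x)"
    using assms differentiable_on_eq_differentiable_at by auto
  then show ?thesis by (simp add: frechet_derivative_works)
qed

lemma frechet_derivative_eq_sum_partial:
  fixes f :: "real^'n \<Rightarrow> 'b::real_normed_vector"
  assumes "(f has_derivative f') (at x)"
  shows "f' h = (\<Sum>i\<in>UNIV. (h $ i) *\<^sub>R partial_deriv i f x)"
proof -
  have l: "linear f'" using assms has_derivative_linear by blast
  have "f' h = f' (\<Sum>i\<in>UNIV. (h $ i) *\<^sub>R axis i 1)"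
    using basis_expansion[of h] by (simp add: scalar_mult_eq_scaleR)
  also have "\<dots> = (\<Sum>i\<in>UNIV. (h $ i) *\<^sub>R f' (axis i 1))"
    by (simp add: linear_sum[OF l] linear_scale[OF l])
  finally show ?thesis by (simp add: partial_deriv_eq[OF assms])
qed

section \<open>Closure of the classes C^k under algebra and composition\<close>

lemma Ck_on_const:
  fixes S :: "(real^'n) set"
  shows "Ck_on k S (\<lambda>x. c)"
proof (induction k arbitrary: c)
  case (Suc k)
  have "partial_deriv i (\<lambda>x::real^'n. c) = (\<lambda>x. 0)" for i
    by (rule ext, rule partial_deriv_eq[of _ "\<lambda>_. 0"]) simp
  with Suc show ?case by simp
qed simp

lemma Ck_on_bounded_linear:
  assumes "bounded_linear h"
  shows "Ck_on k S h"
proof (cases k)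
  case 0
  then show ?thesis using assms by (simp add: linear_continuous_on)
next
  case (Suc m)
  have "partial_deriv i h = (\<lambda>x. h (axis i 1))" for i
    by (rule ext, rule partial_deriv_eq, rule bounded_linear_imp_has_derivative[OF assms])
  moreover have "h differentiable_on S"
    using assms bounded_linear_imp_differentiable_on by blast
  ultimately show ?thesis using Suc by (simp add: Ck_on_const)
qed

lemma Ck_on_add:
  assumes S: "open S"
  shows "Ck_on k S f \<Longrightarrow> Ck_on k S g \<Longrightarrow> Ck_on k S (\<lambda>x. f x + g x)"
proof (induction k arbitrary: f g)
  case 0
  then show ?case by (simp add: continuous_on_add)
next
  case (Suc k)
  have "Ck_on k S (partial_deriv i (\<lambda>x. f x + g x))" for i
  proof (rule Ck_on_cong[OF S])
    show "Ck_on k S (\<lambda>x. partial_deriv i f x + partial_deriv i g x)"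
      using Suc.prems by (intro Suc.IH) auto
    fix y assume "y \<in> S"
    from has_derivative_add[OF has_derivative_Ck[OF S Suc.prems(1) this] has_derivative_Ck[OF S Suc.prems(2) this]]
    show "partial_deriv i f y + partial_deriv i g y = partial_deriv i (\<lambda>x. f x + g x) y"
      by (subst partial_deriv_eq) (auto simp: partial_deriv_def)
  qed
  then show ?case using Suc.prems by (auto intro: differentiable_on_add)
qed

lemma Ck_on_bilinear:
  assumes S: "open S" and p: "bounded_bilinear p"
  shows "Ck_on k S f \<Longrightarrow> Ck_on k S g \<Longrightarrow> Ck_on k S (\<lambda>x. p (f x) (g x))"
proof (induction k arbitrary: f g)
  case 0
  then show ?case using bounded_bilinear.continuous_on[OF p] by simp
next
  case (Suc k)
  have C: "Ck_on k S f" "Ck_on k S g"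
    using Suc.prems(1,2)[THEN Ck_on_Suc_imp] by auto
  have d: "((\<lambda>x. p (f x) (g x)) has_derivative
          (\<lambda>h. p (f y) (frechet_derivative g (at y) h) + p (frechet_derivative f (at y) h) (g y))) (at y)"
    if "y \<in> S" for y
    using bounded_bilinear.FDERIV[OF p has_derivative_Ck[OF S Suc.prems(1) that] has_derivative_Ck[OF S Suc.prems(2) that]] .
  have "Ck_on k S (partial_deriv i (\<lambda>x. p (f x) (g x)))" for i
  proof (rule Ck_on_cong[OF S])
    show "Ck_on k S (\<lambda>x. p (f x) (partial_deriv i g x) + p (partial_deriv i f x) (g x))"
      using Suc.prems C by (intro Ck_on_add[OF S] Suc.IH) auto
    fix y assume "y \<in> S"
    from d[OF this]
    show "p (f y) (partial_deriv i g y) + p (partial_deriv i f y) (g y) = partial_deriv i (\<lambda>x. p (f x) (g x)) y"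
      by (subst partial_deriv_eq) (auto simp: partial_deriv_def)
  qed
  moreover have "(\<lambda>x. p (f x) (g x)) differentiable_on S"
    unfolding differentiable_on_eq_differentiable_at[OF S] differentiable_def using d by blast
  ultimately show ?case by simp
qed

lemmas Ck_on_mult = Ck_on_bilinear[OF _ bounded_bilinear_mult]
lemmas Ck_on_scaleR = Ck_on_bilinear[OF _ bounded_bilinear_scaleR]

lemma Ck_on_sum:
  assumes S: "open S"
  shows "(\<And>a. a \<in> A \<Longrightarrow> Ck_on k S (f a)) \<Longrightarrow> Ck_on k S (\<lambda>x. \<Sum>a\<in>A. f a x)"
proof (induction A rule: infinite_finite_induct)
  case (insert a A)
  then show ?case using Ck_on_add[OF S, of k "f a" "\<lambda>x. \<Sum>a\<in>A. f a x"] by simp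
qed (simp_all add: Ck_on_const)

lemma Ck_on_prod:
  fixes f :: "'a \<Rightarrow> real^'n \<Rightarrow> 'b::{real_normed_algebra_1,comm_ring_1}"
  assumes S: "open S"
  shows "(\<And>a. a \<in> A \<Longrightarrow> Ck_on k S (f a)) \<Longrightarrow> Ck_on k S (\<lambda>x. \<Prod>a\<in>A. f a x)"
proof (induction A rule: infinite_finite_induct)
  case (insert a A)
  then show ?case using Ck_on_mult[OF S, of k "f a" "\<lambda>x. \<Prod>a\<in>A. f a x"] by simp
qed (simp_all add: Ck_on_const)

lemma Ck_on_compose_bounded_linear:
  assumes S: "open S" and h: "bounded_linear h"
  shows "Ck_on k S f \<Longrightarrow> Ck_on k S (\<lambda>x. h (f x))"
proof (induction k arbitrary: f)
  case 0
  then show ?case by (simp add: bounded_linear.continuous_on[OF h])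
next
  case (Suc k)
  have d: "((\<lambda>x. h (f x)) has_derivative (\<lambda>u. h (frechet_derivative f (at y) u))) (at y)" if "y \<in> S" for y
    using bounded_linear.has_derivative[OF h has_derivative_Ck[OF S Suc.prems that]] .
  have "Ck_on k S (partial_deriv i (\<lambda>x. h (f x)))" for i
  proof (rule Ck_on_cong[OF S])
    show "Ck_on k S (\<lambda>x. h (partial_deriv i f x))"
      by (rule Suc.IH) (use Suc.prems in simp)
    show "h (partial_deriv i f y) = partial_deriv i (\<lambda>x. h (f x)) y" if "y \<in> S" for y
      by (subst partial_deriv_eq[OF d[OF that]]) (simp add: partial_deriv_def)
  qed
  moreover have "(\<lambda>x. h (f x)) differentiable_on S"
    unfolding differentiable_on_eq_differentiable_at[OF S] differentiable_def using d by blast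
  ultimately show ?case by simp
qed

text \<open>\<open>Ck_on\<close> only covers functions on \<open>real^'n\<close>. For scalar
  functions a whole sequence D of successive derivatives is exhibited, so that the induction below
  can move from \<open>D m\<close> to \<open>D (Suc m)\<close>.\<close>

definition smooth_real_on :: "real set \<Rightarrow> (real \<Rightarrow> real) \<Rightarrow> bool" where
  "smooth_real_on U g \<longleftrightarrow>
     (\<exists>D. D 0 = g \<and> (\<forall>k. \<forall>t\<in>U. (D k has_real_derivative D (Suc k) t) (at t)))"

text \<open>Induction on k with m arbitrary: the chain rule produces the factor
  \<open>D (Suc m) (h x)\<close>, to which the induction hypothesis applies, times a partial
  derivative of h.\<close>

lemma Ck_on_compose_real:
  assumes S: "open S" and D: "\<And>k t. t \<in> U \<Longrightarrow> (D k has_real_derivative D (Suc k) t) (at t)"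
    and h: "\<And>x. x \<in> S \<Longrightarrow> h x \<in> U"
  shows "Ck_on k S h \<Longrightarrow> Ck_on k S (\<lambda>x. D m (h x))"
proof (induction k arbitrary: m)
  case 0
  have "continuous_on U (D m)"
    using D by (meson DERIV_isCont continuous_at_imp_continuous_on)
  then show ?case using 0 h by (auto intro: continuous_on_compose2)
next
  case (Suc k)
  have d: "((\<lambda>x. D m (h x)) has_derivative
           (\<lambda>u. D (Suc m) (h y) * frechet_derivative h (at y) u)) (at y)" if "y \<in> S" for y
    using has_derivative_compose[OF has_derivative_Ck[OF S Suc.prems that], of "D m" "\<lambda>u. D (Suc m) (h y) * u"]
      D[OF h[OF that], of m] by (simp add: has_field_derivative_def)
  have "Ck_on k S (partial_deriv i (\<lambda>x. D m (h x)))" for i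
  proof (rule Ck_on_cong[OF S])
    show "Ck_on k S (\<lambda>x. D (Suc m) (h x) * partial_deriv i h x)"
      using Suc.prems Ck_on_Suc_imp[OF Suc.prems] by (intro Ck_on_mult[OF S] Suc.IH) auto
    show "D (Suc m) (h y) * partial_deriv i h y = partial_deriv i (\<lambda>x. D m (h x)) y" if "y \<in> S" for y
      by (subst partial_deriv_eq[OF d[OF that]]) (simp add: partial_deriv_def)
  qed
  moreover have "(\<lambda>x. D m (h x)) differentiable_on S"
    unfolding differentiable_on_eq_differentiable_at[OF S] differentiable_def using d by blast
  ultimately show ?case by simp
qed

text \<open>The inner map enters through its components, which is the form in which the regularity
  of \<open>sgn\<close> is available. In each summand of the chain rule one factor is covered by the
  induction hypothesis and the other by the assumption on the components.\<close>

lemma Ck_on_compose: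
  fixes s :: "real^'m \<Rightarrow> real^'n"
  assumes S: "open S" and T: "open T" and s: "\<And>x. x \<in> S \<Longrightarrow> s x \<in> T"
  shows "Ck_on k T f \<Longrightarrow> (\<And>i. Ck_on k S (\<lambda>x. s x $ i)) \<Longrightarrow> Ck_on k S (\<lambda>x. f (s x))"
proof (induction k arbitrary: f)
  case 0
  have "continuous_on S (\<lambda>x. \<chi> i. s x $ i)"
    using 0(2) by (intro continuous_on_vec_lambda) simp
  then show ?case using continuous_on_compose2[of T f S s] 0(1) s by (simp add: image_subset_iff)
next
  case (Suc k)
  define s' where "s' y u = (\<chi> j. frechet_derivative (\<lambda>x. s x $ j) (at y) u)" for y u
  have s': "(s has_derivative s' y) (at y)" if "y \<in> S" for y
    using has_derivative_Ck[OF S Suc.prems(2) that] unfolding s'_def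
    by (subst has_derivative_componentwise_within) (auto simp: Basis_vec_def cart_eq_inner_axis[symmetric] inner_axis)
  have d: "((\<lambda>x. f (s x)) has_derivative (\<lambda>u. frechet_derivative f (at (s y)) (s' y u))) (at y)" if "y \<in> S" for y
    using has_derivative_compose[OF s'[OF that] has_derivative_Ck[OF T Suc.prems(1) s[OF that]]] .
  have "Ck_on k S (partial_deriv i (\<lambda>x. f (s x)))" for i
  proof (rule Ck_on_cong[OF S])
    show "Ck_on k S (\<lambda>x. \<Sum>j\<in>UNIV. partial_deriv i (\<lambda>x. s x $ j) x *\<^sub>R partial_deriv j f (s x))"
      using Suc.prems Ck_on_Suc_imp[OF Suc.prems(2)] by (intro Ck_on_sum[OF S] Ck_on_scaleR[OF S] Suc.IH) auto
    fix y assume y: "y \<in> S"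
    have "partial_deriv i (\<lambda>x. f (s x)) y = frechet_derivative f (at (s y)) (s' y (axis i 1))"
      by (rule partial_deriv_eq[OF d[OF y]])
    also have "\<dots> = (\<Sum>j\<in>UNIV. (s' y (axis i 1) $ j) *\<^sub>R partial_deriv j f (s y))"
      by (rule frechet_derivative_eq_sum_partial[OF has_derivative_Ck[OF T Suc.prems(1) s[OF y]]])
    finally show "(\<Sum>j\<in>UNIV. partial_deriv i (\<lambda>x. s x $ j) y *\<^sub>R partial_deriv j f (s y)) =
         partial_deriv i (\<lambda>x. f (s x)) y"
      by (simp add: s'_def partial_deriv_def)
  qed
  moreover have "(\<lambda>x. f (s x)) differentiable_on S"
    unfolding differentiable_on_eq_differentiable_at[OF S] differentiable_def using d by blast
  ultimately show ?case by simp
qed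

lemma Ck_on_subset:
  assumes "Ck_on k S f" "open S" "T \<subseteq> S"
  shows "Ck_on k T f"
  using assms(1)
proof (induction k arbitrary: f)
  case 0
  then show ?case using assms continuous_on_subset by auto
next
  case (Suc k)
  then show ?case using assms differentiable_on_subset by auto
qed

lemma smooth_on_real_compose:
  assumes "open S" "smooth_real_on U g" "smooth_on S h" "\<And>x. x \<in> S \<Longrightarrow> h x \<in> U"
  shows "smooth_on S (\<lambda>x. g (h x))"
proof -
  obtain D where D: "D 0 = g" "\<And>k t. t \<in> U \<Longrightarrow> (D k has_real_derivative D (Suc k) t) (at t)"
    using assms(2) unfolding smooth_real_on_def by blast
  show ?thesis
    using Ck_on_compose_real[where D = D and U = U and m = 0 and h = h, OF assms(1) D(2) assms(4)] assms(3)
    unfolding smooth_on_def D(1) by blast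
qed

lemma smooth_on_const: "smooth_on S (\<lambda>x. c)"
  by (simp add: smooth_on_def Ck_on_const)

lemma smooth_on_bounded_linear: "bounded_linear h \<Longrightarrow> smooth_on S h"
  by (simp add: smooth_on_def Ck_on_bounded_linear)

lemma smooth_on_compose_bounded_linear:
  "open S \<Longrightarrow> bounded_linear h \<Longrightarrow> smooth_on S f \<Longrightarrow> smooth_on S (\<lambda>x. h (f x))"
  by (simp add: smooth_on_def Ck_on_compose_bounded_linear)

lemma smooth_on_add:
  "open S \<Longrightarrow> smooth_on S f \<Longrightarrow> smooth_on S g \<Longrightarrow> smooth_on S (\<lambda>x. f x + g x)"
  by (simp add: smooth_on_def Ck_on_add)

lemma smooth_on_mult:
  fixes f g :: "real^'n \<Rightarrow> 'b::real_normed_algebra"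
  shows "open S \<Longrightarrow> smooth_on S f \<Longrightarrow> smooth_on S g \<Longrightarrow> smooth_on S (\<lambda>x. f x * g x)"
  by (simp add: smooth_on_def Ck_on_mult)

lemma smooth_on_sum:
  "open S \<Longrightarrow> (\<And>a. a \<in> A \<Longrightarrow> smooth_on S (f a)) \<Longrightarrow> smooth_on S (\<lambda>x. \<Sum>a\<in>A. f a x)"
  by (simp add: smooth_on_def Ck_on_sum)

lemma smooth_on_prod:
  fixes f :: "'a \<Rightarrow> real^'n \<Rightarrow> 'b::{real_normed_algebra_1,comm_ring_1}"
  shows "open S \<Longrightarrow> (\<And>a. a \<in> A \<Longrightarrow> smooth_on S (f a)) \<Longrightarrow> smooth_on S (\<lambda>x. \<Prod>a\<in>A. f a x)"
  by (simp add: smooth_on_def Ck_on_prod)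

lemma smooth_on_subset:
  "smooth_on S f \<Longrightarrow> open S \<Longrightarrow> T \<subseteq> S \<Longrightarrow> smooth_on T f"
  by (meson smooth_on_def Ck_on_subset)

lemma smooth_on_cong:
  "open S \<Longrightarrow> smooth_on S f \<Longrightarrow> (\<And>y. y \<in> S \<Longrightarrow> f y = g y) \<Longrightarrow> smooth_on S g"
  unfolding smooth_on_def by (blast intro: Ck_on_cong)

lemma smooth_on_compose:
  fixes s :: "real^'m \<Rightarrow> real^'n"
  assumes "open S" "open T" "\<And>x. x \<in> S \<Longrightarrow> s x \<in> T" "smooth_on T f" "\<And>i. smooth_on S (\<lambda>x. s x $ i)"
  shows "smooth_on S (\<lambda>x. f (s x))"
  using Ck_on_compose[OF assms(1,2), of s, OF assms(3)] assms(4,5) unfolding smooth_on_def by blast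

lemma smooth_on_partial_deriv:
  "smooth_on S f \<Longrightarrow> smooth_on S (partial_deriv i f)"
  unfolding smooth_on_def by (metis Ck_on.simps(2))

lemma smooth_on_has_derivative:
  "open S \<Longrightarrow> smooth_on S f \<Longrightarrow> x \<in> S \<Longrightarrow> (f has_derivative frechet_derivative f (at x)) (at x)"
  unfolding smooth_on_def using has_derivative_Ck by blast

lemma smooth_on_imp_continuous_on: "smooth_on S f \<Longrightarrow> continuous_on S f"
  unfolding smooth_on_def by (metis Ck_on.simps(1))

text \<open>Serves to glue smoothness off the origin to vanishing near the origin. Openness makes
  continuity and differentiability local.\<close>

lemma smooth_on_Un:
  assumes "smooth_on S f" "smooth_on T f" "open S" "open T"
  shows "smooth_on (S \<union> T) f"
proof -
  have "Ck_on k S f \<Longrightarrow> Ck_on k T f \<Longrightarrow> Ck_on k (S \<union> T) f" for k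
  proof (induction k arbitrary: f)
    case 0
    then show ?case using assms continuous_on_open_Un by auto
  next
    case (Suc k)
    then show ?case
      using assms by (auto simp: differentiable_on_eq_differentiable_at open_Un)
  qed
  with assms show ?thesis unfolding smooth_on_def by blast
qed

section \<open>Smoothness of powers of |x| and of x/|x| off the origin\<close>

lemma smooth_on_component: "smooth_on S (\<lambda>x. x $ i)"
  by (rule smooth_on_bounded_linear) (rule bounded_linear_vec_nth)

lemma smooth_on_norm_sq: "open S \<Longrightarrow> smooth_on S (\<lambda>x::real^'n. (norm x)\<^sup>2)"
  unfolding power2_norm_eq_inner inner_vec_def
  by (intro smooth_on_sum) (auto intro!: smooth_on_mult smooth_on_component)

lemma smooth_real_on_powr: "smooth_real_on {0<..} (\<lambda>q. q powr s)"
  unfolding smooth_real_on_def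
proof (intro exI[of _ "\<lambda>k q. (\<Prod>i<k. (s - real i)) * q powr (s - real k)"] conjI allI ballI)
  fix k :: nat and t :: real assume t: "t \<in> {0<..}"
  have "((\<lambda>q. q powr (s - real k)) has_real_derivative (s - real k) * t powr (s - real k - 1)) (at t)"
    using has_real_derivative_powr[of t "s - real k"] t by simp
  from DERIV_cmult[OF this, of "\<Prod>i<k. (s - real i)"]
  show "((\<lambda>q. (\<Prod>i<k. s - real i) * q powr (s - real k)) has_real_derivative
            (\<Prod>i<Suc k. s - real i) * t powr (s - real (Suc k))) (at t)"
    by (simp add: algebra_simps)
qed auto

lemma smooth_on_norm_powr:
  "smooth_on (- {0::real^'n}) (\<lambda>x. (norm x)\<^sup>2 powr s)"
  by (rule smooth_on_real_compose[OF _ smooth_real_on_powr smooth_on_norm_sq]) auto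

text \<open>Writing the norm as a power of |x|^2, which is a polynomial in the coordinates, reduces
  smoothness of \<open>sgn\<close> to that of \<open>powr\<close> on the positive half-line. At the
  origin both sides are 0.\<close>

lemma sgn_component: "sgn x $ i = x $ i * (norm x)\<^sup>2 powr (- 1/2)" for x :: "real^'n"
proof -
  have "(norm x)\<^sup>2 powr (- 1/2) = inverse (norm x)" if "x \<noteq> 0"
  proof -
    have "(norm x)\<^sup>2 powr (1/2) = norm x"
      using powr_half_sqrt[of "(norm x)\<^sup>2"] by simp
    then show ?thesis using powr_minus[of "(norm x)\<^sup>2" "1/2"] by simp
  qed
  then show ?thesis by (cases "x = 0") (simp_all add: sgn_div_norm mult.commute)
qed

lemma smooth_on_sgn_component: "smooth_on (- {0}) (\<lambda>x::real^'n. sgn x $ i)"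
  unfolding sgn_component by (intro smooth_on_mult smooth_on_component smooth_on_norm_powr) auto

text \<open>Turns the restriction of a function to the sphere of radius r into an admissible angular
  test function; its extension of degree 0 is x -> f(r x/|x|).\<close>

lemma smooth_sphere_slice:
  fixes f :: "real^'n \<Rightarrow> 'b::real_normed_vector"
  assumes "smooth_on (- {0}) f" "r > 0"
  shows "smooth_sphere (\<lambda>\<theta>. f (r *\<^sub>R \<theta>))"
  unfolding smooth_sphere_def
proof (rule smooth_on_compose[where T = "- {0}" and f = f])
  fix i
  show "smooth_on (- {0}) (\<lambda>x. (r *\<^sub>R sgn x) $ i)"
    unfolding vector_scaleR_component real_scaleR_def
    by (intro smooth_on_mult smooth_on_const smooth_on_sgn_component) auto
qed (use assms in \<open>auto simp: sgn_zero_iff\<close>)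

section \<open>Cutoff functions\<close>

text \<open>The usual flat function exp(-1/t). It has no plateau: the value 1 is approached only as
  t tends to infinity, so truncations are removed by sending the argument to infinity.\<close>

definition cutoff :: "real \<Rightarrow> real" where
  "cutoff t = (if t > 0 then exp (- (1 / t)) else 0)"

definition cutoff' :: "real \<Rightarrow> real" where
  "cutoff' t = (if t > 0 then exp (- (1 / t)) / t\<^sup>2 else 0)"

text \<open>In the variable y = 1/t this is the decay of exp(-y) against powers of y.\<close>

lemma poly_exp_tendsto_0:
  "((\<lambda>t. poly p (1 / t) * exp (- (1 / t))) \<longlongrightarrow> (0::real)) (at_right 0)"
proof -
  have "((\<lambda>y. y ^ k * exp (- y)) \<longlongrightarrow> (0::real)) at_top" for k
    using tendsto_power_div_exp_0[of k] by (simp add: exp_minus divide_inverse)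
  then have "((\<lambda>y. coeff p k * (y ^ k * exp (- y))) \<longlongrightarrow> 0) at_top" for k
    by (intro tendsto_mult_right_zero)
  then have "((\<lambda>y. (\<Sum>k\<le>degree p. coeff p k * (y ^ k * exp (- y)))) \<longlongrightarrow> 0) at_top"
    by (intro tendsto_null_sum)
  then have "((\<lambda>y. poly p y * exp (- y)) \<longlongrightarrow> 0) at_top"
    by (simp add: poly_altdef sum_distrib_right mult.assoc)
  moreover have "filterlim (\<lambda>t::real. 1 / t) at_top (at_right 0)"
    using filterlim_inverse_at_top_right by (simp add: inverse_eq_divide)
  ultimately show ?thesis by (rule filterlim_compose)
qed

lemma smooth_real_on_cutoff: "smooth_real_on UNIV cutoff"
proof -
  \<comment> \<open>With y = 1/t the derivative of P(y) exp(-y) in t is y^2 (P(y) - P'(y)) exp(-y);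
    this is the recursion for the polynomials.\<close>
  define P :: "nat \<Rightarrow> real poly" where "P = rec_nat 1 (\<lambda>_ p. [:0,0,1:] * (p - pderiv p))"
  define D where "D k t = (if t > 0 then poly (P k) (1 / t) * exp (- (1 / t)) else 0)" for k and t :: real
  have "(D k has_real_derivative D (Suc k) t) (at t)" for k t
  proof -
    consider "t > 0" | "t < 0" | "t = 0" by linarith
    then show ?thesis
    proof cases
      case 1
      have "((\<lambda>t. poly (P k) (1 / t) * exp (- (1 / t))) has_real_derivative D (Suc k) t) (at t)"
        using 1 unfolding D_def P_def
        by (auto intro!: derivative_eq_intros poly_DERIV[THEN DERIV_chain2] simp: field_simps power2_eq_square)
      then show ?thesis
        by (rule has_field_derivative_transform_within_open[of _ _ _ "{0<..}"]) (use 1 in \<open>auto simp: D_def\<close>)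
    next
      case 2
      have "((\<lambda>t. 0) has_real_derivative D (Suc k) t) (at t)"
        using 2 by (simp add: D_def)
      then show ?thesis
        by (rule has_field_derivative_transform_within_open[of _ _ _ "{..<0}"]) (use 2 in \<open>auto simp: D_def\<close>)
    next
      case 3
      \<comment> \<open>Dividing by h multiplies the polynomial in 1/h by one more factor 1/h, so
        the quotient is again of the type that tends to 0.\<close>
      have "((\<lambda>h. D k h / h) \<longlongrightarrow> 0) (at_right 0)"
      proof (rule Lim_transform_eventually[OF poly_exp_tendsto_0[of "[:0,1:] * P k"]])
        show "\<forall>\<^sub>F x in at_right 0. poly ([:0, 1:] * P k) (1 / x) * exp (- (1 / x)) = D k x / x"
          unfolding eventually_at_right_field by (auto simp: D_def intro!: exI[of _ 1])
      qed
      moreover have "((\<lambda>h. D k h / h) \<longlongrightarrow> 0) (at_left 0)"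
      proof (rule Lim_transform_eventually[OF tendsto_const])
        show "\<forall>\<^sub>F x in at_left 0. 0 = D k x / x"
          unfolding eventually_at_left_field by (auto simp: D_def intro!: exI[of _ "-1"])
      qed
      ultimately have "((\<lambda>h. D k h / h) \<longlongrightarrow> 0) (at 0)"
        by (simp add: filterlim_split_at)
      then show ?thesis using 3 by (simp add: DERIV_def D_def)
    qed
  qed
  moreover have "D 0 = cutoff"
    by (auto simp: D_def P_def cutoff_def)
  ultimately show ?thesis unfolding smooth_real_on_def by blast
qed

lemma DERIV_cutoff: "(cutoff has_real_derivative cutoff' t) (at t)"
proof -
  obtain D where D: "D 0 = cutoff" "\<And>k t. (D k has_real_derivative D (Suc k) t) (at t)"
    using smooth_real_on_cutoff unfolding smooth_real_on_def by blast
  have cd: "isCont (D 1) t" for t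
    using D(2) DERIV_isCont by blast
  have pos: "D 1 t = cutoff' t" if "t > 0" for t
  proof -
    have "((\<lambda>t. exp (- (1 / t))) has_real_derivative cutoff' t) (at t)"
      using that unfolding cutoff'_def
      by (auto intro!: derivative_eq_intros simp: field_simps power2_eq_square)
    then have "(cutoff has_real_derivative cutoff' t) (at t)"
      by (rule has_field_derivative_transform_within_open[of _ _ _ "{0<..}"]) (use that in \<open>auto simp: cutoff_def\<close>)
    then show ?thesis using D(1) D(2)[of 0 t] DERIV_unique by auto
  qed
  have neg: "D 1 t = 0" if "t < 0" for t
  proof -
    have "((\<lambda>t. 0) has_real_derivative 0) (at t)" by simp
    then have "(cutoff has_real_derivative 0) (at t)"
      by (rule has_field_derivative_transform_within_open[of _ _ _ "{..<0}"]) (use that in \<open>auto simp: cutoff_def\<close>)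
    then show ?thesis using D(1) D(2)[of 0 t] DERIV_unique by auto
  qed
  \<comment> \<open>The closed formula says nothing at 0; continuity of \<open>D 1\<close> and its
    vanishing on the left give the value there.\<close>
  have zero: "D 1 0 = 0"
  proof (rule tendsto_unique[of "at_left 0"])
    show "(D 1 \<longlongrightarrow> D 1 0) (at_left 0)"
      using cd[of 0] by (auto simp: isCont_def filterlim_at_split)
    show "(D 1 \<longlongrightarrow> 0) (at_left 0)"
      by (rule Lim_transform_eventually[OF tendsto_const])
         (use neg in \<open>auto simp: eventually_at_left_field intro!: exI[of _ "-1"]\<close>)
  qed simp
  have "D 1 t = cutoff' t"
    using pos neg zero by (cases "t > 0"; cases "t = 0") (auto simp: cutoff'_def)
  then show ?thesis using D(1) D(2)[of 0 t] by simp
qed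

lemma cutoff_bounds: "0 \<le> cutoff t" "cutoff t \<le> 1"
  by (auto simp: cutoff_def)

text \<open>Both upper bounds compare a power of 1/t with exp(1/t). The bound on t
  \<open>cutoff'\<close> t is the scale-invariant one and survives replacing t by a multiple of
  it.\<close>

lemma cutoff'_bounds: "0 \<le> cutoff' t" "cutoff' t \<le> 2" "t * cutoff' t \<le> 1"
proof -
  show "0 \<le> cutoff' t" by (simp add: cutoff'_def)
  have "1 / t\<^sup>2 \<le> 2 * exp (1 / t)" if "t > 0"
  proof -
    have "1 + 1 / t + (1 / t)\<^sup>2 / 2 \<le> exp (1 / t)" "1 / t > 0"
      using exp_lower_Taylor_quadratic[of "1/t"] that by auto
    then show ?thesis unfolding power_one_over[symmetric] by linarith
  qed
  then show "cutoff' t \<le> 2"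
    by (simp add: cutoff'_def exp_minus field_simps)
  have "1 / t \<le> exp (1 / t)"
    by (smt (verit) exp_ge_add_one_self)
  then show "t * cutoff' t \<le> 1"
    by (cases "t > 0") (simp_all add: cutoff'_def exp_minus field_simps power2_eq_square)
qed

lemma smooth_on_cutoff: "open S \<Longrightarrow> smooth_on S h \<Longrightarrow> smooth_on S (\<lambda>x. cutoff (h x))"
  by (rule smooth_on_real_compose[OF _ smooth_real_on_cutoff]) auto

lemma filterlim_nat_affine_at_top:
  "a > 0 \<Longrightarrow> filterlim (\<lambda>n. real n * a + b) at_top sequentially"
  by real_asymp

lemma cutoff_at_top: "(cutoff \<longlongrightarrow> 1) at_top"
proof (rule Lim_transform_eventually)
  show "((\<lambda>t::real. exp (- (1 / t))) \<longlongrightarrow> 1) at_top" by real_asymp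
  show "\<forall>\<^sub>F t in at_top. exp (- (1 / t)) = cutoff t"
    using eventually_gt_at_top[of 0] by eventually_elim (simp add: cutoff_def)
qed

lemma cutoff'_at_top: "((\<lambda>t. (t + c) * cutoff' t) \<longlongrightarrow> 0) at_top"
proof (rule Lim_transform_eventually)
  show "((\<lambda>t::real. (t + c) * (exp (- (1 / t)) / t\<^sup>2)) \<longlongrightarrow> 0) at_top" by real_asymp
  show "\<forall>\<^sub>F t in at_top. (t + c) * (exp (- (1 / t)) / t\<^sup>2) = (t + c) * cutoff' t"
    using eventually_gt_at_top[of 0] by eventually_elim (simp add: cutoff'_def)
qed

text \<open>The variable is q = |x|^2. The first factor removes q <= 1/n, the second removes q >=
  n.\<close>

definition annulus_cutoff :: "nat \<Rightarrow> real \<Rightarrow> real" where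
  "annulus_cutoff n q = cutoff (real n * q - 1) * cutoff (real n - q)"

definition annulus_cutoff' :: "nat \<Rightarrow> real \<Rightarrow> real" where
  "annulus_cutoff' n q =
     real n * cutoff' (real n * q - 1) * cutoff (real n - q) - cutoff (real n * q - 1) * cutoff' (real n - q)"

lemma DERIV_annulus_cutoff: "(annulus_cutoff n has_real_derivative annulus_cutoff' n q) (at q)"
  unfolding annulus_cutoff_def[abs_def] annulus_cutoff'_def
  by (auto intro!: derivative_eq_intros DERIV_chain2[OF DERIV_cutoff])

lemma annulus_cutoff_bounds: "0 \<le> annulus_cutoff n q" "annulus_cutoff n q \<le> 1"
  by (auto simp: annulus_cutoff_def cutoff_bounds intro!: mult_le_one)

lemma annulus_cutoff_support: "annulus_cutoff n q \<noteq> 0 \<Longrightarrow> n > 0 \<and> 1 / real n \<le> q \<and> q \<le> real n"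
  by (cases "n = 0") (auto simp: annulus_cutoff_def cutoff_def field_simps split: if_splits)

text \<open>With t = n q - 1, adding t \<open>cutoff'\<close> t <= 1 and \<open>cutoff'\<close> t <=
  2 gives n q \<open>cutoff'\<close> t <= 3, uniformly in n. In terms of x the singular part 3/q is
  a gradient of size 6/|x|, which the weight 1/|x|^2 in the norm controls.\<close>

lemma annulus_cutoff'_bound:
  assumes "q > 0"
  shows "\<bar>annulus_cutoff' n q\<bar> \<le> 3 / q + 2"
proof -
  have "(real n * q - 1) * cutoff' (real n * q - 1) \<le> 1" "cutoff' (real n * q - 1) \<le> 2"
    using cutoff'_bounds by auto
  then have "real n * q * cutoff' (real n * q - 1) \<le> 3" by (simp add: algebra_simps)
  then have *: "real n * cutoff' (real n * q - 1) \<le> 3 / q"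
    using assms by (simp add: field_simps)
  have "0 \<le> real n * cutoff' (real n * q - 1) * cutoff (real n - q)"
    by (simp add: cutoff'_bounds cutoff_bounds)
  moreover have "real n * cutoff' (real n * q - 1) * cutoff (real n - q) \<le> 3 / q * 1"
    using * assms by (intro mult_mono) (auto simp: cutoff_bounds cutoff'_bounds)
  moreover have "0 \<le> cutoff (real n * q - 1) * cutoff' (real n - q)"
    by (simp add: cutoff'_bounds cutoff_bounds)
  moreover have "cutoff (real n * q - 1) * cutoff' (real n - q) \<le> 1 * 2"
    by (intro mult_mono) (auto simp: cutoff_bounds cutoff'_bounds)
  ultimately show ?thesis unfolding annulus_cutoff'_def by linarith
qed

lemma annulus_cutoff_tendsto:
  assumes "q > 0"
  shows "(\<lambda>n. annulus_cutoff n q) \<longlonglongrightarrow> 1" "(\<lambda>n. annulus_cutoff' n q) \<longlonglongrightarrow> 0"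
proof -
  have a1: "filterlim (\<lambda>n. real n * q - 1) at_top sequentially"
    using filterlim_nat_affine_at_top[OF assms, of "-1"] by simp
  have a2: "filterlim (\<lambda>n. real n - q) at_top sequentially"
    using filterlim_nat_affine_at_top[of 1 "-q"] by simp
  note c1 = filterlim_compose[OF cutoff_at_top a1] and c2 = filterlim_compose[OF cutoff_at_top a2]
  \<comment> \<open>With t = n q - 1 the factor n equals (t + 1)/q, so the limit of (t + 1)
    \<open>cutoff'\<close> t applies.\<close>
  have c3: "(\<lambda>n. real n * cutoff' (real n * q - 1)) \<longlonglongrightarrow> 0"
    using tendsto_divide[OF filterlim_compose[OF cutoff'_at_top[of 1] a1] tendsto_const[of q]] assms
    by (simp add: mult.assoc)
  have c4': "(cutoff' \<longlongrightarrow> 0) at_top"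
    using tendsto_diff[OF cutoff'_at_top[of 1] cutoff'_at_top[of 0]] by (simp add: algebra_simps)
  have c4: "(\<lambda>n. cutoff' (real n - q)) \<longlonglongrightarrow> 0"
    using filterlim_compose[OF c4' a2] .
  show "(\<lambda>n. annulus_cutoff n q) \<longlonglongrightarrow> 1"
    using tendsto_mult[OF c1 c2] by (simp add: annulus_cutoff_def)
  show "(\<lambda>n. annulus_cutoff' n q) \<longlonglongrightarrow> 0"
    using tendsto_diff[OF tendsto_mult[OF c3 c2] tendsto_mult[OF c1 c4]] by (simp add: annulus_cutoff'_def)
qed

section \<open>Polar coordinates\<close>

lemma space_sphere_measure [simp]: "space (sphere_measure :: (real^'n) measure) = sphere 0 1"
  by (simp add: sphere_measure_def space_restrict_space space_scale_measure)

lemma sets_sphere_measure [measurable_cong]: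
  "sets (sphere_measure :: (real^'n) measure) = sets (restrict_space borel (sphere 0 1))"
  by (simp add: sphere_measure_def)

lemma norm_sgn_eq_1: "x \<noteq> 0 \<Longrightarrow> norm (sgn x) = 1" for x :: "'a::real_normed_vector"
  by (simp add: norm_sgn)

lemma borel_measurable_sgn_vec [measurable]: "(sgn :: real^'n \<Rightarrow> real^'n) \<in> borel_measurable borel"
  unfolding sgn_div_norm[abs_def] by measurable

lemma measurable_sgn_sphere:
  assumes "0 \<notin> S"
  shows "sgn \<in> measurable (restrict_space lborel S) (restrict_space borel (sphere 0 (1::real)) :: (real^'n) measure)"
proof (rule measurable_restrict_space2)
  show "sgn \<in> space (restrict_space lborel S) \<rightarrow> sphere 0 (1::real)"
    using assms by (auto simp: space_restrict_space norm_sgn)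
qed (auto intro!: measurable_restrict_space1)

lemma emeasure_sphere_measure:
  assumes B: "B \<in> sets (sphere_measure :: (real^'n) measure)"
  shows "emeasure sphere_measure B =
    of_nat CARD('n) * emeasure lborel {x::real^'n. x \<noteq> 0 \<and> norm x < 1 \<and> sgn x \<in> B}"
proof -
  have m: "sgn \<in> measurable (restrict_space lborel (ball 0 1 - {0})) (restrict_space borel (sphere 0 (1::real)) :: (real^'n) measure)"
    by (rule measurable_sgn_sphere) simp
  have B': "B \<in> sets (restrict_space borel (sphere 0 (1::real)))"
    using B by (simp add: sets_sphere_measure)
  have "emeasure sphere_measure B = of_nat CARD('n) *
      emeasure (restrict_space lborel (ball 0 1 - {0}))
        (sgn -` B \<inter> space (restrict_space lborel (ball 0 1 - {0})))"
    unfolding sphere_measure_def by (simp add: emeasure_scale_measure emeasure_distr[OF m B'])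
  also have "sgn -` B \<inter> space (restrict_space lborel (ball 0 1 - {0})) = {x. x \<noteq> 0 \<and> norm x < 1 \<and> sgn x \<in> B}"
    by (auto simp: space_restrict_space)
  also have "emeasure (restrict_space lborel (ball 0 1 - {0})) {x. x \<noteq> 0 \<and> norm x < 1 \<and> sgn x \<in> B} =
      emeasure lborel {x. x \<noteq> 0 \<and> norm x < 1 \<and> sgn x \<in> B}"
    by (rule emeasure_restrict_space) auto
  finally show ?thesis .
qed

lemma finite_measure_sphere: "finite_measure (sphere_measure :: (real^'n) measure)"
proof
  have "emeasure (sphere_measure :: (real^'n) measure) (sphere 0 1) =
     of_nat CARD('n) * emeasure lborel {x::real^'n. x \<noteq> 0 \<and> norm x < 1 \<and> sgn x \<in> sphere 0 1}"
    using sets.top[of sphere_measure] by (intro emeasure_sphere_measure) simp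
  also have "\<dots> \<le> of_nat CARD('n) * emeasure lborel (ball (0::real^'n) 1)"
    by (intro mult_left_mono emeasure_mono) auto
  also have "\<dots> < \<infinity>"
    using emeasure_lborel_ball_finite[of "0::real^'n" 1] by (auto simp: ennreal_mult_less_top ennreal_of_nat_eq_real_of_nat)
  finally show "emeasure (sphere_measure :: (real^'n) measure) (space sphere_measure) \<noteq> \<infinity>" by simp
qed

lemma measurable_sphere_sets:
  assumes "B \<in> sets (sphere_measure :: (real^'n) measure)"
  shows "B \<in> sets borel"
  using assms by (auto simp: sets_sphere_measure sets_restrict_space)

text \<open>As \<open>sgn 0 = 0\<close> lies outside the sphere, measurability of h gives nothing
  there; the origin is split off as a piece on which the composite is constant. The second
  hypothesis puts \<open>h 0\<close> into the target space.\<close>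

lemma borel_measurable_compose_sgn:
  assumes "h \<in> measurable (sphere_measure :: (real^'n) measure) M"
    and "\<And>y. y \<in> space M"
  shows "(\<lambda>x. h (sgn x)) \<in> measurable borel M"
proof -
  have "(\<lambda>x. if x = 0 then h 0 else h (sgn x)) \<in> measurable borel M"
  proof (subst measurable_If_restrict_space_iff; (intro conjI)?)
    have "(\<lambda>x. h 0) \<in> measurable (restrict_space borel {x. x = 0}) M"
      using assms(2) by simp
    then show "(\<lambda>x. h 0) \<in> measurable (restrict_space borel {x. x = 0}) M" .
    have "sgn \<in> measurable (restrict_space borel {x::real^'n. x \<noteq> 0}) (restrict_space borel (sphere 0 1))"
      using measurable_sgn_sphere[of "{x::real^'n. x \<noteq> 0}"]
      by (simp add: measurable_def space_restrict_space sets_restrict_space)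
    then have "sgn \<in> measurable (restrict_space borel {x::real^'n. x \<noteq> 0}) sphere_measure"
      by (simp cong: measurable_cong_sets add: sets_sphere_measure)
    from measurable_compose[OF this assms(1)]
    show "(\<lambda>x. h (sgn x)) \<in> measurable (restrict_space borel {x. x \<noteq> 0}) M" .
  qed auto
  also have "(\<lambda>x. if x = 0 then h 0 else h (sgn x)) = (\<lambda>x. h (sgn x))"
    by auto
  finally show ?thesis .
qed

section \<open>The radial measure r^(N-1) dr and the product formula\<close>

definition radial_measure :: "nat \<Rightarrow> real measure" where
  "radial_measure N = density lborel (\<lambda>r. ennreal (indicator {0<..} r * r ^ (N - 1)))"

lemma space_radial_measure [simp]: "space (radial_measure N) = UNIV"
  by (simp add: radial_measure_def)

lemma sets_radial_measure [measurable_cong, simp]: "sets (radial_measure N) = sets borel"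
  by (simp add: radial_measure_def)

lemma AE_radial_pos: "AE r in radial_measure N. r > 0"
  unfolding radial_measure_def by (subst AE_density) (auto simp: indicator_def split: if_splits)

lemma sigma_finite_radial: "sigma_finite_measure (radial_measure N)"
  unfolding radial_measure_def by (subst sigma_finite_measure.sigma_finite_iff_density_finite[OF sigma_finite_lborel]) auto

lemma nn_integral_radial:
  assumes "g \<in> borel_measurable borel"
  shows "(\<integral>\<^sup>+r. g r \<partial>radial_measure N) = (\<integral>\<^sup>+r. ennreal (indicator {0<..} r * r ^ (N - 1)) * g r \<partial>lborel)"
  unfolding radial_measure_def by (subst nn_integral_density) (use assms in auto)

lemma emeasure_radial_lessThan:
  assumes "N \<ge> 1" "s > 0"
  shows "emeasure (radial_measure N) {..<s} = ennreal (s ^ N / N)"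
proof -
  have "emeasure (radial_measure N) {..<s} = (\<integral>\<^sup>+r. ennreal (indicator {0<..} r * r ^ (N - 1)) * indicator {..<s} r \<partial>lborel)"
    unfolding radial_measure_def by (subst emeasure_density) auto
  also have "\<dots> = (\<integral>\<^sup>+r. ennreal (r ^ (N - 1)) * indicator {0..s} r \<partial>lborel)"
  proof (rule nn_integral_cong_AE)
    show "AE r in lborel. ennreal (indicator {0<..} r * r ^ (N - 1)) * indicator {..<s} r =
        ennreal (r ^ (N - 1)) * indicator {0..s} r"
      using AE_lborel_singleton[of 0] AE_lborel_singleton[of s]
      by eventually_elim (auto simp: indicator_def)
  qed
  also have "\<dots> = ennreal (s ^ N / N - 0 ^ N / N)"
  proof (rule nn_integral_FTC_Icc)
    fix x :: real
    have "((\<lambda>r. r ^ N / N) has_real_derivative (N * x ^ (N - 1)) / N) (at x)"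
      by (auto intro!: derivative_eq_intros)
    then show "((\<lambda>r. r ^ N / N) has_real_derivative x ^ (N - 1)) (at x)"
      using assms by simp
  qed (use assms in auto)
  finally show ?thesis using assms by (simp add: power_0_left)
qed

text \<open>Dilation by s maps the unit cone over B onto the cone of radius s and multiplies
  Lebesgue measure by s^N; up to the factor N, the unit cone is what defines
  \<open>sphere_measure\<close>.\<close>

lemma emeasure_cone:
  assumes B: "B \<in> sets (sphere_measure :: (real^'n) measure)" and s: "s > 0"
  shows "emeasure lborel {x::real^'n. x \<noteq> 0 \<and> norm x < s \<and> sgn x \<in> B} =
     ennreal (s ^ CARD('n) / CARD('n)) * emeasure sphere_measure B"
proof -
  note [measurable] = measurable_sphere_sets[OF B]
  define S where "S = {x::real^'n. x \<noteq> 0 \<and> norm x < s \<and> sgn x \<in> B}"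
  have S [measurable]: "S \<in> sets borel"
    unfolding S_def by measurable
  have "emeasure lborel S = emeasure (density (distr lborel borel (\<lambda>x. 0 + s *\<^sub>R x)) (\<lambda>_. ennreal (\<bar>s\<bar> ^ DIM(real^'n)))) S"
    using lborel_affine[of s "0::real^'n"] s by simp
  also have "\<dots> = (\<integral>\<^sup>+x. ennreal (s ^ CARD('n)) * indicator S (s *\<^sub>R x) \<partial>lborel)"
    using s by (subst emeasure_density) (auto simp: nn_integral_distr)
  also have "\<dots> = (\<integral>\<^sup>+x. ennreal (s ^ CARD('n)) * indicator {x. x \<noteq> 0 \<and> norm x < 1 \<and> sgn x \<in> B} x \<partial>lborel)"
    using s by (intro nn_integral_cong) (auto simp: S_def indicator_def sgn_scaleR)
  also have "\<dots> = ennreal (s ^ CARD('n)) * emeasure lborel {x. x \<noteq> 0 \<and> norm x < 1 \<and> sgn x \<in> B}"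
    by (rule nn_integral_cmult_indicator) measurable
  also have "\<dots> = ennreal (s ^ CARD('n) / CARD('n)) * (of_nat CARD('n) * emeasure lborel {x. x \<noteq> 0 \<and> norm x < 1 \<and> sgn x \<in> B})"
  proof -
    have "ennreal (s ^ CARD('n)) = ennreal (s ^ CARD('n) / CARD('n)) * of_nat CARD('n)"
      using s by (simp add: ennreal_of_nat_eq_real_of_nat flip: ennreal_mult)
    then show ?thesis by (simp add: mult.assoc)
  qed
  finally show ?thesis unfolding S_def emeasure_sphere_measure[OF B] .
qed

text \<open>For fixed B both sides are measures in A. They agree on the half-lines
  \<open>{..<s}\<close> by the cone formula, and the half-lines form an intersection-stable
  generator on which the measures are finite.\<close>

lemma emeasure_radial_sector:
  assumes B: "B \<in> sets (sphere_measure :: (real^'n) measure)" and A: "A \<in> sets borel"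
  shows "emeasure lborel {x::real^'n. x \<noteq> 0 \<and> norm x \<in> A \<and> sgn x \<in> B} =
     emeasure (radial_measure CARD('n)) A * emeasure sphere_measure B"
proof -
  note [measurable] = measurable_sphere_sets[OF B]
  define W where "W = {x::real^'n. x \<noteq> 0 \<and> sgn x \<in> B}"
  have W [measurable]: "W \<in> sets borel" unfolding W_def by measurable
  define M where "M = distr (restrict_space lborel W) borel norm"
  have nm [measurable]: "norm \<in> measurable (restrict_space lborel W) borel"
    by (rule measurable_restrict_space1) simp
  have M: "emeasure M A = emeasure lborel {x::real^'n. x \<noteq> 0 \<and> norm x \<in> A \<and> sgn x \<in> B}"
    if "A \<in> sets borel" for A
  proof -
    have "emeasure M A = emeasure (restrict_space lborel W) (norm -` A \<inter> space (restrict_space lborel W))"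
      unfolding M_def by (rule emeasure_distr[OF nm]) (use that in simp)
    also have "norm -` A \<inter> space (restrict_space lborel W) = {x::real^'n. x \<noteq> 0 \<and> norm x \<in> A \<and> sgn x \<in> B}"
      by (auto simp: space_restrict_space W_def)
    also have "emeasure (restrict_space lborel W) \<dots> = emeasure lborel {x::real^'n. x \<noteq> 0 \<and> norm x \<in> A \<and> sgn x \<in> B}"
      by (rule emeasure_restrict_space) (use W in \<open>auto simp: W_def\<close>)
    finally show ?thesis .
  qed
  define R where "R = scale_measure (emeasure sphere_measure B) (radial_measure CARD('n))"
  have R: "emeasure R A = emeasure sphere_measure B * emeasure (radial_measure CARD('n)) A" for A
    by (simp add: R_def emeasure_scale_measure)
  have "M = R"
  proof (rule measure_eqI_generator_eq[where \<Omega> = UNIV and E = "range lessThan" and A = "\<lambda>n. {..<real n}"])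
    show "Int_stable (range lessThan :: real set set)"
    proof (rule Int_stableI_image)
      fix a b :: real
      show "\<exists>c\<in>UNIV. {..<a} \<inter> {..<b} = {..<c}"
        by (intro bexI[of _ "min a b"]) auto
    qed
    show "sets M = sigma_sets UNIV (range lessThan)" "sets R = sigma_sets UNIV (range lessThan)"
      by (simp_all add: M_def R_def borel_Iio)
    show "emeasure M X = emeasure R X" if XE: "X \<in> range lessThan" for X
    proof -
      obtain s where X: "X = {..<s}" using XE by auto
      show ?thesis
      proof (cases "s > 0")
        case True
        then show ?thesis
          using emeasure_cone[OF B True] emeasure_radial_lessThan[of "CARD('n)" s]
          by (simp add: X M R Suc_le_eq mult.commute)
      next
        case False
        have "emeasure (radial_measure CARD('n)) {..<s} = 0"
          using False AE_radial_pos[of "CARD('n)"]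
          by (subst AE_iff_measurable[symmetric, where P = "\<lambda>r. \<not> r < s"]) (auto elim: eventually_mono)
        moreover have e: "{x::real^'n. x \<noteq> 0 \<and> norm x \<in> {..<s} \<and> sgn x \<in> B} = {}"
          using False by (auto simp: not_less) (meson norm_ge_zero order_less_le_trans not_less)
        ultimately show ?thesis using M[of "{..<s}", unfolded e] R[of "{..<s}"] by (simp add: X)
      qed
    qed
    show "(\<Union>n. {..<real n}) = UNIV" using reals_Archimedean2 by auto
    show "emeasure M {..<real n} \<noteq> \<infinity>" for n
    proof -
      have "emeasure M {..<real n} \<le> emeasure lborel (ball (0::real^'n) n)"
        using M[of "{..<real n}"] by (auto intro!: emeasure_mono)
      then show ?thesis using emeasure_lborel_ball_finite[of "0::real^'n" n] by (auto simp: top_unique)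
    qed
  qed auto
  then show ?thesis using M[OF A] R[of A] by (simp add: mult.commute)
qed

lemma measurable_scaleR_polar [measurable]:
  "(\<lambda>(r, \<theta>). r *\<^sub>R \<theta>) \<in> measurable (radial_measure CARD('n) \<Otimes>\<^sub>M sphere_measure) (borel :: (real^'n) measure)"
proof -
  have 1: "(\<lambda>\<theta>. \<theta>) \<in> measurable sphere_measure (borel :: (real^'n) measure)"
    by (rule measurable_restrict_space1[of _ borel, THEN measurable_cong_sets[OF sets_sphere_measure refl, THEN equalityD2, THEN subsetD]]) simp
  note [measurable] = this
  show ?thesis by measurable
qed

text \<open>The inverse map x -> (|x|, x/|x|) sends Lebesgue measure off the origin to a measure
  with the product values on rectangles, hence to the product measure. Composing with (r, \<theta>)
  -> r \<theta> gives the identity, and the removed origin is a null set.\<close>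

lemma lborel_polar:
  "lborel = distr (radial_measure CARD('n) \<Otimes>\<^sub>M sphere_measure) borel (\<lambda>(r, \<theta>::real^'n). r *\<^sub>R \<theta>)"
proof -
  let ?L = "restrict_space lborel (- {0::real^'n})"
  let ?P = "radial_measure CARD('n) \<Otimes>\<^sub>M (sphere_measure :: (real^'n) measure)"
  let ?\<Phi> = "\<lambda>x::real^'n. (norm x, sgn x)"
  interpret S: finite_measure "sphere_measure :: (real^'n) measure" by (rule finite_measure_sphere)
  have sg: "sgn \<in> measurable ?L sphere_measure"
    using measurable_sgn_sphere[of "- {0}"] by (simp cong: measurable_cong_sets add: sets_sphere_measure)
  have nm: "norm \<in> measurable ?L (radial_measure CARD('n))"
    by (simp cong: measurable_cong_sets add: measurable_restrict_space1)
  have \<Phi> [measurable]: "?\<Phi> \<in> measurable ?L ?P"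
    using nm sg by (rule measurable_Pair)
  have eq: "?P = distr ?L ?P ?\<Phi>"
  proof (rule pair_measure_eqI)
    fix A B assume A: "A \<in> sets (radial_measure CARD('n))" and B: "B \<in> sets (sphere_measure :: (real^'n) measure)"
    note [measurable] = measurable_sphere_sets[OF B] 
    have [measurable]: "A \<in> sets borel" using A by simp
    have "emeasure (distr ?L ?P ?\<Phi>) (A \<times> B) = emeasure ?L (?\<Phi> -` (A \<times> B) \<inter> space ?L)"
      using A B by (intro emeasure_distr[OF \<Phi>]) auto
    also have "?\<Phi> -` (A \<times> B) \<inter> space ?L = {x. x \<noteq> 0 \<and> norm x \<in> A \<and> sgn x \<in> B}"
      by (auto simp: space_restrict_space)
    also have "emeasure ?L \<dots> = emeasure lborel {x. x \<noteq> 0 \<and> norm x \<in> A \<and> sgn x \<in> B}"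
      by (rule emeasure_restrict_space) auto
    also have "\<dots> = emeasure (radial_measure CARD('n)) A * emeasure sphere_measure B"
      using A B by (intro emeasure_radial_sector) auto
    finally show "emeasure (radial_measure CARD('n)) A * emeasure sphere_measure B = emeasure (distr ?L ?P ?\<Phi>) (A \<times> B)"
      by simp
  qed (auto simp: sigma_finite_radial S.sigma_finite_measure_axioms)
  have "distr ?P borel (\<lambda>(r, \<theta>). r *\<^sub>R \<theta>) = distr (distr ?L ?P ?\<Phi>) borel (\<lambda>(r, \<theta>). r *\<^sub>R \<theta>)"
    using eq by simp
  also have "\<dots> = distr ?L borel ((\<lambda>(r, \<theta>). r *\<^sub>R \<theta>) \<circ> ?\<Phi>)"
    by (rule distr_distr) measurable
  also have "(\<lambda>(r, \<theta>). r *\<^sub>R \<theta>) \<circ> ?\<Phi> = (\<lambda>x. x)"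
  proof
    show "((\<lambda>(r, \<theta>). r *\<^sub>R \<theta>) \<circ> ?\<Phi>) x = x" for x
      by (cases "x = 0") (simp_all add: sgn_div_norm)
  qed
  also have "distr ?L borel (\<lambda>x. x) = lborel"
  proof (rule measure_eqI)
    fix X assume "X \<in> sets (distr ?L borel (\<lambda>x. x))"
    then have X: "X \<in> sets borel" by simp
    have "emeasure (distr ?L borel (\<lambda>x. x)) X = emeasure ?L (X \<inter> space ?L)"
      using X by (subst emeasure_distr) (auto intro!: measurable_restrict_space1)
    also have "\<dots> = emeasure lborel (X - {0})"
      using X by (subst emeasure_restrict_space) (auto simp: space_restrict_space intro!: arg_cong2[where f = emeasure])
    also have "\<dots> = emeasure lborel X"
      using X by (intro emeasure_Diff_null_set finite_imp_null_set_lborel) auto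
    finally show "emeasure (distr ?L borel (\<lambda>x. x)) X = emeasure lborel X" .
  qed auto
  finally show ?thesis by simp
qed

lemma polar_pair_sigma_finite:
  "pair_sigma_finite (radial_measure CARD('n)) (sphere_measure :: (real^'n) measure)"
proof -
  interpret S: finite_measure "sphere_measure :: (real^'n) measure" by (rule finite_measure_sphere)
  show ?thesis
    by (intro pair_sigma_finite.intro sigma_finite_radial S.sigma_finite_measure_axioms)
qed

section \<open>Null sets and integrals in polar coordinates\<close>

lemma AE_polar:
  assumes "AE x::real^'n in lborel. P x"
  shows "AE r in radial_measure CARD('n). AE \<theta> in sphere_measure. P (r *\<^sub>R \<theta>)"
proof -
  interpret pair_sigma_finite "radial_measure CARD('n)" "sphere_measure :: (real^'n) measure"
    by (rule polar_pair_sigma_finite)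
  have "AE x in distr (radial_measure CARD('n) \<Otimes>\<^sub>M sphere_measure) borel (\<lambda>(r, \<theta>::real^'n). r *\<^sub>R \<theta>). P x"
    using assms lborel_polar by metis
  then have "AE p in radial_measure CARD('n) \<Otimes>\<^sub>M sphere_measure. P ((\<lambda>(r, \<theta>::real^'n). r *\<^sub>R \<theta>) p)"
    by (rule AE_distrD[OF measurable_scaleR_polar])
  then show ?thesis
    using AE_pair[of "\<lambda>p. P ((\<lambda>(r, \<theta>::real^'n). r *\<^sub>R \<theta>) p)"] by simp
qed

lemma AE_sphere_imp_AE_sgn:
  assumes "AE \<theta> in (sphere_measure :: (real^'n) measure). P \<theta>"
  shows "AE x in lborel. P (sgn x)"
proof -
  obtain Z where Z: "{\<theta>\<in>space sphere_measure. \<not> P \<theta>} \<subseteq> Z" "emeasure (sphere_measure :: (real^'n) measure) Z = 0" "Z \<in> sets sphere_measure"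
    using assms by (rule AE_E)
  have [measurable]: "Z \<in> sets borel" using measurable_sphere_sets[OF Z(3)] .
  have "emeasure lborel {x::real^'n. x \<noteq> 0 \<and> norm x \<in> UNIV \<and> sgn x \<in> Z} = 0"
    using emeasure_radial_sector[OF Z(3), of UNIV] Z(2) by simp
  then have "{x::real^'n. x \<noteq> 0 \<and> sgn x \<in> Z} \<in> null_sets lborel"
    by (intro null_setsI) auto
  then have "AE x::real^'n in lborel. \<not> (x \<noteq> 0 \<and> sgn x \<in> Z)"
    using AE_not_in by fastforce
  then show ?thesis
    using AE_lborel_singleton[of "0::real^'n"]
  proof eventually_elim
    case (elim x)
    then show ?case using Z(1) norm_sgn_eq_1[of x] by (force simp: subset_iff)
  qed
qed

text \<open>Lets a conclusion that does not mention r be drawn from a statement valid for almost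
  every r.\<close>

lemma not_AE_False_radial:
  assumes "N \<ge> 1"
  shows "\<not> (AE r in radial_measure N. False)"
proof
  assume "AE r in radial_measure N. False"
  then have "emeasure (radial_measure N) UNIV = 0"
    by (subst (asm) AE_iff_measurable[where N = UNIV]) auto
  then have "emeasure (radial_measure N) {..<1} = 0"
    using emeasure_mono[of "{..<1}" UNIV "radial_measure N"] by simp
  then show False using emeasure_radial_lessThan[OF assms, of 1] assms by (simp add: divide_eq_0_iff)
qed

text \<open>Along a ray the property does not depend on r, so a single good radius is
  enough.\<close>

lemma AE_sgn_imp_AE_sphere:
  assumes "AE x::real^'n in lborel. P (sgn x)"
  shows "AE \<theta> in sphere_measure. P \<theta>"
proof -
  have "AE r in radial_measure CARD('n). AE \<theta> in (sphere_measure :: (real^'n) measure). P \<theta>"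
    using AE_polar[OF assms] AE_radial_pos
  proof eventually_elim
    case (elim r)
    show ?case
    proof (rule AE_mp[OF elim(1)], rule AE_I2, rule impI)
      fix \<theta> :: "real^'n" assume "\<theta> \<in> space sphere_measure" and "P (sgn (r *\<^sub>R \<theta>))"
      then show "P \<theta>" using elim(2) by (simp add: sgn_scaleR sgn_div_norm)
    qed
  qed
  moreover have "\<not> (AE r in radial_measure CARD('n). False)"
    by (rule not_AE_False_radial) (simp add: Suc_le_eq)
  ultimately show ?thesis
    by (cases "AE \<theta> in (sphere_measure :: (real^'n) measure). P \<theta>") simp_all
qed

lemma nn_integral_polar:
  fixes f :: "real^'n \<Rightarrow> ennreal"
  assumes [measurable]: "f \<in> borel_measurable borel"
  shows "(\<integral>\<^sup>+x. f x \<partial>lborel) = (\<integral>\<^sup>+r. \<integral>\<^sup>+\<theta>. f (r *\<^sub>R \<theta>) \<partial>sphere_measure \<partial>radial_measure CARD('n))"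
proof -
  interpret pair_sigma_finite "radial_measure CARD('n)" "sphere_measure :: (real^'n) measure"
    by (rule polar_pair_sigma_finite)
  have "(\<integral>\<^sup>+x. f x \<partial>lborel) = (\<integral>\<^sup>+p. f ((\<lambda>(r, \<theta>). r *\<^sub>R \<theta>) p) \<partial>(radial_measure CARD('n) \<Otimes>\<^sub>M sphere_measure))"
    by (subst lborel_polar) (simp add: nn_integral_distr)
  also have "\<dots> = (\<integral>\<^sup>+r. \<integral>\<^sup>+\<theta>. f (r *\<^sub>R \<theta>) \<partial>sphere_measure \<partial>radial_measure CARD('n))"
    by (subst M2.nn_integral_fst[symmetric]) auto
  finally show ?thesis .
qed

lemma nn_integral_polar_prod:
  fixes h :: "real^'n \<Rightarrow> ennreal"
  assumes [measurable]: "g \<in> borel_measurable borel" and h: "h \<in> borel_measurable sphere_measure"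
  shows "(\<integral>\<^sup>+x. g (norm x) * h (sgn x) \<partial>lborel) = (\<integral>\<^sup>+r. g r \<partial>radial_measure CARD('n)) * (\<integral>\<^sup>+\<theta>. h \<theta> \<partial>sphere_measure)"
proof -
  have [measurable]: "(\<lambda>x. h (sgn x)) \<in> borel_measurable borel"
    by (rule borel_measurable_compose_sgn[OF h]) simp
  have "(\<integral>\<^sup>+x. g (norm x) * h (sgn x) \<partial>lborel) =
      (\<integral>\<^sup>+r. \<integral>\<^sup>+\<theta>. g (norm (r *\<^sub>R \<theta>)) * h (sgn (r *\<^sub>R \<theta>)) \<partial>sphere_measure \<partial>radial_measure CARD('n))"
    by (rule nn_integral_polar) measurable
  also have "\<dots> = (\<integral>\<^sup>+r. g r * (\<integral>\<^sup>+\<theta>. h \<theta> \<partial>sphere_measure) \<partial>radial_measure CARD('n))"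
  proof (rule nn_integral_cong_AE)
    show "AE r in radial_measure CARD('n). (\<integral>\<^sup>+\<theta>. g (norm (r *\<^sub>R \<theta>)) * h (sgn (r *\<^sub>R \<theta>)) \<partial>sphere_measure) =
        g r * (\<integral>\<^sup>+\<theta>. h \<theta> \<partial>sphere_measure)"
      using AE_radial_pos
    proof eventually_elim
      case (elim r)
      have "(\<integral>\<^sup>+\<theta>. g (norm (r *\<^sub>R \<theta>)) * h (sgn (r *\<^sub>R \<theta>)) \<partial>sphere_measure) = (\<integral>\<^sup>+\<theta>. g r * h \<theta> \<partial>sphere_measure)"
        using elim by (intro nn_integral_cong) (auto simp: sgn_scaleR sgn_div_norm)
      also have "\<dots> = g r * (\<integral>\<^sup>+\<theta>. h \<theta> \<partial>sphere_measure)"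
        by (rule nn_integral_cmult[OF h])
      finally show ?case .
    qed
  qed
  also have "\<dots> = (\<integral>\<^sup>+r. g r \<partial>radial_measure CARD('n)) * (\<integral>\<^sup>+\<theta>. h \<theta> \<partial>sphere_measure)"
    by (rule nn_integral_multc) simp
  finally show ?thesis .
qed

lemma integrable_polar:
  fixes f :: "real^'n \<Rightarrow> 'b::{banach, second_countable_topology}"
  assumes "f \<in> borel_measurable borel"
  shows "integrable lborel f \<longleftrightarrow>
    integrable (radial_measure CARD('n) \<Otimes>\<^sub>M sphere_measure) (\<lambda>(r, \<theta>). f (r *\<^sub>R \<theta>))"
proof -
  have "integrable lborel f \<longleftrightarrow>
      integrable (distr (radial_measure CARD('n) \<Otimes>\<^sub>M sphere_measure) borel (\<lambda>(r, \<theta>::real^'n). r *\<^sub>R \<theta>)) f"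
    using lborel_polar by metis
  also have "\<dots> \<longleftrightarrow> integrable (radial_measure CARD('n) \<Otimes>\<^sub>M sphere_measure) (\<lambda>p. f ((\<lambda>(r, \<theta>). r *\<^sub>R \<theta>) p))"
    by (rule integrable_distr_eq[OF measurable_scaleR_polar assms])
  finally show ?thesis by (simp add: case_prod_unfold)
qed

lemma integral_polar:
  fixes f :: "real^'n \<Rightarrow> 'b::{banach, second_countable_topology}"
  assumes "integrable lborel f"
  shows "(\<integral>x. f x \<partial>lborel) = (\<integral>r. \<integral>\<theta>. f (r *\<^sub>R \<theta>) \<partial>sphere_measure \<partial>radial_measure CARD('n))"
    and "integrable (radial_measure CARD('n)) (\<lambda>r. \<integral>\<theta>. f (r *\<^sub>R \<theta>) \<partial>sphere_measure)"
    and "AE r in radial_measure CARD('n). integrable sphere_measure (\<lambda>\<theta>. f (r *\<^sub>R \<theta>))"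
proof -
  interpret pair_sigma_finite "radial_measure CARD('n)" "sphere_measure :: (real^'n) measure"
    by (rule polar_pair_sigma_finite)
  have f: "f \<in> borel_measurable borel" using assms by auto
  have i: "integrable (radial_measure CARD('n) \<Otimes>\<^sub>M sphere_measure) (\<lambda>(r, \<theta>). f (r *\<^sub>R \<theta>))"
    using integrable_polar[OF f] assms by simp
  have "(\<integral>x. f x \<partial>lborel) = (\<integral>p. f ((\<lambda>(r, \<theta>). r *\<^sub>R \<theta>) p) \<partial>(radial_measure CARD('n) \<Otimes>\<^sub>M sphere_measure))"
    by (subst lborel_polar) (simp add: integral_distr f)
  also have "\<dots> = (\<integral>r. \<integral>\<theta>. f (r *\<^sub>R \<theta>) \<partial>sphere_measure \<partial>radial_measure CARD('n))"
    using integral_fst'[OF i] by (simp add: case_prod_unfold)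
  finally show "(\<integral>x. f x \<partial>lborel) = (\<integral>r. \<integral>\<theta>. f (r *\<^sub>R \<theta>) \<partial>sphere_measure \<partial>radial_measure CARD('n))" .
  show "integrable (radial_measure CARD('n)) (\<lambda>r. \<integral>\<theta>. f (r *\<^sub>R \<theta>) \<partial>sphere_measure)"
    using integrable_fst'[OF i] by simp
  show "AE r in radial_measure CARD('n). integrable sphere_measure (\<lambda>\<theta>. f (r *\<^sub>R \<theta>))"
    using AE_integrable_fst'[OF i] by simp
qed

section \<open>Vanishing integrals\<close>

text \<open>The common limit argument for approximation by test functions: a is the density of a
  fixed object of finite norm, b n that of an approximation error whose integrals tend to 0.\<close>

lemma integral_tendsto_zero_Cauchy_Schwarz:
  fixes E :: "nat \<Rightarrow> 'a \<Rightarrow> 'b::{banach, second_countable_topology}" and a :: "'a \<Rightarrow> real" and b :: "nat \<Rightarrow> 'a \<Rightarrow> real"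
  assumes [measurable]: "a \<in> borel_measurable M" "\<And>n. b n \<in> borel_measurable M"
    and nonneg: "\<And>x. 0 \<le> a x" "\<And>n x. 0 \<le> b n x" "C \<ge> 0"
    and fin: "(\<integral>\<^sup>+x. ennreal (a x) \<partial>M) < \<infinity>"
    and lim: "(\<lambda>n. \<integral>\<^sup>+x. ennreal (b n x) \<partial>M) \<longlonglongrightarrow> 0"
    and bound: "\<And>n. AE x in M. norm (E n x) \<le> C * sqrt (a x) * sqrt (b n x)"
  shows "(\<lambda>n. integral\<^sup>L M (E n)) \<longlonglongrightarrow> 0"
proof -
  define J where "J = (\<integral>\<^sup>+x. ennreal (a x) \<partial>M)"
  define B where "B n = (\<integral>\<^sup>+x. ennreal (b n x) \<partial>M)" for n
  have le: "ennreal (norm (integral\<^sup>L M (E n))) ^ 2 \<le> ennreal (C\<^sup>2) * J * B n" for n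
  proof -
    \<comment> \<open>A function that is not integrable has Bochner integral 0, so the bound holds
      in that case too.\<close>
    have "ennreal (norm (integral\<^sup>L M (E n))) \<le> (\<integral>\<^sup>+x. ennreal (norm (E n x)) \<partial>M)"
      using integral_norm_bound_ennreal[of M "E n"] by (cases "integrable M (E n)") (auto simp: not_integrable_integral_eq)
    also have "\<dots> \<le> (\<integral>\<^sup>+x. ennreal (C * sqrt (a x)) * ennreal (sqrt (b n x)) \<partial>M)"
      using bound[of n] by (intro nn_integral_mono_AE) (auto elim!: eventually_mono simp: nonneg ennreal_mult[symmetric] intro!: ennreal_leI)
    finally have "ennreal (norm (integral\<^sup>L M (E n))) ^ 2 \<le> (\<integral>\<^sup>+x. ennreal (C * sqrt (a x)) * ennreal (sqrt (b n x)) \<partial>M)\<^sup>2"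
      by (intro power_mono) auto
    also have "\<dots> \<le> (\<integral>\<^sup>+x. ennreal (C * sqrt (a x)) ^ 2 \<partial>M) * (\<integral>\<^sup>+x. ennreal (sqrt (b n x)) ^ 2 \<partial>M)"
      by (rule Cauchy_Schwarz_nn_integral) measurable
    also have "(\<integral>\<^sup>+x. ennreal (C * sqrt (a x)) ^ 2 \<partial>M) = (\<integral>\<^sup>+x. ennreal (C\<^sup>2) * ennreal (a x) \<partial>M)"
      by (intro nn_integral_cong) (simp add: ennreal_power nonneg power_mult_distrib ennreal_mult[symmetric])
    also have "\<dots> = ennreal (C\<^sup>2) * J"
      unfolding J_def by (rule nn_integral_cmult) measurable
    also have "(\<integral>\<^sup>+x. ennreal (sqrt (b n x)) ^ 2 \<partial>M) = B n"
      unfolding B_def by (intro nn_integral_cong) (simp add: ennreal_power nonneg)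
    finally show ?thesis .
  qed
  have "(\<lambda>n. (ennreal (C\<^sup>2) * J) * B n) \<longlonglongrightarrow> (ennreal (C\<^sup>2) * J) * 0"
    using lim fin unfolding B_def J_def by (intro tendsto_mult_ennreal tendsto_const) (auto simp: ennreal_mult_eq_top_iff)
  then have "(\<lambda>n. (ennreal (C\<^sup>2) * J) * B n) \<longlonglongrightarrow> 0" by simp
  from tendsto_sandwich[OF _ _ tendsto_const this, of "\<lambda>n. ennreal (norm (integral\<^sup>L M (E n))) ^ 2"] le
  have "(\<lambda>n. ennreal (norm (integral\<^sup>L M (E n))) ^ 2) \<longlonglongrightarrow> 0" by auto
  then have "(\<lambda>n. ennreal ((norm (integral\<^sup>L M (E n)))\<^sup>2)) \<longlonglongrightarrow> ennreal 0"
    by (simp add: ennreal_power)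
  then have "(\<lambda>n. (norm (integral\<^sup>L M (E n)))\<^sup>2) \<longlonglongrightarrow> 0"
    by (subst (asm) tendsto_ennreal_iff) auto
  from tendsto_real_sqrt[OF this] show ?thesis
    by (simp add: tendsto_norm_zero_iff)
qed

text \<open>Boxes form an intersection-stable generator, and the sets over which f integrates to 0
  are closed under complements and disjoint unions. Hence f has zero integral over every Borel
  set.\<close>

lemma AE_zero_if_box_integrals_zero:
  fixes f :: "'a::euclidean_space \<Rightarrow> 'b::{banach, second_countable_topology}"
  assumes f: "integrable lborel f" and box: "\<And>a b. set_lebesgue_integral lborel (box a b) f = 0"
  shows "AE x in lborel. f x = 0"
proof (rule sigma_finite_measure.density_zero[OF sigma_finite_lborel f])
  have si: "set_integrable lborel A f" if "A \<in> sets lborel" for A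
    unfolding set_integrable_def using f that by (simp add: integrable_mult_indicator)
  \<comment> \<open>Complements require the integral over the whole space, which is the limit over
    growing boxes.\<close>
  have all: "integral\<^sup>L lborel f = 0"
  proof -
    let ?A = "\<lambda>n::nat. box (- (real n *\<^sub>R One)) (real n *\<^sub>R One) :: 'a set"
    have "(\<lambda>n. set_lebesgue_integral lborel (?A n) f) \<longlonglongrightarrow> set_lebesgue_integral lborel (\<Union>n. ?A n) f"
    proof (rule set_integral_cont_up)
      show "incseq ?A"
        by (rule monoI, rule subset_box_imp)
           (auto simp: inner_sum_left inner_Basis subset_box)
    qed (use si in auto)
    then show ?thesis
      unfolding UN_box_eq_UNIV box by (simp add: set_lebesgue_integral_def LIMSEQ_const_iff)
  qed
  fix A :: "'a set" assume "A \<in> sets lborel"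
  then have A: "A \<in> sigma_sets UNIV (range (\<lambda>(a, b). box a b))"
    by (simp add: borel_eq_box)
  have I: "Int_stable (range (\<lambda>(a, b). box a b :: 'a set))"
    by (auto simp: Int_stable_def box_Int_box)
  have "range (\<lambda>(a, b). box a b :: 'a set) \<subseteq> Pow UNIV" by simp
  from I this A show "set_lebesgue_integral lborel A f = 0"
  proof (induction rule: sigma_sets_induct_disjoint)
    case (basic A)
    then show ?case using box by auto
  next
    case (compl A)
    then have A: "A \<in> sets lborel" by (simp add: borel_eq_box)
    have "set_lebesgue_integral lborel (UNIV - A) f = (\<integral>x. f x - indicator A x *\<^sub>R f x \<partial>lborel)"
      unfolding set_lebesgue_integral_def by (intro Bochner_Integration.integral_cong) (auto simp: indicator_def)
    also have "\<dots> = integral\<^sup>L lborel f - set_lebesgue_integral lborel A f"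
      using si[OF A] f unfolding set_integrable_def set_lebesgue_integral_def by (rule Bochner_Integration.integral_diff[rotated])
    finally show ?case using all compl by simp
  next
    case (union A)
    then have "\<And>i. A i \<in> sets lborel" by (auto simp: borel_eq_box)
    moreover from this have "(\<Union>i. A i) \<in> sets lborel" by blast
    ultimately have "set_lebesgue_integral lborel (\<Union>i. A i) f = (\<Sum>i. set_lebesgue_integral lborel (A i) f)"
      using union(1) by (intro lebesgue_integral_countable_add si) (auto simp: disjoint_family_on_def)
    then show ?case using union by simp
  qed (auto simp: set_lebesgue_integral_def)
qed

section \<open>The moment problem for complex densities with exponential decay\<close>

lemma power_le_fact_exp:
  fixes t d :: real
  assumes "t \<ge> 0" "d > 0"
  shows "t ^ n \<le> fact n / d ^ n * exp (d * t)"
proof -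
  have "(\<Sum>k\<in>{n}. (d * t) ^ k /\<^sub>R fact k) \<le> exp (d * t)"
    unfolding exp_def using summable_exp_generic[of "d * t"] assms by (intro sum_le_suminf) auto
  then show ?thesis using assms by (simp add: field_simps power_mult_distrib)
qed

text \<open>The gap c - s > 0 in the exponents pays for the power of T.\<close>

lemma integrable_moment:
  fixes k :: "'a \<Rightarrow> complex" and T :: "'a \<Rightarrow> real"
  assumes int: "integrable M (\<lambda>x. k x * exp (c * T x))" and [measurable]: "k \<in> borel_measurable M" "T \<in> borel_measurable M"
    and T: "\<And>x. T x \<ge> 0" and s: "s < c"
  shows "integrable M (\<lambda>x. k x * (T x ^ n * exp (s * T x)))"
proof (rule Bochner_Integration.integrable_bound)
  show "integrable M (\<lambda>x. complex_of_real (fact n / (c - s) ^ n) * (k x * exp (c * T x)))"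
    using int by (rule integrable_mult_right)
  show "AE x in M. norm (k x * (T x ^ n * exp (s * T x))) \<le> norm (complex_of_real (fact n / (c - s) ^ n) * (k x * exp (c * T x)))"
  proof (rule AE_I2)
    fix x
    have "T x ^ n * exp (s * T x) \<le> fact n / (c - s) ^ n * exp ((c - s) * T x) * exp (s * T x)"
      using power_le_fact_exp[OF T, of "c - s" x n] s by (intro mult_right_mono) auto
    also have "\<dots> = fact n / (c - s) ^ n * exp (c * T x)"
      by (simp add: exp_add[symmetric] algebra_simps)
    finally have "norm (k x) * (T x ^ n * exp (s * T x)) \<le> norm (k x) * (fact n / (c - s) ^ n * exp (c * T x))"
      by (rule mult_left_mono) simp
    then show "norm (k x * (T x ^ n * exp (s * T x))) \<le> norm (complex_of_real (fact n / (c - s) ^ n) * (k x * exp (c * T x)))"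
      using T[of x] s by (simp add: norm_mult norm_power norm_divide algebra_simps flip: of_real_diff)
  qed
qed simp

text \<open>Multiplication by \<open>exp (- s T)\<close> with small \<open>s\<close> preserves the vanishing of all moments, by
  expanding the exponential.\<close>

lemma moments_zero_times_exp:
  fixes k :: "'a \<Rightarrow> complex" and T :: "'a \<Rightarrow> real"
  assumes int: "integrable M (\<lambda>x. k x * exp (c * T x))" and [measurable]: "k \<in> borel_measurable M" "T \<in> borel_measurable M"
    and T: "\<And>x. T x \<ge> 0" and s: "0 \<le> s" "s < c"
    and mom: "\<And>n. (\<integral>x. k x * T x ^ n \<partial>M) = 0"
  shows "(\<integral>x. k x * exp (- s * T x) * T x ^ n \<partial>M) = 0"
proof -
  have "(\<lambda>m. \<integral>x. (\<Sum>i<m. k x * T x ^ n * ((- s * T x) ^ i /\<^sub>R fact i)) \<partial>M) \<longlonglongrightarrow> (\<integral>x. k x * exp (- s * T x) * T x ^ n \<partial>M)"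
  proof (rule integral_dominated_convergence)
    \<comment> \<open>Every partial sum of exp(-s T) is bounded by exp(s T), and s < c keeps this
      majorant integrable.\<close>
    show "integrable M (\<lambda>x. norm (k x * (T x ^ n * exp (s * T x))))"
      using integrable_moment[OF int _ _ T s(2)] by (intro integrable_norm) auto
    show "AE x in M. (\<lambda>m. \<Sum>i<m. k x * T x ^ n * ((- s * T x) ^ i /\<^sub>R fact i)) \<longlonglongrightarrow> k x * exp (- s * T x) * T x ^ n"
    proof (rule AE_I2)
      fix x
      have "(\<lambda>i. complex_of_real ((- s * T x) ^ i /\<^sub>R fact i)) sums complex_of_real (exp (- s * T x))"
        using exp_converges[of "- s * T x"] by (rule sums_of_real)
      from sums_mult[OF this, of "k x * T x ^ n"]
      show "(\<lambda>m. \<Sum>i<m. k x * T x ^ n * ((- s * T x) ^ i /\<^sub>R fact i)) \<longlonglongrightarrow> k x * exp (- s * T x) * T x ^ n"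
        unfolding sums_def by (simp add: mult_ac)
    qed
    fix m
    show "AE x in M. norm (\<Sum>i<m. k x * T x ^ n * ((- s * T x) ^ i /\<^sub>R fact i)) \<le> norm (k x * (T x ^ n * exp (s * T x)))"
    proof (rule AE_I2)
      fix x
      have "norm (\<Sum>i<m. k x * T x ^ n * complex_of_real ((- s * T x) ^ i /\<^sub>R fact i)) \<le>
          (\<Sum>i<m. norm (k x) * T x ^ n * ((s * T x) ^ i /\<^sub>R fact i))"
        using T[of x] s by (intro sum_norm_le) (simp add: norm_mult norm_power power_mult_distrib power_abs norm_inverse)
      also have "\<dots> = norm (k x) * T x ^ n * (\<Sum>i<m. (s * T x) ^ i /\<^sub>R fact i)"
        by (simp add: sum_distrib_left)
      also have "\<dots> \<le> norm (k x) * T x ^ n * exp (s * T x)"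
        unfolding exp_def using T[of x] s summable_exp_generic[of "s * T x"]
        by (intro mult_left_mono sum_le_suminf) auto
      finally show "norm (\<Sum>i<m. k x * T x ^ n * ((- s * T x) ^ i /\<^sub>R fact i)) \<le> norm (k x * (T x ^ n * exp (s * T x)))"
        using T[of x] by (simp add: norm_mult norm_power mult.assoc)
    qed
  qed measurable
  moreover have "(\<integral>x. (\<Sum>i<m. k x * T x ^ n * ((- s * T x) ^ i /\<^sub>R fact i)) \<partial>M) = 0" for m
  proof -
    have i: "integrable M (\<lambda>x. k x * T x ^ j)" for j
      using integrable_moment[OF int _ _ T, of 0 j] s by simp
    have "(\<integral>x. (\<Sum>i<m. k x * T x ^ n * ((- s * T x) ^ i /\<^sub>R fact i)) \<partial>M) =
       (\<integral>x. (\<Sum>i<m. ((- s) ^ i /\<^sub>R fact i) * (k x * T x ^ (n + i))) \<partial>M)"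
      unfolding power_mult_distrib
      by (intro Bochner_Integration.integral_cong sum.cong refl) (simp add: power_add scaleR_conv_of_real)
    also have "\<dots> = (\<Sum>i<m. ((- s) ^ i /\<^sub>R fact i) * (\<integral>x. k x * T x ^ (n + i) \<partial>M))"
      by (subst Bochner_Integration.integral_sum) (auto intro!: integrable_mult_right i[unfolded of_real_power] simp: scaleR_conv_of_real)
    finally show ?thesis unfolding mom by simp
  qed
  ultimately show ?thesis by (simp add: LIMSEQ_const_iff)
qed

text \<open>A bounded variable replaces T: y = exp(-s T) takes values in [0,1]. The integrals of k
  against powers of y vanish, hence those against polynomials in y, by the Weierstrass theorem those
  against continuous functions of y, and in the limit of ramps the one against the indicator of y >
  exp(-s b).\<close>

lemma moments_zero_imp_level_integral_zero:
  fixes k :: "'a \<Rightarrow> complex" and T :: "'a \<Rightarrow> real"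
  assumes c: "c > 0" and int: "integrable M (\<lambda>x. k x * exp (c * T x))"
    and [measurable]: "k \<in> borel_measurable M" "T \<in> borel_measurable M"
    and T: "\<And>x. T x \<ge> 0"
    and mom: "\<And>n. (\<integral>x. k x * T x ^ n \<partial>M) = 0"
  shows "(\<integral>x. k x * indicator {x. T x < b} x \<partial>M) = 0"
proof -
  \<comment> \<open>Any value strictly between 0 and c would serve.\<close>
  define s where "s = c / 2"
  have s: "0 \<le> s" "s < c" "s > 0" using c by (auto simp: s_def)
  have k: "integrable M k"
    using integrable_moment[OF int _ _ T, of 0 0] c by simp
  have mult_bounded: "integrable M (\<lambda>x. k x * complex_of_real (h x))"
    if [measurable]: "h \<in> borel_measurable M" and "\<And>x. \<bar>h x\<bar> \<le> B" for h :: "'a \<Rightarrow> real" and B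
  proof (rule Bochner_Integration.integrable_bound[of M "\<lambda>x. B * norm (k x)"])
    have "\<bar>h x\<bar> \<le> \<bar>B\<bar>" for x using that(2)[of x] by linarith
    then show "AE x in M. norm (k x * complex_of_real (h x)) \<le> norm (B * norm (k x))"
      by (intro AE_I2) (simp add: norm_mult abs_mult mult.commute mult_right_mono)
  qed (use k in auto)
  define y where "y x = exp (- s * T x)" for x
  have [measurable]: "y \<in> borel_measurable M" unfolding y_def by measurable
  have y: "0 \<le> y x" "y x \<le> 1" for x using T[of x] s by (auto simp: y_def)
  \<comment> \<open>One multiplication by y is the preceding lemma. As y <= 1, the product stays
    integrable against exp(c T) with the same c, so the step can be iterated and high powers of y
    cost no decay.\<close>
  have exp_mom: "(\<integral>x. k x * y x ^ i * T x ^ n \<partial>M) = 0 \<and> integrable M (\<lambda>x. k x * y x ^ i * exp (c * T x))" for i n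
  proof (induction i arbitrary: n)
    case 0
    then show ?case using mom int by simp
  next
    case (Suc i)
    have "(\<integral>x. (k x * y x ^ i) * exp (- s * T x) * T x ^ n \<partial>M) = 0"
      by (rule moments_zero_times_exp[OF _ _ _ T s(1,2)]) (use Suc in auto)
    moreover have "integrable M (\<lambda>x. k x * y x ^ Suc i * exp (c * T x))"
    proof (rule Bochner_Integration.integrable_bound[OF Suc[of 0, THEN conjunct2]])
      show "AE x in M. norm (k x * y x ^ Suc i * exp (c * T x)) \<le> norm (k x * y x ^ i * exp (c * T x))"
        using y by (intro AE_I2) (auto simp: norm_mult norm_power mult_le_cancel_right1 mult.assoc intro!: mult_left_mono mult_left_le_one_le)
    qed measurable
    moreover have e: "k x * y x ^ i * complex_of_real (exp (- s * T x)) = k x * y x ^ Suc i" for x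
      unfolding y_def[symmetric] by (simp add: mult_ac)
    ultimately show ?case unfolding e by blast
  qed
  have poly0: "(\<integral>x. k x * complex_of_real (p (y x)) \<partial>M) = 0" if "real_polynomial_function p" for p
  proof -
    obtain a n where p: "p = (\<lambda>x. \<Sum>i\<le>n. a i * x ^ i)"
      using \<open>real_polynomial_function p\<close> unfolding real_polynomial_function_iff_sum by auto
    have "(\<integral>x. k x * complex_of_real (p (y x)) \<partial>M) = (\<integral>x. (\<Sum>i\<le>n. a i * (k x * y x ^ i)) \<partial>M)"
      unfolding p by (simp add: sum_distrib_left mult_ac)
    also have "\<dots> = (\<Sum>i\<le>n. a i * (\<integral>x. k x * y x ^ i \<partial>M))"
    proof (subst Bochner_Integration.integral_sum)
      have "integrable M (\<lambda>x. k x * complex_of_real (y x ^ i))" for i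
        using y by (intro mult_bounded[of _ 1]) (auto simp: power_le_one power_abs)
      then show "integrable M (\<lambda>x. a i * (k x * y x ^ i))" for i
        by (intro integrable_mult_right) simp
    qed simp
    also have "\<dots> = 0"
      using exp_mom[of _ 0] by simp
    finally show ?thesis .
  qed
  have cont0: "(\<integral>x. k x * complex_of_real (\<phi> (y x)) \<partial>M) = 0" if \<phi>: "continuous_on {0..1} \<phi>" for \<phi> :: "real \<Rightarrow> real"
  proof -
    have "norm (\<integral>x. k x * complex_of_real (\<phi> (y x)) \<partial>M) \<le> e * (\<integral>x. norm (k x) \<partial>M)" if e: "e > 0" for e
    proof -
      obtain p where p: "real_polynomial_function p" "\<And>x. x \<in> {0..1} \<Longrightarrow> \<bar>\<phi> x - p x\<bar> < e"
        using Stone_Weierstrass_real_polynomial_function[of "{0..1::real}" \<phi> e] \<phi> e by auto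
      have [measurable]: "p \<in> borel_measurable borel"
        using p(1) by (intro borel_measurable_continuous_onI continuous_on_polymonial_function) (simp add: real_polynomial_function_eq)
      have m: "(\<lambda>x. \<phi> (y x)) \<in> borel_measurable M"
      proof -
        have "(\<lambda>t. indicator {0..1} t *\<^sub>R \<phi> t) \<in> borel_measurable borel"
          using \<phi> by (intro borel_measurable_continuous_on_indicator) auto
        then have "(\<lambda>x. indicator {0..1} (y x) *\<^sub>R \<phi> (y x)) \<in> borel_measurable M"
          by measurable
        then show ?thesis using y by simp
      qed
      obtain B where "\<forall>t\<in>\<phi> ` {0..1}. norm t \<le> B"
        using compact_imp_bounded[OF compact_continuous_image[OF \<phi> compact_Icc]] unfolding bounded_iff by blast
      then have B: "\<bar>\<phi> t\<bar> \<le> B" if "t \<in> {0..1}" for t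
        using that by auto
      have 1: "integrable M (\<lambda>x. k x * complex_of_real (\<phi> (y x)))"
        using B y by (intro mult_bounded[of _ B] m) auto
      have 2: "integrable M (\<lambda>x. k x * complex_of_real (p (y x)))"
      proof (rule mult_bounded[of _ "B + e"])
        show "\<bar>p (y x)\<bar> \<le> B + e" for x
          using B[of "y x"] p(2)[of "y x"] y[of x] by auto
      qed measurable
      have "(\<integral>x. k x * complex_of_real (\<phi> (y x)) \<partial>M) =
          (\<integral>x. k x * complex_of_real (\<phi> (y x)) \<partial>M) - (\<integral>x. k x * complex_of_real (p (y x)) \<partial>M)"
        using poly0[OF p(1)] by simp
      also have "\<dots> = (\<integral>x. k x * complex_of_real (\<phi> (y x)) - k x * complex_of_real (p (y x)) \<partial>M)"
        using 1 2 by (rule Bochner_Integration.integral_diff[symmetric])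
      also have "norm \<dots> \<le> (\<integral>x. e * norm (k x) \<partial>M)"
      proof (rule order_trans[OF integral_norm_bound integral_mono])
        show "norm (k x * complex_of_real (\<phi> (y x)) - k x * complex_of_real (p (y x))) \<le> e * norm (k x)" for x
        proof -
          have "k x * complex_of_real (\<phi> (y x)) - k x * complex_of_real (p (y x)) = k x * complex_of_real (\<phi> (y x) - p (y x))"
            by (simp add: algebra_simps)
          then show ?thesis
            using p(2)[of "y x"] y[of x] by (simp add: norm_mult mult.commute[of e] mult_left_mono del: of_real_diff)
        qed
      qed (use k 1 2 in \<open>auto intro!: integrable_norm Bochner_Integration.integrable_diff\<close>)
      finally show ?thesis by simp
    qed
    then have "norm (\<integral>x. k x * complex_of_real (\<phi> (y x)) \<partial>M) \<le> 0"
    proof -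
      assume *: "\<And>e. e > 0 \<Longrightarrow> norm (\<integral>x. k x * complex_of_real (\<phi> (y x)) \<partial>M) \<le> e * (\<integral>x. norm (k x) \<partial>M)"
      have "((\<lambda>e. e * (\<integral>x. norm (k x) \<partial>M)) \<longlongrightarrow> 0 * (\<integral>x. norm (k x) \<partial>M)) (at_right 0)"
        by (intro tendsto_intros)
      then show ?thesis
        using * by (intro tendsto_lowerbound[where F = "at_right 0" and f = "\<lambda>e. e * (\<integral>x. norm (k x) \<partial>M)"])
           (auto simp: eventually_at_right_less intro: eventually_mono[OF eventually_at_right_less])
    qed
    then show ?thesis by simp
  qed
  define z where "z = exp (- s * b)"
  \<comment> \<open>Ramps of slope m that vanish for t <= z and reach 1 eventually for every t > z;
    the strict inequality matches T < b.\<close>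
  define \<phi> where "\<phi> m t = min 1 (max 0 (real m * (t - z)))" for m :: nat and t
  have "(\<lambda>m. \<integral>x. k x * complex_of_real (\<phi> m (y x)) \<partial>M) \<longlonglongrightarrow> (\<integral>x. k x * indicator {x. T x < b} x \<partial>M)"
  proof (rule integral_dominated_convergence)
    show "integrable M (\<lambda>x. norm (k x))" using k by simp
    show "AE x in M. norm (k x * complex_of_real (\<phi> m (y x))) \<le> norm (k x)" for m
      by (intro AE_I2) (auto simp: norm_mult \<phi>_def intro!: mult_right_le_one_le)
    show "AE x in M. (\<lambda>m. k x * complex_of_real (\<phi> m (y x))) \<longlonglongrightarrow> k x * indicator {x. T x < b} x"
    proof (rule AE_I2)
      fix x
      have "(\<lambda>m. \<phi> m (y x)) \<longlonglongrightarrow> indicator {x. T x < b} x"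
      proof (cases "T x < b")
        case True
        then have "y x > z" using s by (simp add: y_def z_def)
        then obtain m0 where m0: "1 / (y x - z) < real m0" using reals_Archimedean2 by blast
        have "\<phi> m (y x) = 1" if "m \<ge> m0" for m
        proof -
          have "1 / (y x - z) \<le> real m" using m0 that by linarith
          then have "1 \<le> real m * (y x - z)" using \<open>y x > z\<close> by (simp add: field_simps)
          then show ?thesis by (simp add: \<phi>_def)
        qed
        then have "eventually (\<lambda>m. \<phi> m (y x) = 1) sequentially"
          unfolding eventually_sequentially by blast
        then show ?thesis using True by (simp add: tendsto_eventually)
      next
        case False
        then have "y x \<le> z" using s by (simp add: y_def z_def)
        then have "\<phi> m (y x) = 0" for m by (simp add: \<phi>_def mult_nonneg_nonpos)
        then show ?thesis using False by simp
      qed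
      then have "(\<lambda>m. k x * complex_of_real (\<phi> m (y x))) \<longlonglongrightarrow> k x * complex_of_real (indicator {x. T x < b} x)"
        by (intro tendsto_intros)
      then show "(\<lambda>m. k x * complex_of_real (\<phi> m (y x))) \<longlonglongrightarrow> k x * indicator {x. T x < b} x"
        by (cases "T x < b") (auto simp: indicator_def)
    qed
  qed (unfold \<phi>_def, measurable)
  moreover have "(\<integral>x. k x * complex_of_real (\<phi> m (y x)) \<partial>M) = 0" for m
    by (rule cont0) (unfold \<phi>_def, intro continuous_intros)
  ultimately show ?thesis by (simp add: LIMSEQ_const_iff)
qed

section \<open>Test functions\<close>

lemma borel_measurable_vec_nth_comp [measurable (raw)]:
  fixes f :: "'a \<Rightarrow> 'b::euclidean_space ^ 'n"
  assumes "f \<in> borel_measurable M"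
  shows "(\<lambda>x. f x $ i) \<in> borel_measurable M"
proof -
  have "continuous_on UNIV (\<lambda>v :: 'b^'n. v $ i)" by (intro continuous_intros)
  then have "(\<lambda>v :: 'b^'n. v $ i) \<in> borel_measurable borel" by (rule borel_measurable_continuous_onI)
  then show ?thesis using assms by (rule measurable_compose[rotated])
qed

lemma borel_measurable_vec_lambda_comp [measurable (raw)]:
  fixes f :: "'n::finite \<Rightarrow> 'a \<Rightarrow> 'b::euclidean_space"
  assumes "\<And>i. f i \<in> borel_measurable M"
  shows "(\<lambda>x. \<chi> i. f i x) \<in> borel_measurable M"
  unfolding borel_measurable_euclidean_space[where 'c = "'b^'n"] inner_vec_def using assms by simp

lemma norm_vec_sq: "(norm (v :: complex^'n))\<^sup>2 = (\<Sum>i\<in>UNIV. (norm (v $ i))\<^sup>2)"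
  by (simp add: norm_vec_def L2_set_def sum_nonneg)

lemma has_derivative_zero_on_open:
  assumes "open S" "x \<in> S" "\<And>y. y \<in> S \<Longrightarrow> f y = 0"
  shows "(f has_derivative (\<lambda>_. 0)) (at x)"
proof (rule has_derivative_transform_within_open[of "\<lambda>_. 0" _ _ _ S])
  show "((\<lambda>_. 0) has_derivative (\<lambda>_. 0)) (at x)" by simp
qed (use assms in auto)

lemma grad_zero_on_open:
  assumes "open S" "x \<in> S" "\<And>y. y \<in> S \<Longrightarrow> f y = 0"
  shows "grad f x = 0"
  using partial_deriv_eq[OF has_derivative_zero_on_open[OF assms]] by (simp add: grad_def vec_eq_iff)

text \<open>Compact support in the punctured space amounts to support in an annulus with positive
  inner radius. In this form sums and products are easily handled, and smoothness at the origin
  follows from vanishing near it.\<close>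

lemma test_fun_iff:
  "test_fun \<phi> \<longleftrightarrow> smooth_on (- {0}) \<phi> \<and> (\<exists>a>0. \<exists>b. \<forall>x. \<phi> x \<noteq> 0 \<longrightarrow> a \<le> norm x \<and> norm x \<le> b)"
proof
  assume t: "test_fun \<phi>"
  let ?K = "closure {x. \<phi> x \<noteq> 0}"
  have K: "compact ?K" "?K \<subseteq> - {0}" and s: "smooth_on UNIV \<phi>" using t by (auto simp: test_fun_def)
  obtain b where b: "\<forall>x\<in>?K. norm x \<le> b"
    using compact_imp_bounded[OF K(1)] unfolding bounded_iff by blast
  have "open (- ?K)" "0 \<in> - ?K" using K by auto
  then obtain a where a: "a > 0" "ball 0 a \<subseteq> - ?K" by (rule openE)
  have "a \<le> norm x \<and> norm x \<le> b" if "\<phi> x \<noteq> 0" for x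
  proof -
    have "x \<in> ?K" using that closure_subset[of "{x. \<phi> x \<noteq> 0}"] by blast
    moreover from this have "x \<notin> ball 0 a" using a(2) by blast
    ultimately show ?thesis using b by (simp add: not_less)
  qed
  then show "smooth_on (- {0}) \<phi> \<and> (\<exists>a>0. \<exists>b. \<forall>x. \<phi> x \<noteq> 0 \<longrightarrow> a \<le> norm x \<and> norm x \<le> b)"
    using a(1) smooth_on_subset[OF s open_UNIV subset_UNIV, of "- {0}"] by blast
next
  assume "smooth_on (- {0}) \<phi> \<and> (\<exists>a>0. \<exists>b. \<forall>x. \<phi> x \<noteq> 0 \<longrightarrow> a \<le> norm x \<and> norm x \<le> b)"
  then obtain a b where s: "smooth_on (- {0}) \<phi>" and a: "a > 0" "\<And>x. \<phi> x \<noteq> 0 \<Longrightarrow> a \<le> norm x \<and> norm x \<le> b"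
    by blast
  let ?Q = "cball 0 b - ball 0 a :: (real^'a) set"
  have "closed ?Q" by (intro closed_Diff) auto
  then have cl: "closure {x. \<phi> x \<noteq> 0} \<subseteq> ?Q"
  proof (intro closure_minimal subsetI)
    fix x assume "x \<in> {x. \<phi> x \<noteq> 0}"
    then show "x \<in> ?Q" using a(2)[of x] by (simp add: not_less)
  qed
  have "compact ?Q" by (intro compact_diff) auto
  then have "compact (closure {x. \<phi> x \<noteq> 0})"
    using cl closed_closure compact_Int_closed[of ?Q "closure {x. \<phi> x \<noteq> 0}"] by (simp add: Int_absorb1)
  moreover have "smooth_on (ball 0 a) \<phi>"
    by (rule smooth_on_cong[OF _ smooth_on_const[of _ 0]]) (use a in \<open>auto simp: not_le[symmetric]\<close>)
  then have "smooth_on (- {0} \<union> ball 0 a) \<phi>"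
    using s by (intro smooth_on_Un) auto
  moreover have "- {0} \<union> ball 0 a = (UNIV :: (real^'a) set)" using a by auto
  ultimately show "test_fun \<phi>"
    unfolding test_fun_def using cl a(1) by auto
qed

lemma test_fun_smooth: "test_fun \<phi> \<Longrightarrow> smooth_on UNIV \<phi>"
  by (simp add: test_fun_def)

lemma test_fun_supportE:
  fixes \<phi> :: "real^'n \<Rightarrow> complex"
  assumes "test_fun \<phi>"
  obtains a b where "0 < a" "a \<le> b" "\<And>x. norm x < a \<or> b < norm x \<Longrightarrow> \<phi> x = 0"
    "\<And>x. norm x < a \<or> b < norm x \<Longrightarrow> grad \<phi> x = 0"
proof -
  obtain a b where a: "a > 0" "\<And>x. \<phi> x \<noteq> 0 \<Longrightarrow> a \<le> norm x \<and> norm x \<le> b"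
    using assms unfolding test_fun_iff by blast
  have o: "open {x::real^'n. norm x < a \<or> max a b < norm x}"
    by (intro open_Collect_disj open_Collect_less continuous_intros)
  have z: "\<phi> x = 0" if "x \<in> {x. norm x < a \<or> max a b < norm x}" for x
    using that a(2)[of x] by force
  show thesis
  proof (rule that[of a "max a b"])
    fix x :: "real^'n" assume x: "norm x < a \<or> max a b < norm x"
    then show "\<phi> x = 0" by (intro z) simp
    show "grad \<phi> x = 0" by (rule grad_zero_on_open[OF o _ z]) (use x in auto)
  qed (use a in auto)
qed

lemma test_fun_continuous: "test_fun \<phi> \<Longrightarrow> continuous_on UNIV \<phi>"
  by (rule smooth_on_imp_continuous_on[OF test_fun_smooth])

lemma smooth_grad_continuous:
  assumes "smooth_on S \<phi>"
  shows "continuous_on S (grad \<phi>)"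
  unfolding grad_def[abs_def]
  by (intro continuous_on_vec_lambda smooth_on_imp_continuous_on smooth_on_partial_deriv assms)

lemma test_fun_grad_continuous: "test_fun \<phi> \<Longrightarrow> continuous_on UNIV (grad \<phi>)"
  by (rule smooth_grad_continuous[OF test_fun_smooth])

lemma test_fun_measurable:
  assumes "test_fun \<phi>"
  shows "\<phi> \<in> borel_measurable borel" "grad \<phi> \<in> borel_measurable borel"
  using assms by (auto intro!: borel_measurable_continuous_onI test_fun_continuous test_fun_grad_continuous)

lemma integrable_compact_support:
  fixes f :: "'a::euclidean_space \<Rightarrow> 'b::{banach, second_countable_topology}"
  assumes "continuous_on UNIV f" "\<And>x. b < norm x \<Longrightarrow> f x = 0"
  shows "integrable lborel f"
proof -
  have "integrable lborel (\<lambda>x. indicator (cball 0 b) x *\<^sub>R f x)"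
    using assms(1) continuous_on_subset by (intro borel_integrable_compact) auto
  moreover have "indicator (cball 0 b) x *\<^sub>R f x = f x" for x
    using assms(2)[of x] by (auto simp: indicator_def)
  ultimately show ?thesis by simp
qed

lemma smooth_grad_add:
  assumes "open S" "smooth_on S f" "smooth_on S g" "x \<in> S"
  shows "grad (\<lambda>x. f x + g x) x = grad f x + grad g x"
  using has_derivative_add[OF smooth_on_has_derivative[OF assms(1,2,4)] smooth_on_has_derivative[OF assms(1,3,4)]]
  by (simp add: grad_def vec_eq_iff partial_deriv_eq) (simp add: partial_deriv_def)

lemma smooth_grad_mult:
  assumes "open S" "smooth_on S f" "smooth_on S g" "x \<in> S"
  shows "grad (\<lambda>x. f x * g x) x $ i = f x * (grad g x $ i) + (grad f x $ i) * g x"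
  using has_derivative_mult[OF smooth_on_has_derivative[OF assms(1,2,4)] smooth_on_has_derivative[OF assms(1,3,4)]]
  by (simp add: grad_def partial_deriv_eq) (simp add: partial_deriv_def)

lemma smooth_grad_cmult:
  assumes "open S" "smooth_on S f" "x \<in> S"
  shows "grad (\<lambda>x. c * f x) x = (\<chi> i. c * (grad f x $ i))"
  using has_derivative_mult_right[OF smooth_on_has_derivative[OF assms(1,2,3)], of c]
  by (simp add: grad_def vec_eq_iff partial_deriv_eq) (simp add: partial_deriv_def)

lemma test_fun_mult:
  assumes "test_fun \<phi>" "smooth_on (- {0}) \<eta>"
  shows "test_fun (\<lambda>x. \<eta> x * \<phi> x)"
  using assms unfolding test_fun_iff by (auto intro!: smooth_on_mult)

lemma test_fun_add:
  assumes "test_fun \<phi>" "test_fun \<psi>"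
  shows "test_fun (\<lambda>x. \<phi> x + \<psi> x)"
proof -
  obtain a b where 1: "0 < a" "\<And>x. norm x < a \<or> b < norm x \<Longrightarrow> \<phi> x = 0"
    by (rule test_fun_supportE[OF assms(1)]) (rule that; assumption)
  obtain c d where 2: "0 < c" "\<And>x. norm x < c \<or> d < norm x \<Longrightarrow> \<psi> x = 0"
    by (rule test_fun_supportE[OF assms(2)]) (rule that; assumption)
  have "min a c \<le> norm x \<and> norm x \<le> max b d" if "\<phi> x + \<psi> x \<noteq> 0" for x
  proof -
    have "\<phi> x \<noteq> 0 \<or> \<psi> x \<noteq> 0" using that by auto
    then have "(a \<le> norm x \<and> norm x \<le> b) \<or> (c \<le> norm x \<and> norm x \<le> d)"
      using 1(2)[of x] 2(2)[of x] by force
    then show ?thesis by linarith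
  qed
  then show ?thesis
    unfolding test_fun_iff using 1(1) 2(1) assms
    by (intro conjI smooth_on_add exI[of _ "min a c"] exI[of _ "max b d"]) (auto simp: test_fun_iff)
qed

text \<open>Difference quotients integrate to 0 by translation invariance of Lebesgue measure, and
  they converge to the derivative under a uniform Lipschitz bound.\<close>

lemma integral_partial_deriv_zero:
  fixes \<phi> :: "real^'n \<Rightarrow> complex"
  assumes "test_fun \<phi>"
  shows "(\<integral>x. partial_deriv i \<phi> x \<partial>lborel) = 0"
proof -
  let ?e = "axis i 1 :: real^'n"
  obtain a b where ab: "0 < a" "a \<le> b" "\<And>x. norm x < a \<or> b < norm x \<Longrightarrow> \<phi> x = 0"
    by (rule test_fun_supportE[OF assms]) (rule that; assumption)
  define D where "D = partial_deriv i \<phi>"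
  have D_cont: "continuous_on UNIV D"
    unfolding D_def by (intro smooth_on_imp_continuous_on smooth_on_partial_deriv test_fun_smooth assms)
  have D0: "D x = 0" if "b < norm x" for x
    unfolding D_def
    by (rule partial_deriv_eq[OF has_derivative_zero_on_open[of "{x. b < norm x}"]])
       (use that ab in \<open>auto intro!: open_Collect_less continuous_intros\<close>)
  have "bounded (D ` cball 0 b)"
    by (intro compact_imp_bounded compact_continuous_image continuous_on_subset[OF D_cont]) auto
  then obtain B where B: "\<forall>y\<in>D ` cball 0 b. norm y \<le> B" unfolding bounded_iff by blast
  have B': "norm (D x) \<le> max B 0" for x
    using B D0[of x] by (cases "b < norm x") (auto simp: le_max_iff_disj)
  have line: "((\<lambda>t. \<phi> (x + t *\<^sub>R ?e)) has_vector_derivative D (x + t *\<^sub>R ?e)) (at t)" for x t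
  proof -
    have "((\<lambda>t. x + t *\<^sub>R ?e) has_derivative (\<lambda>s. s *\<^sub>R ?e)) (at t)"
      by (auto intro!: derivative_eq_intros)
    from has_derivative_compose[OF this smooth_on_has_derivative[OF open_UNIV test_fun_smooth[OF assms] UNIV_I]]
    have "((\<lambda>t. \<phi> (x + t *\<^sub>R ?e)) has_derivative (\<lambda>s. frechet_derivative \<phi> (at (x + t *\<^sub>R ?e)) (s *\<^sub>R ?e))) (at t)" .
    moreover have "linear (frechet_derivative \<phi> (at y))" for y
      using smooth_on_has_derivative[OF open_UNIV test_fun_smooth[OF assms], of y] has_derivative_linear by blast
    ultimately show ?thesis
      unfolding has_vector_derivative_def D_def partial_deriv_def by (simp add: linear_scale)
  qed
  have Lip: "norm (\<phi> (x + h *\<^sub>R ?e) - \<phi> x) \<le> max B 0 * \<bar>h\<bar>" for x h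
  proof -
    have "norm (\<phi> (x + h *\<^sub>R ?e) - \<phi> (x + 0 *\<^sub>R ?e)) \<le> max B 0 * norm (h - 0)"
    proof (rule differentiable_bound[of UNIV "\<lambda>t. \<phi> (x + t *\<^sub>R ?e)" "\<lambda>t s. s *\<^sub>R D (x + t *\<^sub>R ?e)" "max B 0" h 0])
      show "onorm (\<lambda>s. s *\<^sub>R D (x + t *\<^sub>R ?e)) \<le> max B 0" for t
        by (rule onorm_le) (use B' in \<open>simp add: mult.commute[of "max B 0"] mult_left_mono\<close>)
    qed (use line in \<open>auto simp: has_vector_derivative_def\<close>)
    then show ?thesis by simp
  qed
  define h where "h n = inverse (real (Suc n))" for n
  have h: "h n > 0" "h n \<le> 1" for n by (auto simp: h_def field_simps)
  define F where "F n x = (\<phi> (x + h n *\<^sub>R ?e) - \<phi> x) /\<^sub>R h n" for n x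
  have [measurable]: "\<phi> \<in> borel_measurable borel" "D \<in> borel_measurable borel"
    using test_fun_measurable[OF assms] D_cont by (auto intro: borel_measurable_continuous_onI)
  have \<phi>i: "integrable lborel \<phi>"
    by (rule integrable_compact_support[OF test_fun_continuous[OF assms], of b]) (use ab in auto)
  have shift: "(\<integral>x. \<phi> (x + c) \<partial>lborel) = (\<integral>x. \<phi> x \<partial>lborel)" "integrable lborel (\<lambda>x. \<phi> (x + c))" for c
  proof -
    show "(\<integral>x. \<phi> (x + c) \<partial>lborel) = (\<integral>x. \<phi> x \<partial>lborel)"
      by (subst (2) lborel_distr_plus[of c, symmetric]) (simp add: integral_distr add.commute)
    have "integrable (distr lborel borel ((+) c)) \<phi>" using \<phi>i by (simp add: lborel_distr_plus)
    then show "integrable lborel (\<lambda>x. \<phi> (x + c))"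
      by (subst (asm) integrable_distr_eq) (auto simp: add.commute)
  qed
  have "(\<lambda>n. integral\<^sup>L lborel (F n)) \<longlonglongrightarrow> integral\<^sup>L lborel D"
  proof (rule integral_dominated_convergence)
    \<comment> \<open>The radius b + 1 covers every shifted support, as the steps \<open>h n\<close>
      are at most 1.\<close>
    show "integrable lborel (\<lambda>x::real^'n. max B 0 * indicat_real (cball 0 (b + 1)) x)"
      using emeasure_lborel_cball_finite[of "0::real^'n" "b + 1"] by (intro integrable_mult_right integrable_real_indicator) auto
    show "AE x in lborel. (\<lambda>n. F n x) \<longlonglongrightarrow> D x"
    proof (rule AE_I2)
      fix x
      have "((\<lambda>s. (\<phi> (x + (0 + s) *\<^sub>R ?e) - \<phi> (x + 0 *\<^sub>R ?e)) /\<^sub>R s) \<longlongrightarrow> D (x + 0 *\<^sub>R ?e)) (at 0)"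
      proof -
        have "((\<lambda>s. norm (\<phi> (x + s *\<^sub>R ?e) - \<phi> x - s *\<^sub>R D x) / norm s) \<longlongrightarrow> 0) (at 0)"
          using line[of x 0] by (simp add: has_vector_derivative_def has_derivative_at)
        then have "((\<lambda>s. norm ((\<phi> (x + s *\<^sub>R ?e) - \<phi> x) /\<^sub>R s - D x)) \<longlongrightarrow> 0) (at 0)"
        proof (rule Lim_transform_eventually)
          have "norm (\<phi> (x + s *\<^sub>R ?e) - \<phi> x - s *\<^sub>R D x) / norm s = norm ((\<phi> (x + s *\<^sub>R ?e) - \<phi> x) /\<^sub>R s - D x)"
            if "s \<noteq> 0" for s
          proof -
            have "(\<phi> (x + s *\<^sub>R ?e) - \<phi> x) /\<^sub>R s - D x = (\<phi> (x + s *\<^sub>R ?e) - \<phi> x - s *\<^sub>R D x) /\<^sub>R s"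
              using that by (simp add: scaleR_diff_right)
            then show ?thesis by (simp add: divide_inverse mult.commute)
          qed
          then show "\<forall>\<^sub>F s in at 0. norm (\<phi> (x + s *\<^sub>R ?e) - \<phi> x - s *\<^sub>R D x) / norm s = norm ((\<phi> (x + s *\<^sub>R ?e) - \<phi> x) /\<^sub>R s - D x)"
            by (auto simp: eventually_at intro!: exI[of _ 1])
        qed
        then show ?thesis
          by (simp add: tendsto_norm_zero_iff LIM_zero_iff)
      qed
      moreover have "filterlim h (at 0) sequentially"
        unfolding filterlim_at h_def[abs_def] using LIMSEQ_inverse_real_of_nat by (auto intro: LIMSEQ_inverse_real_of_nat)
      ultimately have "(\<lambda>n. (\<phi> (x + (0 + h n) *\<^sub>R ?e) - \<phi> (x + 0 *\<^sub>R ?e)) /\<^sub>R h n) \<longlonglongrightarrow> D (x + 0 *\<^sub>R ?e)"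
        by (rule filterlim_compose)
      then show "(\<lambda>n. F n x) \<longlonglongrightarrow> D x" by (simp add: F_def)
    qed
    show "AE x in lborel. norm (F n x) \<le> max B 0 * indicat_real (cball 0 (b + 1)) x" for n
    proof (rule AE_I2)
      fix x
      show "norm (F n x) \<le> max B 0 * indicat_real (cball 0 (b + 1)) x"
      proof (cases "norm x \<le> b + 1")
        case True
        then show ?thesis
          using Lip[of x "h n"] h[of n] by (simp add: F_def divide_simps mult.commute)
      next
        case False
        have "norm x \<le> norm (x + h n *\<^sub>R ?e) + norm (h n *\<^sub>R ?e)"
          by (metis add_diff_cancel_right' norm_triangle_ineq4)
        then have "b < norm (x + h n *\<^sub>R ?e)" using False h[of n] by (simp add: norm_axis_1)
        then show ?thesis using False ab(3) by (simp add: F_def)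
      qed
    qed
  qed (unfold F_def, measurable)
  moreover have "integral\<^sup>L lborel (F n) = 0" for n
    unfolding F_def by (simp add: Bochner_Integration.integral_diff \<phi>i shift)
  ultimately show ?thesis by (simp add: LIMSEQ_const_iff D_def)
qed

section \<open>The weighted Sobolev space\<close>

text \<open>The integrand of \<open>H_norm_sq\<close>. Norm estimates are proved for it pointwise
  and integrated afterwards.\<close>

definition H_dens :: "(real^'n \<Rightarrow> complex) \<Rightarrow> (real^'n \<Rightarrow> complex^'n) \<Rightarrow> real^'n \<Rightarrow> real" where
  "H_dens v G x = ((norm (G x))\<^sup>2 + (norm (v x))\<^sup>2 + (norm (v x))\<^sup>2 / (norm x)\<^sup>2) * exp (- (norm x)\<^sup>2 / 4)"

lemma H_norm_sq_eq: "H_norm_sq v G = (\<integral>\<^sup>+x. ennreal (H_dens v G x) \<partial>lborel)"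
  by (simp add: H_norm_sq_def H_dens_def)

lemma H_dens_nonneg: "0 \<le> H_dens v G x"
  by (simp add: H_dens_def)

lemma H_dens_measurable [measurable (raw)]:
  assumes [measurable]: "v \<in> borel_measurable borel" "G \<in> borel_measurable borel"
  shows "H_dens v G \<in> borel_measurable borel"
  unfolding H_dens_def[abs_def] by measurable

lemma norm_add_sq_le: "(norm (a + b))\<^sup>2 \<le> 2 * (norm a)\<^sup>2 + 2 * (norm b)\<^sup>2" for a b :: "'a::real_normed_vector"
proof -
  have "(norm (a + b))\<^sup>2 \<le> (norm a + norm b)\<^sup>2"
    by (intro power_mono norm_triangle_ineq) auto
  also have "\<dots> \<le> 2 * (norm a)\<^sup>2 + 2 * (norm b)\<^sup>2"
    using sum_squares_bound[of "norm a" "norm b"] by (simp add: power2_sum)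
  finally show ?thesis .
qed

lemma H_dens_add_le:
  "H_dens (\<lambda>x. v x + w x) (\<lambda>x. G x + K x) x \<le> 2 * H_dens v G x + 2 * H_dens w K x"
proof -
  have "(norm (v x + w x))\<^sup>2 / (norm x)\<^sup>2 \<le> (2 * (norm (v x))\<^sup>2 + 2 * (norm (w x))\<^sup>2) / (norm x)\<^sup>2"
    by (intro divide_right_mono norm_add_sq_le) simp
  then have "(norm (G x + K x))\<^sup>2 + (norm (v x + w x))\<^sup>2 + (norm (v x + w x))\<^sup>2 / (norm x)\<^sup>2 \<le>
      2 * ((norm (G x))\<^sup>2 + (norm (v x))\<^sup>2 + (norm (v x))\<^sup>2 / (norm x)\<^sup>2) +
      2 * ((norm (K x))\<^sup>2 + (norm (w x))\<^sup>2 + (norm (w x))\<^sup>2 / (norm x)\<^sup>2)"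
    using norm_add_sq_le[of "G x" "K x"] norm_add_sq_le[of "v x" "w x"] by (simp add: add_divide_distrib)
  from mult_right_mono[OF this, of "exp (- (norm x)\<^sup>2 / 4)"] show ?thesis
    unfolding H_dens_def by (simp add: algebra_simps)
qed

lemma H_norm_sq_add_le:
  assumes [measurable]: "v \<in> borel_measurable borel" "G \<in> borel_measurable borel"
    "w \<in> borel_measurable borel" "K \<in> borel_measurable borel"
  shows "H_norm_sq (\<lambda>x. v x + w x) (\<lambda>x. G x + K x) \<le> 2 * H_norm_sq v G + 2 * H_norm_sq w K"
proof -
  have "H_norm_sq (\<lambda>x. v x + w x) (\<lambda>x. G x + K x) \<le> (\<integral>\<^sup>+x. 2 * ennreal (H_dens v G x) + 2 * ennreal (H_dens w K x) \<partial>lborel)"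
    unfolding H_norm_sq_eq
  proof (rule nn_integral_mono)
    fix x
    have "ennreal (H_dens (\<lambda>x. v x + w x) (\<lambda>x. G x + K x) x) \<le> ennreal (2 * H_dens v G x + 2 * H_dens w K x)"
      by (rule ennreal_leI[OF H_dens_add_le])
    also have "\<dots> = 2 * ennreal (H_dens v G x) + 2 * ennreal (H_dens w K x)"
      by (simp add: ennreal_plus ennreal_mult H_dens_nonneg)
    finally show "ennreal (H_dens (\<lambda>x. v x + w x) (\<lambda>x. G x + K x) x) \<le> 2 * ennreal (H_dens v G x) + 2 * ennreal (H_dens w K x)" .
  qed
  also have "\<dots> = 2 * H_norm_sq v G + 2 * H_norm_sq w K"
    unfolding H_norm_sq_eq by (simp add: nn_integral_add nn_integral_cmult)
  finally show ?thesis .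
qed

lemma H_norm_sq_cmult:
  assumes [measurable]: "v \<in> borel_measurable borel" "G \<in> borel_measurable borel"
  shows "H_norm_sq (\<lambda>x. c * v x) (\<lambda>x. \<chi> i. c * (G x $ i)) = ennreal ((norm c)\<^sup>2) * H_norm_sq v G"
proof -
  have "(norm (\<chi> i. c * (G x $ i)))\<^sup>2 = (norm c)\<^sup>2 * (norm (G x))\<^sup>2" for x
    by (simp add: norm_vec_sq norm_mult power_mult_distrib sum_distrib_left)
  then have "H_dens (\<lambda>x. c * v x) (\<lambda>x. \<chi> i. c * (G x $ i)) x = (norm c)\<^sup>2 * H_dens v G x" for x
    by (simp add: H_dens_def norm_mult power_mult_distrib field_simps)
  then show ?thesis
    unfolding H_norm_sq_eq by (simp add: ennreal_mult H_dens_nonneg nn_integral_cmult)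
qed

lemma H_norm_sq_test_fun_finite:
  assumes "test_fun \<phi>"
  shows "H_norm_sq \<phi> (grad \<phi>) < \<infinity>"
proof -
  obtain a b where ab: "0 < a" "a \<le> b" "\<And>x. norm x < a \<or> b < norm x \<Longrightarrow> \<phi> x = 0"
    "\<And>x. norm x < a \<or> b < norm x \<Longrightarrow> grad \<phi> x = 0"
    by (rule test_fun_supportE[OF assms]) (rule that; assumption)
  let ?f = "\<lambda>x. (norm (grad \<phi> x))\<^sup>2 + (norm (\<phi> x))\<^sup>2 + (norm (\<phi> x))\<^sup>2 / a\<^sup>2"
  have "integrable lborel ?f"
  proof (rule integrable_compact_support[where b = b])
    show "continuous_on UNIV ?f"
      using ab(1) by (intro continuous_intros test_fun_continuous[OF assms] test_fun_grad_continuous[OF assms]) auto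
  qed (use ab in auto)
  then have "(\<integral>\<^sup>+x. ennreal (?f x) \<partial>lborel) < \<infinity>"
    using nn_integral_eq_integral[of lborel ?f] by (simp add: ennreal_less_top)
  moreover have "H_norm_sq \<phi> (grad \<phi>) \<le> (\<integral>\<^sup>+x. ennreal (?f x) \<partial>lborel)"
    unfolding H_norm_sq_eq
  proof (intro nn_integral_mono ennreal_leI)
    fix x
    have "(norm (\<phi> x))\<^sup>2 / (norm x)\<^sup>2 \<le> (norm (\<phi> x))\<^sup>2 / a\<^sup>2"
    proof (cases "norm x < a")
      case False
      then show ?thesis using ab(1) by (intro divide_left_mono power_mono mult_pos_pos zero_less_power) auto
    qed (use ab(3)[of x] in simp)
    then have "(norm (grad \<phi> x))\<^sup>2 + (norm (\<phi> x))\<^sup>2 + (norm (\<phi> x))\<^sup>2 / (norm x)\<^sup>2 \<le> ?f x" by simp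
    from mult_mono[OF this, of "exp (- (norm x)\<^sup>2 / 4)" 1] show "H_dens \<phi> (grad \<phi>) x \<le> ?f x"
      by (simp add: H_dens_def)
  qed
  ultimately show ?thesis by (rule le_less_trans[rotated])
qed

lemma has_H_grad_measurable:
  assumes "has_H_grad v G"
  shows "v \<in> borel_measurable borel" "G \<in> borel_measurable borel"
  using assms by (simp_all add: has_H_grad_def)

lemma has_H_gradE:
  assumes "has_H_grad v G"
  obtains \<phi> where "\<And>n::nat. test_fun (\<phi> n)"
    "(\<lambda>n. H_norm_sq (\<lambda>x. \<phi> n x - v x) (\<lambda>x. grad (\<phi> n) x - G x)) \<longlonglongrightarrow> 0"
  using assms unfolding has_H_grad_def by blast

lemma has_H_gradI:
  assumes "v \<in> borel_measurable borel" "G \<in> borel_measurable borel" "\<And>n::nat. test_fun (\<phi> n)"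
    "(\<lambda>n. H_norm_sq (\<lambda>x. \<phi> n x - v x) (\<lambda>x. grad (\<phi> n) x - G x)) \<longlonglongrightarrow> 0"
  shows "has_H_grad v G"
  using assms unfolding has_H_grad_def by auto

lemma has_H_grad_test_fun: "test_fun \<phi> \<Longrightarrow> has_H_grad \<phi> (grad \<phi>)"
  by (rule has_H_gradI[of _ _ "\<lambda>_. \<phi>"]) (auto simp: test_fun_measurable H_norm_sq_def)

text \<open>Some test function has squared distance less than 1 from v, and test functions have
  finite norm.\<close>

lemma H_norm_sq_finite:
  assumes "has_H_grad v G"
  shows "H_norm_sq v G < \<infinity>"
proof -
  obtain \<phi> where \<phi>: "\<And>n::nat. test_fun (\<phi> n)"
    "(\<lambda>n. H_norm_sq (\<lambda>x. \<phi> n x - v x) (\<lambda>x. grad (\<phi> n) x - G x)) \<longlonglongrightarrow> 0"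
    using assms by (rule has_H_gradE) blast
  note [measurable] = has_H_grad_measurable[OF assms] test_fun_measurable[OF \<phi>(1)]
  from \<phi>(2) have "eventually (\<lambda>n. H_norm_sq (\<lambda>x. \<phi> n x - v x) (\<lambda>x. grad (\<phi> n) x - G x) < 1) sequentially"
    by (rule order_tendstoD) simp
  then obtain n where n: "H_norm_sq (\<lambda>x. \<phi> n x - v x) (\<lambda>x. grad (\<phi> n) x - G x) < 1"
    by (auto simp: eventually_sequentially)
  have "H_norm_sq v G \<le> 2 * H_norm_sq (\<lambda>x. (-1) * (\<phi> n x - v x)) (\<lambda>x. \<chi> i. (-1) * ((grad (\<phi> n) x - G x) $ i)) + 2 * H_norm_sq (\<phi> n) (grad (\<phi> n))"
  proof -
    have "v = (\<lambda>x. (-1) * (\<phi> n x - v x) + \<phi> n x)"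
      "G = (\<lambda>x. (\<chi> i. (-1) * ((grad (\<phi> n) x - G x) $ i)) + grad (\<phi> n) x)"
      by (auto simp: fun_eq_iff vec_eq_iff)
    then show ?thesis
      using H_norm_sq_add_le[of "\<lambda>x. (-1) * (\<phi> n x - v x)" "\<lambda>x. \<chi> i. (-1) * ((grad (\<phi> n) x - G x) $ i)" "\<phi> n" "grad (\<phi> n)"]
      by simp
  qed
  also have "\<dots> = 2 * H_norm_sq (\<lambda>x. \<phi> n x - v x) (\<lambda>x. grad (\<phi> n) x - G x) + 2 * H_norm_sq (\<phi> n) (grad (\<phi> n))"
    by (subst H_norm_sq_cmult) auto
  also have "\<dots> < \<infinity>"
    using n H_norm_sq_test_fun_finite[OF \<phi>(1), of n]
    by (auto simp: ennreal_mult_less_top ennreal_add_less_top intro: less_trans[OF _ ennreal_one_less_top])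
  finally show ?thesis .
qed

lemma tendsto_zero_ennreal_le:
  fixes f g :: "nat \<Rightarrow> ennreal"
  assumes "g \<longlonglongrightarrow> 0" "\<And>n. f n \<le> g n"
  shows "f \<longlonglongrightarrow> 0"
  by (rule tendsto_sandwich[OF _ _ tendsto_const assms(1)]) (use assms(2) in auto)

lemma has_H_grad_add:
  assumes v: "has_H_grad v G" and w: "has_H_grad w K"
  shows "has_H_grad (\<lambda>x. v x + w x) (\<lambda>x. G x + K x)"
proof -
  obtain \<phi> where \<phi>: "\<And>n::nat. test_fun (\<phi> n)"
    "(\<lambda>n. H_norm_sq (\<lambda>x. \<phi> n x - v x) (\<lambda>x. grad (\<phi> n) x - G x)) \<longlonglongrightarrow> 0"
    using v by (rule has_H_gradE) blast
  obtain \<psi> where \<psi>: "\<And>n::nat. test_fun (\<psi> n)"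
    "(\<lambda>n. H_norm_sq (\<lambda>x. \<psi> n x - w x) (\<lambda>x. grad (\<psi> n) x - K x)) \<longlonglongrightarrow> 0"
    using w by (rule has_H_gradE) blast
  note [measurable] = has_H_grad_measurable[OF v] has_H_grad_measurable[OF w]
    test_fun_measurable[OF \<phi>(1)] test_fun_measurable[OF \<psi>(1)]
  show ?thesis
  proof (rule has_H_gradI[of _ _ "\<lambda>n x. \<phi> n x + \<psi> n x"])
    have "(\<lambda>n. 2 * H_norm_sq (\<lambda>x. \<phi> n x - v x) (\<lambda>x. grad (\<phi> n) x - G x) +
        2 * H_norm_sq (\<lambda>x. \<psi> n x - w x) (\<lambda>x. grad (\<psi> n) x - K x)) \<longlonglongrightarrow> 2 * 0 + 2 * 0"
      by (intro tendsto_add tendsto_mult_ennreal tendsto_const \<phi>(2) \<psi>(2)) auto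
    then have "(\<lambda>n. 2 * H_norm_sq (\<lambda>x. \<phi> n x - v x) (\<lambda>x. grad (\<phi> n) x - G x) +
        2 * H_norm_sq (\<lambda>x. \<psi> n x - w x) (\<lambda>x. grad (\<psi> n) x - K x)) \<longlonglongrightarrow> 0" by simp
    then show "(\<lambda>n. H_norm_sq (\<lambda>x. \<phi> n x + \<psi> n x - (v x + w x)) (\<lambda>x. grad (\<lambda>x. \<phi> n x + \<psi> n x) x - (G x + K x))) \<longlonglongrightarrow> 0"
    proof (rule tendsto_zero_ennreal_le)
      fix n
      have "grad (\<lambda>x. \<phi> n x + \<psi> n x) x = grad (\<phi> n) x + grad (\<psi> n) x" for x
        by (rule smooth_grad_add[OF open_UNIV test_fun_smooth[OF \<phi>(1)] test_fun_smooth[OF \<psi>(1)] UNIV_I])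
      then have "H_norm_sq (\<lambda>x. \<phi> n x + \<psi> n x - (v x + w x)) (\<lambda>x. grad (\<lambda>x. \<phi> n x + \<psi> n x) x - (G x + K x)) =
         H_norm_sq (\<lambda>x. (\<phi> n x - v x) + (\<psi> n x - w x)) (\<lambda>x. (grad (\<phi> n) x - G x) + (grad (\<psi> n) x - K x))"
        by (simp add: algebra_simps)
      also have "\<dots> \<le> 2 * H_norm_sq (\<lambda>x. \<phi> n x - v x) (\<lambda>x. grad (\<phi> n) x - G x) +
        2 * H_norm_sq (\<lambda>x. \<psi> n x - w x) (\<lambda>x. grad (\<psi> n) x - K x)"
        by (rule H_norm_sq_add_le) measurable
      finally show "H_norm_sq (\<lambda>x. \<phi> n x + \<psi> n x - (v x + w x)) (\<lambda>x. grad (\<lambda>x. \<phi> n x + \<psi> n x) x - (G x + K x)) \<le> \<dots>" .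
    qed
  qed (auto intro!: test_fun_add \<phi> \<psi>)
qed

lemma has_H_grad_cmult:
  assumes v: "has_H_grad v G"
  shows "has_H_grad (\<lambda>x. c * v x) (\<lambda>x. \<chi> i. c * (G x $ i))"
proof -
  obtain \<phi> where \<phi>: "\<And>n::nat. test_fun (\<phi> n)"
    "(\<lambda>n. H_norm_sq (\<lambda>x. \<phi> n x - v x) (\<lambda>x. grad (\<phi> n) x - G x)) \<longlonglongrightarrow> 0"
    using v by (rule has_H_gradE) blast
  note [measurable] = has_H_grad_measurable[OF v] test_fun_measurable[OF \<phi>(1)]
  show ?thesis
  proof (rule has_H_gradI[of _ _ "\<lambda>n x. c * \<phi> n x"])
    have "(\<lambda>n. ennreal ((norm c)\<^sup>2) * H_norm_sq (\<lambda>x. \<phi> n x - v x) (\<lambda>x. grad (\<phi> n) x - G x)) \<longlonglongrightarrow> ennreal ((norm c)\<^sup>2) * 0"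
      by (intro tendsto_mult_ennreal tendsto_const \<phi>(2)) auto
    moreover have "H_norm_sq (\<lambda>x. c * \<phi> n x - c * v x) (\<lambda>x. grad (\<lambda>x. c * \<phi> n x) x - (\<chi> i. c * (G x $ i))) =
      ennreal ((norm c)\<^sup>2) * H_norm_sq (\<lambda>x. \<phi> n x - v x) (\<lambda>x. grad (\<phi> n) x - G x)" for n
    proof -
      have "grad (\<lambda>x. c * \<phi> n x) x - (\<chi> i. c * (G x $ i)) = (\<chi> i. c * ((grad (\<phi> n) x - G x) $ i))" for x
        using smooth_grad_cmult[OF open_UNIV test_fun_smooth[OF \<phi>(1)] UNIV_I, of c n x]
        by (simp add: vec_eq_iff algebra_simps)
      then show ?thesis
        by (subst H_norm_sq_cmult[symmetric]) (auto simp: right_diff_distrib)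
    qed
    ultimately show "(\<lambda>n. H_norm_sq (\<lambda>x. c * \<phi> n x - c * v x) (\<lambda>x. grad (\<lambda>x. c * \<phi> n x) x - (\<chi> i. c * (G x $ i)))) \<longlonglongrightarrow> 0"
      by simp
    show "test_fun (\<lambda>x. c * \<phi> n x)" for n
      by (rule test_fun_mult[OF \<phi>(1) smooth_on_const])
  qed auto
qed

section \<open>Gaussian integrals and smooth truncations\<close>

lemma nn_integral_powr_gauss_finite:
  fixes s c :: real
  assumes "s > - 1" "c > 0"
  shows "(\<integral>\<^sup>+r. ennreal (indicator {0<..} r * (r powr s * exp (- c * r\<^sup>2))) \<partial>lborel) < \<infinity>"
proof -
  have "(\<integral>\<^sup>+r. ennreal (indicator {0<..} r * (r powr s * exp (- c * r\<^sup>2))) \<partial>lborel) \<le>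
     (\<integral>\<^sup>+r. ennreal (exp (1 / (4 * c))) * ennreal (indicator {0..} r * r powr ((s + 1) - 1) / exp r) \<partial>lborel)"
  proof (rule nn_integral_mono)
    fix r :: real
    \<comment> \<open>Expanding this square bounds the Gaussian by a multiple of exp(-r), which
      leads to a Gamma integral.\<close>
    have "0 \<le> c * (r - 1 / (2 * c))\<^sup>2" using assms by simp
    moreover have "c * (r - 1 / (2 * c))\<^sup>2 = c * r\<^sup>2 - r + 1 / (4 * c)"
      using assms by (simp add: power2_eq_square field_simps)
    ultimately have "- c * r\<^sup>2 \<le> 1 / (4 * c) - r" by simp
    then have "exp (- c * r\<^sup>2) \<le> exp (1 / (4 * c)) / exp r"
      by (simp flip: exp_diff)
    then have "r powr s * exp (- c * r\<^sup>2) \<le> r powr s * (exp (1 / (4 * c)) / exp r)"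
      by (intro mult_left_mono) auto
    then show "ennreal (indicator {0<..} r * (r powr s * exp (- c * r\<^sup>2))) \<le>
        ennreal (exp (1 / (4 * c))) * ennreal (indicator {0..} r * r powr ((s + 1) - 1) / exp r)"
      by (auto simp: indicator_def ennreal_mult[symmetric] mult_ac intro!: ennreal_leI)
  qed
  also have "\<dots> = ennreal (exp (1 / (4 * c))) * ennreal (Gamma (s + 1))"
    using assms(1) by (subst nn_integral_cmult) (simp_all add: Gamma_conv_nn_integral_real)
  also have "\<dots> < \<infinity>" by (simp add: ennreal_mult_less_top)
  finally show ?thesis .
qed

text \<open>The density r^(N-1) shifts the exponent to N - 1 + s, which is integrable at 0 exactly
  when s > -N.\<close>

lemma radial_powr_gauss_finite:
  fixes s c :: real
  assumes "N \<ge> 1" "s > - real N" "c > 0"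
  shows "(\<integral>\<^sup>+r. ennreal (r powr s * exp (- c * r\<^sup>2)) \<partial>radial_measure N) < \<infinity>"
proof -
  have "(\<integral>\<^sup>+r. ennreal (r powr s * exp (- c * r\<^sup>2)) \<partial>radial_measure N) =
     (\<integral>\<^sup>+r. ennreal (indicator {0<..} r * (r powr (real N - 1 + s) * exp (- c * r\<^sup>2))) \<partial>lborel)"
  proof (subst nn_integral_radial)
    have "ennreal (indicator {0<..} r * r ^ (N - 1)) * ennreal (r powr s * exp (- c * r\<^sup>2)) =
       ennreal (indicator {0<..} r * (r powr (real N - 1 + s) * exp (- c * r\<^sup>2)))" for r
    proof (cases "r > 0")
      case True
      then have "r ^ (N - 1) = r powr (real N - 1)"
        using assms(1) by (simp add: powr_realpow[symmetric] of_nat_diff)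
      then show ?thesis using True by (simp add: ennreal_mult[symmetric] powr_add)
    qed simp
    then show "(\<integral>\<^sup>+r. ennreal (indicator {0<..} r * r ^ (N - 1)) * ennreal (r powr s * exp (- c * r\<^sup>2)) \<partial>lborel) =
      (\<integral>\<^sup>+r. ennreal (indicator {0<..} r * (r powr (real N - 1 + s) * exp (- c * r\<^sup>2))) \<partial>lborel)"
      by simp
  qed simp
  also have "\<dots> < \<infinity>"
    using assms by (intro nn_integral_powr_gauss_finite) auto
  finally show ?thesis .
qed

lemma gauss_integrable: "integrable lborel (\<lambda>x::real^'n. exp (- (norm x)\<^sup>2 / 4))"
proof (rule integrableI_nonneg)
  interpret S: finite_measure "sphere_measure :: (real^'n) measure" by (rule finite_measure_sphere)
  have "(\<integral>\<^sup>+x. ennreal (exp (- (norm x)\<^sup>2 / 4)) \<partial>(lborel :: (real^'n) measure)) =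
    (\<integral>\<^sup>+x. ennreal (exp (- (norm x)\<^sup>2 / 4)) * 1 \<partial>(lborel :: (real^'n) measure))" by simp
  also have "\<dots> = (\<integral>\<^sup>+r. ennreal (exp (- r\<^sup>2 / 4)) \<partial>radial_measure CARD('n)) * (\<integral>\<^sup>+\<theta>. 1 \<partial>(sphere_measure :: (real^'n) measure))"
    by (rule nn_integral_polar_prod[of "\<lambda>r. ennreal (exp (- r\<^sup>2 / 4))" "\<lambda>_. 1"]) auto
  also have "(\<integral>\<^sup>+r. ennreal (exp (- r\<^sup>2 / 4)) \<partial>radial_measure CARD('n)) =
     (\<integral>\<^sup>+r. ennreal (r powr 0 * exp (- (1/4) * r\<^sup>2)) \<partial>radial_measure CARD('n))"
  proof (rule nn_integral_cong_AE)
    show "AE r in radial_measure CARD('n). ennreal (exp (- r\<^sup>2 / 4)) = ennreal (r powr 0 * exp (- (1/4) * r\<^sup>2))"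
      using AE_radial_pos by eventually_elim simp
  qed
  also have "\<dots> * (\<integral>\<^sup>+\<theta>. 1 \<partial>(sphere_measure :: (real^'n) measure)) < \<infinity>"
  proof -
    have "emeasure (sphere_measure :: (real^'n) measure) (sphere 0 1) < top"
      using S.emeasure_finite[of "sphere 0 1"] unfolding less_top by simp
    then show ?thesis
      using radial_powr_gauss_finite[of "CARD('n)" 0 "1/4"] by (simp add: ennreal_mult_less_top Suc_le_eq)
  qed
  finally show "(\<integral>\<^sup>+x. ennreal (exp (- (norm x)\<^sup>2 / 4)) \<partial>(lborel :: (real^'n) measure)) < \<infinity>" .
qed auto

lemma smooth_on_exp:
  assumes "open S" "smooth_on S h"
  shows "smooth_on S (\<lambda>x. exp (h x :: real))"
proof (rule smooth_on_real_compose[OF assms(1) _ assms(2)])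
  show "smooth_real_on UNIV (exp :: real \<Rightarrow> real)"
    unfolding smooth_real_on_def by (intro exI[of _ "\<lambda>_. exp"]) (auto intro: DERIV_exp)
qed auto

lemma smooth_on_of_real:
  "open S \<Longrightarrow> smooth_on S h \<Longrightarrow> smooth_on S (\<lambda>x. complex_of_real (h x))"
  by (rule smooth_on_compose_bounded_linear[OF _ bounded_linear_of_real])

lemma smooth_on_annulus_cutoff:
  "open S \<Longrightarrow> smooth_on S (\<lambda>x::real^'n. annulus_cutoff k ((norm x)\<^sup>2))"
proof -
  assume S: "open S"
  have q: "smooth_on S (\<lambda>x::real^'n. (norm x)\<^sup>2)" by (rule smooth_on_norm_sq[OF S])
  have 1: "smooth_on S (\<lambda>x::real^'n. real k * (norm x)\<^sup>2 + (- 1))"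
    by (intro smooth_on_add smooth_on_mult smooth_on_const S q)
  have 2: "smooth_on S (\<lambda>x::real^'n. real k + (- 1) * (norm x)\<^sup>2)"
    by (intro smooth_on_add smooth_on_mult smooth_on_const S q)
  show ?thesis
    using smooth_on_mult[OF S smooth_on_cutoff[OF S 1] smooth_on_cutoff[OF S 2]]
    by (simp add: annulus_cutoff_def)
qed

text \<open>The cutoff acts on |x|^2, so the radii of the support are the square roots of 1/k and k.
  For k = 0 the product is the zero function.\<close>

lemma test_fun_annulus_cutoff:
  fixes f :: "real^'n \<Rightarrow> complex"
  assumes "smooth_on (- {0}) f"
  shows "test_fun (\<lambda>x. complex_of_real (annulus_cutoff k ((norm x)\<^sup>2)) * f x)"
  unfolding test_fun_iff
proof (intro conjI)
  show "smooth_on (- {0}) (\<lambda>x. complex_of_real (annulus_cutoff k ((norm x)\<^sup>2)) * f x)"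
    by (intro smooth_on_mult smooth_on_of_real smooth_on_annulus_cutoff assms) auto
  show "\<exists>a>0. \<exists>b. \<forall>x. complex_of_real (annulus_cutoff k ((norm x)\<^sup>2)) * f x \<noteq> 0 \<longrightarrow> a \<le> norm x \<and> norm x \<le> b"
  proof (cases "k = 0")
    case True
    then show ?thesis using annulus_cutoff_support[of 0] by (intro exI[of _ 1]) auto
  next
    case False
    have "sqrt (1 / real k) \<le> norm x \<and> norm x \<le> sqrt (real k)"
      if "complex_of_real (annulus_cutoff k ((norm x)\<^sup>2)) * f x \<noteq> 0" for x
      using that annulus_cutoff_support[of k "(norm x)\<^sup>2"] by (auto intro: real_le_lsqrt real_le_rsqrt)
    then show ?thesis using False by (intro exI[of _ "sqrt (1 / real k)"] conjI exI[of _ "sqrt (real k)"]) auto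
  qed
qed

lemma test_fun_bounded:
  assumes "test_fun (\<phi> :: real^'n \<Rightarrow> complex)"
  obtains B where "B \<ge> 0" "\<And>x. norm (\<phi> x) \<le> B"
proof -
  obtain a b where ab: "0 < a" "a \<le> b" "\<And>x. norm x < a \<or> b < norm x \<Longrightarrow> \<phi> x = 0"
    by (rule test_fun_supportE[OF assms]) (rule that; assumption)
  have "bounded (\<phi> ` cball 0 b)"
    by (intro compact_imp_bounded compact_continuous_image continuous_on_subset[OF test_fun_continuous[OF assms]]) auto
  then obtain B where B: "\<forall>y\<in>\<phi> ` cball 0 b. norm y \<le> B" unfolding bounded_iff by blast
  show thesis
  proof (rule that[of "max B 0"])
    show "norm (\<phi> x) \<le> max B 0" for x
      using B ab(3)[of x] by (cases "b < norm x") (auto simp: le_max_iff_disj)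
  qed simp
qed

lemma integrable_H_dens:
  assumes "has_H_grad v G"
  shows "integrable lborel (H_dens v G)"
proof (rule integrableI_nonneg)
  show "(\<integral>\<^sup>+x. ennreal (H_dens v G x) \<partial>lborel) < \<infinity>"
    using H_norm_sq_finite[OF assms] by (simp add: H_norm_sq_eq)
qed (use has_H_grad_measurable[OF assms] in \<open>auto simp: H_dens_nonneg intro!: H_dens_measurable\<close>)

lemma integrable_partial_deriv_test_fun:
  assumes "test_fun \<phi>"
  shows "integrable lborel (\<lambda>x. grad \<phi> x $ i)"
proof -
  obtain a b where ab: "0 < a" "a \<le> b" "\<And>x. norm x < a \<or> b < norm x \<Longrightarrow> \<phi> x = 0"
    "\<And>x. norm x < a \<or> b < norm x \<Longrightarrow> grad \<phi> x = 0"
    by (rule test_fun_supportE[OF assms]) (rule that; assumption)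
  show ?thesis
  proof (rule integrable_compact_support[where b = b])
    show "continuous_on UNIV (\<lambda>x. grad \<phi> x $ i)"
      by (intro continuous_intros test_fun_grad_continuous[OF assms])
  qed (use ab(4) in simp)
qed

lemma two_term_Cauchy_Schwarz:
  fixes p q r s :: real
  shows "p * q + r * s \<le> sqrt (p\<^sup>2 + r\<^sup>2) * sqrt (q\<^sup>2 + s\<^sup>2)"
proof -
  have "0 \<le> (p * s - r * q)\<^sup>2" by simp
  then have "(p * q + r * s)\<^sup>2 \<le> (p\<^sup>2 + r\<^sup>2) * (q\<^sup>2 + s\<^sup>2)"
    by (simp add: power2_eq_square algebra_simps)
  then show ?thesis by (simp add: real_le_rsqrt flip: real_sqrt_mult)
qed

text \<open>Integration by parts against test functions which approximate the indicator functions
  of boxes.\<close>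

lemma has_H_grad_zero:
  fixes D :: "real^'n \<Rightarrow> complex^'n"
  assumes D: "has_H_grad (\<lambda>_. 0) D"
  shows "AE x in lborel. D x = 0"
proof -
  obtain \<phi> where \<phi>: "\<And>n::nat. test_fun (\<phi> n)"
    "(\<lambda>n. H_norm_sq (\<lambda>x. \<phi> n x - 0) (\<lambda>x. grad (\<phi> n) x - D x)) \<longlonglongrightarrow> 0"
    using D by (rule has_H_gradE) blast
  note [measurable] = has_H_grad_measurable(2)[OF D] test_fun_measurable[OF \<phi>(1)]
  have comp: "AE x in lborel. D x $ i = 0" for i
  proof -
    \<comment> \<open>The component of D is only square integrable against the Gaussian weight;
      multiplied by the weight it is integrable on the whole space.\<close>
    define f where "f x = D x $ i * complex_of_real (exp (- (norm x)\<^sup>2 / 4))" for x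
    have [measurable]: "f \<in> borel_measurable borel" unfolding f_def by measurable
    have f: "integrable lborel f"
    proof (rule Bochner_Integration.integrable_bound)
      show "integrable lborel (\<lambda>x. H_dens (\<lambda>_. 0) D x + exp (- (norm x)\<^sup>2 / 4))"
        by (intro Bochner_Integration.integrable_add integrable_H_dens D gauss_integrable)
      show "AE x in lborel. norm (f x) \<le> norm (H_dens (\<lambda>_. 0) D x + exp (- (norm x)\<^sup>2 / 4))"
      proof (rule AE_I2)
        fix x
        have "norm (D x $ i) \<le> norm (D x)" by (rule Finite_Cartesian_Product.norm_nth_le)
        also have "\<dots> \<le> (norm (D x))\<^sup>2 + 1"
          using sum_squares_bound[of "norm (D x)" 1] norm_ge_zero[of "D x"] by (simp only: power_one mult_1_right)
        finally have "norm (D x $ i) * exp (- (norm x)\<^sup>2 / 4) \<le> ((norm (D x))\<^sup>2 + 1) * exp (- (norm x)\<^sup>2 / 4)"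
          by (rule mult_right_mono) simp
        then show "norm (f x) \<le> norm (H_dens (\<lambda>_. 0) D x + exp (- (norm x)\<^sup>2 / 4))"
          by (simp add: f_def norm_mult H_dens_def distrib_right)
      qed
    qed simp
    have weak0: "(\<integral>x. f x * \<eta> x \<partial>lborel) = 0" if \<eta>: "test_fun \<eta>" for \<eta>
    proof -
      \<comment> \<open>Chosen so that f \<eta> = D_i \<zeta>: the weight is moved onto the test
        function.\<close>
      define \<zeta> where "\<zeta> x = complex_of_real (exp (- (norm x)\<^sup>2 / 4)) * \<eta> x" for x
      have \<zeta>: "test_fun \<zeta>"
        unfolding \<zeta>_def
      proof (rule test_fun_mult[OF \<eta>])
        have "smooth_on (- {0::real^'n}) (\<lambda>x. (- 1/4) * (norm x)\<^sup>2)"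
          by (intro smooth_on_mult smooth_on_const smooth_on_norm_sq) auto
        then have "smooth_on (- {0::real^'n}) (\<lambda>x. complex_of_real (exp ((- 1/4) * (norm x)\<^sup>2)))"
          by (intro smooth_on_of_real smooth_on_exp) auto
        then show "smooth_on (- {0::real^'n}) (\<lambda>x. complex_of_real (exp (- (norm x)\<^sup>2 / 4)))" by simp
      qed
      note [measurable] = test_fun_measurable[OF \<zeta>] test_fun_measurable[OF \<eta>]
      obtain c d where cd: "0 < c" "c \<le> d" "\<And>x. norm x < c \<or> d < norm x \<Longrightarrow> \<zeta> x = 0"
        "\<And>x. norm x < c \<or> d < norm x \<Longrightarrow> grad \<zeta> x = 0"
        by (rule test_fun_supportE[OF \<zeta>]) (rule that; assumption)
      obtain B where B: "B \<ge> 0" "\<And>x. norm (\<eta> x) \<le> B"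
        by (rule test_fun_bounded[OF \<eta>]) (rule that; assumption)
      have f\<eta>: "integrable lborel (\<lambda>x. f x * \<eta> x)"
      proof (rule Bochner_Integration.integrable_bound[of _ "\<lambda>x. B * norm (f x)"])
        show "AE x in lborel. norm (f x * \<eta> x) \<le> norm (B * norm (f x))"
          using B by (intro AE_I2) (simp add: norm_mult mult.commute mult_right_mono)
      qed (use f in auto)
      \<comment> \<open>The factor exp(|x|^2/4) cancels the weight in the density of the error; it
        is harmless because \<zeta> has compact support.\<close>
      define a where "a x = ((norm (grad \<zeta> x))\<^sup>2 + (norm (\<zeta> x))\<^sup>2) * exp ((norm x)\<^sup>2 / 4)" for x
      have ai: "integrable lborel a"
        unfolding a_def
      proof (rule integrable_compact_support[where b = d])
        show "continuous_on UNIV (\<lambda>x. ((norm (grad \<zeta> x))\<^sup>2 + (norm (\<zeta> x))\<^sup>2) * exp ((norm x)\<^sup>2 / 4))"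
          by (intro continuous_intros test_fun_continuous[OF \<zeta>] test_fun_grad_continuous[OF \<zeta>]) auto
      qed (use cd in auto)
      have a0: "a x \<ge> 0" for x by (simp add: a_def)
      \<comment> \<open>This is the i-th partial derivative of \<phi>_n \<zeta> minus D_i \<zeta>.
        The derivative integrates to 0, so every integral of \<open>E n\<close> is minus the wanted
        one, while these integrals tend to 0.\<close>
      define E where "E n x = \<phi> n x * (grad \<zeta> x $ i) + ((grad (\<phi> n) x - D x) $ i) * \<zeta> x" for n x
      have "(\<lambda>n. integral\<^sup>L lborel (E n)) \<longlonglongrightarrow> 0"
      proof (rule integral_tendsto_zero_Cauchy_Schwarz[where C = 1 and a = a and
            b = "\<lambda>n. H_dens (\<lambda>x. \<phi> n x - 0) (\<lambda>x. grad (\<phi> n) x - D x)"])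
        show "a \<in> borel_measurable lborel" using ai by auto
        show "(\<integral>\<^sup>+x. ennreal (a x) \<partial>lborel) < \<infinity>"
          using nn_integral_eq_integral[OF ai] a0 by simp
        show "(\<lambda>n. \<integral>\<^sup>+x. ennreal (H_dens (\<lambda>x. \<phi> n x - 0) (\<lambda>x. grad (\<phi> n) x - D x) x) \<partial>lborel) \<longlonglongrightarrow> 0"
          using \<phi>(2) unfolding H_norm_sq_eq .
        show "AE x in lborel. norm (E n x) \<le> 1 * sqrt (a x) * sqrt (H_dens (\<lambda>x. \<phi> n x - 0) (\<lambda>x. grad (\<phi> n) x - D x) x)" for n
        proof (rule AE_I2)
          fix x
          let ?g = "norm (grad \<zeta> x)" and ?d = "norm (grad (\<phi> n) x - D x)"
          have "norm (E n x) \<le> norm (\<phi> n x) * norm (grad \<zeta> x $ i) + norm ((grad (\<phi> n) x - D x) $ i) * norm (\<zeta> x)"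
            unfolding E_def by (metis norm_mult norm_triangle_ineq)
          also have "\<dots> \<le> norm (\<phi> n x) * ?g + ?d * norm (\<zeta> x)"
            by (intro add_mono mult_left_mono mult_right_mono Finite_Cartesian_Product.norm_nth_le) auto
          also have "\<dots> \<le> sqrt ((norm (\<phi> n x))\<^sup>2 + ?d\<^sup>2) * sqrt (?g\<^sup>2 + (norm (\<zeta> x))\<^sup>2)"
            by (rule two_term_Cauchy_Schwarz)
          also have "\<dots> = sqrt (((norm (\<phi> n x))\<^sup>2 + ?d\<^sup>2) * exp (- (norm x)\<^sup>2 / 4)) * sqrt (a x)"
          proof -
            have "((norm (\<phi> n x))\<^sup>2 + ?d\<^sup>2) * (?g\<^sup>2 + (norm (\<zeta> x))\<^sup>2) = ((norm (\<phi> n x))\<^sup>2 + ?d\<^sup>2) * exp (- (norm x)\<^sup>2 / 4) * a x"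
              by (simp add: a_def exp_minus field_simps)
            then show ?thesis by (simp only: real_sqrt_mult[symmetric])
          qed
          also have "\<dots> \<le> sqrt (H_dens (\<lambda>x. \<phi> n x - 0) (\<lambda>x. grad (\<phi> n) x - D x) x) * sqrt (a x)"
            by (intro mult_right_mono real_sqrt_le_mono) (auto simp: H_dens_def a0 intro!: mult_right_mono)
          finally show "norm (E n x) \<le> 1 * sqrt (a x) * sqrt (H_dens (\<lambda>x. \<phi> n x - 0) (\<lambda>x. grad (\<phi> n) x - D x) x)"
            by (simp add: mult.commute)
        qed
      qed (use a0 in \<open>auto simp: H_dens_nonneg\<close>)
      moreover have "integral\<^sup>L lborel (E n) = - (\<integral>x. f x * \<eta> x \<partial>lborel)" for n
      proof -
        have t: "test_fun (\<lambda>x. \<phi> n x * \<zeta> x)"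
          by (rule test_fun_mult[OF \<zeta> smooth_on_subset[OF test_fun_smooth[OF \<phi>(1)]]]) auto
        have "E n = (\<lambda>x. grad (\<lambda>x. \<phi> n x * \<zeta> x) x $ i - f x * \<eta> x)"
          unfolding fun_eq_iff smooth_grad_mult[OF open_UNIV test_fun_smooth[OF \<phi>(1)] test_fun_smooth[OF \<zeta>] UNIV_I]
          by (simp add: E_def f_def \<zeta>_def algebra_simps)
        then have "integral\<^sup>L lborel (E n) = (\<integral>x. grad (\<lambda>x. \<phi> n x * \<zeta> x) x $ i \<partial>lborel) - (\<integral>x. f x * \<eta> x \<partial>lborel)"
          using Bochner_Integration.integral_diff[OF integrable_partial_deriv_test_fun[OF t, of i] f\<eta>]
          by simp
        then show ?thesis
          using integral_partial_deriv_zero[OF t, of i] by (simp add: grad_def)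
      qed
      ultimately show ?thesis by (simp add: LIMSEQ_const_iff)
    qed
    have "AE x in lborel. f x = 0"
    proof (rule AE_zero_if_box_integrals_zero[OF f])
      fix a b :: "real^'n"
      \<comment> \<open>A product of coordinatewise cutoffs tending to the indicator of the open
        box. The annulus factor introduced next keeps the support off the origin and affects the
        limit only at that point.\<close>
      define \<xi> where "\<xi> k x = (\<Prod>j\<in>UNIV. cutoff (real k * (x $ j - a $ j)) * cutoff (real k * (b $ j - x $ j)))" for k x
      define \<eta> where "\<eta> k x = complex_of_real (annulus_cutoff k ((norm x)\<^sup>2)) * complex_of_real (\<xi> k x)" for k x
      have \<xi>b: "0 \<le> \<xi> k x" "\<xi> k x \<le> 1" for k x
        unfolding \<xi>_def by (auto intro!: prod_nonneg prod_le_1 mult_nonneg_nonneg mult_le_one simp: cutoff_bounds)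
      have \<xi>s: "smooth_on UNIV (\<xi> k)" for k
      proof -
        have 1: "smooth_on UNIV (\<lambda>x::real^'n. real k * (x $ j + - a $ j))" for j
          by (intro smooth_on_mult smooth_on_add smooth_on_const smooth_on_component open_UNIV)
        have 2: "smooth_on UNIV (\<lambda>x::real^'n. real k * (b $ j + (- 1) * x $ j))" for j
          by (intro smooth_on_mult smooth_on_add smooth_on_const smooth_on_component open_UNIV)
        have "smooth_on UNIV (\<lambda>x::real^'n. \<Prod>j\<in>UNIV. cutoff (real k * (x $ j + - a $ j)) * cutoff (real k * (b $ j + (- 1) * x $ j)))"
          by (intro smooth_on_prod smooth_on_mult smooth_on_cutoff 1 2 open_UNIV)
        then show ?thesis by (simp add: \<xi>_def[abs_def])
      qed
      have \<eta>t: "test_fun (\<eta> k)" for k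
        unfolding \<eta>_def
        by (intro test_fun_annulus_cutoff smooth_on_of_real smooth_on_subset[OF \<xi>s]) auto
      note [measurable] = test_fun_measurable[OF \<eta>t]
      have "(\<lambda>k. \<integral>x. f x * \<eta> k x \<partial>lborel) \<longlonglongrightarrow> (\<integral>x. indicator (box a b) x *\<^sub>R f x \<partial>lborel)"
      proof (rule integral_dominated_convergence)
        show "integrable lborel (\<lambda>x. norm (f x))" using f by simp
        show "AE x in lborel. norm (f x * \<eta> k x) \<le> norm (f x)" for k
        proof (rule AE_I2)
          fix x
          have "norm (\<eta> k x) \<le> 1"
            using annulus_cutoff_bounds[of k "(norm x)\<^sup>2"] \<xi>b[of k x] by (simp add: \<eta>_def norm_mult mult_le_one)
          then show "norm (f x * \<eta> k x) \<le> norm (f x)"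
            by (simp add: norm_mult mult_left_le)
        qed
        show "AE x in lborel. (\<lambda>k. f x * \<eta> k x) \<longlonglongrightarrow> indicator (box a b) x *\<^sub>R f x"
          using AE_lborel_singleton[of "0::real^'n"]
        proof eventually_elim
          case (elim x)
          have \<xi>l: "(\<lambda>k. \<xi> k x) \<longlonglongrightarrow> indicator (box a b) x"
          proof (cases "x \<in> box a b")
            case True
            have "(\<lambda>k. cutoff (real k * t)) \<longlonglongrightarrow> 1" if "t > 0" for t
              using filterlim_compose[OF cutoff_at_top filterlim_nat_affine_at_top[OF that, of 0]] by simp
            then have "(\<lambda>k. \<xi> k x) \<longlonglongrightarrow> (\<Prod>j\<in>(UNIV::'n set). 1 * 1)"
              unfolding \<xi>_def using True by (intro tendsto_prod tendsto_mult) (auto simp: mem_box_cart)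
            then show ?thesis using True by simp
          next
            case False
            then obtain j where j: "x $ j \<le> a $ j \<or> b $ j \<le> x $ j"
              by (auto simp: mem_box_cart not_less)
            then have "cutoff (real k * (x $ j - a $ j)) * cutoff (real k * (b $ j - x $ j)) = 0" for k
              by (auto simp: cutoff_def zero_less_mult_iff)
            then have "\<xi> k x = 0" for k
              unfolding \<xi>_def by (intro prod_zero) auto
            then show ?thesis using False by simp
          qed
          have "(\<lambda>k. \<eta> k x) \<longlonglongrightarrow> complex_of_real 1 * complex_of_real (indicator (box a b) x)"
            unfolding \<eta>_def using elim by (intro tendsto_intros \<xi>l annulus_cutoff_tendsto(1)) auto
          then have "(\<lambda>k. f x * \<eta> k x) \<longlonglongrightarrow> f x * (complex_of_real 1 * complex_of_real (indicator (box a b) x))"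
            by (intro tendsto_mult tendsto_const)
          then show ?case by (simp add: scaleR_conv_of_real mult.commute)
        qed
      qed measurable
      then show "set_lebesgue_integral lborel (box a b) f = 0"
        unfolding weak0[OF \<eta>t] set_lebesgue_integral_def by (simp add: LIMSEQ_const_iff)
    qed
    then show ?thesis by eventually_elim (simp add: f_def)
  qed
  then have "AE x in lborel. \<forall>i. D x $ i = 0"
    by (simp add: AE_all_countable)
  then show ?thesis by eventually_elim (simp add: vec_eq_iff)
qed

lemma has_H_grad_unique:
  assumes "has_H_grad v G" "has_H_grad v K"
  shows "AE x in lborel. G x = K x"
proof -
  have "has_H_grad (\<lambda>x. v x + (- 1) * v x) (\<lambda>x. G x + (\<chi> i. (- 1) * (K x $ i)))"
    by (intro has_H_grad_add has_H_grad_cmult assms)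
  then have "AE x in lborel. G x + (\<chi> i. (- 1) * (K x $ i)) = 0"
    by (intro has_H_grad_zero) simp
  then show ?thesis by eventually_elim (simp add: vec_eq_iff add_eq_0_iff)
qed

lemma has_H_grad_H_grad: "has_H_grad v G \<Longrightarrow> has_H_grad v (H_grad v)"
  unfolding H_grad_def by (rule someI[of "has_H_grad v"])

lemma H_grad_AE_eq: "has_H_grad v G \<Longrightarrow> AE x in lborel. H_grad v x = G x"
  by (rule has_H_grad_unique[OF has_H_grad_H_grad])

section \<open>Products of radial and spherical functions\<close>

lemma smooth_sphere_has_derivative:
  assumes "smooth_sphere f" "x \<noteq> 0"
  shows "((\<lambda>x. f (sgn x)) has_derivative frechet_derivative (\<lambda>x. f (sgn x)) (at x)) (at x)"
  using smooth_on_has_derivative[of "- {0}" "\<lambda>x. f (sgn x)" x] assms by (auto simp: smooth_sphere_def)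

text \<open>The extension F of degree 0 satisfies F(y/|x|) = F(y) for the fixed scale |x|, so its
  derivative at x is the one at x/|x| composed with division by |x|.\<close>

lemma grad_compose_sgn:
  fixes f :: "real^'n \<Rightarrow> complex"
  assumes f: "smooth_sphere f" and x: "x \<noteq> 0"
  shows "grad (\<lambda>x. f (sgn x)) x = (1 / norm x) *\<^sub>R sphere_grad f (sgn x)"
proof -
  define F where "F = (\<lambda>x. f (sgn x))"
  define D where "D = frechet_derivative F (at (sgn x))"
  have D: "(F has_derivative D) (at (sgn x))"
    unfolding F_def D_def using smooth_sphere_has_derivative[OF f, of "sgn x"] x by (simp add: sgn_zero_iff)
  have lin: "linear D" using D has_derivative_linear by blast
  have "((\<lambda>y. (1 / norm x) *\<^sub>R y) has_derivative (\<lambda>h. (1 / norm x) *\<^sub>R h)) (at x)"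
    by (auto intro!: derivative_eq_intros)
  moreover have "(1 / norm x) *\<^sub>R x = sgn x" by (simp add: sgn_div_norm divide_inverse)
  ultimately have "((\<lambda>y. F ((1 / norm x) *\<^sub>R y)) has_derivative (\<lambda>h. D ((1 / norm x) *\<^sub>R h))) (at x)"
    using has_derivative_compose[of "\<lambda>y. (1 / norm x) *\<^sub>R y" _ x UNIV F D] D by simp
  moreover have "F ((1 / norm x) *\<^sub>R y) = F y" for y
    using x by (simp add: F_def sgn_scaleR)
  ultimately have "(F has_derivative (\<lambda>h. D ((1 / norm x) *\<^sub>R h))) (at x)" by simp
  then have "partial_deriv i F x = (1 / norm x) *\<^sub>R partial_deriv i F (sgn x)" for i
    using partial_deriv_eq[OF D, of i] by (subst partial_deriv_eq) (auto simp: linear_scale[OF lin])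
  then show ?thesis
    by (simp add: F_def[symmetric] sphere_grad_def grad_def vec_eq_iff)
qed

text \<open>The extension of degree 0 is constant along the ray through \<theta>.\<close>

lemma sphere_grad_tangential:
  fixes f :: "real^'n \<Rightarrow> complex"
  assumes f: "smooth_sphere f" and \<theta>: "norm \<theta> = 1"
  shows "(\<Sum>i\<in>UNIV. (\<theta> $ i) *\<^sub>R (sphere_grad f \<theta> $ i)) = 0"
proof -
  define F where "F = (\<lambda>x. f (sgn x))"
  define D where "D = frechet_derivative F (at \<theta>)"
  have D: "(F has_derivative D) (at \<theta>)"
    unfolding F_def D_def using smooth_sphere_has_derivative[OF f, of \<theta>] \<theta> by force
  have "((\<lambda>t. t *\<^sub>R \<theta>) has_derivative (\<lambda>s. s *\<^sub>R \<theta>)) (at 1)"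
    by (auto intro!: derivative_eq_intros)
  then have "((\<lambda>t. F (t *\<^sub>R \<theta>)) has_derivative (\<lambda>s. D (s *\<^sub>R \<theta>))) (at 1)"
    using has_derivative_compose[of "\<lambda>t. t *\<^sub>R \<theta>" _ 1 UNIV F D] D by simp
  then have "((\<lambda>t::real. F \<theta>) has_derivative (\<lambda>s. D (s *\<^sub>R \<theta>))) (at 1)"
    by (rule has_derivative_transform_within_open[of _ _ _ _ "{0<..}"]) (auto simp: F_def sgn_scaleR)
  moreover have "((\<lambda>t::real. F \<theta>) has_derivative (\<lambda>s. 0)) (at 1)" by simp
  ultimately have "(\<lambda>s::real. D (s *\<^sub>R \<theta>)) = (\<lambda>s. 0)" by (rule has_derivative_unique)
  then have "D (1 *\<^sub>R \<theta>) = 0" by (rule fun_cong)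
  then show ?thesis
    using frechet_derivative_eq_sum_partial[OF D, of \<theta>] by (simp add: sphere_grad_def grad_def F_def[symmetric])
qed

lemma smooth_sphere_continuous:
  assumes "smooth_sphere f"
  shows "continuous_on (sphere 0 1) f"
proof (rule continuous_on_eq)
  have "continuous_on (- {0}) (\<lambda>x. f (sgn x))"
    using assms unfolding smooth_sphere_def by (rule smooth_on_imp_continuous_on)
  then show "continuous_on (sphere 0 1) (\<lambda>x. f (sgn x))" by (rule continuous_on_subset) auto
qed (auto simp: sgn_div_norm)

lemma sphere_grad_continuous:
  assumes "smooth_sphere f"
  shows "continuous_on (sphere 0 1) (sphere_grad f)"
  unfolding sphere_grad_def[abs_def]
proof (rule continuous_on_subset[OF smooth_grad_continuous])
  show "smooth_on (- {0}) (\<lambda>x. f (sgn x))" using assms by (simp add: smooth_sphere_def)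
qed auto

lemma borel_measurable_sphere_continuous:
  fixes f :: "real^'n \<Rightarrow> 'b::topological_space"
  assumes "continuous_on (sphere 0 1) f"
  shows "f \<in> borel_measurable sphere_measure"
  using borel_measurable_continuous_on_restrict[OF assms] by (simp cong: measurable_cong_sets add: sets_sphere_measure)

lemma smooth_sphere_measurable:
  fixes f :: "real^'n \<Rightarrow> complex"
  assumes "smooth_sphere f"
  shows "f \<in> borel_measurable sphere_measure" "sphere_grad f \<in> borel_measurable sphere_measure"
  by (intro borel_measurable_sphere_continuous smooth_sphere_continuous sphere_grad_continuous assms)+

definition S_norm_sq :: "(real^'n \<Rightarrow> complex) \<Rightarrow> (real^'n \<Rightarrow> complex^'n) \<Rightarrow> ennreal" where
  "S_norm_sq u G = (\<integral>\<^sup>+\<theta>. ennreal ((norm (G \<theta>))\<^sup>2 + (norm (u \<theta>))\<^sup>2) \<partial>sphere_measure)"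

lemma has_H1_sphere_grad_measurable:
  assumes "has_H1_sphere_grad u G"
  shows "u \<in> borel_measurable sphere_measure" "G \<in> borel_measurable sphere_measure"
  using assms by (simp_all add: has_H1_sphere_grad_def)

lemma has_H1_sphere_gradE:
  assumes "has_H1_sphere_grad u G"
  obtains \<phi> where "\<And>n::nat. smooth_sphere (\<phi> n)"
    "(\<lambda>n. S_norm_sq (\<lambda>\<theta>. \<phi> n \<theta> - u \<theta>) (\<lambda>\<theta>. sphere_grad (\<phi> n) \<theta> - G \<theta>)) \<longlonglongrightarrow> 0"
  using assms unfolding has_H1_sphere_grad_def S_norm_sq_def by blast

lemma has_H1_sphere_grad_smooth:
  assumes "smooth_sphere f"
  shows "has_H1_sphere_grad f (sphere_grad f)"
  unfolding has_H1_sphere_grad_def using smooth_sphere_measurable[OF assms] assms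
  by (intro conjI exI[of _ "\<lambda>_. f"]) auto

lemma ennreal_double_add: "0 \<le> a \<Longrightarrow> 0 \<le> b \<Longrightarrow> ennreal (2 * a + 2 * b) = 2 * ennreal a + 2 * ennreal b"
  by (simp add: ennreal_plus ennreal_mult)

lemma emeasure_sphere_finite: "emeasure (sphere_measure :: (real^'n) measure) (sphere 0 1) < top"
  using finite_measure.emeasure_finite[OF finite_measure_sphere, of "sphere 0 1"] unfolding less_top by simp

lemma S_norm_sq_add_le:
  assumes [measurable]: "u \<in> borel_measurable sphere_measure" "G \<in> borel_measurable sphere_measure"
    "w \<in> borel_measurable sphere_measure" "K \<in> borel_measurable sphere_measure"
  shows "S_norm_sq (\<lambda>x. u x + w x) (\<lambda>x. G x + K x) \<le> 2 * S_norm_sq u G + 2 * S_norm_sq w K"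
proof -
  have "S_norm_sq (\<lambda>x. u x + w x) (\<lambda>x. G x + K x) \<le>
     (\<integral>\<^sup>+x. 2 * ennreal ((norm (G x))\<^sup>2 + (norm (u x))\<^sup>2) + 2 * ennreal ((norm (K x))\<^sup>2 + (norm (w x))\<^sup>2) \<partial>sphere_measure)"
    unfolding S_norm_sq_def
  proof (rule nn_integral_mono)
    fix x
    have "ennreal ((norm (G x + K x))\<^sup>2 + (norm (u x + w x))\<^sup>2) \<le>
        ennreal (2 * ((norm (G x))\<^sup>2 + (norm (u x))\<^sup>2) + 2 * ((norm (K x))\<^sup>2 + (norm (w x))\<^sup>2))"
      using norm_add_sq_le[of "G x" "K x"] norm_add_sq_le[of "u x" "w x"] by (intro ennreal_leI) simp
    also have "\<dots> = 2 * ennreal ((norm (G x))\<^sup>2 + (norm (u x))\<^sup>2) + 2 * ennreal ((norm (K x))\<^sup>2 + (norm (w x))\<^sup>2)"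
      by (rule ennreal_double_add) auto
    finally show "ennreal ((norm (G x + K x))\<^sup>2 + (norm (u x + w x))\<^sup>2) \<le> \<dots>" .
  qed
  also have "\<dots> = 2 * S_norm_sq u G + 2 * S_norm_sq w K"
    unfolding S_norm_sq_def by (simp add: nn_integral_add nn_integral_cmult del: ennreal_plus)
  finally show ?thesis .
qed

lemma S_norm_sq_smooth_finite:
  fixes f :: "real^'n \<Rightarrow> complex"
  assumes "smooth_sphere f"
  shows "S_norm_sq f (sphere_grad f) < \<infinity>"
proof -
  let ?h = "\<lambda>\<theta>. (norm (sphere_grad f \<theta>))\<^sup>2 + (norm (f \<theta>))\<^sup>2"
  have "bounded (?h ` sphere 0 1)"
    by (intro compact_imp_bounded compact_continuous_image continuous_intros
        smooth_sphere_continuous[OF assms] sphere_grad_continuous[OF assms]) auto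
  then obtain B where B: "\<forall>y\<in>?h ` sphere 0 1. norm y \<le> B" unfolding bounded_iff by blast
  have "?h \<theta> \<le> B" if "\<theta> \<in> sphere 0 1" for \<theta>
    using B that by force
  then have "S_norm_sq f (sphere_grad f) \<le> (\<integral>\<^sup>+\<theta>. ennreal B \<partial>(sphere_measure :: (real^'n) measure))"
    unfolding S_norm_sq_def by (intro nn_integral_mono ennreal_leI) simp
  also have "\<dots> < \<infinity>"
    using emeasure_sphere_finite[where 'n = 'n] by (simp add: ennreal_mult_less_top)
  finally show ?thesis .
qed

lemma S_norm_sq_finite:
  assumes "has_H1_sphere_grad u G"
  shows "S_norm_sq u G < \<infinity>"
proof -
  obtain \<phi> where \<phi>: "\<And>n::nat. smooth_sphere (\<phi> n)"
    "(\<lambda>n. S_norm_sq (\<lambda>x. \<phi> n x - u x) (\<lambda>x. sphere_grad (\<phi> n) x - G x)) \<longlonglongrightarrow> 0"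
    using assms by (rule has_H1_sphere_gradE) blast
  note [measurable] = has_H1_sphere_grad_measurable[OF assms] smooth_sphere_measurable[OF \<phi>(1)]
  from \<phi>(2) have "eventually (\<lambda>n. S_norm_sq (\<lambda>x. \<phi> n x - u x) (\<lambda>x. sphere_grad (\<phi> n) x - G x) < 1) sequentially"
    by (rule order_tendstoD) simp
  then obtain n where n: "S_norm_sq (\<lambda>x. \<phi> n x - u x) (\<lambda>x. sphere_grad (\<phi> n) x - G x) < 1"
    by (auto simp: eventually_sequentially)
  have "S_norm_sq u G \<le> 2 * S_norm_sq (\<lambda>x. - (\<phi> n x - u x)) (\<lambda>x. - (sphere_grad (\<phi> n) x - G x)) + 2 * S_norm_sq (\<phi> n) (sphere_grad (\<phi> n))"
    using S_norm_sq_add_le[of "\<lambda>x. - (\<phi> n x - u x)" "\<lambda>x. - (sphere_grad (\<phi> n) x - G x)" "\<phi> n" "sphere_grad (\<phi> n)"]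
    by simp
  also have "\<dots> = 2 * S_norm_sq (\<lambda>x. \<phi> n x - u x) (\<lambda>x. sphere_grad (\<phi> n) x - G x) + 2 * S_norm_sq (\<phi> n) (sphere_grad (\<phi> n))"
    by (simp only: S_norm_sq_def norm_minus_cancel)
  also have "\<dots> < \<infinity>"
    using n S_norm_sq_smooth_finite[OF \<phi>(1), of n]
    by (auto simp: ennreal_mult_less_top ennreal_add_less_top intro: less_trans[OF _ ennreal_one_less_top])
  finally show ?thesis .
qed

text \<open>Radial factors are functions of \<open>q = |x|\<^sup>2\<close>, which is smooth in \<open>x\<close>; \<open>\<rho>'\<close> is the derivative
  in \<open>q\<close>.\<close>

definition polar_grad ::
  "(real \<Rightarrow> real) \<Rightarrow> (real \<Rightarrow> real) \<Rightarrow> (real^'n \<Rightarrow> complex) \<Rightarrow> (real^'n \<Rightarrow> complex^'n) \<Rightarrow> real^'n \<Rightarrow> complex^'n" where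
  "polar_grad \<rho> \<rho>' u G x =
     (\<chi> i. complex_of_real (2 * \<rho>' ((norm x)\<^sup>2) * x $ i) * u (sgn x)) + (\<rho> ((norm x)\<^sup>2) / norm x) *\<^sub>R G (sgn x)"

lemma has_derivative_norm_sq: "((\<lambda>x::'a::real_inner. (norm x)\<^sup>2) has_derivative (\<lambda>h. 2 * (x \<bullet> h))) (at x)"
  unfolding power2_norm_eq_inner by (auto intro!: derivative_eq_intros simp: inner_commute)

lemma grad_polar_product:
  fixes f :: "real^'n \<Rightarrow> complex"
  assumes f: "smooth_sphere f" and x: "x \<noteq> 0"
    and \<rho>: "(\<rho> has_real_derivative \<rho>' ((norm x)\<^sup>2)) (at ((norm x)\<^sup>2))"
  shows "grad (\<lambda>x. complex_of_real (\<rho> ((norm x)\<^sup>2)) * f (sgn x)) x = polar_grad \<rho> \<rho>' f (sphere_grad f) x"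
proof -
  let ?F = "\<lambda>x. f (sgn x)"
  let ?D = "frechet_derivative ?F (at x)"
  have "((\<lambda>x. \<rho> ((norm x)\<^sup>2)) has_derivative (\<lambda>h. \<rho>' ((norm x)\<^sup>2) * (2 * (x \<bullet> h)))) (at x)"
    using has_derivative_compose[OF has_derivative_norm_sq[of x], of \<rho> "\<lambda>h. \<rho>' ((norm x)\<^sup>2) * h"] \<rho>
    by (simp add: has_field_derivative_def)
  then have "((\<lambda>x. complex_of_real (\<rho> ((norm x)\<^sup>2))) has_derivative (\<lambda>h. complex_of_real (\<rho>' ((norm x)\<^sup>2) * (2 * (x \<bullet> h))))) (at x)"
    by (rule bounded_linear.has_derivative[OF bounded_linear_of_real])
  note d = has_derivative_mult[OF this smooth_sphere_has_derivative[OF f x]]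
  have "partial_deriv i (\<lambda>x. complex_of_real (\<rho> ((norm x)\<^sup>2)) * ?F x) x =
      complex_of_real (\<rho> ((norm x)\<^sup>2)) * partial_deriv i ?F x + complex_of_real (\<rho>' ((norm x)\<^sup>2) * (2 * x $ i)) * ?F x" for i
    unfolding partial_deriv_eq[OF d] by (simp add: partial_deriv_def inner_axis)
  moreover have "partial_deriv i ?F x = (1 / norm x) *\<^sub>R (sphere_grad f (sgn x) $ i)" for i
    using grad_compose_sgn[OF f x] by (simp add: grad_def vec_eq_iff)
  ultimately show ?thesis
    unfolding vec_eq_iff
    by (simp add: grad_def polar_grad_def) (simp add: scaleR_conv_of_real mult_ac)
qed

text \<open>Radial factor of a bound for \<open>H_dens\<close> of a separated function, with q =
  |x|^2. The radial derivative contributes 2 (2 |x| \<rho>')^2 = 8 q \<rho>'^2, while the tangential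
  gradient and the weight 1/|x|^2 are both covered by 2 \<rho>^2/q. The summand q \<rho>^2 leaves
  room for the bounded part 2 of the estimate for \<open>annulus_cutoff'\<close>.\<close>

definition radial_dens :: "(real \<Rightarrow> real) \<Rightarrow> (real \<Rightarrow> real) \<Rightarrow> real \<Rightarrow> real" where
  "radial_dens \<rho> \<rho>' q = (8 * q * (\<rho>' q)\<^sup>2 + (1 + q) * (\<rho> q)\<^sup>2 + 2 * (\<rho> q)\<^sup>2 / q) * exp (- q / 4)"

lemma radial_dens_nonneg: "q \<ge> 0 \<Longrightarrow> radial_dens \<rho> \<rho>' q \<ge> 0"
  by (simp add: radial_dens_def)

lemma radial_dens_measurable [measurable (raw)]:
  assumes [measurable]: "\<rho> \<in> borel_measurable borel" "\<rho>' \<in> borel_measurable borel"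
  shows "radial_dens \<rho> \<rho>' \<in> borel_measurable borel"
  unfolding radial_dens_def[abs_def] by measurable

lemma H_dens_polar_le:
  fixes u :: "real^'n \<Rightarrow> complex"
  shows "H_dens (\<lambda>x. complex_of_real (\<rho> ((norm x)\<^sup>2)) * u (sgn x)) (polar_grad \<rho> \<rho>' u G) x \<le>
     radial_dens \<rho> \<rho>' ((norm x)\<^sup>2) * ((norm (G (sgn x)))\<^sup>2 + (norm (u (sgn x)))\<^sup>2)"
proof -
  let ?q = "(norm x)\<^sup>2" and ?U = "(norm (u (sgn x)))\<^sup>2" and ?G = "(norm (G (sgn x)))\<^sup>2"
  have a: "(norm (\<chi> i. complex_of_real (2 * \<rho>' ?q * x $ i) * u (sgn x)))\<^sup>2 = 4 * ?q * (\<rho>' ?q)\<^sup>2 * ?U"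
    unfolding norm_vec_sq
    by (simp add: norm_mult power_mult_distrib norm_vec_def[of x] L2_set_def sum_nonneg sum_distrib_left sum_distrib_right mult_ac)
  have "(norm (polar_grad \<rho> \<rho>' u G x))\<^sup>2 \<le> 8 * ?q * (\<rho>' ?q)\<^sup>2 * ?U + 2 * ((\<rho> ?q)\<^sup>2 / ?q) * ?G"
    using norm_add_sq_le[of "\<chi> i. complex_of_real (2 * \<rho>' ?q * x $ i) * u (sgn x)" "(\<rho> ?q / norm x) *\<^sub>R G (sgn x)"]
    unfolding a polar_grad_def[symmetric] by (simp add: power_mult_distrib power_divide)
  moreover have "0 \<le> (\<rho> ?q)\<^sup>2 / ?q * ?U" "0 \<le> ?q * (\<rho>' ?q)\<^sup>2 * ?G" "0 \<le> (\<rho> ?q)\<^sup>2 * ?G" "0 \<le> ?q * ((\<rho> ?q)\<^sup>2 * ?G)" "0 \<le> ?q * ((\<rho> ?q)\<^sup>2 * ?U)"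
    by auto
  ultimately have "(norm (polar_grad \<rho> \<rho>' u G x))\<^sup>2 + (\<rho> ?q)\<^sup>2 * ?U + (\<rho> ?q)\<^sup>2 / ?q * ?U \<le>
     (8 * ?q * (\<rho>' ?q)\<^sup>2 + (1 + ?q) * (\<rho> ?q)\<^sup>2 + 2 * ((\<rho> ?q)\<^sup>2 / ?q)) * (?G + ?U)"
    unfolding distrib_right distrib_left mult.assoc mult_1_left by linarith
  from mult_right_mono[OF this, of "exp (- ?q / 4)"] show ?thesis
    by (simp add: H_dens_def radial_dens_def norm_mult power_mult_distrib mult_ac)
qed

lemma polar_grad_measurable:
  fixes u :: "real^'n \<Rightarrow> complex"
  assumes [measurable]: "\<rho> \<in> borel_measurable borel" "\<rho>' \<in> borel_measurable borel"
    and u: "u \<in> borel_measurable sphere_measure" and G: "G \<in> borel_measurable sphere_measure"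
  shows "polar_grad \<rho> \<rho>' u G \<in> borel_measurable borel"
    "(\<lambda>x. complex_of_real (\<rho> ((norm x)\<^sup>2)) * u (sgn x)) \<in> borel_measurable borel"
proof -
  have [measurable]: "(\<lambda>x. u (sgn x)) \<in> borel_measurable borel" "(\<lambda>x. G (sgn x)) \<in> borel_measurable borel"
    by (intro borel_measurable_compose_sgn u G; simp)+
  show "polar_grad \<rho> \<rho>' u G \<in> borel_measurable borel"
    unfolding polar_grad_def[abs_def] by measurable
  show "(\<lambda>x. complex_of_real (\<rho> ((norm x)\<^sup>2)) * u (sgn x)) \<in> borel_measurable borel"
    by measurable
qed

lemma H_norm_sq_polar_le:
  fixes u :: "real^'n \<Rightarrow> complex"
  assumes [measurable]: "\<rho> \<in> borel_measurable borel" "\<rho>' \<in> borel_measurable borel"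
    and [measurable]: "u \<in> borel_measurable sphere_measure" "G \<in> borel_measurable sphere_measure"
  shows "H_norm_sq (\<lambda>x. complex_of_real (\<rho> ((norm x)\<^sup>2)) * u (sgn x)) (polar_grad \<rho> \<rho>' u G) \<le>
    (\<integral>\<^sup>+r. ennreal (radial_dens \<rho> \<rho>' (r\<^sup>2)) \<partial>radial_measure CARD('n)) * S_norm_sq u G"
proof -
  have [measurable]: "radial_dens \<rho> \<rho>' \<in> borel_measurable borel"
    by (rule radial_dens_measurable; measurable)
  have "H_norm_sq (\<lambda>x. complex_of_real (\<rho> ((norm x)\<^sup>2)) * u (sgn x)) (polar_grad \<rho> \<rho>' u G) \<le>
    (\<integral>\<^sup>+x. ennreal (radial_dens \<rho> \<rho>' ((norm x)\<^sup>2)) * ennreal ((norm (G (sgn x)))\<^sup>2 + (norm (u (sgn x)))\<^sup>2) \<partial>lborel)"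
    unfolding H_norm_sq_eq
    by (intro nn_integral_mono) (simp add: ennreal_mult[symmetric] radial_dens_nonneg H_dens_polar_le ennreal_leI del: ennreal_plus)
  also have "\<dots> = (\<integral>\<^sup>+r. ennreal (radial_dens \<rho> \<rho>' (r\<^sup>2)) \<partial>radial_measure CARD('n)) * S_norm_sq u G"
    unfolding S_norm_sq_def
    by (rule nn_integral_polar_prod[of "\<lambda>r. ennreal (radial_dens \<rho> \<rho>' (r\<^sup>2))" "\<lambda>\<theta>. ennreal ((norm (G \<theta>))\<^sup>2 + (norm (u \<theta>))\<^sup>2)"]; measurable)
  finally show ?thesis .
qed

text \<open>Here t and s stand for a truncation factor and its derivative at q, and a, b for the
  values of \<rho>, \<rho>' there. The bound on s gives q s^2 <= 9/q + 12 + 4 q, and each of these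
  terms times a^2 is dominated by a term of \<open>radial_dens\<close>. The constant 200 exceeds the
  largest ratio of coefficients, which is 193, for a^2.\<close>

lemma radial_dens_cutoff_le:
  fixes s t q :: real
  assumes "q > 0" "\<bar>t\<bar> \<le> 1" "\<bar>s\<bar> \<le> 3 / q + 2"
  shows "radial_dens (\<lambda>_. t * a) (\<lambda>_. s * a + t * b) q \<le> 200 * radial_dens (\<lambda>_. a) (\<lambda>_. b) q"
proof -
  have t: "t\<^sup>2 \<le> 1" using assms(2) by (simp add: abs_square_le_1)
  have "s\<^sup>2 \<le> (3 / q + 2)\<^sup>2" using assms by (simp add: abs_le_square_iff[symmetric])
  then have "q * s\<^sup>2 \<le> q * (3 / q + 2)\<^sup>2" using assms(1) by (intro mult_left_mono) auto
  also have "\<dots> = 9 / q + 12 + 4 * q" using assms(1) by (simp add: power2_eq_square field_simps)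
  finally have s: "q * s\<^sup>2 \<le> 9 / q + 12 + 4 * q" .
  have "(s * a + t * b)\<^sup>2 \<le> 2 * (s * a)\<^sup>2 + 2 * (t * b)\<^sup>2"
    using norm_add_sq_le[of "s * a" "t * b"] by simp
  then have "q * (s * a + t * b)\<^sup>2 \<le> q * (2 * (s * a)\<^sup>2 + 2 * (t * b)\<^sup>2)"
    using assms(1) by (intro mult_left_mono) auto
  also have "\<dots> = 2 * ((q * s\<^sup>2) * a\<^sup>2) + 2 * (t\<^sup>2 * (q * b\<^sup>2))"
    by (simp add: power_mult_distrib algebra_simps)
  also have "\<dots> \<le> 2 * ((9 / q + 12 + 4 * q) * a\<^sup>2) + 2 * (1 * (q * b\<^sup>2))"
    using assms(1) by (intro add_mono mult_left_mono mult_right_mono s t) auto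
  finally have 1: "q * (s * a + t * b)\<^sup>2 \<le> 18 * (a\<^sup>2 / q) + 24 * a\<^sup>2 + 8 * (q * a\<^sup>2) + 2 * (q * b\<^sup>2)"
    by (simp add: algebra_simps)
  have 2: "(t * a)\<^sup>2 \<le> a\<^sup>2" using t by (simp add: power_mult_distrib mult_left_le_one_le)
  then have 3: "q * (t * a)\<^sup>2 \<le> q * a\<^sup>2" "(t * a)\<^sup>2 / q \<le> a\<^sup>2 / q"
    using assms(1) by (auto intro: mult_left_mono divide_right_mono)
  have 4: "0 \<le> a\<^sup>2 / q" "0 \<le> a\<^sup>2" "0 \<le> q * a\<^sup>2" "0 \<le> q * b\<^sup>2" using assms(1) by auto
  have "8 * (q * (s * a + t * b)\<^sup>2) + ((t * a)\<^sup>2 + q * (t * a)\<^sup>2) + 2 * ((t * a)\<^sup>2 / q) \<le>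
      200 * (8 * (q * b\<^sup>2) + (a\<^sup>2 + q * a\<^sup>2) + 2 * (a\<^sup>2 / q))"
    using 1 2 3 4 unfolding distrib_left by linarith
  from mult_right_mono[OF this, of "exp (- q / 4)"] show ?thesis
    unfolding radial_dens_def by (simp add: algebra_simps)
qed

lemma H_norm_sq_cong_AE:
  assumes "AE x in lborel. v x = w x" "AE x in lborel. G x = K x"
  shows "H_norm_sq v G = H_norm_sq w K"
  unfolding H_norm_sq_def using assms
  by (intro nn_integral_cong_AE) (auto elim: eventually_elim2)

text \<open>The factor 512 = 2 * 16^2 turns the quadratic Taylor term of exp(q/16) into q^2.\<close>

lemma exp_bounds_quadratic:
  fixes q :: real
  assumes "q \<ge> 0"
  shows "10 + q + q\<^sup>2 \<le> 512 * exp (q / 16)"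
proof -
  have "1 + q / 16 + (q / 16)\<^sup>2 / 2 \<le> exp (q / 16)"
    using exp_lower_Taylor_quadratic[of "q / 16"] assms by simp
  then have "512 * (1 + q / 16 + (q / 16)\<^sup>2 / 2) \<le> 512 * exp (q / 16)" by simp
  moreover have "512 * (1 + q / 16 + (q / 16)\<^sup>2 / 2) = 512 + 32 * q + q\<^sup>2" by (simp add: power_divide)
  ultimately show ?thesis using assms by linarith
qed

text \<open>The growth exp(q/32) squares to exp(q/16), the polynomial 10 + q + q^2 costs another
  exp(q/16), and the weight exp(-q/4) leaves exp(-q/8). In r the remaining power is r^(4 s - 2),
  integrable against r^(N-1) at 0 precisely for s > (2 - N)/4.\<close>

lemma radial_dens_finite:
  assumes N: "N \<ge> 2" and s: "s > (2 - real N) / 4" and C: "C \<ge> 0"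
    and \<rho>: "\<And>q. q > 0 \<Longrightarrow> \<bar>\<rho> q\<bar> \<le> C * q powr s * exp (q / 32)"
    and \<rho>': "\<And>q. q > 0 \<Longrightarrow> \<bar>\<rho>' q\<bar> \<le> C * q powr (s - 1) * exp (q / 32)"
  shows "(\<integral>\<^sup>+r. ennreal (radial_dens \<rho> \<rho>' (r\<^sup>2)) \<partial>radial_measure N) < \<infinity>"
proof -
  have le: "radial_dens \<rho> \<rho>' q \<le> 512 * C\<^sup>2 * (q powr (2 * s - 1) * exp (- q / 8))" if q: "q > 0" for q
  proof -
    let ?X = "C\<^sup>2 * q powr (2 * s - 1) * exp (q / 16)"
    have sq: "(C * q powr t * exp (q / 32))\<^sup>2 = C\<^sup>2 * q powr (2 * t) * exp (q / 16)" for t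
    proof -
      have "(q powr t)\<^sup>2 = q powr (2 * t)" by (simp add: power2_eq_square flip: powr_add)
      moreover have "(exp (q / 32))\<^sup>2 = exp (q / 16)" by (simp add: power2_eq_square flip: exp_add)
      ultimately show ?thesis by (simp only: power_mult_distrib)
    qed
    have "(\<rho> q)\<^sup>2 \<le> C\<^sup>2 * q powr (2 * s) * exp (q / 16)"
      using \<rho>[OF q] C unfolding sq[symmetric] by (simp add: abs_le_square_iff[symmetric])
    also have "\<dots> = q * ?X" using q by (simp add: powr_diff)
    finally have 1: "(\<rho> q)\<^sup>2 \<le> q * ?X" .
    have "(\<rho>' q)\<^sup>2 \<le> C\<^sup>2 * q powr (2 * (s - 1)) * exp (q / 16)"
      using \<rho>'[OF q] C unfolding sq[symmetric] by (simp add: abs_le_square_iff[symmetric])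
    also have "q powr (2 * (s - 1)) = q powr (2 * s - 1) / q"
      using q powr_diff[of q "2 * s - 1" 1] by (simp add: algebra_simps)
    finally have "(\<rho>' q)\<^sup>2 \<le> ?X / q" by simp
    then have 2: "q * (\<rho>' q)\<^sup>2 \<le> ?X" using q by (simp add: pos_le_divide_eq mult.commute)
    have 3: "(1 + q) * (\<rho> q)\<^sup>2 \<le> (1 + q) * (q * ?X)" "(\<rho> q)\<^sup>2 / q \<le> ?X"
      using 1 q by (auto intro!: mult_left_mono simp: pos_divide_le_eq mult.commute)
    have "8 * q * (\<rho>' q)\<^sup>2 + (1 + q) * (\<rho> q)\<^sup>2 + 2 * (\<rho> q)\<^sup>2 / q \<le> (10 + q + q\<^sup>2) * ?X"
    proof -
      have "8 * q * (\<rho>' q)\<^sup>2 + (1 + q) * (\<rho> q)\<^sup>2 + 2 * (\<rho> q)\<^sup>2 / q = 8 * (q * (\<rho>' q)\<^sup>2) + (1 + q) * (\<rho> q)\<^sup>2 + 2 * ((\<rho> q)\<^sup>2 / q)"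
        by simp
      also have "\<dots> \<le> 8 * ?X + (1 + q) * (q * ?X) + 2 * ?X"
        using 2 3 by (intro add_mono) auto
      finally show ?thesis by (simp add: algebra_simps power2_eq_square)
    qed
    also have "\<dots> \<le> 512 * exp (q / 16) * ?X"
      using q exp_bounds_quadratic[of q] by (intro mult_right_mono) auto
    finally have "radial_dens \<rho> \<rho>' q \<le> 512 * exp (q / 16) * ?X * exp (- q / 4)"
      unfolding radial_dens_def by (rule mult_right_mono) simp
    also have "\<dots> = 512 * C\<^sup>2 * (q powr (2 * s - 1) * (exp (q / 16) * exp (q / 16) * exp (- q / 4)))" by simp
    also have "exp (q / 16) * exp (q / 16) * exp (- q / 4) = exp (- q / 8)"
      unfolding exp_add[symmetric] by simp
    finally show ?thesis .
  qed
  have "(\<integral>\<^sup>+r. ennreal (radial_dens \<rho> \<rho>' (r\<^sup>2)) \<partial>radial_measure N) \<le>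
      (\<integral>\<^sup>+r. ennreal (512 * C\<^sup>2) * ennreal (r powr (4 * s - 2) * exp (- (1 / 8) * r\<^sup>2)) \<partial>radial_measure N)"
  proof (rule nn_integral_mono_AE)
    show "AE r in radial_measure N. ennreal (radial_dens \<rho> \<rho>' (r\<^sup>2)) \<le>
        ennreal (512 * C\<^sup>2) * ennreal (r powr (4 * s - 2) * exp (- (1 / 8) * r\<^sup>2))"
      using AE_radial_pos
    proof eventually_elim
      case (elim r)
      have "(r\<^sup>2) powr (2 * s - 1) = r powr (4 * s - 2)"
        using elim by (simp add: powr_powr algebra_simps flip: powr_numeral)
      then show ?case
        using le[of "r\<^sup>2"] elim by (simp add: ennreal_mult[symmetric] ennreal_leI)
    qed
  qed
  also have "\<dots> = ennreal (512 * C\<^sup>2) * (\<integral>\<^sup>+r. ennreal (r powr (4 * s - 2) * exp (- (1 / 8) * r\<^sup>2)) \<partial>radial_measure N)"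
    by (rule nn_integral_cmult) measurable
  also have "\<dots> < \<infinity>"
    using radial_powr_gauss_finite[of N "4 * s - 2" "1/8"] N s by (simp add: ennreal_mult_less_top)
  finally show ?thesis .
qed

text \<open>The approximants truncate the radial factor and replace u by smooth angular functions.
  The error splits into truncation error times u and truncated factor times angular error: the first
  tends to 0 by dominated convergence, the second because the truncated factors have uniformly
  bounded radial integrals.\<close>

lemma has_H_grad_polar:
  fixes u :: "real^'n \<Rightarrow> complex"
  assumes u: "has_H1_sphere_grad u G"
    and smooth: "smooth_on (- {0::real^'n}) (\<lambda>x. complex_of_real (\<rho> ((norm x)\<^sup>2)))"
    and der: "\<And>q. q > 0 \<Longrightarrow> (\<rho> has_real_derivative \<rho>' q) (at q)"
    and [measurable]: "\<rho> \<in> borel_measurable borel" "\<rho>' \<in> borel_measurable borel"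
    and fin: "(\<integral>\<^sup>+r. ennreal (radial_dens \<rho> \<rho>' (r\<^sup>2)) \<partial>radial_measure CARD('n)) < \<infinity>"
  shows "has_H_grad (\<lambda>x. complex_of_real (\<rho> ((norm x)\<^sup>2)) * u (sgn x)) (polar_grad \<rho> \<rho>' u G)"
proof -
  obtain \<phi> where \<phi>: "\<And>n::nat. smooth_sphere (\<phi> n)"
    "(\<lambda>n. S_norm_sq (\<lambda>x. \<phi> n x - u x) (\<lambda>x. sphere_grad (\<phi> n) x - G x)) \<longlonglongrightarrow> 0"
    using u by (rule has_H1_sphere_gradE) blast
  note [measurable] = has_H1_sphere_grad_measurable[OF u] smooth_sphere_measurable[OF \<phi>(1)]
  define \<rho>n where "\<rho>n n q = annulus_cutoff n q * \<rho> q" for n q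
  define \<rho>n' where "\<rho>n' n q = annulus_cutoff' n q * \<rho> q + annulus_cutoff n q * \<rho>' q" for n q
  have cm [measurable]: "annulus_cutoff n \<in> borel_measurable borel" "annulus_cutoff' n \<in> borel_measurable borel" for n
    unfolding annulus_cutoff_def[abs_def] annulus_cutoff'_def[abs_def] cutoff_def cutoff'_def by measurable
  have [measurable]: "\<rho>n n \<in> borel_measurable borel" "\<rho>n' n \<in> borel_measurable borel" for n
    unfolding \<rho>n_def[abs_def] \<rho>n'_def[abs_def] by measurable
  have der_n: "(\<rho>n n has_real_derivative \<rho>n' n q) (at q)" if "q > 0" for n q
    unfolding \<rho>n_def[abs_def] \<rho>n'_def using DERIV_mult[OF DERIV_annulus_cutoff[of n q] der[OF that]]
    by (simp add: mult.commute add.commute)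
  note [measurable] = radial_dens_measurable
  let ?I = "\<lambda>\<rho> \<rho>'. (\<integral>\<^sup>+r. ennreal (radial_dens \<rho> \<rho>' (r\<^sup>2)) \<partial>radial_measure CARD('n))"
  \<comment> \<open>The value c = 0 bounds the truncated factor itself, c = 1 its difference from
    \<rho>; both share one integrable majorant.\<close>
  have dom: "AE r in radial_measure CARD('n). ennreal (radial_dens (\<lambda>q. \<rho>n n q - c * \<rho> q) (\<lambda>q. \<rho>n' n q - c * \<rho>' q) (r\<^sup>2)) \<le>
      200 * ennreal (radial_dens \<rho> \<rho>' (r\<^sup>2))" if c: "c \<in> {0, 1}" for n c
    using AE_radial_pos
  proof eventually_elim
    case (elim r)
    let ?q = "r\<^sup>2"
    have q: "?q > 0" using elim by simp
    have "\<bar>annulus_cutoff n ?q - c\<bar> \<le> 1" using annulus_cutoff_bounds[of n ?q] c by auto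
    from radial_dens_cutoff_le[OF q this annulus_cutoff'_bound[OF q, of n], where a = "\<rho> ?q" and b = "\<rho>' ?q"]
    have "radial_dens (\<lambda>q. \<rho>n n q - c * \<rho> q) (\<lambda>q. \<rho>n' n q - c * \<rho>' q) ?q \<le> 200 * radial_dens \<rho> \<rho>' ?q"
      by (simp add: radial_dens_def \<rho>n_def \<rho>n'_def algebra_simps)
    from ennreal_leI[OF this] show ?case by (simp add: ennreal_mult radial_dens_nonneg)
  qed
  have fin200: "200 * ?I \<rho> \<rho>' < \<infinity>" using fin by (simp add: ennreal_mult_less_top)
  have bound: "?I (\<rho>n n) (\<rho>n' n) \<le> 200 * ?I \<rho> \<rho>'" for n
  proof -
    have "?I (\<rho>n n) (\<rho>n' n) \<le> (\<integral>\<^sup>+r. 200 * ennreal (radial_dens \<rho> \<rho>' (r\<^sup>2)) \<partial>radial_measure CARD('n))"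
      using dom[of 0 n] by (intro nn_integral_mono_AE) simp
    also have "\<dots> = 200 * ?I \<rho> \<rho>'" by (rule nn_integral_cmult) measurable
    finally show ?thesis .
  qed
  have lim: "(\<lambda>n. ?I (\<lambda>q. \<rho>n n q - \<rho> q) (\<lambda>q. \<rho>n' n q - \<rho>' q)) \<longlonglongrightarrow> (\<integral>\<^sup>+r. 0 \<partial>radial_measure CARD('n))"
  proof (rule nn_integral_dominated_convergence[where w = "\<lambda>r. 200 * ennreal (radial_dens \<rho> \<rho>' (r\<^sup>2))"])
    show "(\<integral>\<^sup>+r. 200 * ennreal (radial_dens \<rho> \<rho>' (r\<^sup>2)) \<partial>radial_measure CARD('n)) < \<infinity>"
      using fin200 by (subst nn_integral_cmult) auto
    show "AE r in radial_measure CARD('n). ennreal (radial_dens (\<lambda>q. \<rho>n n q - \<rho> q) (\<lambda>q. \<rho>n' n q - \<rho>' q) (r\<^sup>2)) \<le>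
      200 * ennreal (radial_dens \<rho> \<rho>' (r\<^sup>2))" for n using dom[of 1 n] by simp
    show "AE r in radial_measure CARD('n). (\<lambda>n. ennreal (radial_dens (\<lambda>q. \<rho>n n q - \<rho> q) (\<lambda>q. \<rho>n' n q - \<rho>' q) (r\<^sup>2))) \<longlonglongrightarrow> 0"
      using AE_radial_pos
    proof eventually_elim
      case (elim r)
      then have q: "r\<^sup>2 > 0" by simp
      have "(\<lambda>n. \<rho>n n (r\<^sup>2) - \<rho> (r\<^sup>2)) \<longlonglongrightarrow> 1 * \<rho> (r\<^sup>2) - \<rho> (r\<^sup>2)"
        unfolding \<rho>n_def by (intro tendsto_intros annulus_cutoff_tendsto q)
      moreover have "(\<lambda>n. \<rho>n' n (r\<^sup>2) - \<rho>' (r\<^sup>2)) \<longlonglongrightarrow> (0 * \<rho> (r\<^sup>2) + 1 * \<rho>' (r\<^sup>2)) - \<rho>' (r\<^sup>2)"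
        unfolding \<rho>n'_def by (intro tendsto_intros annulus_cutoff_tendsto q)
      ultimately have "(\<lambda>n. radial_dens (\<lambda>q. \<rho>n n q - \<rho> q) (\<lambda>q. \<rho>n' n q - \<rho>' q) (r\<^sup>2)) \<longlonglongrightarrow>
          (8 * r\<^sup>2 * 0\<^sup>2 + (1 + r\<^sup>2) * 0\<^sup>2 + 2 * 0\<^sup>2 / r\<^sup>2) * exp (- r\<^sup>2 / 4)"
        unfolding radial_dens_def using q by (intro tendsto_intros) auto
      then have "(\<lambda>n. ennreal (radial_dens (\<lambda>q. \<rho>n n q - \<rho> q) (\<lambda>q. \<rho>n' n q - \<rho>' q) (r\<^sup>2))) \<longlonglongrightarrow> ennreal 0"
        by (intro tendsto_ennrealI) simp
      then show ?case by simp
    qed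
  qed measurable
  define \<Phi> where "\<Phi> n x = complex_of_real (annulus_cutoff n ((norm x)\<^sup>2)) * (complex_of_real (\<rho> ((norm x)\<^sup>2)) * \<phi> n (sgn x))" for n x
  have \<Phi>_eq: "\<Phi> n = (\<lambda>x. complex_of_real (\<rho>n n ((norm x)\<^sup>2)) * \<phi> n (sgn x))" for n
    by (simp add: \<Phi>_def[abs_def] \<rho>n_def mult.assoc)
  have \<Phi>: "test_fun (\<Phi> n)" for n
    unfolding \<Phi>_def[abs_def]
    by (intro test_fun_annulus_cutoff smooth_on_mult smooth \<phi>(1)[unfolded smooth_sphere_def]) auto
  have grad\<Phi>: "AE x in lborel. grad (\<Phi> n) x = polar_grad (\<rho>n n) (\<rho>n' n) (\<phi> n) (sphere_grad (\<phi> n)) x" for n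
    using AE_lborel_singleton[of "0 :: real^'n"]
  proof eventually_elim
    case (elim x)
    show ?case unfolding \<Phi>_eq
      by (rule grad_polar_product[where \<rho> = "\<rho>n n", OF \<phi>(1) elim]) (rule der_n, use elim in simp)
  qed
  show ?thesis
  proof (rule has_H_gradI[of _ _ \<Phi>])
    show "(\<lambda>x. complex_of_real (\<rho> ((norm x)\<^sup>2)) * u (sgn x)) \<in> borel_measurable borel"
      "polar_grad \<rho> \<rho>' u G \<in> borel_measurable borel"
      by (rule polar_grad_measurable; measurable)+
    have "(\<lambda>n. 2 * (?I (\<lambda>q. \<rho>n n q - \<rho> q) (\<lambda>q. \<rho>n' n q - \<rho>' q) * S_norm_sq u G) +
        2 * ((200 * ?I \<rho> \<rho>') * S_norm_sq (\<lambda>x. \<phi> n x - u x) (\<lambda>x. sphere_grad (\<phi> n) x - G x))) \<longlonglongrightarrow>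
        2 * ((\<integral>\<^sup>+r. 0 \<partial>radial_measure CARD('n)) * S_norm_sq u G) + 2 * ((200 * ?I \<rho> \<rho>') * 0)"
      using S_norm_sq_finite[OF u] fin200 fin
      by (intro tendsto_add tendsto_mult_ennreal tendsto_const lim \<phi>(2)) (auto simp: ennreal_mult_eq_top_iff)
    then have "(\<lambda>n. 2 * (?I (\<lambda>q. \<rho>n n q - \<rho> q) (\<lambda>q. \<rho>n' n q - \<rho>' q) * S_norm_sq u G) +
        2 * ((200 * ?I \<rho> \<rho>') * S_norm_sq (\<lambda>x. \<phi> n x - u x) (\<lambda>x. sphere_grad (\<phi> n) x - G x))) \<longlonglongrightarrow> 0" by simp
    then show "(\<lambda>n. H_norm_sq (\<lambda>x. \<Phi> n x - complex_of_real (\<rho> ((norm x)\<^sup>2)) * u (sgn x))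
        (\<lambda>x. grad (\<Phi> n) x - polar_grad \<rho> \<rho>' u G x)) \<longlonglongrightarrow> 0"
    proof (rule tendsto_zero_ennreal_le)
      fix n
      let ?a = "\<lambda>q. \<rho>n n q - \<rho> q" and ?a' = "\<lambda>q. \<rho>n' n q - \<rho>' q"
      let ?w = "\<lambda>x. \<phi> n x - u x" and ?K = "\<lambda>x. sphere_grad (\<phi> n) x - G x"
      have "H_norm_sq (\<lambda>x. \<Phi> n x - complex_of_real (\<rho> ((norm x)\<^sup>2)) * u (sgn x)) (\<lambda>x. grad (\<Phi> n) x - polar_grad \<rho> \<rho>' u G x) =
        H_norm_sq (\<lambda>x. complex_of_real (?a ((norm x)\<^sup>2)) * u (sgn x) + complex_of_real (\<rho>n n ((norm x)\<^sup>2)) * ?w (sgn x))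
           (\<lambda>x. polar_grad ?a ?a' u G x + polar_grad (\<rho>n n) (\<rho>n' n) ?w ?K x)"
      proof (rule H_norm_sq_cong_AE)
        show "AE x in lborel. grad (\<Phi> n) x - polar_grad \<rho> \<rho>' u G x =
            polar_grad ?a ?a' u G x + polar_grad (\<rho>n n) (\<rho>n' n) ?w ?K x"
          using grad\<Phi>[of n]
        proof eventually_elim
          case (elim x)
          show ?case unfolding elim
            unfolding vec_eq_iff by (simp add: polar_grad_def) (simp add: scaleR_conv_of_real algebra_simps diff_divide_distrib)
        qed
      qed (simp add: \<Phi>_eq algebra_simps)
      also have "\<dots> \<le> 2 * H_norm_sq (\<lambda>x. complex_of_real (?a ((norm x)\<^sup>2)) * u (sgn x)) (polar_grad ?a ?a' u G) +
         2 * H_norm_sq (\<lambda>x. complex_of_real (\<rho>n n ((norm x)\<^sup>2)) * ?w (sgn x)) (polar_grad (\<rho>n n) (\<rho>n' n) ?w ?K)"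
        by (rule H_norm_sq_add_le; rule polar_grad_measurable; measurable)
      also have "\<dots> \<le> 2 * (?I ?a ?a' * S_norm_sq u G) + 2 * (?I (\<rho>n n) (\<rho>n' n) * S_norm_sq ?w ?K)"
        by (intro add_mono mult_left_mono H_norm_sq_polar_le) auto
      also have "\<dots> \<le> 2 * (?I ?a ?a' * S_norm_sq u G) + 2 * ((200 * ?I \<rho> \<rho>') * S_norm_sq ?w ?K)"
        by (intro add_mono mult_left_mono mult_right_mono bound) auto
      finally show "H_norm_sq (\<lambda>x. \<Phi> n x - complex_of_real (\<rho> ((norm x)\<^sup>2)) * u (sgn x)) (\<lambda>x. grad (\<Phi> n) x - polar_grad \<rho> \<rho>' u G x) \<le> \<dots>" .
    qed
  qed (rule \<Phi>)
qed

text \<open>Each gradient of u yields a gradient of |x|^2 u(x/|x|) on the whole space, where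
  uniqueness is known. The factor |x|^2 is smooth and vanishes at the origin, so the lift lies in
  \<open>H_space\<close> for every N >= 2; the radial parts of the two lifted gradients
  coincide.\<close>

lemma has_H1_sphere_grad_unique:
  fixes u :: "real^'n \<Rightarrow> complex"
  assumes N: "CARD('n) \<ge> 2" and G: "has_H1_sphere_grad u G" and K: "has_H1_sphere_grad u K"
  shows "AE \<theta> in sphere_measure. G \<theta> = K \<theta>"
proof -
  have fin: "(\<integral>\<^sup>+r. ennreal (radial_dens (\<lambda>q. q) (\<lambda>q. 1) (r\<^sup>2)) \<partial>radial_measure CARD('n)) < \<infinity>"
    by (rule radial_dens_finite[OF N, of 1 1]) (use N in auto)
  have sm: "smooth_on (- {0::real^'n}) (\<lambda>x. complex_of_real ((norm x)\<^sup>2))"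
    by (intro smooth_on_of_real smooth_on_norm_sq) auto
  have H: "has_H_grad (\<lambda>x. complex_of_real ((norm x)\<^sup>2) * u (sgn x)) (polar_grad (\<lambda>q. q) (\<lambda>q. 1) u L)"
    if "has_H1_sphere_grad u L" for L
    by (rule has_H_grad_polar[OF that sm _ _ _ fin]) auto
  have "AE x in lborel. G (sgn x) = K (sgn x)"
    using has_H_grad_unique[OF H[OF G] H[OF K]] AE_lborel_singleton[of "0::real^'n"]
    by eventually_elim (simp add: polar_grad_def)
  then show ?thesis by (rule AE_sgn_imp_AE_sphere)
qed

section \<open>The quadratic form\<close>

lemma norm_cdot_le: "norm (cdot u w) \<le> norm u * norm w"
proof -
  have "norm (cdot u w) \<le> (\<Sum>i\<in>UNIV. \<bar>norm (u $ i)\<bar> * \<bar>norm (w $ i)\<bar>)"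
    unfolding cdot_def by (rule order_trans[OF norm_sum]) (simp add: norm_mult)
  also have "\<dots> \<le> L2_set (\<lambda>i. norm (u $ i)) UNIV * L2_set (\<lambda>i. norm (w $ i)) UNIV"
    by (rule L2_set_mult_ineq)
  finally show ?thesis by (simp add: norm_vec_def)
qed

lemma cnj_cdot: "cnj (cdot u w) = cdot w u"
  by (simp add: cdot_def mult.commute)

lemma cdot_add_left: "cdot (u + v) w = cdot u w + cdot v w"
  by (simp add: cdot_def distrib_right sum.distrib)

lemma cdot_add_right: "cdot u (v + w) = cdot u v + cdot u w"
  by (simp add: cdot_def distrib_left sum.distrib)

lemma cdot_diff_right: "cdot u (v - w) = cdot u v - cdot u w"
  by (simp add: cdot_def right_diff_distrib sum_subtractf)

lemma cdot_cmult_left: "cdot (\<chi> i. c * (u $ i)) w = c * cdot u w"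
  by (simp add: cdot_def sum_distrib_left mult.assoc)

lemma cdot_cmult_right: "cdot u (\<chi> i. c * (w $ i)) = cnj c * cdot u w"
  by (simp add: cdot_def sum_distrib_left mult_ac)

lemma cdot_scaleR_left: "cdot (r *\<^sub>R u) w = of_real r * cdot u w"
  unfolding cdot_def vector_scaleR_component by (simp add: sum_distrib_left scaleR_conv_of_real mult.assoc)

lemma cdot_scaleR_right: "cdot u (r *\<^sub>R w) = of_real r * cdot u w"
  unfolding cdot_def vector_scaleR_component by (simp add: sum_distrib_left scaleR_conv_of_real mult_ac)

lemma borel_measurable_cnj [measurable]: "cnj \<in> borel_measurable borel"
  by (intro borel_measurable_continuous_onI continuous_intros)

lemma borel_measurable_cdot [measurable (raw)]:
  assumes [measurable]: "f \<in> borel_measurable M" "g \<in> borel_measurable M"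
  shows "(\<lambda>x. cdot (f x) (g x)) \<in> borel_measurable M"
  unfolding cdot_def by measurable

definition gauss_inner :: "(real^'n \<Rightarrow> complex) \<Rightarrow> (real^'n \<Rightarrow> complex) \<Rightarrow> complex" where
  "gauss_inner v w = (\<integral>x. v x * cnj (w x) * complex_of_real (exp (- (norm x)\<^sup>2 / 4)) \<partial>lborel)"

lemma L_eigen_eq_gauss:
  "L_eigen_eq A a \<gamma> g \<longleftrightarrow> (\<forall>w\<in>H_space. L_op A a g w = \<gamma> * gauss_inner g w)"
  by (simp add: L_eigen_eq_def gauss_inner_def)

lemma cnj_gauss_inner: "cnj (gauss_inner v w) = gauss_inner w v"
  unfolding gauss_inner_def by (subst Bochner_Integration.integral_cnj[symmetric], rule Bochner_Integration.integral_cong) (simp_all add: mult_ac)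

lemma cnj_L_op: "cnj (L_op A a v w) = L_op A a w v"
  unfolding L_op_def by (subst Bochner_Integration.integral_cnj[symmetric], rule Bochner_Integration.integral_cong) (simp_all add: cnj_cdot mult_ac)

lemma gauss_dens_le:
  "norm (v x * cnj (w x) * complex_of_real (exp (- (norm x)\<^sup>2 / 4))) \<le> sqrt (H_dens v G x) * sqrt (H_dens w K x)"
proof -
  have "(norm (v x))\<^sup>2 * exp (- (norm x)\<^sup>2 / 4) \<le> H_dens v G x" for v :: "real^'a \<Rightarrow> complex" and G
    unfolding H_dens_def by (rule mult_right_mono) auto
  then have "sqrt ((norm (v x))\<^sup>2 * exp (- (norm x)\<^sup>2 / 4)) * sqrt ((norm (w x))\<^sup>2 * exp (- (norm x)\<^sup>2 / 4)) \<le>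
     sqrt (H_dens v G x) * sqrt (H_dens w K x)"
    by (intro mult_mono real_sqrt_le_mono) (auto simp: H_dens_nonneg)
  moreover have "sqrt ((norm (v x))\<^sup>2 * exp (- (norm x)\<^sup>2 / 4)) * sqrt ((norm (w x))\<^sup>2 * exp (- (norm x)\<^sup>2 / 4)) =
     norm (v x) * norm (w x) * exp (- (norm x)\<^sup>2 / 4)"
    by (simp add: real_sqrt_mult)
  ultimately show ?thesis by (simp add: norm_mult)
qed

lemma sqrt_prod_le_sum: "0 \<le> a \<Longrightarrow> 0 \<le> b \<Longrightarrow> sqrt a * sqrt b \<le> a + b"
proof -
  assume ab: "0 \<le> a" "0 \<le> b"
  have "2 * sqrt a * sqrt b \<le> a + b"
    using sum_squares_bound[of "sqrt a" "sqrt b"] ab by simp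
  moreover have "0 \<le> sqrt a * sqrt b" using ab by simp
  ultimately show ?thesis by linarith
qed

lemma integrable_H_dens_bound:
  fixes E :: "real^'n \<Rightarrow> complex"
  assumes [measurable]: "E \<in> borel_measurable borel" and v: "has_H_grad v G" and w: "has_H_grad w K" and C: "C \<ge> 0"
    and bound: "AE x in lborel. norm (E x) \<le> C * sqrt (H_dens v G x) * sqrt (H_dens w K x)"
  shows "integrable lborel E"
proof (rule Bochner_Integration.integrable_bound)
  show "integrable lborel (\<lambda>x. C * (H_dens v G x + H_dens w K x))"
    by (intro integrable_mult_right Bochner_Integration.integrable_add integrable_H_dens v w)
  show "AE x in lborel. norm (E x) \<le> norm (C * (H_dens v G x + H_dens w K x))"
    using bound
  proof eventually_elim
    case (elim x)
    have "C * (sqrt (H_dens v G x) * sqrt (H_dens w K x)) \<le> C * (H_dens v G x + H_dens w K x)"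
      using C by (intro mult_left_mono sqrt_prod_le_sum H_dens_nonneg) auto
    also have "\<dots> \<le> norm (C * (H_dens v G x + H_dens w K x))" by simp
    finally show ?case using elim by (simp only: mult.assoc)
  qed
qed simp

lemma integrable_gauss_dens:
  assumes v: "has_H_grad v G" and w: "has_H_grad w K"
  shows "integrable lborel (\<lambda>x. v x * cnj (w x) * complex_of_real (exp (- (norm x)\<^sup>2 / 4)))"
proof -
  note [measurable] = has_H_grad_measurable[OF v] has_H_grad_measurable[OF w]
  show ?thesis
  proof (rule integrable_H_dens_bound[OF _ v w, of _ 1])
    show "AE x in lborel. norm (v x * cnj (w x) * complex_of_real (exp (- (norm x)\<^sup>2 / 4))) \<le>
        1 * sqrt (H_dens v G x) * sqrt (H_dens w K x)"
      unfolding mult_1_left by (rule AE_I2) (rule gauss_dens_le)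
  qed auto
qed

lemma gauss_inner_add_left:
  assumes "v1 \<in> H_space" "v2 \<in> H_space" "w \<in> H_space"
  shows "gauss_inner (\<lambda>x. v1 x + v2 x) w = gauss_inner v1 w + gauss_inner v2 w"
proof -
  obtain G1 G2 K where "has_H_grad v1 G1" "has_H_grad v2 G2" "has_H_grad w K"
    using assms unfolding H_space_def by blast
  then show ?thesis
    unfolding gauss_inner_def distrib_right
    by (intro Bochner_Integration.integral_add integrable_gauss_dens)
qed

lemma gauss_inner_cmult_left: "gauss_inner (\<lambda>x. c * v x) w = c * gauss_inner v w"
  unfolding gauss_inner_def by (simp add: mult.assoc)

lemma H_space_add: "v \<in> H_space \<Longrightarrow> w \<in> H_space \<Longrightarrow> (\<lambda>x. v x + w x) \<in> H_space"
  unfolding H_space_def using has_H_grad_add by blast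

lemma H_space_cmult: "v \<in> H_space \<Longrightarrow> (\<lambda>x. c * v x) \<in> H_space"
  unfolding H_space_def using has_H_grad_cmult by blast

lemma H_space_zero: "(\<lambda>_. 0) \<in> H_space"
proof -
  have "test_fun (\<lambda>_. 0)"
    unfolding test_fun_iff by (auto simp: smooth_on_const intro: exI[of _ 1])
  then show ?thesis unfolding H_space_def using has_H_grad_test_fun by blast
qed

lemma H_space_sum:
  assumes "\<And>j. j \<in> J \<Longrightarrow> f j \<in> H_space"
  shows "(\<lambda>x. \<Sum>j\<in>J. c j * f j x) \<in> H_space"
  using assms by (induction J rule: infinite_finite_induct) (auto simp: H_space_zero intro!: H_space_add H_space_cmult)

lemma H_space_has_H_grad: "v \<in> H_space \<Longrightarrow> has_H_grad v (H_grad v)"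
  unfolding H_space_def using has_H_grad_H_grad by blast

text \<open>Here and in \<open>form_dens\<close> the gradient is an argument, which frees the
  integrand of \<open>L_op\<close> from the choice made in \<open>H_grad\<close>.\<close>

definition mag_field :: "(real^'n \<Rightarrow> real^'n) \<Rightarrow> (real^'n \<Rightarrow> complex) \<Rightarrow> (real^'n \<Rightarrow> complex^'n) \<Rightarrow> real^'n \<Rightarrow> complex^'n" where
  "mag_field A v G x = G x + (\<chi> i. \<i> * complex_of_real (A (sgn x) $ i / norm x) * v x)"

definition form_dens :: "(real^'n \<Rightarrow> real^'n) \<Rightarrow> (real^'n \<Rightarrow> real) \<Rightarrow> (real^'n \<Rightarrow> complex) \<Rightarrow> (real^'n \<Rightarrow> complex^'n) \<Rightarrow>
    (real^'n \<Rightarrow> complex) \<Rightarrow> (real^'n \<Rightarrow> complex^'n) \<Rightarrow> real^'n \<Rightarrow> complex" where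
  "form_dens A a v G w K x =
     (cdot (mag_field A v G x) (mag_field A w K x) - complex_of_real (a (sgn x) / (norm x)\<^sup>2) * v x * cnj (w x))
       * complex_of_real (exp (- (norm x)\<^sup>2 / 4))"

lemma L_op_eq_form_dens: "L_op A a v w = (\<integral>x. form_dens A a v (H_grad v) w (H_grad w) x \<partial>lborel)"
  by (simp add: L_op_def form_dens_def mag_field_def mag_grad_def)

lemma mag_field_add: "mag_field A (\<lambda>x. v x + w x) (\<lambda>x. G x + K x) x = mag_field A v G x + mag_field A w K x"
  by (simp add: mag_field_def vec_eq_iff algebra_simps add_divide_distrib)

lemma mag_field_cmult: "mag_field A (\<lambda>x. c * v x) (\<lambda>x. \<chi> i. c * (G x $ i)) x = (\<chi> i. c * (mag_field A v G x $ i))"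
  by (simp add: mag_field_def vec_eq_iff algebra_simps add_divide_distrib)

lemma form_dens_add_left:
  "form_dens A a (\<lambda>x. v x + v' x) (\<lambda>x. G x + G' x) w K x = form_dens A a v G w K x + form_dens A a v' G' w K x"
  unfolding form_dens_def mag_field_add by (simp add: cdot_add_left algebra_simps add_divide_distrib)

lemma form_dens_cmult_left:
  "form_dens A a (\<lambda>x. c * v x) (\<lambda>x. \<chi> i. c * (G x $ i)) w K x = c * form_dens A a v G w K x"
  unfolding form_dens_def mag_field_cmult by (simp add: cdot_cmult_left algebra_simps)

lemma form_dens_diff_right:
  "form_dens A a v G w K x - form_dens A a v G w' K' x = form_dens A a v G (\<lambda>x. w x - w' x) (\<lambda>x. K x - K' x) x"
proof -
  have "mag_field A (\<lambda>x. w x - w' x) (\<lambda>x. K x - K' x) x = mag_field A w K x - mag_field A w' K' x"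
    by (simp add: mag_field_def vec_eq_iff right_diff_distrib diff_divide_distrib)
  then show ?thesis
    by (simp only: form_dens_def cdot_diff_right) (simp add: algebra_simps diff_divide_distrib)
qed

section \<open>The form for a fixed magnetic potential A and coefficient a\<close>

locale magnetic =
  fixes A :: "real^'n \<Rightarrow> real^'n" and a :: "real^'n \<Rightarrow> real"
  assumes dim_ge_2: "CARD('n) \<ge> 2"
    and A_C1: "Ck_sphere 1 A"
    and A_tangential: "\<And>\<theta>. \<theta> \<in> sphere 0 1 \<Longrightarrow> A \<theta> \<bullet> \<theta> = 0"
    and a_Linf: "Linf_sphere a"
begin

lemma A_continuous: "continuous_on (sphere 0 1) A"
proof (rule continuous_on_eq)
  have "Ck_on 0 (- {0}) (\<lambda>x. A (sgn x))"
    using A_C1 unfolding Ck_sphere_def One_nat_def by (rule Ck_on_Suc_imp)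
  then have "continuous_on (- {0}) (\<lambda>x. A (sgn x))" by simp
  then show "continuous_on (sphere 0 1) (\<lambda>x. A (sgn x))" by (rule continuous_on_subset) auto
qed (auto simp: sgn_div_norm)

lemma A_measurable: "A \<in> borel_measurable sphere_measure"
  by (rule borel_measurable_sphere_continuous[OF A_continuous])

lemma A_sgn_measurable [measurable]: "(\<lambda>x. A (sgn x)) \<in> borel_measurable borel"
  by (rule borel_measurable_compose_sgn[OF A_measurable]) simp

lemma a_measurable: "a \<in> borel_measurable sphere_measure"
  using a_Linf by (simp add: Linf_sphere_def)

lemma a_sgn_measurable [measurable]: "(\<lambda>x. a (sgn x)) \<in> borel_measurable borel"
  by (rule borel_measurable_compose_sgn[OF a_measurable]) simp

lemma A_boundE:
  obtains M where "M \<ge> 0" "\<And>\<theta>. norm \<theta> = 1 \<Longrightarrow> norm (A \<theta>) \<le> M"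
proof -
  have "bounded (A ` sphere 0 1)"
    by (intro compact_imp_bounded compact_continuous_image A_continuous) auto
  then obtain M where "\<forall>y\<in>A ` sphere 0 1. norm y \<le> M" unfolding bounded_iff by blast
  then show thesis by (intro that[of "max M 0"]) (auto simp: le_max_iff_disj)
qed

lemma a_boundE:
  obtains c where "c \<ge> 0" "AE \<theta> in sphere_measure. \<bar>a \<theta>\<bar> \<le> c"
proof -
  obtain c where "AE \<theta> in sphere_measure. \<bar>a \<theta>\<bar> \<le> c"
    using a_Linf by (auto simp: Linf_sphere_def)
  then have "AE \<theta> in sphere_measure. \<bar>a \<theta>\<bar> \<le> max c 0"
    by eventually_elim auto
  then show thesis by (intro that[of "max c 0"]) auto
qed

lemma form_dens_measurable:
  assumes [measurable]: "v \<in> borel_measurable borel" "G \<in> borel_measurable borel"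
    "w \<in> borel_measurable borel" "K \<in> borel_measurable borel"
  shows "form_dens A a v G w K \<in> borel_measurable borel"
  unfolding form_dens_def[abs_def] mag_field_def[abs_def] by measurable

text \<open>C depends only on bounds for A and a, not on the functions. The weight 1/|x|^2 in the
  density controls both A v/|x| and a v w/|x|^2. The bound on a holds almost everywhere on the
  sphere and is transported to almost every x.\<close>

lemma form_dens_boundE:
  obtains C where "C \<ge> 0" "\<And>v G w K. AE x in lborel. norm (form_dens A a v G w K x) \<le> C * sqrt (H_dens v G x) * sqrt (H_dens w K x)"
proof -
  obtain M where M: "M \<ge> 0" "\<And>\<theta>. norm \<theta> = 1 \<Longrightarrow> norm (A \<theta>) \<le> M" by (rule A_boundE) blast
  obtain c where c: "c \<ge> 0" "AE \<theta> in sphere_measure. \<bar>a \<theta>\<bar> \<le> c" by (rule a_boundE) blast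
  have "AE x in lborel. norm (form_dens A a v G w K x) \<le> ((1 + M)\<^sup>2 + c) * sqrt (H_dens v G x) * sqrt (H_dens w K x)" for v G w K
    using AE_sphere_imp_AE_sgn[OF c(2)] AE_lborel_singleton[of "0 :: real^'n"]
  proof eventually_elim
    case (elim x)
    let ?N = "\<lambda>v G. sqrt ((norm (G x))\<^sup>2 + (norm (v x))\<^sup>2 + (norm (v x))\<^sup>2 / (norm x)\<^sup>2)"
    have n1: "norm (v x) / norm x \<le> ?N v G" for v :: "real^'n \<Rightarrow> complex" and G :: "real^'n \<Rightarrow> complex^'n"
      by (rule real_le_rsqrt) (simp add: power_divide)
    have n2: "norm (G x) \<le> ?N v G" for v :: "real^'n \<Rightarrow> complex" and G :: "real^'n \<Rightarrow> complex^'n"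
      by (rule real_le_rsqrt) simp
    have mag: "norm (mag_field A v G x) \<le> (1 + M) * ?N v G" for v G
    proof -
      have "(norm (\<chi> i. \<i> * complex_of_real (A (sgn x) $ i / norm x) * v x))\<^sup>2 = (norm (A (sgn x)) * (norm (v x) / norm x))\<^sup>2"
        unfolding norm_vec_sq
        by (simp add: norm_mult norm_divide power_mult_distrib power_divide norm_vec_def[of "A (sgn x)"] L2_set_def sum_nonneg
            sum_distrib_right sum_divide_distrib)
      then have "norm (\<chi> i. \<i> * complex_of_real (A (sgn x) $ i / norm x) * v x) = norm (A (sgn x)) * (norm (v x) / norm x)"
        by (rule power2_eq_imp_eq) auto
      also have "\<dots> \<le> M * ?N v G"
        using M(1) M(2)[of "sgn x"] elim n1[of v G] by (intro mult_mono) (auto simp: norm_sgn)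
      finally have "norm (\<chi> i. \<i> * complex_of_real (A (sgn x) $ i / norm x) * v x) \<le> M * ?N v G" .
      then show ?thesis
        unfolding mag_field_def using norm_triangle_le n2[of G v] by (simp add: algebra_simps norm_triangle_mono)
    qed
    have "norm (cdot (mag_field A v G x) (mag_field A w K x)) \<le> ((1 + M) * ?N v G) * ((1 + M) * ?N w K)"
      by (rule order_trans[OF norm_cdot_le]) (intro mult_mono mag; use M in simp)
    moreover have "norm (complex_of_real (a (sgn x) / (norm x)\<^sup>2) * v x * cnj (w x)) \<le> c * (?N v G * ?N w K)"
    proof -
      have "norm (complex_of_real (a (sgn x) / (norm x)\<^sup>2) * v x * cnj (w x)) = \<bar>a (sgn x)\<bar> * ((norm (v x) / norm x) * (norm (w x) / norm x))"
        by (simp add: norm_mult norm_divide power2_eq_square)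
      also have "\<dots> \<le> c * (?N v G * ?N w K)"
        using elim c by (intro mult_mono n1) auto
      finally show ?thesis .
    qed
    ultimately have "norm (cdot (mag_field A v G x) (mag_field A w K x) - complex_of_real (a (sgn x) / (norm x)\<^sup>2) * v x * cnj (w x)) \<le>
      ((1 + M) * ?N v G) * ((1 + M) * ?N w K) + c * (?N v G * ?N w K)"
      by (rule order_trans[OF norm_triangle_ineq4 add_mono])
    also have "\<dots> = ((1 + M)\<^sup>2 + c) * (?N v G * ?N w K)" by (simp add: power2_eq_square algebra_simps)
    finally have *: "norm (form_dens A a v G w K x) \<le> ((1 + M)\<^sup>2 + c) * (?N v G * ?N w K) * exp (- (norm x)\<^sup>2 / 4)"
      unfolding form_dens_def by (simp add: norm_mult)
    have e: "exp (- (norm x)\<^sup>2 / 4) = sqrt (exp (- (norm x)\<^sup>2 / 4)) * sqrt (exp (- (norm x)\<^sup>2 / 4))" by simp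
    show ?case
      using * unfolding H_dens_def real_sqrt_mult by (subst (asm) e) (simp only: mult_ac)
  qed
  then show thesis using M c by (intro that[of "(1 + M)\<^sup>2 + c"]) auto
qed

lemma integrable_form_dens:
  assumes v: "has_H_grad v G" and w: "has_H_grad w K"
  shows "integrable lborel (form_dens A a v G w K)"
proof -
  obtain C where C: "C \<ge> 0" "\<And>v G w K. AE x in lborel. norm (form_dens A a v G w K x) \<le> C * sqrt (H_dens v G x) * sqrt (H_dens w K x)"
    by (rule form_dens_boundE) blast
  show ?thesis
    by (rule integrable_H_dens_bound[OF _ v w C(1)]) (intro form_dens_measurable has_H_grad_measurable[OF v] has_H_grad_measurable[OF w], rule C(2))
qed

text \<open>Any gradient may replace the chosen one, since the two agree almost everywhere.\<close>

lemma L_op_eq: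
  assumes v: "has_H_grad v G" and w: "has_H_grad w K"
  shows "L_op A a v w = (\<integral>x. form_dens A a v G w K x \<partial>lborel)"
  unfolding L_op_eq_form_dens
proof (rule integral_cong_AE)
  note v' = has_H_grad_H_grad[OF v] and w' = has_H_grad_H_grad[OF w]
  show "form_dens A a v (H_grad v) w (H_grad w) \<in> borel_measurable lborel" "form_dens A a v G w K \<in> borel_measurable lborel"
    using form_dens_measurable has_H_grad_measurable[OF v] has_H_grad_measurable[OF w]
      has_H_grad_measurable[OF v'] has_H_grad_measurable[OF w'] by simp_all
  show "AE x in lborel. form_dens A a v (H_grad v) w (H_grad w) x = form_dens A a v G w K x"
    using H_grad_AE_eq[OF v] H_grad_AE_eq[OF w]
    by eventually_elim (simp add: form_dens_def mag_field_def)
qed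

lemma L_op_add_left:
  assumes "v \<in> H_space" "v' \<in> H_space" "w \<in> H_space"
  shows "L_op A a (\<lambda>x. v x + v' x) w = L_op A a v w + L_op A a v' w"
proof -
  note H = assms[THEN H_space_has_H_grad]
  show ?thesis
    unfolding L_op_eq[OF has_H_grad_add[OF H(1,2)] H(3)] L_op_eq[OF H(1,3)] L_op_eq[OF H(2,3)] form_dens_add_left
    by (intro Bochner_Integration.integral_add integrable_form_dens H)
qed

lemma L_op_cmult_left:
  assumes "v \<in> H_space" "w \<in> H_space"
  shows "L_op A a (\<lambda>x. c * v x) w = c * L_op A a v w"
proof -
  note H = assms[THEN H_space_has_H_grad]
  show ?thesis
    unfolding L_op_eq[OF has_H_grad_cmult[OF H(1)] H(2)] L_op_eq[OF H] form_dens_cmult_left by simp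
qed

lemma L_eigen_eq_add:
  assumes "v \<in> H_space" "w \<in> H_space" "L_eigen_eq A a \<gamma> v" "L_eigen_eq A a \<gamma> w"
  shows "L_eigen_eq A a \<gamma> (\<lambda>x. v x + w x)"
  using assms by (simp add: L_eigen_eq_gauss L_op_add_left gauss_inner_add_left distrib_left)

lemma L_eigen_eq_cmult:
  assumes "v \<in> H_space" "L_eigen_eq A a \<gamma> v"
  shows "L_eigen_eq A a \<gamma> (\<lambda>x. c * v x)"
  using assms by (simp add: L_eigen_eq_gauss L_op_cmult_left gauss_inner_cmult_left)

lemma L_eigen_eq_zero: "L_eigen_eq A a \<gamma> (\<lambda>_. 0)"
  using L_op_cmult_left[OF H_space_zero, of _ 0] by (simp add: L_eigen_eq_gauss gauss_inner_def)

lemma L_eigen_eq_sum: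
  assumes "\<And>j. j \<in> J \<Longrightarrow> f j \<in> H_space" "\<And>j. j \<in> J \<Longrightarrow> L_eigen_eq A a \<gamma> (f j)"
  shows "L_eigen_eq A a \<gamma> (\<lambda>x. \<Sum>j\<in>J. c j * f j x)"
  using assms
proof (induction J rule: infinite_finite_induct)
  case (insert j J)
  then show ?case
    using L_eigen_eq_add[of "\<lambda>x. c j * f j x" "\<lambda>x. \<Sum>j\<in>J. c j * f j x" \<gamma>]
    by (simp add: H_space_cmult H_space_sum L_eigen_eq_cmult)
qed (simp_all add: L_eigen_eq_zero)

lemma L_eigen_orthogonal:
  assumes g: "g \<in> H_space" "L_eigen_eq A a \<gamma> g" and v: "v \<in> H_space" "L_eigen_eq A a (complex_of_real \<delta>) v"
    and ne: "\<gamma> \<noteq> complex_of_real \<delta>"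
  shows "gauss_inner g v = 0"
proof -
  have "\<gamma> * gauss_inner g v = L_op A a g v" using g v by (simp add: L_eigen_eq_gauss)
  also have "\<dots> = cnj (L_op A a v g)" by (simp add: cnj_L_op)
  \<comment> \<open>Conjugation leaves \<delta> unchanged because it is real; \<gamma> itself may be
    any complex number.\<close>
  also have "\<dots> = complex_of_real \<delta> * gauss_inner g v"
    using g v by (simp add: L_eigen_eq_gauss cnj_gauss_inner)
  finally show ?thesis using ne by simp
qed

text \<open>Test functions are dense in \<open>H_space\<close> by construction, and the pointwise
  bounds make both sides of the equation continuous in the second argument.\<close>

lemma L_eigen_eq_test_funI:
  assumes v: "has_H_grad v G"
    and test: "\<And>\<phi>. test_fun \<phi> \<Longrightarrow> (\<integral>x. form_dens A a v G \<phi> (grad \<phi>) x \<partial>lborel) = \<gamma> * gauss_inner v \<phi>"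
  shows "L_eigen_eq A a \<gamma> v"
  unfolding L_eigen_eq_gauss
proof
  fix w :: "real^'n \<Rightarrow> complex" assume "w \<in> H_space"
  then obtain K where w: "has_H_grad w K" unfolding H_space_def by blast
  then obtain \<phi> where \<phi>: "\<And>n::nat. test_fun (\<phi> n)"
    "(\<lambda>n. H_norm_sq (\<lambda>x. \<phi> n x - w x) (\<lambda>x. grad (\<phi> n) x - K x)) \<longlonglongrightarrow> 0"
    by (rule has_H_gradE) blast
  note \<phi>H = has_H_grad_test_fun[OF \<phi>(1)]
  obtain C where C: "C \<ge> 0" "\<And>v G w K. AE x in lborel. norm (form_dens A a v G w K x) \<le> C * sqrt (H_dens v G x) * sqrt (H_dens w K x)"
    by (rule form_dens_boundE) blast
  note [measurable] = has_H_grad_measurable[OF v] has_H_grad_measurable[OF w] test_fun_measurable[OF \<phi>(1)]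
  define g where "g u x = v x * cnj (u x) * complex_of_real (exp (- (norm x)\<^sup>2 / 4))" for u :: "real^'n \<Rightarrow> complex" and x
  define E where "E n x = (form_dens A a v G (\<phi> n) (grad (\<phi> n)) x - \<gamma> * g (\<phi> n) x) - (form_dens A a v G w K x - \<gamma> * g w x)" for n x
  have "(\<lambda>n. integral\<^sup>L lborel (E n)) \<longlonglongrightarrow> 0"
  proof (rule integral_tendsto_zero_Cauchy_Schwarz[where C = "C + norm \<gamma>" and a = "H_dens v G" and
        b = "\<lambda>n. H_dens (\<lambda>x. \<phi> n x - w x) (\<lambda>x. grad (\<phi> n) x - K x)"])
    show "(\<integral>\<^sup>+x. ennreal (H_dens v G x) \<partial>lborel) < \<infinity>"
      using H_norm_sq_finite[OF v] by (simp add: H_norm_sq_eq)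
    show "(\<lambda>n. \<integral>\<^sup>+x. ennreal (H_dens (\<lambda>x. \<phi> n x - w x) (\<lambda>x. grad (\<phi> n) x - K x) x) \<partial>lborel) \<longlonglongrightarrow> 0"
      using \<phi>(2) unfolding H_norm_sq_eq .
    show "AE x in lborel. norm (E n x) \<le> (C + norm \<gamma>) * sqrt (H_dens v G x) * sqrt (H_dens (\<lambda>x. \<phi> n x - w x) (\<lambda>x. grad (\<phi> n) x - K x) x)" for n
      using C(2)[of v G "\<lambda>x. \<phi> n x - w x" "\<lambda>x. grad (\<phi> n) x - K x"]
    proof eventually_elim
      case (elim x)
      have "E n x = form_dens A a v G (\<lambda>x. \<phi> n x - w x) (\<lambda>x. grad (\<phi> n) x - K x) x - \<gamma> * g (\<lambda>x. \<phi> n x - w x) x"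
        unfolding form_dens_diff_right[symmetric] by (simp add: E_def g_def algebra_simps)
      then have "norm (E n x) \<le> norm (form_dens A a v G (\<lambda>x. \<phi> n x - w x) (\<lambda>x. grad (\<phi> n) x - K x) x) + norm \<gamma> * norm (g (\<lambda>x. \<phi> n x - w x) x)"
        by (metis norm_triangle_ineq4 norm_mult)
      also have "\<dots> \<le> C * sqrt (H_dens v G x) * sqrt (H_dens (\<lambda>x. \<phi> n x - w x) (\<lambda>x. grad (\<phi> n) x - K x) x) +
          norm \<gamma> * (sqrt (H_dens v G x) * sqrt (H_dens (\<lambda>x. \<phi> n x - w x) (\<lambda>x. grad (\<phi> n) x - K x) x))"
        unfolding g_def by (intro add_mono elim mult_left_mono gauss_dens_le) auto
      finally show ?case by (simp add: algebra_simps)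
    qed
  qed (use C in \<open>auto simp: H_dens_nonneg intro!: H_dens_measurable\<close>)
  moreover have "integral\<^sup>L lborel (E n) = - (L_op A a v w - \<gamma> * gauss_inner v w)" for n
  proof -
    have i: "integrable lborel (\<lambda>x. form_dens A a v G u L x - \<gamma> * g u x)"
      "(\<integral>x. form_dens A a v G u L x - \<gamma> * g u x \<partial>lborel) = (\<integral>x. form_dens A a v G u L x \<partial>lborel) - \<gamma> * gauss_inner v u"
      if u: "has_H_grad u L" for u L
    proof -
      have 1: "integrable lborel (form_dens A a v G u L)" by (rule integrable_form_dens[OF v u])
      have 2: "integrable lborel (\<lambda>x. \<gamma> * g u x)"
        unfolding g_def by (intro integrable_mult_right integrable_gauss_dens[OF v u])
      show "integrable lborel (\<lambda>x. form_dens A a v G u L x - \<gamma> * g u x)"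
        using 1 2 by (rule Bochner_Integration.integrable_diff)
      show "(\<integral>x. form_dens A a v G u L x - \<gamma> * g u x \<partial>lborel) = (\<integral>x. form_dens A a v G u L x \<partial>lborel) - \<gamma> * gauss_inner v u"
        using Bochner_Integration.integral_diff[OF 1 2] by (simp add: gauss_inner_def g_def)
    qed
    have "integral\<^sup>L lborel (E n) = (\<integral>x. form_dens A a v G (\<phi> n) (grad (\<phi> n)) x - \<gamma> * g (\<phi> n) x \<partial>lborel) -
        (\<integral>x. form_dens A a v G w K x - \<gamma> * g w x \<partial>lborel)"
      unfolding E_def by (rule Bochner_Integration.integral_diff[OF i(1)[OF \<phi>H] i(1)[OF w]])
    then show ?thesis
      unfolding i(2)[OF \<phi>H] i(2)[OF w] test[OF \<phi>(1)] L_op_eq[OF v w] by simp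
  qed
  ultimately show "L_op A a v w = \<gamma> * gauss_inner v w" by (simp add: LIMSEQ_const_iff)
qed

end

section \<open>Separated eigenfunctions\<close>

text \<open>Real directions viewed as complex vectors, so that radial components can be taken with
  \<open>cdot\<close>.\<close>

definition cvec :: "real^'n \<Rightarrow> complex^'n" where
  "cvec \<theta> = (\<chi> i. complex_of_real (\<theta> $ i))"

lemma cvec_nth [simp]: "cvec \<theta> $ i = complex_of_real (\<theta> $ i)"
  by (simp add: cvec_def)

lemma norm_cvec: "norm (cvec \<theta>) = norm \<theta>"
  by (simp add: norm_vec_def)

lemma cdot_cvec_self: "cdot (cvec \<theta>) (cvec \<theta>) = complex_of_real ((norm \<theta>)\<^sup>2)"
  by (simp add: cdot_def power2_norm_eq_inner inner_vec_def)

lemma cdot_cvec: "cdot u (cvec \<theta>) = (\<Sum>i\<in>UNIV. (\<theta> $ i) *\<^sub>R (u $ i))"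
  by (simp add: cdot_def scaleR_conv_of_real mult.commute)

lemma cvec_continuous: "continuous_on S cvec"
  unfolding cvec_def[abs_def] by (intro continuous_intros)

lemma cdot_continuous:
  "continuous_on S f \<Longrightarrow> continuous_on S g \<Longrightarrow> continuous_on S (\<lambda>x. cdot (f x) (g x))"
  unfolding cdot_def by (intro continuous_intros)

lemma cdot_diff_left: "cdot (u - v) w = cdot u w - cdot v w"
  by (simp add: cdot_def left_diff_distrib sum_subtractf)

text \<open>Gradients of smooth functions are tangential, so the radial component of G has the same
  modulus as that of the error against any approximant. Its norm therefore lies below every term of
  a sequence tending to 0.\<close>

lemma H1_grad_tangential:
  fixes u :: "real^'n \<Rightarrow> complex"
  assumes u: "has_H1_sphere_grad u G"
  shows "AE \<theta> in sphere_measure. cdot (G \<theta>) (cvec \<theta>) = 0"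
proof -
  obtain \<phi> where \<phi>: "\<And>n::nat. smooth_sphere (\<phi> n)"
    "(\<lambda>n. S_norm_sq (\<lambda>x. \<phi> n x - u x) (\<lambda>x. sphere_grad (\<phi> n) x - G x)) \<longlonglongrightarrow> 0"
    using u by (rule has_H1_sphere_gradE) blast
  note [measurable] = has_H1_sphere_grad_measurable[OF u]
  have [measurable]: "cvec \<in> borel_measurable sphere_measure"
    by (rule borel_measurable_sphere_continuous[OF cvec_continuous])
  let ?t = "\<lambda>\<theta>. cdot (G \<theta>) (cvec \<theta>)"
  have "(\<integral>\<^sup>+\<theta>. ennreal ((norm (?t \<theta>))\<^sup>2) \<partial>sphere_measure) \<le> S_norm_sq (\<lambda>x. \<phi> n x - u x) (\<lambda>x. sphere_grad (\<phi> n) x - G x)" for n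
    unfolding S_norm_sq_def
  proof (intro nn_integral_mono ennreal_leI)
    fix \<theta> :: "real^'n" assume "\<theta> \<in> space sphere_measure"
    then have \<theta>: "norm \<theta> = 1" by simp
    have "cdot (sphere_grad (\<phi> n) \<theta>) (cvec \<theta>) = 0"
      unfolding cdot_cvec by (rule sphere_grad_tangential[OF \<phi>(1) \<theta>])
    then have "norm (?t \<theta>) = norm (cdot (sphere_grad (\<phi> n) \<theta> - G \<theta>) (cvec \<theta>))"
      by (simp add: cdot_diff_left)
    also have "\<dots> \<le> norm (sphere_grad (\<phi> n) \<theta> - G \<theta>)"
      using norm_cdot_le[of "sphere_grad (\<phi> n) \<theta> - G \<theta>" "cvec \<theta>"] \<theta> by (simp add: norm_cvec)
    finally have "(norm (?t \<theta>))\<^sup>2 \<le> (norm (sphere_grad (\<phi> n) \<theta> - G \<theta>))\<^sup>2" by (intro power_mono) auto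
    then show "(norm (?t \<theta>))\<^sup>2 \<le> (norm (sphere_grad (\<phi> n) \<theta> - G \<theta>))\<^sup>2 + (norm (\<phi> n \<theta> - u \<theta>))\<^sup>2"
      by (smt (verit) zero_le_power2)
  qed
  then have "(\<integral>\<^sup>+\<theta>. ennreal ((norm (?t \<theta>))\<^sup>2) \<partial>sphere_measure) \<le> 0"
    by (intro LIMSEQ_le_const[OF \<phi>(2)]) auto
  then have "(\<integral>\<^sup>+\<theta>. ennreal ((norm (?t \<theta>))\<^sup>2) \<partial>sphere_measure) = 0" by simp
  then have "AE \<theta> in sphere_measure. ennreal ((norm (?t \<theta>))\<^sup>2) = 0"
    by (subst (asm) nn_integral_0_iff_AE) auto
  then show ?thesis by eventually_elim (simp add: ennreal_eq_0_iff)
qed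

text \<open>The derivative of y -> r y/|y| at a unit vector \<theta> is r times the orthogonal
  projection onto the complement of \<theta>.\<close>

lemma sphere_grad_slice:
  fixes \<phi> :: "real^'n \<Rightarrow> complex"
  assumes \<phi>: "smooth_on UNIV \<phi>" and \<theta>: "norm \<theta> = 1"
  shows "sphere_grad (\<lambda>\<theta>. \<phi> (r *\<^sub>R \<theta>)) \<theta> $ i =
     complex_of_real r * (grad \<phi> (r *\<^sub>R \<theta>) $ i - cdot (grad \<phi> (r *\<^sub>R \<theta>)) (cvec \<theta>) * complex_of_real (\<theta> $ i))"
proof -
  let ?D = "frechet_derivative \<phi> (at (r *\<^sub>R \<theta>))"
  have n: "\<theta> \<noteq> 0" using \<theta> by auto
  have "((\<lambda>y. (r * inverse (norm y)) *\<^sub>R y) has_derivative (\<lambda>h. r *\<^sub>R (h - (h \<bullet> \<theta>) *\<^sub>R \<theta>))) (at \<theta>)"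
  proof -
    have "(norm has_derivative (\<lambda>h. h \<bullet> \<theta>)) (at \<theta>)"
      using has_derivative_norm[OF n] \<theta> by (simp add: sgn_div_norm)
    then show ?thesis
      using n \<theta> by (auto intro!: derivative_eq_intros simp: algebra_simps)
  qed
  moreover have "(\<lambda>y::real^'n. (r * inverse (norm y)) *\<^sub>R y) = (\<lambda>y. r *\<^sub>R sgn y)"
    by (simp add: sgn_div_norm)
  ultimately have s: "((\<lambda>y. r *\<^sub>R sgn y) has_derivative (\<lambda>h. r *\<^sub>R (h - (h \<bullet> \<theta>) *\<^sub>R \<theta>))) (at \<theta>)" by simp
  have D: "(\<phi> has_derivative ?D) (at (r *\<^sub>R \<theta>))"
    by (rule smooth_on_has_derivative[OF open_UNIV \<phi> UNIV_I])
  have lin: "linear ?D" using D has_derivative_linear by blast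
  have "sgn \<theta> = \<theta>" using \<theta> by (simp add: sgn_div_norm)
  then have "((\<lambda>y. \<phi> (r *\<^sub>R sgn y)) has_derivative (\<lambda>h. ?D (r *\<^sub>R (h - (h \<bullet> \<theta>) *\<^sub>R \<theta>)))) (at \<theta>)"
    using has_derivative_compose[OF s, of \<phi> ?D] D by simp
  from partial_deriv_eq[OF this, of i]
  have "partial_deriv i (\<lambda>y. \<phi> (r *\<^sub>R sgn y)) \<theta> = ?D (r *\<^sub>R (axis i 1 - (\<theta> $ i) *\<^sub>R \<theta>))"
    by (simp add: inner_axis')
  also have "\<dots> = r *\<^sub>R (?D (axis i 1) - (\<theta> $ i) *\<^sub>R ?D \<theta>)"
    by (simp add: linear_scale[OF lin] linear_diff[OF lin])
  also have "?D \<theta> = cdot (grad \<phi> (r *\<^sub>R \<theta>)) (cvec \<theta>)"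
    unfolding cdot_cvec frechet_derivative_eq_sum_partial[OF D, of \<theta>] by (simp add: grad_def)
  finally show ?thesis
    by (simp add: sphere_grad_def grad_def partial_deriv_def scaleR_conv_of_real mult.commute)
qed

text \<open>On a finite measure square integrability implies integrability, by t <= t^2 + 1.\<close>

lemma sphere_L1:
  fixes u :: "real^'n \<Rightarrow> complex"
  assumes u: "has_H1_sphere_grad u G"
  shows "integrable sphere_measure u" "integrable sphere_measure G"
proof -
  interpret S: finite_measure "sphere_measure :: (real^'n) measure" by (rule finite_measure_sphere)
  note [measurable] = has_H1_sphere_grad_measurable[OF u]
  have i: "integrable sphere_measure (\<lambda>\<theta>. ((norm (G \<theta>))\<^sup>2 + (norm (u \<theta>))\<^sup>2) + 1)"
  proof (rule Bochner_Integration.integrable_add)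
    show "integrable sphere_measure (\<lambda>\<theta>. (norm (G \<theta>))\<^sup>2 + (norm (u \<theta>))\<^sup>2)"
      using S_norm_sq_finite[OF u] unfolding S_norm_sq_def by (intro integrableI_nonneg) auto
  qed simp
  have le: "t \<le> t\<^sup>2 + 1" if "t \<ge> 0" for t :: real
    using sum_squares_bound[of t 1] that by (simp only: power_one mult_1_right)
  show "integrable sphere_measure u"
  proof (rule Bochner_Integration.integrable_bound[OF i])
    have "norm (u \<theta>) \<le> norm ((norm (G \<theta>))\<^sup>2 + (norm (u \<theta>))\<^sup>2 + 1)" for \<theta>
    proof -
      have "norm (u \<theta>) \<le> (norm (G \<theta>))\<^sup>2 + (norm (u \<theta>))\<^sup>2 + 1"
        using le[of "norm (u \<theta>)"] zero_le_power2[of "norm (G \<theta>)"] norm_ge_zero[of "u \<theta>"] by linarith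
      then show ?thesis by simp
    qed
    then show "AE \<theta> in sphere_measure. norm (u \<theta>) \<le> norm ((norm (G \<theta>))\<^sup>2 + (norm (u \<theta>))\<^sup>2 + 1)" by simp
  qed simp
  show "integrable sphere_measure G"
  proof (rule Bochner_Integration.integrable_bound[OF i])
    have "norm (G \<theta>) \<le> norm ((norm (G \<theta>))\<^sup>2 + (norm (u \<theta>))\<^sup>2 + 1)" for \<theta>
    proof -
      have "norm (G \<theta>) \<le> (norm (G \<theta>))\<^sup>2 + (norm (u \<theta>))\<^sup>2 + 1"
        using le[of "norm (G \<theta>)"] zero_le_power2[of "norm (u \<theta>)"] norm_ge_zero[of "G \<theta>"] by linarith
      then show ?thesis by simp
    qed
    then show "AE \<theta> in sphere_measure. norm (G \<theta>) \<le> norm ((norm (G \<theta>))\<^sup>2 + (norm (u \<theta>))\<^sup>2 + 1)" by simp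
  qed simp
qed

text \<open>Integration along rays comes first here, the order in which an exact radial derivative
  can be used.\<close>

lemma integral_polar_swap:
  fixes f :: "real^'n \<Rightarrow> 'b::{banach, second_countable_topology}"
  assumes "integrable lborel f"
  shows "(\<integral>x. f x \<partial>lborel) = (\<integral>\<theta>. \<integral>r. f (r *\<^sub>R \<theta>) \<partial>radial_measure CARD('n) \<partial>sphere_measure)"
proof -
  interpret pair_sigma_finite "radial_measure CARD('n)" "sphere_measure :: (real^'n) measure"
    by (rule polar_pair_sigma_finite)
  have f: "f \<in> borel_measurable borel" using assms by auto
  have i: "integrable (radial_measure CARD('n) \<Otimes>\<^sub>M sphere_measure) (\<lambda>(r, \<theta>). f (r *\<^sub>R \<theta>))"
    using integrable_polar[OF f] assms by simp
  show ?thesis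
    unfolding integral_polar(1)[OF assms] by (rule Fubini_integral[OF i, symmetric])
qed

lemma integral_radial:
  fixes f :: "real \<Rightarrow> 'b::{banach, second_countable_topology}"
  assumes "f \<in> borel_measurable borel"
  shows "(\<integral>r. f r \<partial>radial_measure N) = (\<integral>r. (indicator {0<..} r * r ^ (N - 1)) *\<^sub>R f r \<partial>lborel)"
  unfolding radial_measure_def
  by (rule integral_density) (use assms in \<open>auto simp: indicator_def\<close>)

text \<open>The \<open>\<kappa>\<close> below is what remains of the eigenvalue equation after the angular operator
  has been evaluated; on each ray \<open>r\<^sup>N\<^sup>-\<^sup>1 \<kappa>\<close> is an exact derivative, by the radial equation.\<close>

lemma radial_exact_integral_zero:
  fixes \<phi> :: "real^'n \<Rightarrow> complex" and \<rho> \<rho>' \<rho>'' :: "real \<Rightarrow> real"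
  assumes \<phi>: "test_fun \<phi>" and \<theta>: "norm \<theta> = 1"
    and der: "\<And>q. q > 0 \<Longrightarrow> (\<rho> has_real_derivative \<rho>' q) (at q)"
    and der2: "\<And>q. q > 0 \<Longrightarrow> (\<rho>' has_real_derivative \<rho>'' q) (at q)"
    and [measurable]: "\<rho> \<in> borel_measurable borel" "\<rho>' \<in> borel_measurable borel"
    and ode: "\<And>q. q > 0 \<Longrightarrow> 4 * q * \<rho>'' q + (2 * real CARD('n) - q) * \<rho>' q - \<mu> * \<rho> q / q + \<gamma> * \<rho> q = 0"
  shows "(\<integral>r. complex_of_real (exp (- r\<^sup>2 / 4)) *
      (complex_of_real (2 * r * \<rho>' (r\<^sup>2)) * cnj (cdot (grad \<phi> (r *\<^sub>R \<theta>)) (cvec \<theta>)) +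
       complex_of_real (\<mu> * \<rho> (r\<^sup>2) / r\<^sup>2 - \<gamma> * \<rho> (r\<^sup>2)) * cnj (\<phi> (r *\<^sub>R \<theta>))) \<partial>radial_measure CARD('n)) = 0"
    (is "(\<integral>r. ?k r \<partial>_) = 0")
proof -
  obtain c d where cd: "0 < c" "c \<le> d" "\<And>x. norm x < c \<or> d < norm x \<Longrightarrow> \<phi> x = 0"
    "\<And>x. norm x < c \<or> d < norm x \<Longrightarrow> grad \<phi> x = 0"
    by (rule test_fun_supportE[OF \<phi>]) (rule that; assumption)
  note [measurable] = test_fun_measurable[OF \<phi>]
  define N where "N = CARD('n)"
  have N: "N \<ge> 1" by (simp add: N_def Suc_le_eq)
  \<comment> \<open>Margins on both sides of the support annulus, so that the boundary terms of the
    antiderivative vanish.\<close>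
  define a' where "a' = c / 2"
  define b' where "b' = d + 1"
  have ab: "0 < a'" "a' \<le> b'" "a' < c" "d < b'" using cd by (auto simp: a'_def b'_def)
  \<comment> \<open>The flux r^(N-1) exp(-r^2/4) times the radial derivative 2 r \<rho>'(r^2),
    paired with the test function on the ray.\<close>
  define F where "F r = complex_of_real (2 * r ^ N * exp (- r\<^sup>2 / 4) * \<rho>' (r\<^sup>2)) * cnj (\<phi> (r *\<^sub>R \<theta>))" for r
  define f where "f r = complex_of_real (r ^ (N - 1)) * ?k r" for r
  have km: "?k \<in> borel_measurable borel"
    by measurable
  have der_line: "((\<lambda>r. cnj (\<phi> (r *\<^sub>R \<theta>))) has_vector_derivative cnj (cdot (grad \<phi> (r *\<^sub>R \<theta>)) (cvec \<theta>))) (at r)" for r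
  proof -
    have "((\<lambda>t. t *\<^sub>R \<theta>) has_derivative (\<lambda>s. s *\<^sub>R \<theta>)) (at r)"
      by (auto intro!: derivative_eq_intros)
    from has_derivative_compose[OF this smooth_on_has_derivative[OF open_UNIV test_fun_smooth[OF \<phi>] UNIV_I]]
    have "((\<lambda>t. \<phi> (t *\<^sub>R \<theta>)) has_derivative (\<lambda>s. frechet_derivative \<phi> (at (r *\<^sub>R \<theta>)) (s *\<^sub>R \<theta>))) (at r)" .
    moreover have D: "(\<phi> has_derivative frechet_derivative \<phi> (at (r *\<^sub>R \<theta>))) (at (r *\<^sub>R \<theta>))"
      by (rule smooth_on_has_derivative[OF open_UNIV test_fun_smooth[OF \<phi>] UNIV_I])
    moreover have "frechet_derivative \<phi> (at (r *\<^sub>R \<theta>)) (s *\<^sub>R \<theta>) = s *\<^sub>R cdot (grad \<phi> (r *\<^sub>R \<theta>)) (cvec \<theta>)" for s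
    proof -
      have "linear (frechet_derivative \<phi> (at (r *\<^sub>R \<theta>)))" using D has_derivative_linear by blast
      then show ?thesis
        unfolding cdot_cvec by (simp add: linear_scale frechet_derivative_eq_sum_partial[OF D, of \<theta>] grad_def)
    qed
    ultimately have "((\<lambda>t. \<phi> (t *\<^sub>R \<theta>)) has_vector_derivative cdot (grad \<phi> (r *\<^sub>R \<theta>)) (cvec \<theta>)) (at r)"
      by (simp add: has_vector_derivative_def)
    then show ?thesis by (rule has_vector_derivative_cnj)
  qed
  \<comment> \<open>After the product rule the radial equation trades \<rho>'' and \<rho>' for
    \<rho>.\<close>
  have der_w: "((\<lambda>r. 2 * r ^ N * exp (- r\<^sup>2 / 4) * \<rho>' (r\<^sup>2)) has_real_derivative
       r ^ (N - 1) * exp (- r\<^sup>2 / 4) * (\<mu> * \<rho> (r\<^sup>2) / r\<^sup>2 - \<gamma> * \<rho> (r\<^sup>2))) (at r)" if r: "r > 0" for r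
  proof -
    have d2: "((\<lambda>r. \<rho>' (r\<^sup>2)) has_real_derivative \<rho>'' (r\<^sup>2) * (2 * r)) (at r)"
      using r by (intro DERIV_chain2[OF der2]) (auto intro!: derivative_eq_intros)
    have "((\<lambda>r. 2 * r ^ N * exp (- r\<^sup>2 / 4) * \<rho>' (r\<^sup>2)) has_real_derivative
       (2 * (real N * r ^ (N - 1)) * exp (- r\<^sup>2 / 4) + 2 * r ^ N * (exp (- r\<^sup>2 / 4) * (- (r / 2)))) * \<rho>' (r\<^sup>2) +
       2 * r ^ N * exp (- r\<^sup>2 / 4) * (\<rho>'' (r\<^sup>2) * (2 * r))) (at r)"
      using N by (auto intro!: derivative_eq_intros d2)
    moreover have "(2 * (real N * r ^ (N - 1)) * exp (- r\<^sup>2 / 4) + 2 * r ^ N * (exp (- r\<^sup>2 / 4) * (- (r / 2)))) * \<rho>' (r\<^sup>2) +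
       2 * r ^ N * exp (- r\<^sup>2 / 4) * (\<rho>'' (r\<^sup>2) * (2 * r)) =
       r ^ (N - 1) * exp (- r\<^sup>2 / 4) * (4 * r\<^sup>2 * \<rho>'' (r\<^sup>2) + (2 * real N - r\<^sup>2) * \<rho>' (r\<^sup>2))"
    proof -
      have "r ^ N = r ^ (N - 1) * r" using N by (cases N) auto
      then show ?thesis by (simp add: power2_eq_square algebra_simps)
    qed
    moreover have "4 * r\<^sup>2 * \<rho>'' (r\<^sup>2) + (2 * real N - r\<^sup>2) * \<rho>' (r\<^sup>2) = \<mu> * \<rho> (r\<^sup>2) / r\<^sup>2 - \<gamma> * \<rho> (r\<^sup>2)"
      using ode[of "r\<^sup>2"] r unfolding N_def[symmetric] by simp
    ultimately show ?thesis by simp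
  qed
  have derF: "(F has_vector_derivative f r) (at r)" if r: "r > 0" for r
  proof -
    have "((\<lambda>r. complex_of_real (2 * r ^ N * exp (- r\<^sup>2 / 4) * \<rho>' (r\<^sup>2))) has_vector_derivative
       complex_of_real (r ^ (N - 1) * exp (- r\<^sup>2 / 4) * (\<mu> * \<rho> (r\<^sup>2) / r\<^sup>2 - \<gamma> * \<rho> (r\<^sup>2)))) (at r)"
      using der_w[OF r] by (intro has_vector_derivative_of_real) (simp add: has_real_derivative_iff_has_vector_derivative)
    from has_vector_derivative_mult[OF this der_line]
    have "(F has_vector_derivative
       complex_of_real (2 * r ^ N * exp (- r\<^sup>2 / 4) * \<rho>' (r\<^sup>2)) * cnj (cdot (grad \<phi> (r *\<^sub>R \<theta>)) (cvec \<theta>)) +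
       complex_of_real (r ^ (N - 1) * exp (- r\<^sup>2 / 4) * (\<mu> * \<rho> (r\<^sup>2) / r\<^sup>2 - \<gamma> * \<rho> (r\<^sup>2))) * cnj (\<phi> (r *\<^sub>R \<theta>))) (at r)"
      unfolding F_def[abs_def] .
    moreover have "complex_of_real (2 * r ^ N * exp (- r\<^sup>2 / 4) * \<rho>' (r\<^sup>2)) * cnj (cdot (grad \<phi> (r *\<^sub>R \<theta>)) (cvec \<theta>)) +
       complex_of_real (r ^ (N - 1) * exp (- r\<^sup>2 / 4) * (\<mu> * \<rho> (r\<^sup>2) / r\<^sup>2 - \<gamma> * \<rho> (r\<^sup>2))) * cnj (\<phi> (r *\<^sub>R \<theta>)) = f r"
    proof -
      have "r ^ N = r ^ (N - 1) * r" using N by (cases N) auto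
      then show ?thesis unfolding f_def by (simp only: of_real_mult distrib_left mult_ac)
    qed
    ultimately show ?thesis by simp
  qed
  have cont: "continuous_on {a'..b'} f"
  proof -
    have c1: "continuous_on {0<..} \<rho>" "continuous_on {0<..} \<rho>'"
      using der der2 by (auto intro!: continuous_at_imp_continuous_on DERIV_isCont)
    have c2: "continuous_on {a'..b'} (\<lambda>r. \<rho> (r\<^sup>2))" "continuous_on {a'..b'} (\<lambda>r. \<rho>' (r\<^sup>2))"
      using ab by (auto intro!: continuous_on_compose2[OF c1(1)] continuous_on_compose2[OF c1(2)] continuous_intros)
    have c3: "continuous_on {a'..b'} (\<lambda>r. \<phi> (r *\<^sub>R \<theta>))" "continuous_on {a'..b'} (\<lambda>r. grad \<phi> (r *\<^sub>R \<theta>))"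
      by (auto intro!: continuous_on_compose2[OF test_fun_continuous[OF \<phi>]] continuous_on_compose2[OF test_fun_grad_continuous[OF \<phi>]] continuous_intros)
    show ?thesis
      unfolding f_def using ab by (intro continuous_intros c2 c3 cdot_continuous) auto
  qed
  have "(\<integral>r. ?k r \<partial>radial_measure N) = (\<integral>r. (indicator {0<..} r * r ^ (N - 1)) *\<^sub>R ?k r \<partial>lborel)"
    by (rule integral_radial[OF km])
  also have "\<dots> = (\<integral>r. indicator {a'..b'} r *\<^sub>R f r \<partial>lborel)"
  proof (rule Bochner_Integration.integral_cong[OF refl])
    fix r
    show "(indicator {0<..} r * r ^ (N - 1)) *\<^sub>R ?k r = indicator {a'..b'} r *\<^sub>R f r"
    proof (cases "r \<in> {a'..b'}")
      case True
      then show ?thesis using ab by (simp add: f_def scaleR_conv_of_real)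
    next
      case False
      show ?thesis
      proof (cases "r > 0")
        case True
        then have "norm (r *\<^sub>R \<theta>) < c \<or> d < norm (r *\<^sub>R \<theta>)" using False ab \<theta> by auto
        then have "\<phi> (r *\<^sub>R \<theta>) = 0" "grad \<phi> (r *\<^sub>R \<theta>) = 0" using cd(3,4) by auto
        then show ?thesis using False by (simp add: cdot_def)
      qed (use False in simp)
    qed
  qed
  also have "\<dots> = F b' - F a'"
  proof (rule integral_FTC_atLeastAtMost[OF ab(2) _ cont])
    fix r assume "a' \<le> r" "r \<le> b'"
    then show "(F has_vector_derivative f r) (at r within {a'..b'})"
      using derF[of r] ab by (auto intro: has_vector_derivative_at_within)
  qed
  also have "\<dots> = 0"
    using cd(3)[of "a' *\<^sub>R \<theta>"] cd(3)[of "b' *\<^sub>R \<theta>"] ab \<theta> by (simp add: F_def)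
  finally show ?thesis by (simp add: N_def)
qed

text \<open>u is merely integrable on the sphere; the product formula in polar coordinates separates
  it from the bounded factor with bounded support.\<close>

lemma integrable_sphere_times_bounded_support:
  fixes u :: "real^'n \<Rightarrow> complex" and k :: "real^'n \<Rightarrow> complex"
  assumes u: "integrable sphere_measure u" and [measurable]: "k \<in> borel_measurable borel"
    and k: "\<And>x. norm (k x) \<le> B * indicator (cball 0 b) x"
  shows "integrable lborel (\<lambda>x. u (sgn x) * k x)"
proof (rule integrableI_bounded)
  have um: "u \<in> borel_measurable sphere_measure" using u by auto
  have [measurable]: "(\<lambda>x. u (sgn x)) \<in> borel_measurable borel"
    by (rule borel_measurable_compose_sgn[OF um]) simp
  show "(\<lambda>x. u (sgn x) * k x) \<in> borel_measurable lborel" by simp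
  have "(\<integral>\<^sup>+x. ennreal (norm (u (sgn x) * k x)) \<partial>lborel) \<le>
     (\<integral>\<^sup>+x. ennreal (max B 0) * indicator {..b} (norm x) * ennreal (norm (u (sgn x))) \<partial>lborel)"
  proof (rule nn_integral_mono)
    fix x
    have "norm (k x) \<le> max B 0 * indicator {..b} (norm x)"
      using k[of x] by (auto simp: indicator_def split: if_splits)
    from mult_right_mono[OF this, of "norm (u (sgn x))"]
    have "norm (u (sgn x) * k x) \<le> max B 0 * indicator {..b} (norm x) * norm (u (sgn x))"
      by (simp add: norm_mult mult.commute)
    then have "ennreal (norm (u (sgn x) * k x)) \<le> ennreal (max B 0 * indicator {..b} (norm x) * norm (u (sgn x)))"
      by (rule ennreal_leI)
    also have "\<dots> = ennreal (max B 0) * indicator {..b} (norm x) * ennreal (norm (u (sgn x)))"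
      by (auto simp: ennreal_mult indicator_def)
    finally show "ennreal (norm (u (sgn x) * k x)) \<le> ennreal (max B 0) * indicator {..b} (norm x) * ennreal (norm (u (sgn x)))" .
  qed
  also have "\<dots> = (\<integral>\<^sup>+r. ennreal (max B 0) * indicator {..b} r \<partial>radial_measure CARD('n)) * (\<integral>\<^sup>+\<theta>. ennreal (norm (u \<theta>)) \<partial>sphere_measure)"
    by (rule nn_integral_polar_prod[of "\<lambda>r. ennreal (max B 0) * indicator {..b} r" "\<lambda>\<theta>. ennreal (norm (u \<theta>))"])
       (use um in measurable)
  also have "\<dots> < \<infinity>"
  proof -
    have "emeasure (radial_measure CARD('n)) {..b} \<le> emeasure (radial_measure CARD('n)) {..<\<bar>b\<bar> + 1}"
      by (intro emeasure_mono) auto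
    also have "\<dots> < top"
      by (subst emeasure_radial_lessThan) (auto simp: Suc_le_eq)
    finally show ?thesis
      using u by (simp add: nn_integral_cmult_indicator ennreal_mult_less_top integrable_iff_bounded)
  qed
  finally show "(\<integral>\<^sup>+x. ennreal (norm (u (sgn x) * k x)) \<partial>lborel) < \<infinity>" .
qed

context magnetic
begin

text \<open>On each sphere |x| = r the form splits into a radial and a tangential part without mixed
  terms, because the angular gradients and A are tangential. The tangential part is \<rho>(r^2)/r^2
  times the angular form of u and the slice of the test function, so the angular equation evaluates
  it with \<mu>. The remainder beyond \<gamma> times the scalar product integrates to 0 along every
  ray.\<close>

lemma polar_L_eigen_eq:
  fixes \<rho> \<rho>' \<rho>'' :: "real \<Rightarrow> real"
  assumes u: "T_eigenfunction A a \<mu> u"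
    and smooth: "smooth_on (- {0::real^'n}) (\<lambda>x. complex_of_real (\<rho> ((norm x)\<^sup>2)))"
    and der: "\<And>q. q > 0 \<Longrightarrow> (\<rho> has_real_derivative \<rho>' q) (at q)"
    and der2: "\<And>q. q > 0 \<Longrightarrow> (\<rho>' has_real_derivative \<rho>'' q) (at q)"
    and [measurable]: "\<rho> \<in> borel_measurable borel" "\<rho>' \<in> borel_measurable borel"
    and fin: "(\<integral>\<^sup>+r. ennreal (radial_dens \<rho> \<rho>' (r\<^sup>2)) \<partial>radial_measure CARD('n)) < \<infinity>"
    and ode: "\<And>q. q > 0 \<Longrightarrow> 4 * q * \<rho>'' q + (2 * real CARD('n) - q) * \<rho>' q - \<mu> * \<rho> q / q + \<gamma> * \<rho> q = 0"
  shows "L_eigen_eq A a (complex_of_real \<gamma>) (\<lambda>x. complex_of_real (\<rho> ((norm x)\<^sup>2)) * u (sgn x))"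
proof -
  define G where "G = H1_sphere_grad u"
  have "u \<in> H1_sphere" using u by (simp add: T_eigenfunction_def)
  then have uG: "has_H1_sphere_grad u G"
    unfolding H1_sphere_def G_def H1_sphere_grad_def by (auto intro: someI[of "has_H1_sphere_grad u"])
  define V where "V x = complex_of_real (\<rho> ((norm x)\<^sup>2)) * u (sgn x)" for x
  define GV where "GV = polar_grad \<rho> \<rho>' u G"
  have VG: "has_H_grad V GV"
    unfolding V_def[abs_def] GV_def by (rule has_H_grad_polar[OF uG smooth der _ _ fin]) auto
  note [measurable] = has_H1_sphere_grad_measurable[OF uG] A_measurable a_measurable
  obtain M where M: "M \<ge> 0" "\<And>\<theta>. norm \<theta> = 1 \<Longrightarrow> norm (A \<theta>) \<le> M" by (rule A_boundE) blast
  obtain ca where ca: "ca \<ge> 0" "AE \<theta> in sphere_measure. \<bar>a \<theta>\<bar> \<le> ca" by (rule a_boundE) blast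
  show ?thesis
    unfolding V_def[symmetric]
  proof (rule L_eigen_eq_test_funI[OF VG])
    fix \<phi> :: "real^'n \<Rightarrow> complex" assume \<phi>: "test_fun \<phi>"
    note [measurable] = test_fun_measurable[OF \<phi>]
    obtain c d where cd: "0 < c" "c \<le> d" "\<And>x. norm x < c \<or> d < norm x \<Longrightarrow> \<phi> x = 0"
      "\<And>x. norm x < c \<or> d < norm x \<Longrightarrow> grad \<phi> x = 0"
      by (rule test_fun_supportE[OF \<phi>]) (rule that; assumption)
    \<comment> \<open>u \<kappa> is the form density, after the angular evaluation, minus \<gamma>
      times the density of the scalar product.\<close>
    define \<kappa> where "\<kappa> x = complex_of_real (exp (- (norm x)\<^sup>2 / 4)) *
      (complex_of_real (2 * norm x * \<rho>' ((norm x)\<^sup>2)) * cnj (cdot (grad \<phi> x) (cvec (sgn x))) +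
       complex_of_real (\<mu> * \<rho> ((norm x)\<^sup>2) / (norm x)\<^sup>2 - \<gamma> * \<rho> ((norm x)\<^sup>2)) * cnj (\<phi> x))" for x
    have [measurable]: "(\<lambda>x. cvec (sgn x)) \<in> borel_measurable borel"
      by (rule measurable_compose[OF borel_measurable_sgn_vec borel_measurable_continuous_onI[OF cvec_continuous]])
    have \<kappa>m [measurable]: "\<kappa> \<in> borel_measurable borel"
      unfolding \<kappa>_def[abs_def] by measurable
    have \<kappa>c: "continuous_on (- {0}) \<kappa>"
    proof -
      have c1: "continuous_on {0<..} \<rho>" "continuous_on {0<..} \<rho>'"
        using der der2 by (auto intro!: continuous_at_imp_continuous_on DERIV_isCont)
      have c2: "continuous_on (- {0::real^'n}) (\<lambda>x. \<rho> ((norm x)\<^sup>2))" "continuous_on (- {0::real^'n}) (\<lambda>x. \<rho>' ((norm x)\<^sup>2))"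
        by (auto intro!: continuous_on_compose2[OF c1(1)] continuous_on_compose2[OF c1(2)] continuous_intros)
      have c3: "continuous_on (- {0}) \<phi>" "continuous_on (- {0}) (grad \<phi>)"
        using test_fun_continuous[OF \<phi>] test_fun_grad_continuous[OF \<phi>] continuous_on_subset by blast+
      have c4: "continuous_on (- {0::real^'n}) (\<lambda>x. cvec (sgn x))"
        unfolding sgn_div_norm[abs_def]
        by (auto intro!: continuous_on_compose2[OF cvec_continuous[of UNIV]] continuous_intros)
      show ?thesis
        unfolding \<kappa>_def by (intro continuous_intros c2 c3 c4 cdot_continuous) auto
    qed
    have \<kappa>0: "\<kappa> x = 0" if "norm x < c \<or> d < norm x" for x
      using cd(3,4)[OF that] by (simp add: \<kappa>_def cdot_def)
    have "compact (cball 0 d - ball (0::real^'n) c)" by (intro compact_diff) auto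
    moreover have "cball 0 d - ball (0::real^'n) c \<subseteq> - {0}" using cd by auto
    ultimately have "bounded (\<kappa> ` (cball 0 d - ball 0 c))"
      by (intro compact_imp_bounded compact_continuous_image continuous_on_subset[OF \<kappa>c])
    then obtain B where B: "\<forall>y\<in>\<kappa> ` (cball 0 d - ball 0 c). norm y \<le> B" unfolding bounded_iff by blast
    have \<kappa>b: "norm (\<kappa> x) \<le> max B 0 * indicator (cball 0 d) x" for x
    proof (cases "x \<in> cball 0 d - ball 0 c")
      case True
      then have "norm (\<kappa> x) \<le> B" using B by blast
      then show ?thesis using True by (simp add: le_max_iff_disj)
    next
      case False
      then have "\<kappa> x = 0" by (intro \<kappa>0) (auto simp: not_le not_less)
      then show ?thesis by simp
    qed
    have u\<kappa>: "integrable lborel (\<lambda>x. u (sgn x) * \<kappa> x)"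
      by (rule integrable_sphere_times_bounded_support[OF sphere_L1(1)[OF uG] \<kappa>m \<kappa>b])
    have u\<kappa>0: "(\<integral>x. u (sgn x) * \<kappa> x \<partial>lborel) = 0"
    proof -
      have "(\<integral>x. u (sgn x) * \<kappa> x \<partial>lborel) =
          (\<integral>\<theta>. \<integral>r. u (sgn (r *\<^sub>R \<theta>)) * \<kappa> (r *\<^sub>R \<theta>) \<partial>radial_measure CARD('n) \<partial>sphere_measure)"
        by (rule integral_polar_swap[OF u\<kappa>])
      also have "\<dots> = (\<integral>\<theta>. 0 \<partial>(sphere_measure :: (real^'n) measure))"
      proof (rule Bochner_Integration.integral_cong[OF refl])
        fix \<theta> :: "real^'n" assume "\<theta> \<in> space sphere_measure"
        then have \<theta>: "norm \<theta> = 1" by simp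
        let ?k = "\<lambda>r. complex_of_real (exp (- r\<^sup>2 / 4)) *
          (complex_of_real (2 * r * \<rho>' (r\<^sup>2)) * cnj (cdot (grad \<phi> (r *\<^sub>R \<theta>)) (cvec \<theta>)) +
           complex_of_real (\<mu> * \<rho> (r\<^sup>2) / r\<^sup>2 - \<gamma> * \<rho> (r\<^sup>2)) * cnj (\<phi> (r *\<^sub>R \<theta>)))"
        have um: "(\<lambda>x. u (sgn x)) \<in> borel_measurable borel"
          by (rule borel_measurable_compose_sgn) auto
        note [measurable] = um
        have "(\<integral>r. u (sgn (r *\<^sub>R \<theta>)) * \<kappa> (r *\<^sub>R \<theta>) \<partial>radial_measure CARD('n)) = (\<integral>r. u \<theta> * ?k r \<partial>radial_measure CARD('n))"
        proof (rule integral_cong_AE)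
          show "AE r in radial_measure CARD('n). u (sgn (r *\<^sub>R \<theta>)) * \<kappa> (r *\<^sub>R \<theta>) = u \<theta> * ?k r"
            using AE_radial_pos
          proof eventually_elim
            case (elim r)
            have "sgn (r *\<^sub>R \<theta>) = \<theta>" "norm (r *\<^sub>R \<theta>) = r" using elim \<theta> by (auto simp: sgn_scaleR sgn_div_norm)
            then show ?case by (simp add: \<kappa>_def)
          qed
        qed measurable
        also have "\<dots> = u \<theta> * (\<integral>r. ?k r \<partial>radial_measure CARD('n))" by simp
        also have "(\<integral>r. ?k r \<partial>radial_measure CARD('n)) = 0"
          by (rule radial_exact_integral_zero[OF \<phi> \<theta> der der2 _ _ ode]) auto
        finally show "(\<integral>r. u (sgn (r *\<^sub>R \<theta>)) * \<kappa> (r *\<^sub>R \<theta>) \<partial>radial_measure CARD('n)) = 0" by simp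
      qed
      finally show ?thesis by simp
    qed
    note \<phi>H = has_H_grad_test_fun[OF \<phi>]
    let ?g = "\<lambda>x. V x * cnj (\<phi> x) * complex_of_real (exp (- (norm x)\<^sup>2 / 4))"
    have gi: "integrable lborel ?g" by (rule integrable_gauss_dens[OF VG \<phi>H])
    define R where "R x = u (sgn x) * \<kappa> x + complex_of_real \<gamma> * ?g x" for x
    have Ri: "integrable lborel R"
      unfolding R_def by (intro Bochner_Integration.integrable_add u\<kappa> integrable_mult_right gi)
    have fi: "integrable lborel (form_dens A a V GV \<phi> (grad \<phi>))"
      by (rule integrable_form_dens[OF VG \<phi>H])
    have slice: "(\<integral>\<theta>. form_dens A a V GV \<phi> (grad \<phi>) (r *\<^sub>R \<theta>) \<partial>sphere_measure) = (\<integral>\<theta>. R (r *\<^sub>R \<theta>) \<partial>sphere_measure)"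
      if r: "r > 0" for r
    proof -
      \<comment> \<open>The slice of the test function at radius r, which serves as angular test
        function.\<close>
      define w where "w \<theta> = \<phi> (r *\<^sub>R \<theta>)" for \<theta>
      have ws: "smooth_sphere w"
        unfolding w_def by (rule smooth_sphere_slice[OF smooth_on_subset[OF test_fun_smooth[OF \<phi>]] r]) auto
      have wH: "has_H1_sphere_grad w (sphere_grad w)" by (rule has_H1_sphere_grad_smooth[OF ws])
      have wH': "has_H1_sphere_grad w (H1_sphere_grad w)"
        unfolding H1_sphere_grad_def by (rule someI[of "has_H1_sphere_grad w", OF wH])
      note [measurable] = has_H1_sphere_grad_measurable[OF wH] has_H1_sphere_grad_measurable[OF wH']
      define M1 where "M1 \<theta> = G \<theta> + (\<chi> i. \<i> * complex_of_real (A \<theta> $ i) * u \<theta>)" for \<theta>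
      define M2 where "M2 \<theta> = sphere_grad w \<theta> + (\<chi> i. \<i> * complex_of_real (A \<theta> $ i) * w \<theta>)" for \<theta>
      define t where "t \<theta> = cdot (M1 \<theta>) (M2 \<theta>) - complex_of_real (a \<theta>) * u \<theta> * cnj (w \<theta>)" for \<theta>
      have [measurable]: "t \<in> borel_measurable sphere_measure"
        unfolding t_def[abs_def] M1_def[abs_def] M2_def[abs_def] by measurable
      define dr where "dr \<theta> = cdot (grad \<phi> (r *\<^sub>R \<theta>)) (cvec \<theta>)" for \<theta>
      \<comment> \<open>The angular eigenvalue equation, with the chosen gradient of w replaced by
        the classical one.\<close>
      have T: "(\<integral>\<theta>. t \<theta> \<partial>sphere_measure) = complex_of_real \<mu> * (\<integral>\<theta>. u \<theta> * cnj (w \<theta>) \<partial>sphere_measure)"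
      proof -
        have "w \<in> H1_sphere" using wH unfolding H1_sphere_def by blast
        then have "T_form A a u w = complex_of_real \<mu> * L2_sphere_inner u w"
          using u unfolding T_eigenfunction_def by blast
        moreover have "T_form A a u w = (\<integral>\<theta>. t \<theta> \<partial>sphere_measure)"
          unfolding T_form_def
        proof (rule integral_cong_AE)
          show "(\<lambda>\<theta>. cdot (mag_sphere_grad A u \<theta>) (mag_sphere_grad A w \<theta>) - complex_of_real (a \<theta>) * u \<theta> * cnj (w \<theta>)) \<in> borel_measurable sphere_measure"
            unfolding mag_sphere_grad_def G_def[symmetric] by measurable
          show "AE \<theta> in sphere_measure. cdot (mag_sphere_grad A u \<theta>) (mag_sphere_grad A w \<theta>) - complex_of_real (a \<theta>) * u \<theta> * cnj (w \<theta>) = t \<theta>"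
            using has_H1_sphere_grad_unique[OF dim_ge_2 wH' wH]
            by eventually_elim (simp add: t_def M1_def M2_def mag_sphere_grad_def G_def)
        qed simp
        ultimately show ?thesis by (simp add: L2_sphere_inner_def)
      qed
      have w_bdd: "\<exists>B. \<forall>\<theta>\<in>sphere 0 1. norm (h \<theta>) \<le> B" if "continuous_on (sphere 0 1) h" for h :: "real^'n \<Rightarrow> 'c::real_normed_vector"
        using compact_imp_bounded[OF compact_continuous_image[OF that compact_sphere]] unfolding bounded_iff by auto
      have drc: "continuous_on (sphere 0 1) dr"
        unfolding dr_def
        by (intro cdot_continuous cvec_continuous continuous_on_compose2[OF test_fun_grad_continuous[OF \<phi>]] continuous_intros) auto
      note [measurable] = borel_measurable_sphere_continuous[OF drc]
      have ub: "integrable sphere_measure (\<lambda>\<theta>. u \<theta> * cnj (h \<theta>))" if h: "continuous_on (sphere 0 1) h" for h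
      proof -
        note [measurable] = borel_measurable_sphere_continuous[OF h]
        obtain B where B: "\<forall>\<theta>\<in>sphere 0 1. norm (h \<theta>) \<le> B" using w_bdd[OF h] by blast
        show ?thesis
        proof (rule Bochner_Integration.integrable_bound[of _ "\<lambda>\<theta>. complex_of_real B * u \<theta>"])
          show "AE \<theta> in sphere_measure. norm (u \<theta> * cnj (h \<theta>)) \<le> norm (complex_of_real B * u \<theta>)"
          proof (rule AE_I2)
            fix \<theta> :: "real^'n" assume "\<theta> \<in> space sphere_measure"
            then have "norm (h \<theta>) \<le> B" using B by simp
            then show "norm (u \<theta> * cnj (h \<theta>)) \<le> norm (complex_of_real B * u \<theta>)"
              by (simp add: norm_mult mult.commute mult_right_mono)
          qed
        qed (use sphere_L1(1)[OF uG] in auto)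
      qed
      have i1: "integrable sphere_measure (\<lambda>\<theta>. u \<theta> * cnj (dr \<theta>))" by (rule ub[OF drc])
      have wc: "continuous_on (sphere 0 1) w" by (rule smooth_sphere_continuous[OF ws])
      have i2: "integrable sphere_measure (\<lambda>\<theta>. u \<theta> * cnj (w \<theta>))" by (rule ub[OF wc])
      have i3: "integrable sphere_measure t"
      proof -
        have M2c: "continuous_on (sphere 0 1) M2"
          unfolding M2_def by (intro continuous_intros sphere_grad_continuous[OF ws] A_continuous wc)
        obtain B2 where B2: "\<forall>\<theta>\<in>sphere 0 1. norm (M2 \<theta>) \<le> B2" using w_bdd[OF M2c] by blast
        obtain Bw where Bw: "\<forall>\<theta>\<in>sphere 0 1. norm (w \<theta>) \<le> Bw" using w_bdd[OF wc] by blast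
        show ?thesis
        proof (rule Bochner_Integration.integrable_bound[of _ "\<lambda>\<theta>. B2 * norm (G \<theta>) + (M * B2 + ca * Bw) * norm (u \<theta>)"])
          show "integrable sphere_measure (\<lambda>\<theta>. B2 * norm (G \<theta>) + (M * B2 + ca * Bw) * norm (u \<theta>))"
            using sphere_L1[OF uG] by (intro Bochner_Integration.integrable_add integrable_mult_right integrable_norm)
          show "AE \<theta> in sphere_measure. norm (t \<theta>) \<le> norm (B2 * norm (G \<theta>) + (M * B2 + ca * Bw) * norm (u \<theta>))"
            using ca(2) AE_space
          proof eventually_elim
            case (elim \<theta>)
            then have \<theta>: "norm \<theta> = 1" "\<theta> \<in> sphere 0 1" by auto
            have "(norm (\<chi> i. \<i> * complex_of_real (A \<theta> $ i) * u \<theta>))\<^sup>2 = (norm (A \<theta>) * norm (u \<theta>))\<^sup>2"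
              unfolding norm_vec_sq
              by (simp add: norm_mult power_mult_distrib norm_vec_def[of "A \<theta>"] L2_set_def sum_nonneg sum_distrib_right)
            then have "norm (\<chi> i. \<i> * complex_of_real (A \<theta> $ i) * u \<theta>) = norm (A \<theta>) * norm (u \<theta>)"
              by (rule power2_eq_imp_eq) auto
            also have "\<dots> \<le> M * norm (u \<theta>)" using M(2)[OF \<theta>(1)] by (rule mult_right_mono) simp
            finally have "norm (M1 \<theta>) \<le> norm (G \<theta>) + M * norm (u \<theta>)"
              unfolding M1_def by (rule norm_triangle_mono[OF order_refl])
            then have "norm (cdot (M1 \<theta>) (M2 \<theta>)) \<le> (norm (G \<theta>) + M * norm (u \<theta>)) * B2"
              using B2 \<theta>(2) M(1) by (intro order_trans[OF norm_cdot_le] mult_mono) auto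
            moreover have "norm (complex_of_real (a \<theta>) * u \<theta> * cnj (w \<theta>)) \<le> ca * norm (u \<theta>) * Bw"
              unfolding norm_mult using elim(1) Bw \<theta>(2) ca(1) by (intro mult_mono) auto
            ultimately have "norm (t \<theta>) \<le> (norm (G \<theta>) + M * norm (u \<theta>)) * B2 + ca * norm (u \<theta>) * Bw"
              unfolding t_def by (rule order_trans[OF norm_triangle_ineq4 add_mono])
            also have "\<dots> = B2 * norm (G \<theta>) + (M * B2 + ca * Bw) * norm (u \<theta>)" by (simp add: algebra_simps)
            also have "\<dots> \<le> norm (B2 * norm (G \<theta>) + (M * B2 + ca * Bw) * norm (u \<theta>))" by simp
            finally show ?case .
          qed
        qed measurable
      qed
      define e where "e = complex_of_real (exp (- r\<^sup>2 / 4))"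
      define c1 where "c1 = complex_of_real (2 * r * \<rho>' (r\<^sup>2))"
      define c2 where "c2 = complex_of_real (\<rho> (r\<^sup>2) / r\<^sup>2)"
      have [measurable]: "(\<lambda>\<theta>. h (r *\<^sub>R \<theta>)) \<in> borel_measurable sphere_measure" if "h \<in> borel_measurable borel" for h :: "real^'n \<Rightarrow> complex"
      proof -
        have "(\<lambda>\<theta>. r *\<^sub>R \<theta>) \<in> borel_measurable (sphere_measure :: (real^'n) measure)"
          by (rule borel_measurable_sphere_continuous) (intro continuous_intros)
        from measurable_compose[OF this that] show ?thesis .
      qed
      have "(\<integral>\<theta>. form_dens A a V GV \<phi> (grad \<phi>) (r *\<^sub>R \<theta>) \<partial>sphere_measure) =
         (\<integral>\<theta>. e * (c1 * (u \<theta> * cnj (dr \<theta>)) + c2 * t \<theta>) \<partial>sphere_measure)"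
      proof (rule integral_cong_AE)
        show "(\<lambda>\<theta>. form_dens A a V GV \<phi> (grad \<phi>) (r *\<^sub>R \<theta>)) \<in> borel_measurable sphere_measure"
          using fi by (intro \<open>\<And>h. h \<in> borel_measurable borel \<Longrightarrow> (\<lambda>\<theta>. h (r *\<^sub>R \<theta>)) \<in> borel_measurable sphere_measure\<close>) auto
        show "AE \<theta> in sphere_measure. form_dens A a V GV \<phi> (grad \<phi>) (r *\<^sub>R \<theta>) = e * (c1 * (u \<theta> * cnj (dr \<theta>)) + c2 * t \<theta>)"
          using H1_grad_tangential[OF uG] AE_space
        proof eventually_elim
          case (elim \<theta>)
          then have \<theta>: "norm \<theta> = 1" by simp
          have sg: "sgn (r *\<^sub>R \<theta>) = \<theta>" "norm (r *\<^sub>R \<theta>) = r" using r \<theta> by (auto simp: sgn_scaleR sgn_div_norm)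
          \<comment> \<open>The magnetic terms are orthogonal to \<theta> since A is
            tangential.\<close>
          have At: "cdot (\<chi> i. \<i> * complex_of_real (A \<theta> $ i) * z) (cvec \<theta>) = 0" for z
          proof -
            have "cdot (\<chi> i. \<i> * complex_of_real (A \<theta> $ i) * z) (cvec \<theta>) = \<i> * z * complex_of_real (A \<theta> \<bullet> \<theta>)"
              by (simp add: cdot_def inner_vec_def sum_distrib_left mult_ac)
            then show ?thesis using A_tangential[of \<theta>] \<theta> by simp
          qed
          have t1: "cdot (M1 \<theta>) (cvec \<theta>) = 0"
            unfolding M1_def cdot_add_left At using elim(1) by simp
          have t2: "cdot (cvec \<theta>) (M2 \<theta>) = 0"
          proof -
            have "cdot (M2 \<theta>) (cvec \<theta>) = 0"
              unfolding M2_def cdot_add_left At using sphere_grad_tangential[OF ws \<theta>] by (simp add: cdot_cvec)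
            then show ?thesis by (metis cnj_cdot complex_cnj_zero)
          qed
          \<comment> \<open>Radial plus tangential component; the potential contributes to the
            tangential one only.\<close>
          have m1: "mag_field A V GV (r *\<^sub>R \<theta>) = (\<chi> i. (c1 * u \<theta>) * (cvec \<theta> $ i)) + (\<rho> (r\<^sup>2) / r) *\<^sub>R M1 \<theta>"
            unfolding mag_field_def GV_def polar_grad_def V_def sg M1_def vec_eq_iff
            by (simp add: c1_def) (simp add: scaleR_conv_of_real algebra_simps)
          have m2: "mag_field A \<phi> (grad \<phi>) (r *\<^sub>R \<theta>) = (\<chi> i. dr \<theta> * (cvec \<theta> $ i)) + (1 / r) *\<^sub>R M2 \<theta>"
          proof -
            have "grad \<phi> (r *\<^sub>R \<theta>) $ i = dr \<theta> * complex_of_real (\<theta> $ i) + (1 / r) *\<^sub>R (sphere_grad w \<theta> $ i)" for i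
              using sphere_grad_slice[OF test_fun_smooth[OF \<phi>] \<theta>, of r i] r
              by (simp add: w_def[abs_def] dr_def scaleR_conv_of_real field_simps)
            then show ?thesis
              unfolding mag_field_def sg M2_def vec_eq_iff
              by simp (simp add: scaleR_conv_of_real w_def algebra_simps)
          qed
          have "cdot (mag_field A V GV (r *\<^sub>R \<theta>)) (mag_field A \<phi> (grad \<phi>) (r *\<^sub>R \<theta>)) =
             c1 * (u \<theta> * cnj (dr \<theta>)) + c2 * cdot (M1 \<theta>) (M2 \<theta>)"
            unfolding m1 m2 cdot_add_left cdot_add_right cdot_cmult_left cdot_cmult_right cdot_scaleR_left cdot_scaleR_right
            using t1 t2 \<theta> by (simp add: vec_lambda_eta cdot_cvec_self c2_def power2_eq_square mult_ac)
          moreover have "complex_of_real (a \<theta> / r\<^sup>2) * V (r *\<^sub>R \<theta>) * cnj (\<phi> (r *\<^sub>R \<theta>)) = c2 * (complex_of_real (a \<theta>) * u \<theta> * cnj (w \<theta>))"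
            unfolding V_def sg by (simp add: c2_def w_def)
          ultimately show ?case
            unfolding form_dens_def sg by (simp add: t_def e_def algebra_simps)
        qed
      qed measurable
      also have "\<dots> = e * (c1 * (\<integral>\<theta>. u \<theta> * cnj (dr \<theta>) \<partial>sphere_measure) + c2 * (\<integral>\<theta>. t \<theta> \<partial>sphere_measure))"
        using i1 i3 by (simp add: Bochner_Integration.integral_add)
      also have "\<dots> = e * (c1 * (\<integral>\<theta>. u \<theta> * cnj (dr \<theta>) \<partial>sphere_measure) + c2 * complex_of_real \<mu> * (\<integral>\<theta>. u \<theta> * cnj (w \<theta>) \<partial>sphere_measure))"
        unfolding T by (simp add: mult.assoc)
      also have "\<dots> = (\<integral>\<theta>. e * (c1 * (u \<theta> * cnj (dr \<theta>)) + c2 * complex_of_real \<mu> * (u \<theta> * cnj (w \<theta>))) \<partial>sphere_measure)"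
        using i1 i2 by (simp add: Bochner_Integration.integral_add)
      also have "\<dots> = (\<integral>\<theta>. R (r *\<^sub>R \<theta>) \<partial>sphere_measure)"
      proof (rule Bochner_Integration.integral_cong[OF refl])
        fix \<theta> :: "real^'n" assume "\<theta> \<in> space sphere_measure"
        then have \<theta>: "norm \<theta> = 1" by simp
        have sg: "sgn (r *\<^sub>R \<theta>) = \<theta>" "norm (r *\<^sub>R \<theta>) = r" using r \<theta> by (auto simp: sgn_scaleR sgn_div_norm)
        show "e * (c1 * (u \<theta> * cnj (dr \<theta>)) + c2 * complex_of_real \<mu> * (u \<theta> * cnj (w \<theta>))) = R (r *\<^sub>R \<theta>)"
          unfolding R_def \<kappa>_def V_def sg e_def c1_def c2_def dr_def w_def by (simp add: algebra_simps)
      qed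
      finally show ?thesis .
    qed
    have "(\<integral>x. form_dens A a V GV \<phi> (grad \<phi>) x \<partial>lborel) = (\<integral>x. R x \<partial>lborel)"
      unfolding integral_polar(1)[OF fi] integral_polar(1)[OF Ri]
    proof (rule integral_cong_AE)
      show "AE r in radial_measure CARD('n). (\<integral>\<theta>. form_dens A a V GV \<phi> (grad \<phi>) (r *\<^sub>R \<theta>) \<partial>sphere_measure) = (\<integral>\<theta>. R (r *\<^sub>R \<theta>) \<partial>sphere_measure)"
        using AE_radial_pos by eventually_elim (rule slice)
    qed (use integral_polar(2)[OF fi] integral_polar(2)[OF Ri] in auto)
    also have "\<dots> = (\<integral>x. u (sgn x) * \<kappa> x \<partial>lborel) + complex_of_real \<gamma> * gauss_inner V \<phi>"
      unfolding R_def gauss_inner_def using u\<kappa> gi by (subst Bochner_Integration.integral_add) auto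
    finally show "(\<integral>x. form_dens A a V GV \<phi> (grad \<phi>) x \<partial>lborel) = complex_of_real \<gamma> * gauss_inner V \<phi>"
      using u\<kappa>0 by simp
  qed
qed

end

section \<open>The explicit eigenfunctions\<close>

definition powr_poly :: "real \<Rightarrow> real poly \<Rightarrow> real \<Rightarrow> real" where
  "powr_poly s p q = q powr s * poly p (q / 4)"

text \<open>The operator s + t d/dt. With t = q/4 the derivative of q^s p(q/4) is q^(s-1) (s p + t
  p')(q/4), so derivatives of a \<open>powr_poly\<close> keep the same shape with the exponent
  lowered by 1.\<close>

definition euler_op :: "real \<Rightarrow> real poly \<Rightarrow> real poly" where
  "euler_op s p = smult s p + [:0, 1:] * pderiv p"

lemma DERIV_powr_poly:
  assumes "q > 0"
  shows "(powr_poly s p has_real_derivative powr_poly (s - 1) (euler_op s p) q) (at q)"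
proof -
  have d: "((\<lambda>q. poly p (q / 4)) has_real_derivative poly (pderiv p) (q / 4) * (1 / 4)) (at q)"
    by (rule DERIV_chain2[OF poly_DERIV]) (auto intro!: derivative_eq_intros)
  have "((\<lambda>q. q powr s * poly p (q / 4)) has_real_derivative
     s * q powr (s - 1) * poly p (q / 4) + q powr s * (poly (pderiv p) (q / 4) * (1 / 4))) (at q)"
    using DERIV_mult[OF has_real_derivative_powr[OF assms] d] by (simp add: algebra_simps)
  moreover have "q powr s = q powr (s - 1) * q"
    using assms by (simp add: powr_diff)
  ultimately show ?thesis
    unfolding powr_poly_def[abs_def] euler_op_def by (simp add: algebra_simps)
qed

lemma powr_poly_measurable [measurable]: "powr_poly s p \<in> borel_measurable borel"
proof -
  have "poly p \<in> borel_measurable borel" by (intro borel_measurable_continuous_onI continuous_intros)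
  then show ?thesis unfolding powr_poly_def[abs_def] by measurable
qed

text \<open>Each monomial is absorbed separately by the exponential; K collects the resulting
  constants.\<close>

lemma poly_exp_bound:
  fixes p :: "real poly"
  assumes "d > 0"
  obtains K where "K \<ge> 0" "\<And>t. t \<ge> 0 \<Longrightarrow> \<bar>poly p t\<bar> \<le> K * exp (d * t)"
proof (rule that[of "\<Sum>i\<le>degree p. \<bar>coeff p i\<bar> * (fact i / d ^ i)"])
  show "0 \<le> (\<Sum>i\<le>degree p. \<bar>coeff p i\<bar> * (fact i / d ^ i))" using assms by (intro sum_nonneg) simp
  fix t :: real assume t: "t \<ge> 0"
  have "\<bar>poly p t\<bar> \<le> (\<Sum>i\<le>degree p. \<bar>coeff p i * t ^ i\<bar>)" unfolding poly_altdef by (rule sum_abs)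
  also have "\<dots> \<le> (\<Sum>i\<le>degree p. \<bar>coeff p i\<bar> * (fact i / d ^ i * exp (d * t)))"
  proof (rule sum_mono)
    fix i
    show "\<bar>coeff p i * t ^ i\<bar> \<le> \<bar>coeff p i\<bar> * (fact i / d ^ i * exp (d * t))"
      using mult_left_mono[OF power_le_fact_exp[OF t assms, of i], of "\<bar>coeff p i\<bar>"] t by (simp add: abs_mult)
  qed
  finally show "\<bar>poly p t\<bar> \<le> (\<Sum>i\<le>degree p. \<bar>coeff p i\<bar> * (fact i / d ^ i)) * exp (d * t)"
    by (simp add: sum_distrib_right mult.assoc)
qed

lemma powr_poly_radial_finite:
  assumes N: "N \<ge> 2" and s: "s > (2 - real N) / 4"
  shows "(\<integral>\<^sup>+r. ennreal (radial_dens (powr_poly s p) (powr_poly (s - 1) (euler_op s p)) (r\<^sup>2)) \<partial>radial_measure N) < \<infinity>"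
proof -
  obtain K where K: "K \<ge> 0" "\<And>t. t \<ge> 0 \<Longrightarrow> \<bar>poly p t\<bar> \<le> K * exp (1 / 8 * t)"
    by (rule poly_exp_bound[of "1/8" p]) (simp, rule that)
  obtain K' where K': "K' \<ge> 0" "\<And>t. t \<ge> 0 \<Longrightarrow> \<bar>poly (euler_op s p) t\<bar> \<le> K' * exp (1 / 8 * t)"
    by (rule poly_exp_bound[of "1/8" "euler_op s p"]) (simp, rule that)
  show ?thesis
  proof (rule radial_dens_finite[OF N s, of "max K K'"])
    fix q :: real assume q: "q > 0"
    have "\<bar>powr_poly s p q\<bar> \<le> q powr s * (max K K' * exp (q / 32))"
      unfolding powr_poly_def abs_mult using K(2)[of "q / 4"] q
      by (auto intro!: mult_left_mono order_trans[OF _ mult_right_mono[of K "max K K'" "exp (q / 32)"]])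
    then show "\<bar>powr_poly s p q\<bar> \<le> max K K' * q powr s * exp (q / 32)" by (simp add: mult_ac)
    have "\<bar>powr_poly (s - 1) (euler_op s p) q\<bar> \<le> q powr (s - 1) * (max K K' * exp (q / 32))"
      unfolding powr_poly_def abs_mult using K'(2)[of "q / 4"] q
      by (auto intro!: mult_left_mono order_trans[OF _ mult_right_mono[of K' "max K K'" "exp (q / 32)"]])
    then show "\<bar>powr_poly (s - 1) (euler_op s p) q\<bar> \<le> max K K' * q powr (s - 1) * exp (q / 32)" by (simp add: mult_ac)
  qed (use K K' in auto)
qed

lemma smooth_on_powr_poly:
  "smooth_on (- {0::real^'n}) (\<lambda>x. complex_of_real (powr_poly s p ((norm x)\<^sup>2)))"
proof -
  have "smooth_on (- {0::real^'n}) (\<lambda>x. ((norm x)\<^sup>2) ^ i)" for i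
    by (induction i) (auto intro!: smooth_on_const smooth_on_mult smooth_on_norm_sq)
  then have "smooth_on (- {0::real^'n}) (\<lambda>x. (norm x)\<^sup>2 powr s * (\<Sum>i\<le>degree p. (coeff p i / 4 ^ i) * ((norm x)\<^sup>2) ^ i))"
    by (intro smooth_on_mult smooth_on_norm_powr smooth_on_sum smooth_on_const) auto
  then have "smooth_on (- {0::real^'n}) (\<lambda>x. powr_poly s p ((norm x)\<^sup>2))"
    by (simp add: powr_poly_def poly_altdef power_divide)
  then show ?thesis by (intro smooth_on_of_real) auto
qed

text \<open>The terminating confluent hypergeometric series 1F1(-n; b; t), for b > 0 a nonzero
  multiple of the Laguerre polynomial of degree n with parameter b - 1.\<close>

definition kummer_poly :: "real \<Rightarrow> nat \<Rightarrow> real poly" where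
  "kummer_poly b n = (\<Sum>i\<le>n. monom (pochhammer (- real n) i / pochhammer b i / fact i) i)"

lemma coeff_kummer_poly:
  "coeff (kummer_poly b n) i = pochhammer (- real n) i / pochhammer b i / fact i"
proof (cases "i \<le> n")
  case False
  then have "pochhammer (- real n) i = 0" by (simp add: pochhammer_of_nat_eq_0_iff)
  then show ?thesis using False by (simp add: kummer_poly_def coeff_sum)
qed (simp add: kummer_poly_def coeff_sum)

lemma poly_kummer_poly:
  "poly (kummer_poly (real N / 2 - alpha N \<mu> j) n) t = P_poly N \<mu> j n t"
  by (simp add: kummer_poly_def poly_sum poly_monom P_poly_def atLeast0AtMost)

text \<open>On coefficients the equation is the recursion (b + i)(i + 1) c_(i+1) = (i - n) c_i,
  which consecutive Pochhammer quotients satisfy. At i = n the right-hand side vanishes, in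
  accordance with the degree.\<close>

lemma kummer_poly_ode:
  assumes b: "b > 0"
  shows "[:0, 1:] * pderiv (pderiv (kummer_poly b n)) + [:b, - 1:] * pderiv (kummer_poly b n) + smult (real n) (kummer_poly b n) = 0"
    (is "?L = 0")
proof (rule poly_eqI)
  fix i
  let ?c = "coeff (kummer_poly b n)"
  have cancel: "y * (z * (A * w / (B * y) / (z * F))) = w * (A / B / F)"
    if "B \<noteq> 0" "F \<noteq> 0" "y \<noteq> 0" "z \<noteq> 0" for A B F w y z :: real
    using that by (simp add: field_simps)
  have "pochhammer b i \<noteq> 0" using pochhammer_pos[OF b, of i] by simp
  then have "(b + real i) * ((real i + 1) * (pochhammer (- real n) i * (- real n + real i) / (pochhammer b i * (b + real i)) / ((real i + 1) * fact i))) =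
      (- real n + real i) * (pochhammer (- real n) i / pochhammer b i / fact i)"
    using b by (intro cancel) auto
  then have rec: "(real i + b) * ((real i + 1) * ?c (Suc i)) = (real i - real n) * ?c i"
    by (simp add: coeff_kummer_poly pochhammer_Suc add.commute)
  have "coeff ?L i = (real i + b) * ((real i + 1) * ?c (Suc i)) - (real i - real n) * ?c i"
    by (cases i) (simp_all add: coeff_pderiv mult_pCons_left coeff_pCons algebra_simps)
  then show "coeff ?L i = coeff 0 i" using rec by simp
qed

text \<open>The nonzero leading coefficient makes the family triangular in the powers of t, so that
  orthogonality to it can be turned into vanishing moments.\<close>

lemma kummer_poly_degree: "b > 0 \<Longrightarrow> coeff (kummer_poly b n) n \<noteq> 0" "i > n \<Longrightarrow> coeff (kummer_poly b n) i = 0"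
proof -
  show "i > n \<Longrightarrow> coeff (kummer_poly b n) i = 0"
    by (simp add: coeff_kummer_poly pochhammer_of_nat_eq_0_iff)
  assume b: "b > 0"
  have "pochhammer b n \<noteq> 0" using pochhammer_pos[OF b] by (metis less_irrefl)
  moreover have "pochhammer (- real n) n \<noteq> 0" by (simp add: pochhammer_of_nat_eq_0_iff)
  ultimately show "coeff (kummer_poly b n) n \<noteq> 0" by (simp add: coeff_kummer_poly)
qed

text \<open>After q^(s-1) is factored out, the multiples of P without a factor t cancel by the
  choice of \<mu>, the multiples of P' combine through b = N/2 + 2 s, and \<gamma> = n + s leaves
  the term n P. What remains is 4 t times Kummer's equation.\<close>

lemma radial_ode:
  assumes b: "b > 0" and q: "q > 0" and bs: "b = N / 2 + 2 * s" and \<mu>: "\<mu> = 4 * s\<^sup>2 + 2 * (N - 2) * s" and \<gamma>: "\<gamma> = real n + s"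
  defines "p \<equiv> kummer_poly b n"
  shows "4 * q * powr_poly (s - 2) (euler_op (s - 1) (euler_op s p)) q + (2 * N - q) * powr_poly (s - 1) (euler_op s p) q
     - \<mu> * powr_poly s p q / q + \<gamma> * powr_poly s p q = 0"
proof -
  define t where "t = q / 4"
  define P P1 P2 where "P = poly p t" and "P1 = poly (pderiv p) t" and "P2 = poly (pderiv (pderiv p)) t"
  have e1: "poly (euler_op s p) t = s * P + t * P1"
    by (simp add: euler_op_def P_def P1_def)
  have e2: "poly (euler_op (s - 1) (euler_op s p)) t = s * (s - 1) * P + 2 * s * t * P1 + t\<^sup>2 * P2"
    unfolding euler_op_def P_def P1_def P2_def
    by (simp add: pderiv_add pderiv_smult pderiv_mult pderiv_pCons algebra_simps power2_eq_square)
  have "poly ([:0, 1:] * pderiv (pderiv p) + [:b, - 1:] * pderiv p + smult (real n) p) t = 0"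
    unfolding p_def kummer_poly_ode[OF b] by simp
  then have ode: "t * P2 + (b - t) * P1 + real n * P = 0"
    by (simp add: P_def P1_def P2_def algebra_simps)
  have w: "q powr s = q powr (s - 1) * q" "q powr (s - 1) = q powr (s - 2) * q"
    using q powr_add[of q "s - 1" 1] powr_add[of q "s - 2" 1] by auto
  have "4 * q * powr_poly (s - 2) (euler_op (s - 1) (euler_op s p)) q + (2 * N - q) * powr_poly (s - 1) (euler_op s p) q
     - \<mu> * powr_poly s p q / q + \<gamma> * powr_poly s p q =
     q powr (s - 1) * (4 * (s * (s - 1) * P + 2 * s * t * P1 + t\<^sup>2 * P2) + (2 * N - 4 * t) * (s * P + t * P1) - \<mu> * P + 4 * t * \<gamma> * P)"
    unfolding powr_poly_def t_def[symmetric] e1 e2 P_def[symmetric] w(1) using q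
    by (simp add: w(2) t_def algebra_simps)
  also have "4 * (s * (s - 1) * P + 2 * s * t * P1 + t\<^sup>2 * P2) + (2 * N - 4 * t) * (s * P + t * P1) - \<mu> * P + 4 * t * \<gamma> * P =
     4 * t * (t * P2 + (b - t) * P1 + real n * P)"
    unfolding bs \<mu> \<gamma> by (simp add: algebra_simps power2_eq_square)
  finally show ?thesis unfolding ode by simp
qed

section \<open>The explicit functions attached to an angular spectrum\<close>

locale magnetic_spectrum = magnetic A a for A :: "real^'n \<Rightarrow> real^'n" and a :: "real^'n \<Rightarrow> real" +
  fixes \<mu> :: "nat \<Rightarrow> real" and \<psi> :: "nat \<Rightarrow> real^'n \<Rightarrow> complex"
  assumes spectrum: "angular_spectrum A a \<mu> \<psi>"
    and mu_1: "\<mu> 1 > - (((real CARD('n) - 2) / 2)\<^sup>2)"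
begin

lemma disc_pos:
  assumes "j \<ge> 1"
  shows "((real CARD('n) - 2) / 2)\<^sup>2 + \<mu> j > 0"
proof -
  have "\<mu> 1 \<le> \<mu> j" using spectrum assms unfolding angular_spectrum_def by blast
  then show ?thesis using mu_1 by linarith
qed

text \<open>The lower bound on \<open>\<mu> 1\<close> is strict, so the square root is positive.
  This inequality yields both the integrability of the powers at the origin and the positivity of
  Kummer's parameter.\<close>

lemma alpha_less:
  assumes "j \<ge> 1"
  shows "alpha CARD('n) \<mu> j < (real CARD('n) - 2) / 2"
proof -
  have "0 < sqrt (((real CARD('n) - 2) / 2)\<^sup>2 + \<mu> j)" using disc_pos[OF assms] by simp
  then show ?thesis unfolding alpha_def by linarith
qed

text \<open>The exponent s = -\<alpha>_j/2 is a root of the indicial equation 4 s^2 + 2 (N - 2) s =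
  \<mu>_j of the radial equation.\<close>

lemma alpha_eq:
  assumes "j \<ge> 1"
  shows "\<mu> j = 4 * (- alpha CARD('n) \<mu> j / 2)\<^sup>2 + 2 * (real CARD('n) - 2) * (- alpha CARD('n) \<mu> j / 2)"
proof -
  let ?m = "(real CARD('n) - 2) / 2"
  have "(alpha CARD('n) \<mu> j - ?m)\<^sup>2 = ?m\<^sup>2 + \<mu> j"
    using disc_pos[OF assms] by (simp add: alpha_def)
  then show ?thesis by (simp add: power2_eq_square field_simps)
qed

lemma T_eigen: "j \<ge> 1 \<Longrightarrow> T_eigenfunction A a (\<mu> j) (\<psi> j)"
  using spectrum by (simp add: angular_spectrum_def)

lemma psi_L2: "j \<ge> 1 \<Longrightarrow> \<psi> j \<in> L2_sphere"
  using spectrum by (simp add: angular_spectrum_def orthonormal_basis_L2_sphere_def)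

lemma psi_measurable: "j \<ge> 1 \<Longrightarrow> \<psi> j \<in> borel_measurable sphere_measure"
  using psi_L2[of j] by (simp add: L2_sphere_def)

lemma psi_sgn_measurable: "j \<ge> 1 \<Longrightarrow> (\<lambda>x. \<psi> j (sgn x)) \<in> borel_measurable borel"
  by (rule borel_measurable_compose_sgn[OF psi_measurable]) auto

lemma V_fun_eq:
  "V_fun \<mu> \<psi> n j x =
     complex_of_real (powr_poly (- alpha CARD('n) \<mu> j / 2) (kummer_poly (real CARD('n) / 2 - alpha CARD('n) \<mu> j) n) ((norm x)\<^sup>2)) * \<psi> j (sgn x)"
proof -
  have "(norm x)\<^sup>2 powr (- alpha CARD('n) \<mu> j / 2) = norm x powr (- alpha CARD('n) \<mu> j)"
    by (cases "x = 0") (simp_all add: powr_powr flip: powr_numeral)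
  then show ?thesis by (simp add: V_fun_def powr_poly_def poly_kummer_poly)
qed

lemma exponent_bound: "j \<ge> 1 \<Longrightarrow> - alpha CARD('n) \<mu> j / 2 > (2 - real CARD('n)) / 4"
  using alpha_less[of j] by (simp add: field_simps)

lemma kummer_param_pos: "j \<ge> 1 \<Longrightarrow> real CARD('n) / 2 - alpha CARD('n) \<mu> j > 0"
  using alpha_less[of j] by (simp add: field_simps)

lemma V_fun_H:
  assumes j: "j \<ge> 1"
  shows "V_fun \<mu> \<psi> n j \<in> H_space"
proof -
  have "\<psi> j \<in> H1_sphere" using T_eigen[OF j] by (simp add: T_eigenfunction_def)
  then obtain G where G: "has_H1_sphere_grad (\<psi> j) G" unfolding H1_sphere_def by blast
  have "has_H_grad (\<lambda>x. complex_of_real (powr_poly (- alpha CARD('n) \<mu> j / 2) (kummer_poly (real CARD('n) / 2 - alpha CARD('n) \<mu> j) n) ((norm x)\<^sup>2)) * \<psi> j (sgn x))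
     (polar_grad (powr_poly (- alpha CARD('n) \<mu> j / 2) (kummer_poly (real CARD('n) / 2 - alpha CARD('n) \<mu> j) n))
        (powr_poly (- alpha CARD('n) \<mu> j / 2 - 1) (euler_op (- alpha CARD('n) \<mu> j / 2) (kummer_poly (real CARD('n) / 2 - alpha CARD('n) \<mu> j) n))) (\<psi> j) G)"
    by (rule has_H_grad_polar[OF G smooth_on_powr_poly DERIV_powr_poly powr_poly_measurable powr_poly_measurable
        powr_poly_radial_finite[OF dim_ge_2 exponent_bound[OF j]]])
  then show ?thesis unfolding H_space_def V_fun_eq[abs_def] by blast
qed

lemma V_fun_eigen:
  assumes j: "j \<ge> 1"
  shows "L_eigen_eq A a (complex_of_real (real n - alpha CARD('n) \<mu> j / 2)) (V_fun \<mu> \<psi> n j)"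
  unfolding V_fun_eq[abs_def]
proof (rule polar_L_eigen_eq[OF T_eigen[OF j] smooth_on_powr_poly DERIV_powr_poly DERIV_powr_poly powr_poly_measurable
      powr_poly_measurable powr_poly_radial_finite[OF dim_ge_2 exponent_bound[OF j]]])
  let ?s = "- alpha CARD('n) \<mu> j / 2" and ?p = "kummer_poly (real CARD('n) / 2 - alpha CARD('n) \<mu> j) n"
  fix q :: real assume q: "q > 0"
  have "4 * q * powr_poly (?s - 2) (euler_op (?s - 1) (euler_op ?s ?p)) q + (2 * real CARD('n) - q) * powr_poly (?s - 1) (euler_op ?s ?p) q
     - \<mu> j * powr_poly ?s ?p q / q + (real n - alpha CARD('n) \<mu> j / 2) * powr_poly ?s ?p q = 0"
    by (rule radial_ode[OF kummer_param_pos[OF j] q _ alpha_eq[OF j]]) auto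
  then show "4 * q * powr_poly (?s - 1 - 1) (euler_op (?s - 1) (euler_op ?s ?p)) q + (2 * real CARD('n) - q) * powr_poly (?s - 1) (euler_op ?s ?p) q
     - \<mu> j * powr_poly ?s ?p q / q + (real n - alpha CARD('n) \<mu> j / 2) * powr_poly ?s ?p q = 0"
    by (simp add: diff_diff_eq)
qed assumption+

end

section \<open>Completeness\<close>

text \<open>Differences of integrals over balls give integrals over intervals, to which the
  criterion for boxes applies. The density r^(N-1) is positive for r > 0, so its product with g
  vanishes only where g does.\<close>

lemma AE_radial_zero_if_ball_integrals_zero:
  fixes g :: "real \<Rightarrow> complex"
  assumes g: "integrable (radial_measure N) g"
    and zero: "\<And>t. t > 0 \<Longrightarrow> (\<integral>r. g r * indicator {r. r < t} r \<partial>radial_measure N) = 0"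
  shows "AE r in radial_measure N. g r = 0"
proof -
  have gm [measurable]: "g \<in> borel_measurable borel" using g by auto
  define w where "w r = indicator {0<..} r * r ^ (N - 1)" for r :: real
  have w: "0 \<le> w r" for r by (auto simp: w_def indicator_def)
  have [measurable]: "w \<in> borel_measurable borel" unfolding w_def[abs_def] by measurable
  define h where "h r = w r *\<^sub>R g r" for r
  have h: "integrable lborel h"
    using g unfolding radial_measure_def h_def w_def[symmetric] by (subst (asm) integrable_density) (auto simp: w)
  have cut: "(\<integral>r. indicator {..<t} r *\<^sub>R h r \<partial>lborel) = 0" for t
  proof (cases "t > 0")
    case True
    have "(\<integral>r. g r * indicator {r. r < t} r \<partial>radial_measure N) = (\<integral>r. w r *\<^sub>R (g r * indicator {r. r < t} r) \<partial>lborel)"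
      unfolding w_def by (rule integral_radial) measurable
    also have "\<dots> = (\<integral>r. indicator {..<t} r *\<^sub>R h r \<partial>lborel)"
      by (intro Bochner_Integration.integral_cong refl) (auto simp: h_def indicator_def)
    finally show ?thesis using zero[OF True] by simp
  next
    case False
    then have "indicator {..<t} r *\<^sub>R h r = 0" for r
      by (auto simp: h_def w_def indicator_def)
    then show ?thesis by (simp only: Bochner_Integration.integral_zero)
  qed
  have "AE r in lborel. h r = 0"
  proof (rule AE_zero_if_box_integrals_zero[OF h])
    fix s t :: real
    show "set_lebesgue_integral lborel (box s t) h = 0"
    proof (cases "s < t")
      case True
      have i: "integrable lborel (\<lambda>r. indicator {..<t} r *\<^sub>R h r)" for t
        using h by (intro integrable_mult_indicator) auto
      have "set_lebesgue_integral lborel (box s t) h = (\<integral>r. indicator {..<t} r *\<^sub>R h r - indicator {..<s} r *\<^sub>R h r \<partial>lborel)"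
        unfolding set_lebesgue_integral_def
      proof (rule integral_cong_AE)
        show "AE r in lborel. indicator (box s t) r *\<^sub>R h r = indicator {..<t} r *\<^sub>R h r - indicator {..<s} r *\<^sub>R h r"
          using AE_lborel_singleton[of s] by eventually_elim (use True in \<open>auto simp: indicator_def box_real\<close>)
      qed (use h in auto)
      also have "\<dots> = 0"
        using Bochner_Integration.integral_diff[OF i i, of t s] cut by simp
      finally show ?thesis .
    next
      case False
      then have "box s t = {}" by auto
      then show ?thesis by (simp add: set_lebesgue_integral_def)
    qed
  qed
  then have "AE r in lborel. 0 < ennreal (w r) \<longrightarrow> g r = 0"
    by eventually_elim (auto simp: h_def)
  then show ?thesis
    unfolding radial_measure_def w_def[symmetric] by (subst AE_density) auto
qed

lemma polar_slice_measurable: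
  fixes f :: "real^'n \<Rightarrow> ennreal"
  assumes "f \<in> borel_measurable borel"
  shows "(\<lambda>r. \<integral>\<^sup>+\<theta>. f (r *\<^sub>R \<theta>) \<partial>sphere_measure) \<in> borel_measurable (radial_measure CARD('n))"
proof -
  interpret pair_sigma_finite "radial_measure CARD('n)" "sphere_measure :: (real^'n) measure"
    by (rule polar_pair_sigma_finite)
  have "(\<lambda>p. f ((\<lambda>(r, \<theta>). r *\<^sub>R \<theta>) p)) \<in> borel_measurable (radial_measure CARD('n) \<Otimes>\<^sub>M sphere_measure)"
    by (rule measurable_compose[OF measurable_scaleR_polar assms])
  from M2.borel_measurable_nn_integral_fst[OF this] show ?thesis by simp
qed

lemma gauss_inner_self_eq_0_iff:
  assumes v: "v \<in> H_space"
  shows "gauss_inner v v = 0 \<longleftrightarrow> (AE x in lborel. v x = 0)"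
proof -
  obtain G where G: "has_H_grad v G" using v unfolding H_space_def by blast
  note [measurable] = has_H_grad_measurable[OF G]
  let ?f = "\<lambda>x. (norm (v x))\<^sup>2 * exp (- (norm x)\<^sup>2 / 4)"
  have eq: "v x * cnj (v x) * complex_of_real (exp (- (norm x)\<^sup>2 / 4)) = complex_of_real (?f x)" for x
    by (simp add: complex_norm_square[symmetric])
  have "integrable lborel (\<lambda>x. complex_of_real (?f x))"
    using integrable_gauss_dens[OF G G] unfolding eq .
  then have i: "integrable lborel ?f" using integrable_Re by force
  have "gauss_inner v v = complex_of_real (\<integral>x. ?f x \<partial>lborel)"
    unfolding gauss_inner_def eq by (rule integral_complex_of_real)
  then have "gauss_inner v v = 0 \<longleftrightarrow> (\<integral>x. ?f x \<partial>lborel) = 0" by simp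
  also have "\<dots> \<longleftrightarrow> (AE x in lborel. ?f x = 0)"
    by (rule integral_nonneg_eq_0_iff_AE[OF i]) auto
  finally show ?thesis by simp
qed

context magnetic_spectrum
begin

lemma psi_orthonormal:
  "i \<ge> 1 \<Longrightarrow> j \<ge> 1 \<Longrightarrow> L2_sphere_inner (\<psi> i) (\<psi> j) = (if i = j then 1 else 0)"
  using spectrum unfolding angular_spectrum_def orthonormal_basis_L2_sphere_def by blast

text \<open>All partial sums of the expansion vanish, so the error is constantly the squared norm of
  f, and it tends to 0.\<close>

lemma psi_complete:
  assumes f: "f \<in> L2_sphere" and zero: "\<And>j. j \<ge> 1 \<Longrightarrow> L2_sphere_inner f (\<psi> j) = 0"
  shows "AE \<theta> in sphere_measure. f \<theta> = 0"
proof -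
  have [measurable]: "f \<in> borel_measurable sphere_measure" using f by (simp add: L2_sphere_def)
  have "(\<lambda>n. \<integral>\<^sup>+\<theta>. ennreal ((norm (f \<theta> - (\<Sum>k=1..n. L2_sphere_inner f (\<psi> k) * \<psi> k \<theta>)))\<^sup>2) \<partial>sphere_measure) \<longlonglongrightarrow> 0"
    using spectrum f unfolding angular_spectrum_def orthonormal_basis_L2_sphere_def by blast
  then have "(\<integral>\<^sup>+\<theta>. ennreal ((norm (f \<theta>))\<^sup>2) \<partial>sphere_measure) = 0"
    using zero by (simp add: LIMSEQ_const_iff)
  then have "AE \<theta> in sphere_measure. ennreal ((norm (f \<theta>))\<^sup>2) = 0"
    by (subst (asm) nn_integral_0_iff_AE) auto
  then show ?thesis by eventually_elim (simp add: ennreal_eq_0_iff)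
qed

text \<open>k collects everything in the scalar product of g with \<open>V_fun\<close> except the
  polynomial. For fixed j there is one polynomial of each exact degree, so all moments of k in |x|^2
  vanish, and the moment problem is solved with T = |x|^2.\<close>

lemma radial_moments_zero:
  fixes g :: "real^'n \<Rightarrow> complex"
  assumes g: "g \<in> H_space" and j: "j \<ge> 1" and orth: "\<And>n. gauss_inner g (V_fun \<mu> \<psi> n j) = 0"
  defines "k \<equiv> \<lambda>x. g x * cnj (\<psi> j (sgn x)) * complex_of_real ((norm x)\<^sup>2 powr (- alpha CARD('n) \<mu> j / 2) * exp (- (norm x)\<^sup>2 / 4))"
  shows "integrable lborel k"
    and "\<And>t. (\<integral>x. k x * indicator {x. (norm x)\<^sup>2 < t} x \<partial>lborel) = 0"
proof -
  let ?s = "- alpha CARD('n) \<mu> j / 2"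
  let ?b = "real CARD('n) / 2 - alpha CARD('n) \<mu> j"
  obtain G where G: "has_H_grad g G" using g unfolding H_space_def by blast
  note [measurable] = has_H_grad_measurable[OF G] psi_sgn_measurable[OF j] psi_measurable[OF j]
  have km [measurable]: "k \<in> borel_measurable borel" unfolding k_def by measurable
  \<comment> \<open>The squared angular and power factors, with decay exp(-|x|^2/8); integrable
    because 4 s > -N for s = -\<alpha>_j/2.\<close>
  define y where "y x = (norm (\<psi> j (sgn x)))\<^sup>2 * ((norm x)\<^sup>2 powr (2 * ?s) * exp (- (norm x)\<^sup>2 / 8))" for x
  have yi: "integrable lborel y"
  proof (rule integrableI_nonneg)
    have "(\<integral>\<^sup>+x. ennreal (y x) \<partial>lborel) =
       (\<integral>\<^sup>+x. ennreal ((norm x)\<^sup>2 powr (2 * ?s) * exp (- (norm x)\<^sup>2 / 8)) * ennreal ((norm (\<psi> j (sgn x)))\<^sup>2) \<partial>lborel)"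
      by (intro nn_integral_cong) (simp add: y_def ennreal_mult[symmetric] mult.commute)
    also have "\<dots> = (\<integral>\<^sup>+r. ennreal (r\<^sup>2 powr (2 * ?s) * exp (- r\<^sup>2 / 8)) \<partial>radial_measure CARD('n)) * (\<integral>\<^sup>+\<theta>. ennreal ((norm (\<psi> j \<theta>))\<^sup>2) \<partial>sphere_measure)"
      by (rule nn_integral_polar_prod[of "\<lambda>r. ennreal (r\<^sup>2 powr (2 * ?s) * exp (- r\<^sup>2 / 8))" "\<lambda>\<theta>. ennreal ((norm (\<psi> j \<theta>))\<^sup>2)"]; measurable)
    also have "(\<integral>\<^sup>+r. ennreal (r\<^sup>2 powr (2 * ?s) * exp (- r\<^sup>2 / 8)) \<partial>radial_measure CARD('n)) =
       (\<integral>\<^sup>+r. ennreal (r powr (4 * ?s) * exp (- (1/8) * r\<^sup>2)) \<partial>radial_measure CARD('n))"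
    proof (rule nn_integral_cong_AE)
      show "AE r in radial_measure CARD('n). ennreal (r\<^sup>2 powr (2 * ?s) * exp (- r\<^sup>2 / 8)) = ennreal (r powr (4 * ?s) * exp (- (1/8) * r\<^sup>2))"
        using AE_radial_pos by eventually_elim (simp add: powr_powr flip: powr_numeral)
    qed
    also have "\<dots> * (\<integral>\<^sup>+\<theta>. ennreal ((norm (\<psi> j \<theta>))\<^sup>2) \<partial>sphere_measure) < \<infinity>"
    proof -
      have "4 * ?s > - real CARD('n)" using exponent_bound[OF j] by simp
      then show ?thesis
        using radial_powr_gauss_finite[of "CARD('n)" "4 * ?s" "1/8"] psi_L2[OF j]
        by (simp add: L2_sphere_def ennreal_mult_less_top Suc_le_eq)
    qed
    finally show "(\<integral>\<^sup>+x. ennreal (y x) \<partial>lborel) < \<infinity>" .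
  qed (auto simp: y_def[abs_def])
  \<comment> \<open>The factor exp(q/16) is the decay margin required by the moment problem. With it
    the Gaussian becomes exp(-q/8) exp(-q/16): the first factor goes with g and the second with the
    eigenfunction, and both resulting squares are integrable.\<close>
  have int: "integrable lborel (\<lambda>x. k x * complex_of_real (exp (1/16 * (norm x)\<^sup>2)))"
  proof (rule Bochner_Integration.integrable_bound)
    show "integrable lborel (\<lambda>x. H_dens g G x + y x)"
      by (intro Bochner_Integration.integrable_add integrable_H_dens G yi)
    show "AE x in lborel. norm (k x * complex_of_real (exp (1/16 * (norm x)\<^sup>2))) \<le> norm (H_dens g G x + y x)"
    proof (rule AE_I2)
      fix x :: "real^'n"
      let ?q = "(norm x)\<^sup>2"
      define A where "A = norm (g x) * exp (- ?q / 8)"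
      define B where "B = norm (\<psi> j (sgn x)) * (?q powr ?s * exp (- ?q / 16))"
      have AB: "A \<ge> 0" "B \<ge> 0" by (auto simp: A_def B_def)
      have "exp (- ?q / 4) * exp (1/16 * ?q) = exp (- ?q / 8) * exp (- ?q / 16)"
        by (simp flip: exp_add)
      then have "norm (k x * complex_of_real (exp (1/16 * ?q))) = A * B"
        by (simp add: k_def norm_mult A_def B_def)
      also have "\<dots> \<le> A\<^sup>2 + B\<^sup>2"
      proof -
        have "2 * A * B \<le> A\<^sup>2 + B\<^sup>2" by (rule sum_squares_bound)
        moreover have "0 \<le> A * B" using AB by simp
        ultimately show ?thesis by linarith
      qed
      also have "A\<^sup>2 = (norm (g x))\<^sup>2 * exp (- ?q / 4)"
        unfolding A_def power_mult_distrib by (simp add: power2_eq_square flip: exp_add)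
      also have "B\<^sup>2 = y x"
      proof -
        have "(?q powr ?s)\<^sup>2 = ?q powr (2 * ?s)" unfolding power2_eq_square[of "?q powr ?s"] powr_add[symmetric] by (simp only: mult_2)
        moreover have "(exp (- ?q / 16))\<^sup>2 = exp (- ?q / 8)" by (simp add: power2_eq_square[of "exp _"] flip: exp_add)
        ultimately show ?thesis unfolding B_def y_def power_mult_distrib by simp
      qed
      also have "(norm (g x))\<^sup>2 * exp (- ?q / 4) \<le> H_dens g G x"
        unfolding H_dens_def by (rule mult_right_mono) auto
      finally show "norm (k x * complex_of_real (exp (1/16 * ?q))) \<le> norm (H_dens g G x + y x)"
        by (simp add: add.commute)
    qed
  qed measurable
  have mi: "integrable lborel (\<lambda>x. k x * complex_of_real (((norm x)\<^sup>2) ^ i))" for i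
    using integrable_moment[OF int, of 0 i] by simp
  show "integrable lborel k" using mi[of 0] by simp
  have mom: "(\<integral>x. k x * complex_of_real (((norm x)\<^sup>2) ^ n) \<partial>lborel) = 0" for n
  proof (induction n rule: less_induct)
    case (less n)
    let ?c = "coeff (kummer_poly ?b n)"
    have "gauss_inner g (V_fun \<mu> \<psi> n j) = (\<integral>x. (\<Sum>i\<le>n. complex_of_real (?c i / 4 ^ i) * (k x * complex_of_real (((norm x)\<^sup>2) ^ i))) \<partial>lborel)"
      unfolding gauss_inner_def
    proof (rule Bochner_Integration.integral_cong[OF refl])
      fix x :: "real^'n"
      let ?q = "(norm x)\<^sup>2"
      have "poly (kummer_poly ?b n) (?q / 4) = (\<Sum>i\<le>n. ?c i / 4 ^ i * ?q ^ i)"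
        unfolding coeff_kummer_poly by (simp add: kummer_poly_def poly_sum poly_monom power_divide)
      then have "complex_of_real (powr_poly ?s (kummer_poly ?b n) ?q) = complex_of_real (?q powr ?s) * (\<Sum>i\<le>n. complex_of_real (?c i / 4 ^ i * ?q ^ i))"
        by (simp add: powr_poly_def)
      then show "g x * cnj (V_fun \<mu> \<psi> n j x) * complex_of_real (exp (- (norm x)\<^sup>2 / 4)) =
          (\<Sum>i\<le>n. complex_of_real (?c i / 4 ^ i) * (k x * complex_of_real (?q ^ i)))"
        unfolding V_fun_eq complex_cnj_mult complex_cnj_complex_of_real k_def
        by (simp only: sum_distrib_left sum_distrib_right of_real_mult mult_ac)
    qed
    also have "\<dots> = (\<Sum>i\<le>n. complex_of_real (?c i / 4 ^ i) * (\<integral>x. k x * complex_of_real (((norm x)\<^sup>2) ^ i) \<partial>lborel))"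
      by (subst Bochner_Integration.integral_sum) (auto intro!: integrable_mult_right mi simp del: of_real_power)
    \<comment> \<open>By the induction hypothesis only the leading term survives, and its
      coefficient is nonzero.\<close>
    also have "\<dots> = complex_of_real (?c n / 4 ^ n) * (\<integral>x. k x * complex_of_real (((norm x)\<^sup>2) ^ n) \<partial>lborel)"
      using less.IH by (subst sum.remove[of _ n]) (auto intro!: sum.neutral simp del: of_real_power)
    finally show ?case
      using orth[of n] kummer_poly_degree(1)[OF kummer_param_pos[OF j], of n] by simp
  qed
  show "(\<integral>x. k x * indicator {x. (norm x)\<^sup>2 < t} x \<partial>lborel) = 0" for t
    by (rule moments_zero_imp_level_integral_zero[of "1/16", OF _ int _ _ _ mom]) auto
qed

text \<open>For each j the integrals over all balls force the j-th angular coefficient of g to be 0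
  on almost every sphere. Completeness of \<psi> then makes g vanish on almost every sphere.\<close>

lemma V_fun_complete:
  fixes g :: "real^'n \<Rightarrow> complex"
  assumes g: "g \<in> H_space" and orth: "\<And>n j. j \<ge> 1 \<Longrightarrow> gauss_inner g (V_fun \<mu> \<psi> n j) = 0"
  shows "AE x in lborel. g x = 0"
proof -
  obtain G where G: "has_H_grad g G" using g unfolding H_space_def by blast
  note [measurable] = has_H_grad_measurable[OF G]
  let ?N = "CARD('n)"
  have slice_m: "(\<lambda>\<theta>. h (r *\<^sub>R \<theta>)) \<in> borel_measurable sphere_measure"
    if "h \<in> borel_measurable borel" for h :: "real^'n \<Rightarrow> 'c::topological_space" and r
  proof -
    have "(\<lambda>\<theta>. r *\<^sub>R \<theta>) \<in> borel_measurable (sphere_measure :: (real^'n) measure)"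
      by (rule borel_measurable_sphere_continuous) (intro continuous_intros)
    from measurable_compose[OF this that] show ?thesis .
  qed
  have coeff0: "AE r in radial_measure ?N. L2_sphere_inner (\<lambda>\<theta>. g (r *\<^sub>R \<theta>)) (\<psi> j) = 0" if j: "j \<ge> 1" for j
  proof -
    define k where "k x = g x * cnj (\<psi> j (sgn x)) * complex_of_real ((norm x)\<^sup>2 powr (- alpha CARD('n) \<mu> j / 2) * exp (- (norm x)\<^sup>2 / 4))" for x
    have k: "integrable lborel k" and zero: "\<And>t. (\<integral>x. k x * indicator {x. (norm x)\<^sup>2 < t} x \<partial>lborel) = 0"
      using radial_moments_zero[OF g j orth[OF j]] unfolding k_def by auto
    have [measurable]: "k \<in> borel_measurable borel" using k by auto
    have "AE r in radial_measure ?N. (\<integral>\<theta>. k (r *\<^sub>R \<theta>) \<partial>sphere_measure) = 0"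
    proof (rule AE_radial_zero_if_ball_integrals_zero[OF integral_polar(2)[OF k]])
      fix t :: real assume t: "t > 0"
      \<comment> \<open>The cut is at |x|^2 < t^2 because the moments are taken in |x|^2; for
        positive radii it is the ball of radius t.\<close>
      let ?f = "\<lambda>x. k x * indicator {x. (norm x)\<^sup>2 < t\<^sup>2} x"
      have fi: "integrable lborel ?f"
        by (rule Bochner_Integration.integrable_bound[OF k]) (auto simp: indicator_def norm_mult)
      have "0 = (\<integral>r. \<integral>\<theta>. ?f (r *\<^sub>R \<theta>) \<partial>sphere_measure \<partial>radial_measure ?N)"
        using zero[of "t\<^sup>2"] integral_polar(1)[OF fi] by simp
      also have "\<dots> = (\<integral>r. (\<integral>\<theta>. k (r *\<^sub>R \<theta>) \<partial>sphere_measure) * indicator {r. r < t} r \<partial>radial_measure ?N)"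
      proof (rule integral_cong_AE)
        show "AE r in radial_measure ?N. (\<integral>\<theta>. ?f (r *\<^sub>R \<theta>) \<partial>sphere_measure) = (\<integral>\<theta>. k (r *\<^sub>R \<theta>) \<partial>sphere_measure) * indicator {r. r < t} r"
          using AE_radial_pos
        proof eventually_elim
          case (elim r)
          have "(\<integral>\<theta>. ?f (r *\<^sub>R \<theta>) \<partial>sphere_measure) = (\<integral>\<theta>. k (r *\<^sub>R \<theta>) * indicator {r. r < t} r \<partial>sphere_measure)"
          proof (rule Bochner_Integration.integral_cong[OF refl])
            fix \<theta> :: "real^'n" assume "\<theta> \<in> space sphere_measure"
            then have "norm (r *\<^sub>R \<theta>) = r" using elim by simp
            moreover have "r\<^sup>2 < t\<^sup>2 \<longleftrightarrow> r < t" using elim t by (auto intro: power2_less_imp_less power_strict_mono)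
            ultimately show "?f (r *\<^sub>R \<theta>) = k (r *\<^sub>R \<theta>) * indicator {r. r < t} r" by (simp add: indicator_def)
          qed
          then show ?case by simp
        qed
        show "(\<lambda>r. \<integral>\<theta>. ?f (r *\<^sub>R \<theta>) \<partial>sphere_measure) \<in> borel_measurable (radial_measure ?N)"
          using integral_polar(2)[OF fi] by (rule borel_measurable_integrable)
        have "(\<lambda>r. \<integral>\<theta>. k (r *\<^sub>R \<theta>) \<partial>sphere_measure) \<in> borel_measurable (radial_measure ?N)"
          using integral_polar(2)[OF k] by (rule borel_measurable_integrable)
        then show "(\<lambda>r. (\<integral>\<theta>. k (r *\<^sub>R \<theta>) \<partial>sphere_measure) * indicator {r. r < t} r) \<in> borel_measurable (radial_measure ?N)"
          by measurable
      qed
      finally show "(\<integral>r. (\<integral>\<theta>. k (r *\<^sub>R \<theta>) \<partial>sphere_measure) * indicator {r. r < t} r \<partial>radial_measure ?N) = 0" by simp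
    qed
    then show ?thesis using AE_radial_pos
    proof eventually_elim
      case (elim r)
      let ?c = "complex_of_real (r\<^sup>2 powr (- alpha CARD('n) \<mu> j / 2) * exp (- r\<^sup>2 / 4))"
      have "(\<integral>\<theta>. k (r *\<^sub>R \<theta>) \<partial>sphere_measure) = (\<integral>\<theta>. g (r *\<^sub>R \<theta>) * cnj (\<psi> j \<theta>) * ?c \<partial>sphere_measure)"
      proof (rule Bochner_Integration.integral_cong[OF refl])
        fix \<theta> :: "real^'n" assume "\<theta> \<in> space sphere_measure"
        then have "norm (r *\<^sub>R \<theta>) = r" "sgn (r *\<^sub>R \<theta>) = \<theta>" using elim by (auto simp: sgn_scaleR sgn_div_norm)
        then show "k (r *\<^sub>R \<theta>) = g (r *\<^sub>R \<theta>) * cnj (\<psi> j \<theta>) * ?c" unfolding k_def by simp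
      qed
      also have "\<dots> = L2_sphere_inner (\<lambda>\<theta>. g (r *\<^sub>R \<theta>)) (\<psi> j) * ?c"
        by (simp add: L2_sphere_inner_def)
      finally show ?case using elim by simp
    qed
  qed
  \<comment> \<open>As j ranges over a countable set, one null set of radii serves for all
    coefficients.\<close>
  have all0: "AE r in radial_measure ?N. \<forall>j. j \<ge> 1 \<longrightarrow> L2_sphere_inner (\<lambda>\<theta>. g (r *\<^sub>R \<theta>)) (\<psi> j) = 0"
    unfolding AE_all_countable
  proof
    fix j :: nat
    show "AE r in radial_measure ?N. j \<ge> 1 \<longrightarrow> L2_sphere_inner (\<lambda>\<theta>. g (r *\<^sub>R \<theta>)) (\<psi> j) = 0"
      using coeff0[of j] by (cases "j \<ge> 1") auto
  qed
  let ?e = "\<lambda>x. ennreal ((norm (g x))\<^sup>2 * exp (- (norm x)\<^sup>2 / 4))"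
  have "(\<integral>\<^sup>+x. ?e x \<partial>lborel) \<le> H_norm_sq g G"
    unfolding H_norm_sq_eq H_dens_def by (intro nn_integral_mono ennreal_leI mult_right_mono) auto
  then have "(\<integral>\<^sup>+r. \<integral>\<^sup>+\<theta>. ?e (r *\<^sub>R \<theta>) \<partial>sphere_measure \<partial>radial_measure ?N) \<noteq> \<infinity>"
    using H_norm_sq_finite[OF G] by (subst nn_integral_polar[symmetric]) (auto simp: top_unique)
  moreover have "(\<lambda>r. \<integral>\<^sup>+\<theta>. ?e (r *\<^sub>R \<theta>) \<partial>sphere_measure) \<in> borel_measurable (radial_measure ?N)"
    by (rule polar_slice_measurable) measurable
  \<comment> \<open>Almost every slice is square integrable, as completeness on the sphere
    requires.\<close>
  ultimately have "AE r in radial_measure ?N. (\<integral>\<^sup>+\<theta>. ?e (r *\<^sub>R \<theta>) \<partial>sphere_measure) \<noteq> \<infinity>"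
    by (intro nn_integral_PInf_AE)
  with all0 AE_radial_pos
  have zero: "AE r in radial_measure ?N. AE \<theta> in sphere_measure. g (r *\<^sub>R \<theta>) = 0"
  proof eventually_elim
    case (elim r)
    have "(\<lambda>\<theta>. g (r *\<^sub>R \<theta>)) \<in> L2_sphere"
      unfolding L2_sphere_def
    proof (intro CollectI conjI)
      show "(\<lambda>\<theta>. g (r *\<^sub>R \<theta>)) \<in> borel_measurable sphere_measure" by (rule slice_m) measurable
      have "(\<integral>\<^sup>+\<theta>. ennreal ((norm (g (r *\<^sub>R \<theta>)))\<^sup>2) \<partial>sphere_measure) =
         (\<integral>\<^sup>+\<theta>. ennreal (exp (r\<^sup>2 / 4)) * ?e (r *\<^sub>R \<theta>) \<partial>sphere_measure)"
      proof (rule nn_integral_cong)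
        fix \<theta> :: "real^'n" assume "\<theta> \<in> space sphere_measure"
        then have "norm (r *\<^sub>R \<theta>) = r" using elim by simp
        then show "ennreal ((norm (g (r *\<^sub>R \<theta>)))\<^sup>2) = ennreal (exp (r\<^sup>2 / 4)) * ?e (r *\<^sub>R \<theta>)"
          by (simp add: ennreal_mult[symmetric] exp_minus field_simps)
      qed
      also have "\<dots> = ennreal (exp (r\<^sup>2 / 4)) * (\<integral>\<^sup>+\<theta>. ?e (r *\<^sub>R \<theta>) \<partial>sphere_measure)"
        by (intro nn_integral_cmult slice_m) measurable
      also have "\<dots> < \<infinity>" using elim by (simp add: ennreal_mult_less_top less_top)
      finally show "(\<integral>\<^sup>+\<theta>. ennreal ((norm (g (r *\<^sub>R \<theta>)))\<^sup>2) \<partial>sphere_measure) < \<infinity>" .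
    qed
    then show ?case by (rule psi_complete) (use elim in blast)
  qed
  have "(\<integral>\<^sup>+x. ennreal (norm (g x)) \<partial>lborel) = (\<integral>\<^sup>+r. \<integral>\<^sup>+\<theta>. ennreal (norm (g (r *\<^sub>R \<theta>))) \<partial>sphere_measure \<partial>radial_measure ?N)"
    by (rule nn_integral_polar) measurable
  also have "\<dots> = (\<integral>\<^sup>+r. 0 \<partial>radial_measure ?N)"
  proof (rule nn_integral_cong_AE)
    show "AE r in radial_measure ?N. (\<integral>\<^sup>+\<theta>. ennreal (norm (g (r *\<^sub>R \<theta>))) \<partial>sphere_measure) = 0"
      using zero
    proof eventually_elim
      case (elim r)
      have "(\<integral>\<^sup>+\<theta>. ennreal (norm (g (r *\<^sub>R \<theta>))) \<partial>sphere_measure) = (\<integral>\<^sup>+\<theta>. 0 \<partial>(sphere_measure :: (real^'n) measure))"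
        by (rule nn_integral_cong_AE) (use elim in \<open>auto elim: eventually_mono\<close>)
      then show ?case by simp
    qed
  qed
  finally have "(\<integral>\<^sup>+x. ennreal (norm (g x)) \<partial>lborel) = 0" by simp
  then have "AE x in lborel. ennreal (norm (g x)) = 0"
    by (subst (asm) nn_integral_0_iff_AE) auto
  then show ?thesis by eventually_elim simp
qed

text \<open>Orthogonality of \<psi>_i and \<psi>_j on each sphere is enough for what follows: within
  one eigenspace every j occurs with a single n, so different functions there have different angular
  indices.\<close>

lemma V_fun_orthogonal:
  assumes i: "i \<ge> 1" and j: "j \<ge> 1" and ne: "i \<noteq> j"
  shows "gauss_inner (V_fun \<mu> \<psi> m i) (V_fun \<mu> \<psi> n j) = 0"
proof -
  obtain G K where G: "has_H_grad (V_fun \<mu> \<psi> m i) G" and K: "has_H_grad (V_fun \<mu> \<psi> n j) K"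
    using V_fun_H[OF i, of m] V_fun_H[OF j, of n] unfolding H_space_def by blast
  let ?R = "\<lambda>m i r. complex_of_real (powr_poly (- alpha CARD('n) \<mu> i / 2) (kummer_poly (real CARD('n) / 2 - alpha CARD('n) \<mu> i) m) (r\<^sup>2))"
  let ?f = "\<lambda>x. V_fun \<mu> \<psi> m i x * cnj (V_fun \<mu> \<psi> n j x) * complex_of_real (exp (- (norm x)\<^sup>2 / 4))"
  note fi = integrable_gauss_dens[OF G K]
  have "gauss_inner (V_fun \<mu> \<psi> m i) (V_fun \<mu> \<psi> n j) = (\<integral>r. \<integral>\<theta>. ?f (r *\<^sub>R \<theta>) \<partial>sphere_measure \<partial>radial_measure CARD('n))"
    unfolding gauss_inner_def by (rule integral_polar(1)[OF fi])
  also have "\<dots> = (\<integral>r. 0 \<partial>radial_measure CARD('n))"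
  proof (rule integral_cong_AE)
    show "AE r in radial_measure CARD('n). (\<integral>\<theta>. ?f (r *\<^sub>R \<theta>) \<partial>sphere_measure) = 0"
      using AE_radial_pos
    proof eventually_elim
      case (elim r)
      have "(\<integral>\<theta>. ?f (r *\<^sub>R \<theta>) \<partial>sphere_measure) =
         (\<integral>\<theta>. (?R m i r * ?R n j r * complex_of_real (exp (- r\<^sup>2 / 4))) * (\<psi> i \<theta> * cnj (\<psi> j \<theta>)) \<partial>sphere_measure)"
      proof (rule Bochner_Integration.integral_cong[OF refl])
        fix \<theta> :: "real^'n" assume "\<theta> \<in> space sphere_measure"
        then have s: "norm (r *\<^sub>R \<theta>) = r" "sgn (r *\<^sub>R \<theta>) = \<theta>" using elim by (auto simp: sgn_scaleR sgn_div_norm)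
        show "?f (r *\<^sub>R \<theta>) = (?R m i r * ?R n j r * complex_of_real (exp (- r\<^sup>2 / 4))) * (\<psi> i \<theta> * cnj (\<psi> j \<theta>))"
          unfolding V_fun_eq s by simp
      qed
      also have "\<dots> = (?R m i r * ?R n j r * complex_of_real (exp (- r\<^sup>2 / 4))) * L2_sphere_inner (\<psi> i) (\<psi> j)"
        unfolding L2_sphere_inner_def by (rule integral_mult_right_zero)
      finally show ?case using psi_orthonormal[OF i j] ne by simp
    qed
    show "(\<lambda>r. \<integral>\<theta>. ?f (r *\<^sub>R \<theta>) \<partial>sphere_measure) \<in> borel_measurable (radial_measure CARD('n))"
      using integral_polar(2)[OF fi] by (rule borel_measurable_integrable)
  qed simp
  finally show ?thesis by simp
qed

text \<open>The radial polynomial has finitely many zeros, so on almost every sphere the vanishing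
  of \<open>V_fun\<close> would force \<psi>_j to vanish.\<close>

lemma V_fun_nonzero:
  assumes j: "j \<ge> 1"
  shows "\<not> (AE x in lborel. V_fun \<mu> \<psi> n j x = 0)"
proof
  assume "AE x in lborel. V_fun \<mu> \<psi> n j x = 0"
  note slices = AE_polar[OF this]
  let ?p = "kummer_poly (real CARD('n) / 2 - alpha CARD('n) \<mu> j) n"
  have "?p \<noteq> 0" using kummer_poly_degree(1)[OF kummer_param_pos[OF j], of n] by auto
  then have fin: "finite {t. poly ?p t = 0}" by (rule poly_roots_finite)
  have "finite ((\<lambda>t. sqrt (4 * t)) ` {t. poly ?p t = 0})" using fin by simp
  then have "(\<lambda>t. sqrt (4 * t)) ` {t. poly ?p t = 0} \<in> null_sets lborel" by (rule finite_imp_null_set_lborel)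
  then have "AE r in lborel. r \<notin> (\<lambda>t. sqrt (4 * t)) ` {t. poly ?p t = 0}" by (rule AE_not_in)
  then have "AE r in radial_measure CARD('n). r \<notin> (\<lambda>t. sqrt (4 * t)) ` {t. poly ?p t = 0}"
    unfolding radial_measure_def by (subst AE_density) auto
  with slices AE_radial_pos have "AE r in radial_measure CARD('n). False"
  proof eventually_elim
    case (elim r)
    have "poly ?p (r\<^sup>2 / 4) \<noteq> 0"
    proof
      assume "poly ?p (r\<^sup>2 / 4) = 0"
      moreover have "r = sqrt (4 * (r\<^sup>2 / 4))" using elim by simp
      ultimately show False using elim by blast
    qed
    then have ne: "powr_poly (- alpha CARD('n) \<mu> j / 2) ?p (r\<^sup>2) \<noteq> 0" using elim by (simp add: powr_poly_def)
    have "AE \<theta> in (sphere_measure :: (real^'n) measure). \<psi> j \<theta> = 0"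
      using elim(1) AE_space
    proof eventually_elim
      case (elim \<theta>)
      then have "norm (r *\<^sub>R \<theta>) = r" "sgn (r *\<^sub>R \<theta>) = \<theta>" using \<open>0 < r\<close> by (auto simp: sgn_scaleR sgn_div_norm)
      then show ?case using elim(1) ne by (simp add: V_fun_eq)
    qed
    then show False using T_eigen[OF j] by (simp add: T_eigenfunction_def)
  qed
  moreover have "\<not> (AE r in radial_measure CARD('n). False)"
    by (rule not_AE_False_radial) (simp add: Suc_le_eq)
  ultimately show False by blast
qed

end

section \<open>The eigenspaces\<close>

lemma ae_class_eq_iff: "ae_class f = ae_class g \<longleftrightarrow> (AE x in lborel. f x = g x)"
  by (rule ae_fun.abs_eq_iff)

lemma ae_class_eq_0_iff: "ae_class f = 0 \<longleftrightarrow> (AE x in lborel. f x = 0)"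
  by (simp add: zero_ae_fun_def ae_class_eq_iff)

lemma ae_class_add: "ae_class (\<lambda>x. f x + g x) = ae_class f + ae_class g"
  by (simp add: plus_ae_fun.abs_eq)

lemma ae_class_scale: "ae_class (\<lambda>x. c * f x) = scale_ae c (ae_class f)"
  by (simp add: scale_ae.abs_eq)

lemma ae_class_sum:
  "ae_class (\<lambda>x. \<Sum>j\<in>J. c j * f j x) = (\<Sum>j\<in>J. scale_ae (c j) (ae_class (f j)))"
proof (induction J rule: infinite_finite_induct)
  case (insert j J)
  then show ?case
    by (simp add: ae_class_add ae_class_scale)
qed (simp_all add: ae_class_eq_0_iff)

lemma gauss_inner_sum_left:
  assumes "\<And>j. j \<in> J \<Longrightarrow> f j \<in> H_space" "w \<in> H_space"
  shows "gauss_inner (\<lambda>x. \<Sum>j\<in>J. c j * f j x) w = (\<Sum>j\<in>J. c j * gauss_inner (f j) w)"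
  using assms
proof (induction J rule: infinite_finite_induct)
  case (insert j J)
  then show ?case
    using gauss_inner_add_left[of "\<lambda>x. c j * f j x" "\<lambda>x. \<Sum>j\<in>J. c j * f j x" w]
    by (simp add: H_space_cmult H_space_sum gauss_inner_cmult_left)
qed (simp_all add: gauss_inner_def)

lemma gauss_inner_AE_zero_left:
  assumes "AE x in lborel. v x = 0"
  shows "gauss_inner v w = 0"
  unfolding gauss_inner_def
  by (rule integral_eq_zero_AE) (use assms in eventually_elim, simp)

context magnetic_spectrum
begin

text \<open>\<gamma> is complex, since an eigenvalue is not known to be real beforehand. Only j is
  recorded: it determines n together with \<gamma>, so the pairs (n, j) of an eigenvalue are counted
  by j.\<close>

definition eig_index :: "complex \<Rightarrow> nat set" where
  "eig_index \<gamma> = {j. j \<ge> 1 \<and> (\<exists>n::nat. \<gamma> = complex_of_real (real n - alpha CARD('n) \<mu> j / 2))}"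

definition eig_fun :: "complex \<Rightarrow> nat \<Rightarrow> real^'n \<Rightarrow> complex" where
  "eig_fun \<gamma> j = V_fun \<mu> \<psi> (SOME n. \<gamma> = complex_of_real (real n - alpha CARD('n) \<mu> j / 2)) j"

lemma eig_fun_eq:
  assumes "\<gamma> = complex_of_real (real n - alpha CARD('n) \<mu> j / 2)"
  shows "eig_fun \<gamma> j = V_fun \<mu> \<psi> n j"
proof -
  have "(SOME n. \<gamma> = complex_of_real (real n - alpha CARD('n) \<mu> j / 2)) = n"
    by (rule some_equality) (use assms in \<open>auto simp flip: of_real_eq_iff\<close>)
  then show ?thesis by (simp add: eig_fun_def)
qed

lemma eig_indexE:
  assumes "j \<in> eig_index \<gamma>"
  obtains n where "j \<ge> 1" "\<gamma> = complex_of_real (real n - alpha CARD('n) \<mu> j / 2)" "eig_fun \<gamma> j = V_fun \<mu> \<psi> n j"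
  using assms eig_fun_eq unfolding eig_index_def by blast

lemma eig_fun_H: "j \<in> eig_index \<gamma> \<Longrightarrow> eig_fun \<gamma> j \<in> H_space"
  by (erule eig_indexE) (simp add: V_fun_H)

lemma eig_fun_eigen: "j \<in> eig_index \<gamma> \<Longrightarrow> L_eigen_eq A a \<gamma> (eig_fun \<gamma> j)"
  by (erule eig_indexE) (metis V_fun_eigen)

lemma eig_fun_orthogonal: "i \<in> eig_index \<gamma> \<Longrightarrow> j \<in> eig_index \<gamma> \<Longrightarrow> i \<noteq> j \<Longrightarrow> gauss_inner (eig_fun \<gamma> i) (eig_fun \<gamma> j) = 0"
  by (elim eig_indexE) (simp add: V_fun_orthogonal)

lemma eig_fun_norm_nonzero:
  assumes "j \<in> eig_index \<gamma>"
  shows "gauss_inner (eig_fun \<gamma> j) (eig_fun \<gamma> j) \<noteq> 0"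
proof -
  obtain n where "j \<ge> 1" "eig_fun \<gamma> j = V_fun \<mu> \<psi> n j" using assms by (rule eig_indexE)
  then show ?thesis
    using gauss_inner_self_eq_0_iff[OF eig_fun_H[OF assms]] V_fun_nonzero[of j n] by simp
qed

text \<open>\<mu>_j tends to infinity, so -\<alpha>_j/2 eventually exceeds Re \<gamma>, and adding n
  >= 0 does not help.\<close>

lemma finite_eig_index: "finite (eig_index \<gamma>)"
proof -
  define m where "m = (real CARD('n) - 2) / 2"
  have m: "m \<ge> 0" using dim_ge_2 by (simp add: m_def)
  \<comment> \<open>Chosen so that \<mu>_j >= c^2 forces -\<alpha>_j >= 2 |Re \<gamma>| + 1.\<close>
  define c where "c = m + 2 * \<bar>Re \<gamma>\<bar> + 1"
  have "filterlim \<mu> at_top sequentially" using spectrum by (simp add: angular_spectrum_def)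
  then have "eventually (\<lambda>j. \<mu> j \<ge> c\<^sup>2) sequentially" by (simp add: filterlim_at_top)
  then obtain j0 where j0: "\<And>j. j \<ge> j0 \<Longrightarrow> \<mu> j \<ge> c\<^sup>2" by (auto simp: eventually_sequentially)
  have "eig_index \<gamma> \<subseteq> {..<j0}"
  proof
    fix j assume "j \<in> eig_index \<gamma>"
    then obtain n where n: "\<gamma> = complex_of_real (real n - alpha CARD('n) \<mu> j / 2)" by (rule eig_indexE)
    show "j \<in> {..<j0}"
    proof (rule ccontr)
      assume "j \<notin> {..<j0}"
      then have "c\<^sup>2 \<le> \<mu> j" by (intro j0) simp
      then have "c\<^sup>2 \<le> m\<^sup>2 + \<mu> j" using zero_le_power2[of m] by linarith
      then have "c \<le> sqrt (m\<^sup>2 + \<mu> j)" by (rule real_le_rsqrt)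
      then have "alpha CARD('n) \<mu> j \<le> m - c" by (simp add: alpha_def m_def)
      moreover have "Re \<gamma> = real n - alpha CARD('n) \<mu> j / 2" unfolding n by simp
      ultimately have "2 * \<bar>Re \<gamma>\<bar> + 1 \<le> 2 * Re \<gamma> - 2 * real n" by (simp add: c_def)
      then show False by linarith
    qed
  qed
  then show ?thesis by (rule finite_subset) simp
qed

lemma L_eigen_expansion:
  assumes g: "g \<in> H_space" "L_eigen_eq A a \<gamma> g"
  obtains c where "AE x in lborel. g x = (\<Sum>j\<in>eig_index \<gamma>. c j * eig_fun \<gamma> j x)"
proof -
  let ?J = "eig_index \<gamma>" and ?E = "eig_fun \<gamma>"
  \<comment> \<open>The family is orthogonal but not normalised, hence the division by the squared
    norms.\<close>
  define c where "c j = gauss_inner g (?E j) / gauss_inner (?E j) (?E j)" for j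
  define s where "s x = (\<Sum>j\<in>?J. c j * ?E j x)" for x
  have s: "s \<in> H_space" "L_eigen_eq A a \<gamma> s"
    unfolding s_def by (intro H_space_sum L_eigen_eq_sum eig_fun_H eig_fun_eigen; assumption)+
  define h where "h x = g x + (- 1) * s x" for x
  have h: "h \<in> H_space" "L_eigen_eq A a \<gamma> h"
    unfolding h_def by (intro H_space_add H_space_cmult L_eigen_eq_add L_eigen_eq_cmult g s)+
  have "AE x in lborel. h x = 0"
  proof (rule V_fun_complete[OF h(1)])
    fix n i assume i: "i \<ge> (1::nat)"
    show "gauss_inner h (V_fun \<mu> \<psi> n i) = 0"
    \<comment> \<open>In the first case the function is one of those projected away; in the second
      its eigenvalue differs from \<gamma>.\<close>
    proof (cases "\<gamma> = complex_of_real (real n - alpha CARD('n) \<mu> i / 2)")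
      case True
      then have iJ: "i \<in> ?J" using i by (auto simp: eig_index_def)
      have "gauss_inner s (?E i) = (\<Sum>j\<in>?J. c j * gauss_inner (?E j) (?E i))"
        unfolding s_def by (rule gauss_inner_sum_left) (auto intro: eig_fun_H iJ)
      also have "\<dots> = c i * gauss_inner (?E i) (?E i)"
        using eig_fun_orthogonal[OF _ iJ]
        by (subst sum.remove[OF finite_eig_index iJ]) (auto intro!: sum.neutral)
      also have "\<dots> = gauss_inner g (?E i)" using eig_fun_norm_nonzero[OF iJ] by (simp add: c_def)
      finally have "gauss_inner h (?E i) = 0"
        unfolding h_def gauss_inner_add_left[OF g(1) H_space_cmult[OF s(1)] eig_fun_H[OF iJ]] gauss_inner_cmult_left
        by simp
      then show ?thesis by (simp add: eig_fun_eq[OF True])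
    next
      case False
      then show ?thesis by (rule L_eigen_orthogonal[OF h V_fun_H[OF i] V_fun_eigen[OF i]])
    qed
  qed
  then have "AE x in lborel. g x = (\<Sum>j\<in>?J. c j * ?E j x)"
    by eventually_elim (simp add: h_def s_def)
  then show thesis by (rule that)
qed

text \<open>Over an empty index set the expansion is an empty sum, which leaves no nonzero
  eigenfunction.\<close>

lemma L_eigenvalue_iff: "L_eigenvalue A a \<gamma> \<longleftrightarrow> eig_index \<gamma> \<noteq> {}"
proof
  assume "L_eigenvalue A a \<gamma>"
  then obtain g where g: "g \<in> H_space" "ae_class g \<noteq> 0" "L_eigen_eq A a \<gamma> g"
    unfolding L_eigenvalue_def by blast
  obtain c where "AE x in lborel. g x = (\<Sum>j\<in>eig_index \<gamma>. c j * eig_fun \<gamma> j x)"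
    using g(1,3) by (rule L_eigen_expansion)
  then show "eig_index \<gamma> \<noteq> {}" using g(2) by (auto simp: ae_class_eq_0_iff)
next
  assume "eig_index \<gamma> \<noteq> {}"
  then obtain j where j: "j \<in> eig_index \<gamma>" by blast
  have "ae_class (eig_fun \<gamma> j) \<noteq> 0"
    using eig_fun_norm_nonzero[OF j] gauss_inner_AE_zero_left by (auto simp: ae_class_eq_0_iff)
  then show "L_eigenvalue A a \<gamma>"
    unfolding L_eigenvalue_def using eig_fun_H[OF j] eig_fun_eigen[OF j] by blast
qed

lemma subspace_L_eigenspace: "ae.subspace (L_eigenspace A a \<gamma>)"
proof -
  have "(0 :: (real^'n) ae_fun) \<in> L_eigenspace A a \<gamma>"
    unfolding L_eigenspace_def zero_ae_fun_def using H_space_zero L_eigen_eq_zero by blast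
  moreover have "x + y \<in> L_eigenspace A a \<gamma>" if "x \<in> L_eigenspace A a \<gamma>" "y \<in> L_eigenspace A a \<gamma>" for x y
    using that unfolding L_eigenspace_def by (auto simp: ae_class_add[symmetric] intro!: imageI H_space_add L_eigen_eq_add)
  moreover have "scale_ae c x \<in> L_eigenspace A a \<gamma>" if "x \<in> L_eigenspace A a \<gamma>" for c x
    using that unfolding L_eigenspace_def by (auto simp: ae_class_scale[symmetric] intro!: imageI H_space_cmult L_eigen_eq_cmult)
  ultimately show ?thesis unfolding ae.subspace_def by blast
qed

text \<open>Pairing a vanishing combination with each \<open>eig_fun\<close> isolates one
  coefficient, by orthogonality. Injectivity is included because the multiplicity counts indices
  while a basis is a set of classes.\<close>

lemma L_eigenspace_basis:
  defines "F \<equiv> \<lambda>\<gamma> j. ae_class (eig_fun \<gamma> j)"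
  shows "inj_on (F \<gamma>) (eig_index \<gamma>)"
    and "ae.independent (F \<gamma> ` eig_index \<gamma>)"
    and "ae.span (F \<gamma> ` eig_index \<gamma>) = L_eigenspace A a \<gamma>"
proof -
  let ?J = "eig_index \<gamma>" and ?E = "eig_fun \<gamma>"
  have coeffs: "c i = 0" if c: "(\<Sum>j\<in>?J. scale_ae (c j) (F \<gamma> j)) = 0" and i: "i \<in> ?J" for c i
  proof -
    have "AE x in lborel. (\<Sum>j\<in>?J. c j * ?E j x) = 0"
      using c unfolding F_def ae_class_sum[symmetric] ae_class_eq_0_iff .
    then have "0 = gauss_inner (\<lambda>x. \<Sum>j\<in>?J. c j * ?E j x) (?E i)"
      by (rule gauss_inner_AE_zero_left[symmetric])
    also have "\<dots> = (\<Sum>j\<in>?J. c j * gauss_inner (?E j) (?E i))"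
      by (rule gauss_inner_sum_left) (auto intro: eig_fun_H i)
    also have "\<dots> = c i * gauss_inner (?E i) (?E i)"
      using eig_fun_orthogonal[OF _ i]
      by (subst sum.remove[OF finite_eig_index i]) (auto intro!: sum.neutral)
    finally show ?thesis using eig_fun_norm_nonzero[OF i] by simp
  qed
  show inj: "inj_on (F \<gamma>) ?J"
  proof (rule inj_onI, rule ccontr)
    fix i j assume ij: "i \<in> ?J" "j \<in> ?J" "F \<gamma> i = F \<gamma> j" "i \<noteq> j"
    \<comment> \<open>Two equal classes would give a relation with coefficients 1 and -1.\<close>
    define c :: "nat \<Rightarrow> complex" where "c k = (if k = i then 1 else if k = j then - 1 else 0)" for k
    have "(\<Sum>k\<in>?J. scale_ae (c k) (F \<gamma> k)) = (\<Sum>k\<in>{i, j}. scale_ae (c k) (F \<gamma> k))"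
      by (rule sum.mono_neutral_right) (use ij finite_eig_index in \<open>auto simp: c_def\<close>)
    also have "\<dots> = 0" using ij by (simp add: c_def)
    finally have "c i = 0" using ij(1) by (rule coeffs)
    then show False by (simp add: c_def)
  qed
  show "ae.independent (F \<gamma> ` ?J)"
  proof
    assume "ae.dependent (F \<gamma> ` ?J)"
    then obtain u where u: "\<exists>v\<in>F \<gamma> ` ?J. u v \<noteq> 0" "(\<Sum>v\<in>F \<gamma> ` ?J. scale_ae (u v) v) = 0"
      using finite_eig_index by (subst (asm) ae.dependent_finite) auto
    from u(2) have "(\<Sum>j\<in>?J. scale_ae (u (F \<gamma> j)) (F \<gamma> j)) = 0"
      by (simp add: sum.reindex[OF inj])
    from coeffs[OF this] u(1) show False by auto
  qed
  show "ae.span (F \<gamma> ` ?J) = L_eigenspace A a \<gamma>"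
  proof
    have "F \<gamma> ` ?J \<subseteq> L_eigenspace A a \<gamma>"
      unfolding F_def L_eigenspace_def using eig_fun_H eig_fun_eigen by blast
    then show "ae.span (F \<gamma> ` ?J) \<subseteq> L_eigenspace A a \<gamma>"
      using subspace_L_eigenspace by (rule ae.span_minimal)
    show "L_eigenspace A a \<gamma> \<subseteq> ae.span (F \<gamma> ` ?J)"
    proof
      fix x assume "x \<in> L_eigenspace A a \<gamma>"
      then obtain g where g: "g \<in> H_space" "L_eigen_eq A a \<gamma> g" and x: "x = ae_class g"
        unfolding L_eigenspace_def by blast
      obtain c where "AE x in lborel. g x = (\<Sum>j\<in>?J. c j * ?E j x)"
        using g by (rule L_eigen_expansion)
      then have "x = (\<Sum>j\<in>?J. scale_ae (c j) (F \<gamma> j))"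
        unfolding x F_def ae_class_sum[symmetric] ae_class_eq_iff .
      then show "x \<in> ae.span (F \<gamma> ` ?J)"
        by (simp add: ae.span_sum ae.span_scale ae.span_base)
    qed
  qed
qed

lemma dim_L_eigenspace: "ae.dim (L_eigenspace A a \<gamma>) = card (eig_index \<gamma>)"
proof -
  have "ae.dim (L_eigenspace A a \<gamma>) = ae.dim ((\<lambda>j. ae_class (eig_fun \<gamma> j)) ` eig_index \<gamma>)"
    unfolding L_eigenspace_basis(3)[symmetric] by (rule ae.dim_span)
  also have "\<dots> = card ((\<lambda>j. ae_class (eig_fun \<gamma> j)) ` eig_index \<gamma>)"
    by (rule ae.dim_eq_card_independent[OF L_eigenspace_basis(2)])
  also have "\<dots> = card (eig_index \<gamma>)"
    by (rule card_image[OF L_eigenspace_basis(1)])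
  finally show ?thesis .
qed

lemma eig_index_of_real:
  "eig_index (complex_of_real \<gamma>) = {j. j \<ge> 1 \<and> \<gamma> + alpha CARD('n) \<mu> j / 2 \<in> \<nat>}"
proof -
  have "(\<exists>n::nat. complex_of_real \<gamma> = complex_of_real (real n - \<beta> / 2)) \<longleftrightarrow> \<gamma> + \<beta> / 2 \<in> \<nat>" for \<beta>
  proof
    assume "\<exists>n::nat. complex_of_real \<gamma> = complex_of_real (real n - \<beta> / 2)"
    then obtain n :: nat where "\<gamma> = real n - \<beta> / 2" by (auto simp only: of_real_eq_iff)
    then show "\<gamma> + \<beta> / 2 \<in> \<nat>" by simp
  next
    assume "\<gamma> + \<beta> / 2 \<in> \<nat>"
    then obtain n where "\<gamma> + \<beta> / 2 = real n" by (rule Nats_cases)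
    then show "\<exists>n::nat. complex_of_real \<gamma> = complex_of_real (real n - \<beta> / 2)"
      by (intro exI[of _ n]) (simp only: of_real_eq_iff)
  qed
  then show ?thesis unfolding eig_index_def by blast
qed

text \<open>Passes from the indexing by j alone to the pairs (n, j) of the explicit family, where n
  is recovered from j and \<gamma>.\<close>

lemma eig_fun_image:
  "(\<lambda>j. ae_class (eig_fun (complex_of_real \<gamma>) j)) ` eig_index (complex_of_real \<gamma>) =
     {ae_class (V_fun \<mu> \<psi> n j) | n j. j \<ge> 1 \<and> \<gamma> = real n - alpha CARD('n) \<mu> j / 2}"
  (is "?L = ?R")
proof
  show "?L \<subseteq> ?R"
  proof
    fix y assume "y \<in> ?L"
    then obtain j where j: "j \<in> eig_index (complex_of_real \<gamma>)" "y = ae_class (eig_fun (complex_of_real \<gamma>) j)" by blast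
    from j(1) obtain n where "j \<ge> 1" "complex_of_real \<gamma> = complex_of_real (real n - alpha CARD('n) \<mu> j / 2)"
      "eig_fun (complex_of_real \<gamma>) j = V_fun \<mu> \<psi> n j" by (rule eig_indexE)
    then show "y \<in> ?R" using j(2) by (auto simp only: of_real_eq_iff)
  qed
  show "?R \<subseteq> ?L"
  proof
    fix y assume "y \<in> ?R"
    then obtain n j where nj: "j \<ge> 1" "\<gamma> = real n - alpha CARD('n) \<mu> j / 2" "y = ae_class (V_fun \<mu> \<psi> n j)" by blast
    then have "complex_of_real \<gamma> = complex_of_real (real n - alpha CARD('n) \<mu> j / 2)" by (simp only:)
    then have "j \<in> eig_index (complex_of_real \<gamma>)" "eig_fun (complex_of_real \<gamma>) j = V_fun \<mu> \<psi> n j"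
      using nj(1) eig_fun_eq unfolding eig_index_def by blast+
    then show "y \<in> ?L" using nj(3) by (metis image_eqI)
  qed
qed

end

text \<open>\<open>card\<close> is 0 on infinite sets, so finiteness of the index set is asserted
  explicitly next to the multiplicity.\<close>

theorem proposition1p1:
  fixes A :: "real^'n \<Rightarrow> real^'n" and a :: "real^'n \<Rightarrow> real"
    and \<mu> :: "nat \<Rightarrow> real" and \<psi> :: "nat \<Rightarrow> real^'n \<Rightarrow> complex"
  assumes "CARD('n) \<ge> 2"
    and "Ck_sphere 1 A"
    and "\<And>\<theta>. \<theta> \<in> sphere 0 1 \<Longrightarrow> A \<theta> \<bullet> \<theta> = 0"
    and "Linf_sphere a"
    and "angular_spectrum A a \<mu> \<psi>"
    and "\<mu> 1 > - (((real CARD('n) - 2) / 2)\<^sup>2)"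
  shows "{\<gamma>. L_eigenvalue A a \<gamma>} = {complex_of_real (gamma_mk CARD('n) \<mu> m k) | m k. k \<ge> 1}
    \<and> (\<forall>m k. k \<ge> 1 \<longrightarrow>
        finite {j. j \<ge> 1 \<and> gamma_mk CARD('n) \<mu> m k + alpha CARD('n) \<mu> j / 2 \<in> \<nat>}
      \<and> ae.dim (L_eigenspace A a (complex_of_real (gamma_mk CARD('n) \<mu> m k)))
          = card {j. j \<ge> 1 \<and> gamma_mk CARD('n) \<mu> m k + alpha CARD('n) \<mu> j / 2 \<in> \<nat>}
      \<and> ae.independent {ae_class (V_fun \<mu> \<psi> n j) | n j.
            j \<ge> 1 \<and> gamma_mk CARD('n) \<mu> m k = real n - alpha CARD('n) \<mu> j / 2}
      \<and> ae.span {ae_class (V_fun \<mu> \<psi> n j) | n j.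
            j \<ge> 1 \<and> gamma_mk CARD('n) \<mu> m k = real n - alpha CARD('n) \<mu> j / 2}
          = L_eigenspace A a (complex_of_real (gamma_mk CARD('n) \<mu> m k)))"
proof -
  interpret magnetic_spectrum A a \<mu> \<psi>
    by unfold_locales (use assms in auto)
  have "{\<gamma>. L_eigenvalue A a \<gamma>} = {complex_of_real (gamma_mk CARD('n) \<mu> m k) | m k. k \<ge> 1}"
    unfolding L_eigenvalue_iff eig_index_def gamma_mk_def by blast
  then show ?thesis
    unfolding eig_fun_image[symmetric] eig_index_of_real[symmetric]
    using finite_eig_index dim_L_eigenspace L_eigenspace_basis(2,3) by simp
qed

end
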